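(* Let $R$ be any symmetric $\mathbb{T}$-Poisson CGL extension of length $n$. For every $\tau\in\Xi_n$, the integer matrix $$M_\tau=(\tau_\bullet\tau)\,(M'_\tau\varepsilon'_\tau)\,\big((\tau_\bullet\tau)^{-1}\big)_{\mathrm{ex}_\tau\times\mathrm{ex}}\in\mathrm{Mat}_{n\times\mathrm{ex}}(\mathbb{Z})$$ is the unique solution in $\mathrm{Mat}_{n\times\mathrm{ex}}(\mathbf{k})$ of the linear equations $$\mathbf{q}_\tau M_\tau=-\Lambda\quad\text{and}\quad\chi_{\mathbf{y}_\tau}M_\tau=0,$$ and explicitly one has $$M_\tau=E^t\tau_\bullet\boldsymbol\nu^{-1}\tau_\bullet^tE\Lambda=E^t\tau_\bullet Q\,\tau_\bullet^tE_{n\times\mathrm{ex}}=(E^{-1}\tau_\bullet^{-1}E)^t\,M\,(E^{-1}\tau_\bullet^{-1}E)_{\mathrm{ex}\times\mathrm{ex}},$$ where $Q=\boldsymbol\nu^{-1}\overline\Lambda$ and $M=M_{\mathrm{id}}$.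
   Context: $\mathbf{k}$ is a field of characteristic $0$, $\mathbf{k}^\times=\mathbf{k}\setminus\{0\}$; $\mathbb{T}$ is a split $\mathbf{k}$-torus with Lie algebra $\mathfrak{t}$ and character lattice $X(\mathbb{T})\subset\mathfrak{t}^*$ (characters identified with differentials). $[a,b]$ is the set of integers between $a$ and $b$. Vectors are columns, standard basis $e_1,\dots,e_n$, $e_{\pm\infty}:=0$. $\mathrm{Mat}_{I\times J}$: rows indexed by $I$, columns by $J$ ($n$ means $[1,n]$); $X_{I\times J}$ is the corresponding sub-matrix of $X$. A permutation $\sigma\in S_n$ also denotes the matrix with columns $e_{\sigma(1)},\dots,e_{\sigma(n)}$, so $\sigma^{-1}=\sigma^t$. CGL extension. A $\mathbb{T}$-Poisson CGL extension of length $n$ is a polynomial algebra $R=\mathbf{k}[x_1,\dots,x_n]$ with a $\mathbb{T}$-action by algebra automorphisms and a $\mathbb{T}$-invariant Poisson bracket such that each $x_j$ is a weight vector of weight $\chi_j\in X(\mathbb{T})$, and there are $h_1,\dots,h_n\in\mathfrak t$ with $\lambda_j:=\chi_j(h_j)\in\mathbf{k}^\times$ and $\{x_i,x_j\}=-\chi_i(h_j)x_ix_j-\delta_j(x_i)$ for $i<j$, where $\delta_j$ is a locally nilpotent derivation of $\mathbf{k}[x_1,\dots,x_{j-1}]$ ($\delta_1=0$). It is symmetric if there are $h_1^*,\dots,h_n^*\in\mathfrak t$ with $\lambda_j^*:=\chi_j(h_j^* )\in\mathbf{k}^\times$ for all $j$, $\chi_i(h_j)=-\chi_j(h_i^* )$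 for $i<j$, and $\delta_j(x_i)\in\mathbf{k}[x_{i+1},\dots,x_{j-1}]$ for $i<j$. Homogeneous Poisson primes (Goodearl–Yakimov; for any CGL extension). With $R_k=\mathbf{k}[x_1,\dots,x_k]$: $y_1=x_1$, $p(1)=-\infty$; for $k\ge2$, if $\delta_k=0$ then $p(k)=-\infty$, $y_k=x_k$; otherwise $p(k)\in[1,k-1]$ is the unique index such that $y_{p(k)}$ is a homogeneous ($\mathbb{T}$-weight vector) Poisson prime element of $R_{k-1}$ (prime with $\{y,R_{k-1}\}\subset yR_{k-1}$) and $\delta_k(y_{p(k)})\ne0$, and $y_k=y_{p(k)}x_k-\delta_k(y_{p(k)})/\lambda_k$. Successor map: $s(j)=k$ if $p(k)=j$, and $s(j)=+\infty$ if there is no such $k$. The $y_j$ are $\mathbb{T}$-weight vectors (weights $\chi_{y_j}$) and $\{y_i,y_j\}=q_{i,j}y_iy_j$, $q_{i,j}\in\mathbf{k}$. Level sets are the classes of the equivalence relation on $[1,n]$ generated by $j\sim s(j)$ ($s(j)\ne+\infty$). Matrices. $\mathrm{ex}=\{j:s(j)\ne+\infty\}$; $\Lambda\in\mathrm{Mat}_{n\times\mathrm{ex}}(\mathbf{k})$ has $j$-th column $\lambda_{s(j)}e_j$; $\overline\Lambda$ is the $n\times n$ diagonal matrix with $(j,j)$-entry $\lambda_{\max L(j)}$, $L(j)$ the level set of $j$ (equal to $\lambda_{s(j)}$ for $j\in\mathrm{ex}$); $E$ has $j$-th column $e_j-e_{s(j)}$; $\boldsymbol\nu$ is upper triangular with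 diagonal entries $\lambda_j$ and $(i,j)$-entry $\chi_i(h_j)+\chi_j(h_i)$ for $i<j$. GSV matrix of a CGL extension. For any CGL extension $R$ the equations $\mathbf{q}M=-\Lambda$, $\chi_{\mathbf y}M=0$ (with $\mathbf{q}=(q_{i,j})$, $\chi_{\mathbf y}=(\chi_{y_1},\dots,\chi_{y_n})$) have a unique solution $M\in\mathrm{Mat}_{n\times\mathrm{ex}}(\mathbf{k})$, which is integral. Re-orderings. $\Xi_n\subset S_n$ is the set of $\tau$ such that $\tau([1,j])$ is an interval for every $j$. Put $\tau(+)=\{j\in[2,n]:\tau(j)>\tau(1)\}$, $\tau(-)=\{j\in[2,n]:\tau(j)<\tau(1)\}$. For $\tau\in\Xi_n$, the same Poisson algebra $R$ is a $\mathbb{T}$-Poisson CGL extension, denoted $R_\tau$, in the ordered generators $(x_{\tau(1)},\dots,x_{\tau(n)})$, with elements $h_{\tau,1}=h_{\tau(1)}$, $h_{\tau,k}=h_{\tau(k)}$ for $k\in\tau(+)$, $h_{\tau,k}=h^*_{\tau(k)}$ for $k\in\tau(-)$. Let $\mathbf{y}'_\tau$, $s_\tau$, $\mathrm{ex}_\tau=\{j:s_\tau(j)\neq+\infty\}$ be its sequence of homogeneous Poisson primes, successor map, and exchangeable set, and let $M'_\tau\in\mathrm{Mat}_{n\times\mathrm{ex}_\tau}(\mathbb{Z})$ be the GSV matrix of $R_\tau$ (i.e. the matrix $M$ of the previous paragraph formed from $R_\tau$, with $\Lambda_\tau$ having $j$-th column $\chi_{\tau(s_\tau(j))}(h_{\tau,s_\tau(j)})e_j$).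 $\varepsilon'_\tau\in\mathrm{Mat}_{\mathrm{ex}_\tau\times\mathrm{ex}_\tau}(\mathbb{Z})$ is diagonal with $(j,j)$-entry $1$ if $s_\tau(j)\in\tau(+)$ and $-1$ if $s_\tau(j)\in\tau(-)$. $\tau_\bullet\in S_n$ is the unique permutation with $\tau_\bullet(L)=L$ and $\tau_\bullet\tau|_{\tau^{-1}(L)}:\tau^{-1}(L)\to L$ order preserving for every level set $L$ of $R$; $\tau_\bullet\tau$ restricts to a bijection $\mathrm{ex}_\tau\to\mathrm{ex}$. Set $\mathbf{y}_\tau=(y_{\tau,1},\dots,y_{\tau,n})$ with $y_{\tau,k}=y'_{\tau,(\tau_\bullet\tau)^{-1}(k)}$; $\mathbf{q}_\tau$ is the matrix of coefficients $\{y_{\tau,i},y_{\tau,j}\}/(y_{\tau,i}y_{\tau,j})\in\mathbf{k}$ and $\chi_{\mathbf{y}_\tau}$ is the row of $\mathbb{T}$-weights of the $y_{\tau,k}$. *)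

theory Defs
  imports "HOL-Analysis.Finite_Cartesian_Product" "HOL-Library.Poly_Mapping"
    "HOL-Combinatorics.Permutations"
begin

section \<open>Polynomial algebras\<close>

type_synonym 'k mpoly = "(nat \<Rightarrow>\<^sub>0 nat) \<Rightarrow>\<^sub>0 'k"

definition Const :: "'k::zero \<Rightarrow> 'k mpoly" where
  "Const c = Poly_Mapping.single 0 c"

definition Var :: "nat \<Rightarrow> 'k::zero_neq_one mpoly" where
  "Var v = Poly_Mapping.single (Poly_Mapping.single v 1) 1"

text \<open>The subalgebra generated by the variables with index in \<open>V\<close>.\<close>

definition polys_in :: "nat set \<Rightarrow> 'k::zero mpoly set" where
  "polys_in V = {f. \<forall>m \<in> Poly_Mapping.keys f. Poly_Mapping.keys m \<subseteq> V}"

definition derivation_on :: "'k::comm_ring_1 mpoly set \<Rightarrow> ('k mpoly \<Rightarrow> 'k mpoly) \<Rightarrow> bool" where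
  "derivation_on S d \<longleftrightarrow>
     (\<forall>a\<in>S. d a \<in> S) \<and>
     (\<forall>a\<in>S. \<forall>b\<in>S. d (a + b) = d a + d b) \<and>
     (\<forall>c. \<forall>a\<in>S. d (Const c * a) = Const c * d a) \<and>
     (\<forall>a\<in>S. \<forall>b\<in>S. d (a * b) = d a * b + a * d b)"

definition locally_nilpotent_on :: "'k::comm_ring_1 mpoly set \<Rightarrow> ('k mpoly \<Rightarrow> 'k mpoly) \<Rightarrow> bool" where
  "locally_nilpotent_on S d \<longleftrightarrow> (\<forall>a\<in>S. \<exists>m. (d ^^ m) a = 0)"

definition poisson_bracket_on ::
    "'k::comm_ring_1 mpoly set \<Rightarrow> ('k mpoly \<Rightarrow> 'k mpoly \<Rightarrow> 'k mpoly) \<Rightarrow> bool" where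
  "poisson_bracket_on S br \<longleftrightarrow>
     (\<forall>a\<in>S. derivation_on S (br a)) \<and>
     (\<forall>b\<in>S. derivation_on S (\<lambda>a. br a b)) \<and>
     (\<forall>a\<in>S. br a a = 0) \<and>
     (\<forall>a\<in>S. \<forall>b\<in>S. \<forall>c\<in>S. br a (br b c) + br b (br c a) + br c (br a b) = 0)"

definition dvd_on :: "'k::comm_ring_1 mpoly set \<Rightarrow> 'k mpoly \<Rightarrow> 'k mpoly \<Rightarrow> bool" where
  "dvd_on S a b \<longleftrightarrow> (\<exists>c\<in>S. b = a * c)"

definition prime_elem_on :: "'k::comm_ring_1 mpoly set \<Rightarrow> 'k mpoly \<Rightarrow> bool" where
  "prime_elem_on S y \<longleftrightarrow> y \<in> S \<and> y \<noteq> 0 \<and> \<not> dvd_on S y 1 \<and>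
     (\<forall>a\<in>S. \<forall>b\<in>S. dvd_on S y (a * b) \<longrightarrow> dvd_on S y a \<or> dvd_on S y b)"


section \<open>The split torus\<close>

text \<open>
  The split torus of rank \<open>CARD('r)\<close> is represented by its \<open>'k\<close>-points: the elements of
  \<open>'k ^ 'r\<close> without zero coordinate, under the coordinatewise product. Its character lattice
  is \<open>int ^ 'r\<close> and its Lie algebra is \<open>'k ^ 'r\<close>. As \<open>'k\<close> is infinite, the \<open>'k\<close>-points are
  Zariski dense, so weight vectors are detected on them.
\<close>

definition torus :: "('k::field ^ 'r::finite) set" where
  "torus = {t. \<forall>i. t $ i \<noteq> 0}"

definition char_eval :: "int ^ 'r::finite \<Rightarrow> 'k::field ^ 'r \<Rightarrow> 'k" where
  "char_eval w t = (\<Prod>i\<in>UNIV. (t $ i) powi (w $ i))"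

text \<open>The differential of a character, as a linear functional on the Lie algebra.\<close>

definition char_diff :: "int ^ 'r::finite \<Rightarrow> 'k::field ^ 'r \<Rightarrow> 'k" where
  "char_diff w h = (\<Sum>i\<in>UNIV. of_int (w $ i) * h $ i)"


section \<open>Matrices with rows and columns indexed by sets of natural numbers\<close>

text \<open>
  A matrix with rows indexed by \<open>I\<close> and columns indexed by \<open>J\<close> is a function of which only the
  values on \<open>I \<times> J\<close> are relevant; hence a submatrix is given by the same function, with
  smaller index sets. The index set that is summed over is explicit in products.
\<close>

type_synonym 'k matr = "nat \<Rightarrow> nat \<Rightarrow> 'k"

definition mat_mul :: "'k::comm_ring_1 matr \<Rightarrow> nat set \<Rightarrow> 'k matr \<Rightarrow> 'k matr"
    ("(_ \<cdot>\<^bsub>_\<^esub> _)" [70, 0, 71] 70) where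
  "A \<cdot>\<^bsub>K\<^esub> B = (\<lambda>i j. \<Sum>k\<in>K. A i k * B k j)"

definition mat_eq :: "nat set \<Rightarrow> nat set \<Rightarrow> 'k matr \<Rightarrow> 'k matr \<Rightarrow> bool" where
  "mat_eq I J A B \<longleftrightarrow> (\<forall>i\<in>I. \<forall>j\<in>J. A i j = B i j)"

definition mat_transpose :: "'k matr \<Rightarrow> 'k matr" where
  "mat_transpose A = (\<lambda>i j. A j i)"

definition id_mat :: "'k::comm_ring_1 matr" where
  "id_mat = (\<lambda>i j. if i = j then 1 else 0)"

text \<open>The entries of the inverse outside \<open>I \<times> I\<close> are fixed to make it unique as a function.\<close>

definition mat_inv :: "nat set \<Rightarrow> 'k::comm_ring_1 matr \<Rightarrow> 'k matr" where
  "mat_inv I A = (THE B. (\<forall>i j. i \<notin> I \<or> j \<notin> I \<longrightarrow> B i j = 0) \<and>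
     mat_eq I I (A \<cdot>\<^bsub>I\<^esub> B) id_mat \<and> mat_eq I I (B \<cdot>\<^bsub>I\<^esub> A) id_mat)"

text \<open>Column \<open>j\<close> is the standard basis vector with index \<open>\<sigma> j\<close>.\<close>

definition perm_mat :: "(nat \<Rightarrow> nat) \<Rightarrow> 'k::comm_ring_1 matr" where
  "perm_mat \<sigma> = (\<lambda>i j. if i = \<sigma> j then 1 else 0)"


section \<open>Poisson CGL extensions\<close>

text \<open>
  The data of a Poisson CGL extension: the length \<open>n\<close>, the names of the variables that serve as
  the ordered generators \<open>x\<^sub>1, \<dots>, x\<^sub>n\<close>, the torus action, the Poisson bracket, the weights
  \<open>\<chi>\<^sub>j\<close> of the generators and the elements \<open>h\<^sub>j\<close> of the Lie algebra. Naming the variables makes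
  a re-ordering of the generators a structure on the same underlying algebra. The sequences are
  relevant at the indices \<open>1, \<dots>, n\<close> only, the action and the bracket on \<open>alg C\<close> only.
\<close>

record (overloaded) ('k, 'r) cgl =
  len :: nat
  var :: "nat \<Rightarrow> nat"
  act :: "'k ^ 'r \<Rightarrow> 'k mpoly \<Rightarrow> 'k mpoly"
  bracket :: "'k mpoly \<Rightarrow> 'k mpoly \<Rightarrow> 'k mpoly"
  wt :: "nat \<Rightarrow> int ^ 'r"
  lie :: "nat \<Rightarrow> 'k ^ 'r"

abbreviation idx :: "('k::field_char_0, 'r::finite) cgl \<Rightarrow> nat set" where
  "idx C \<equiv> {1..len C}"

definition gen :: "('k::field_char_0, 'r::finite) cgl \<Rightarrow> nat \<Rightarrow> 'k mpoly" where
  "gen C j = Var (var C j)"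

text \<open>The subalgebra generated by the generators \<open>x\<^sub>j\<close>, \<open>j \<in> J\<close>.\<close>

definition subalg :: "('k::field_char_0, 'r::finite) cgl \<Rightarrow> nat set \<Rightarrow> 'k mpoly set" where
  "subalg C J = polys_in (var C ` J)"

abbreviation alg :: "('k::field_char_0, 'r::finite) cgl \<Rightarrow> 'k mpoly set" where
  "alg C \<equiv> subalg C (idx C)"

definition torus_action :: "('k::field_char_0, 'r::finite) cgl \<Rightarrow> bool" where
  "torus_action C \<longleftrightarrow>
     (\<forall>a\<in>alg C. act C 1 a = a) \<and>
     (\<forall>t\<in>torus. \<forall>u\<in>torus. \<forall>a\<in>alg C. act C (t * u) a = act C t (act C u a)) \<and>
     (\<forall>t\<in>torus. bij_betw (act C t) (alg C) (alg C) \<and>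
        (\<forall>c. act C t (Const c) = Const c) \<and>
        (\<forall>a\<in>alg C. \<forall>b\<in>alg C. act C t (a + b) = act C t a + act C t b) \<and>
        (\<forall>a\<in>alg C. \<forall>b\<in>alg C. act C t (a * b) = act C t a * act C t b))"

definition weight_vector :: "('k::field_char_0, 'r::finite) cgl \<Rightarrow> int ^ 'r \<Rightarrow> 'k mpoly \<Rightarrow> bool" where
  "weight_vector C w a \<longleftrightarrow> (\<forall>t\<in>torus. act C t a = Const (char_eval w t) * a)"

definition weight_of :: "('k::field_char_0, 'r::finite) cgl \<Rightarrow> 'k mpoly \<Rightarrow> int ^ 'r" where
  "weight_of C a = (THE w. weight_vector C w a)"

definition lam :: "('k::field_char_0, 'r::finite) cgl \<Rightarrow> nat \<Rightarrow> 'k" where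
  "lam C j = char_diff (wt C j) (lie C j)"

definition is_delta ::
    "('k::field_char_0, 'r::finite) cgl \<Rightarrow> nat \<Rightarrow> ('k mpoly \<Rightarrow> 'k mpoly) \<Rightarrow> bool" where
  "is_delta C j d \<longleftrightarrow>
     derivation_on (subalg C {1..<j}) d \<and>
     locally_nilpotent_on (subalg C {1..<j}) d \<and>
     (\<forall>i\<in>{1..<j}. bracket C (gen C i) (gen C j) =
        - Const (char_diff (wt C i) (lie C j)) * gen C i * gen C j - d (gen C i))"

text \<open>
  A derivation satisfying \<open>is_delta C j\<close> is determined on the subalgebra generated by
  \<open>x\<^sub>1, \<dots>, x\<^sub>j\<^sub>-\<^sub>1\<close>, because the bracket prescribes its values on these generators; the choice
  below only concerns irrelevant values. For \<open>j = 1\<close> that subalgebra consists of the constants,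
  on which every derivation vanishes.
\<close>

definition delta :: "('k::field_char_0, 'r::finite) cgl \<Rightarrow> nat \<Rightarrow> 'k mpoly \<Rightarrow> 'k mpoly" where
  "delta C j = (SOME d. is_delta C j d)"

definition cgl_extension :: "('k::field_char_0, 'r::finite) cgl \<Rightarrow> bool" where
  "cgl_extension C \<longleftrightarrow>
     inj_on (var C) (idx C) \<and>
     torus_action C \<and>
     poisson_bracket_on (alg C) (bracket C) \<and>
     (\<forall>t\<in>torus. \<forall>a\<in>alg C. \<forall>b\<in>alg C.
        act C t (bracket C a b) = bracket C (act C t a) (act C t b)) \<and>
     (\<forall>j\<in>idx C. weight_vector C (wt C j) (gen C j)) \<and>
     (\<forall>j\<in>idx C. lam C j \<noteq> 0) \<and>
     (\<forall>j\<in>idx C. \<exists>d. is_delta C j d)"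

text \<open>The second argument is the sequence of the elements \<open>h\<^sup>*\<^sub>j\<close>.\<close>

definition symmetric_cgl_extension ::
    "('k::field_char_0, 'r::finite) cgl \<Rightarrow> (nat \<Rightarrow> 'k ^ 'r) \<Rightarrow> bool" where
  "symmetric_cgl_extension C hs \<longleftrightarrow>
     cgl_extension C \<and>
     (\<forall>j\<in>idx C. char_diff (wt C j) (hs j) \<noteq> 0) \<and>
     (\<forall>j\<in>idx C. \<forall>i\<in>{1..<j}. char_diff (wt C i) (lie C j) = - char_diff (wt C j) (hs i)) \<and>
     (\<forall>j\<in>idx C. \<forall>i\<in>{1..<j}. delta C j (gen C i) \<in> subalg C {i<..<j})"


section \<open>Homogeneous Poisson primes, successor map and level sets\<close>

definition homogeneous_poisson_prime ::
    "('k::field_char_0, 'r::finite) cgl \<Rightarrow> 'k mpoly set \<Rightarrow> 'k mpoly \<Rightarrow> bool" where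
  "homogeneous_poisson_prime C S y \<longleftrightarrow>
     prime_elem_on S y \<and> (\<exists>w. weight_vector C w y) \<and> (\<forall>a\<in>S. dvd_on S y (bracket C y a))"

text \<open>
  The index \<open>p(k)\<close> and the element \<open>y\<^sub>k\<close> computed from the sequence \<open>y\<close> of the preceding
  elements; \<open>None\<close> stands for the value minus infinity.
\<close>

definition pred_from ::
    "('k::field_char_0, 'r::finite) cgl \<Rightarrow> nat \<Rightarrow> (nat \<Rightarrow> 'k mpoly) \<Rightarrow> nat option" where
  "pred_from C k y =
     (if \<forall>a\<in>subalg C {1..<k}. delta C k a = 0 then None
      else Some (THE p. p \<in> {1..<k} \<and>
             homogeneous_poisson_prime C (subalg C {1..<k}) (y p) \<and> delta C k (y p) \<noteq> 0))"

definition next_prime ::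
    "('k::field_char_0, 'r::finite) cgl \<Rightarrow> nat \<Rightarrow> (nat \<Rightarrow> 'k mpoly) \<Rightarrow> 'k mpoly" where
  "next_prime C k y =
     (case pred_from C k y of
        None \<Rightarrow> gen C k
      | Some p \<Rightarrow> y p * gen C k - Const (1 / lam C k) * delta C k (y p))"

primrec prime_seq_upto :: "('k::field_char_0, 'r::finite) cgl \<Rightarrow> nat \<Rightarrow> nat \<Rightarrow> 'k mpoly" where
  "prime_seq_upto C 0 = (\<lambda>_. 0)"
| "prime_seq_upto C (Suc k) =
     (prime_seq_upto C k)(Suc k := next_prime C (Suc k) (prime_seq_upto C k))"

definition prime_seq :: "('k::field_char_0, 'r::finite) cgl \<Rightarrow> nat \<Rightarrow> 'k mpoly" where
  "prime_seq C k = prime_seq_upto C k k"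

definition pred :: "('k::field_char_0, 'r::finite) cgl \<Rightarrow> nat \<Rightarrow> nat option" where
  "pred C k = pred_from C k (prime_seq C)"

text \<open>\<open>None\<close> stands for the value plus infinity.\<close>

definition succ :: "('k::field_char_0, 'r::finite) cgl \<Rightarrow> nat \<Rightarrow> nat option" where
  "succ C j = (if \<exists>k\<in>idx C. pred C k = Some j
               then Some (THE k. k \<in> idx C \<and> pred C k = Some j) else None)"

definition ex :: "('k::field_char_0, 'r::finite) cgl \<Rightarrow> nat set" where
  "ex C = {j \<in> idx C. succ C j \<noteq> None}"

definition level_set :: "('k::field_char_0, 'r::finite) cgl \<Rightarrow> nat \<Rightarrow> nat set" where
  "level_set C j = {i \<in> idx C. equivclp (\<lambda>a b. a \<in> idx C \<and> succ C a = Some b) j i}"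

definition level_sets :: "('k::field_char_0, 'r::finite) cgl \<Rightarrow> nat set set" where
  "level_sets C = level_set C ` idx C"


section \<open>The matrices attached to a CGL extension\<close>

definition Lam_mat :: "('k::field_char_0, 'r::finite) cgl \<Rightarrow> 'k matr" where
  "Lam_mat C = (\<lambda>i j. if i = j then lam C (the (succ C j)) else 0)"

definition Lam_bar_mat :: "('k::field_char_0, 'r::finite) cgl \<Rightarrow> 'k matr" where
  "Lam_bar_mat C = (\<lambda>i j. if i = j then lam C (Max (level_set C j)) else 0)"

definition E_mat :: "('k::field_char_0, 'r::finite) cgl \<Rightarrow> 'k matr" where
  "E_mat C = (\<lambda>i j. (if i = j then 1 else 0) - (if succ C j = Some i then 1 else 0))"

definition nu_mat :: "('k::field_char_0, 'r::finite) cgl \<Rightarrow> 'k matr" where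
  "nu_mat C = (\<lambda>i j. if i = j then lam C j
     else if i < j then char_diff (wt C i) (lie C j) + char_diff (wt C j) (lie C i)
     else 0)"

definition Q_mat :: "('k::field_char_0, 'r::finite) cgl \<Rightarrow> 'k matr" where
  "Q_mat C = mat_inv (idx C) (nu_mat C) \<cdot>\<^bsub>idx C\<^esub> Lam_bar_mat C"

text \<open>The coefficients \<open>{y\<^sub>i, y\<^sub>j} / (y\<^sub>i y\<^sub>j)\<close> of a sequence \<open>y\<close>.\<close>

definition q_mat :: "('k::field_char_0, 'r::finite) cgl \<Rightarrow> (nat \<Rightarrow> 'k mpoly) \<Rightarrow> 'k matr" where
  "q_mat C y = (\<lambda>i j. THE c. bracket C (y i) (y j) = Const c * (y i * y j))"

text \<open>
  The linear system for an unknown matrix \<open>M\<close> with rows indexed by \<open>idx C\<close> and columns by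
  \<open>J\<close>, for a sequence \<open>y\<close> of weight vectors. The second condition is an equality in the dual of
  the Lie algebra.
\<close>

definition gsv_equations ::
    "('k::field_char_0, 'r::finite) cgl \<Rightarrow> (nat \<Rightarrow> 'k mpoly) \<Rightarrow> nat set \<Rightarrow> 'k matr \<Rightarrow> 'k matr \<Rightarrow> bool"
  where
  "gsv_equations C y J L M \<longleftrightarrow>
     mat_eq (idx C) J (q_mat C y \<cdot>\<^bsub>idx C\<^esub> M) (\<lambda>i j. - L i j) \<and>
     (\<forall>j\<in>J. \<forall>h. (\<Sum>k\<in>idx C. char_diff (weight_of C (y k)) h * M k j) = 0)"

text \<open>The entries outside \<open>idx C \<times> ex C\<close> are fixed to make the matrix unique as a function.\<close>

definition gsv_mat :: "('k::field_char_0, 'r::finite) cgl \<Rightarrow> 'k matr" where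
  "gsv_mat C = (THE M. (\<forall>i j. i \<notin> idx C \<or> j \<notin> ex C \<longrightarrow> M i j = 0) \<and>
     gsv_equations C (prime_seq C) (ex C) (Lam_mat C) M)"


section \<open>Re-orderings of a symmetric CGL extension\<close>

definition Xi :: "nat \<Rightarrow> (nat \<Rightarrow> nat) set" where
  "Xi n = {\<tau>. \<tau> permutes {1..n} \<and> (\<forall>j\<in>{1..n}. \<exists>a b. \<tau> ` {1..j} = {a..b})}"

definition tau_plus :: "nat \<Rightarrow> (nat \<Rightarrow> nat) \<Rightarrow> nat set" where
  "tau_plus n \<tau> = {j \<in> {2..n}. \<tau> j > \<tau> 1}"

definition tau_minus :: "nat \<Rightarrow> (nat \<Rightarrow> nat) \<Rightarrow> nat set" where
  "tau_minus n \<tau> = {j \<in> {2..n}. \<tau> j < \<tau> 1}"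

definition reorder ::
    "('k::field_char_0, 'r::finite) cgl \<Rightarrow> (nat \<Rightarrow> 'k ^ 'r) \<Rightarrow> (nat \<Rightarrow> nat) \<Rightarrow> ('k, 'r) cgl" where
  "reorder C hs \<tau> = C\<lparr>
     var := (\<lambda>k. var C (\<tau> k)),
     wt := (\<lambda>k. wt C (\<tau> k)),
     lie := (\<lambda>k. if k \<in> tau_minus (len C) \<tau> then hs (\<tau> k) else lie C (\<tau> k))\<rparr>"

definition eps_mat ::
    "('k::field_char_0, 'r::finite) cgl \<Rightarrow> (nat \<Rightarrow> 'k ^ 'r) \<Rightarrow> (nat \<Rightarrow> nat) \<Rightarrow> 'k matr" where
  "eps_mat C hs \<tau> = (\<lambda>i j. if i = j then
       (if the (succ (reorder C hs \<tau>) j) \<in> tau_plus (len C) \<tau> then 1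
        else if the (succ (reorder C hs \<tau>) j) \<in> tau_minus (len C) \<tau> then -1
        else 0)
     else 0)"

definition tau_bullet :: "('k::field_char_0, 'r::finite) cgl \<Rightarrow> (nat \<Rightarrow> nat) \<Rightarrow> nat \<Rightarrow> nat" where
  "tau_bullet C \<tau> = (THE \<sigma>. \<sigma> permutes idx C \<and>
     (\<forall>L\<in>level_sets C. \<sigma> ` L = L \<and> strict_mono_on (\<tau> -` L) (\<sigma> \<circ> \<tau>)))"

definition prime_seq_tau ::
    "('k::field_char_0, 'r::finite) cgl \<Rightarrow> (nat \<Rightarrow> 'k ^ 'r) \<Rightarrow> (nat \<Rightarrow> nat) \<Rightarrow> nat \<Rightarrow> 'k mpoly" where
  "prime_seq_tau C hs \<tau> k = prime_seq (reorder C hs \<tau>) (inv (tau_bullet C \<tau> \<circ> \<tau>) k)"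

definition M_tau ::
    "('k::field_char_0, 'r::finite) cgl \<Rightarrow> (nat \<Rightarrow> 'k ^ 'r) \<Rightarrow> (nat \<Rightarrow> nat) \<Rightarrow> 'k matr" where
  "M_tau C hs \<tau> =
     perm_mat (tau_bullet C \<tau> \<circ> \<tau>) \<cdot>\<^bsub>idx C\<^esub>
     (gsv_mat (reorder C hs \<tau>) \<cdot>\<^bsub>ex (reorder C hs \<tau>)\<^esub> eps_mat C hs \<tau>) \<cdot>\<^bsub>ex (reorder C hs \<tau>)\<^esub>
     perm_mat (inv (tau_bullet C \<tau> \<circ> \<tau>))"

end

theory Submission
  imports Defs "HOL-Computational_Algebra.Factorial_Ring" "HOL-Library.Infinite_Set"
begin

section \<open>Polynomials over a field of characteristic 0: subalgebras, substitution,
  divisibility\<close>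

section \<open>Polynomials\<close>

text \<open>Two coordinate systems are compared: the generators x, in which weights and the leading
  parts of brackets are explicit, and the homogeneous Poisson primes Y of a given order, in which
  the bracket is log-canonical.

  For any extension it must first be shown that the sequence Y behaves as prescribed. Over the
  Laurent ring in Y_1, ..., Y_{k-1} the derivation delta_k takes the form a -> (u/v) (h_k . a) -
  {u/v, a} (\<open>rel_exists\<close>). With u/v in lowest terms, local nilpotency forces v to be a
  single Y_p (\<open>predecessor_exists\<close>), and Y_k = Y_p x_k + u. The quotient Y_k / Y_p then
  brackets with the earlier generators through the action of h_k alone (\<open>br_Y_rel\<close>).
  Hence differences of the coefficients q_{i,j} along predecessors are values of weights
  (\<open>eq_rec\<close>), and second differences are the coefficients of x_i x_j in {x_i, x_j}
  (\<open>second_difference\<close>).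

  For a symmetric extension each \<tau> in Xi_n gives an extension again
  (\<open>cgl_reorder\<close>). Its predecessor map depends on the level sets of R only: the
  predecessor of a position m is the last earlier position whose index lies in the level set of
  \<tau>(m) (\<open>pt_iff\<close>). This rests on an order-free relation \<open>lnk\<close> and on
  the induction \<open>pred_linked\<close>, which compares primes of different orders by
  divisibility and leading exponents. Therefore \<kappa>, the composite of \<open>tau_bullet\<close>
  with \<tau>, conjugates the successor map of R_\<tau> into that of R (\<open>succ_kappa\<close>).
  Moreover lambda_w = -lambda*_u for u < w in one level set (\<open>lam_relation\<close>), so the
  signs in \<open>eps_mat\<close> make every right-hand side equal to one constant per level set
  (\<open>lam_T\<close>).

  Summation by parts converts a column of the GSV equations into a problem in the x coordinates
  (\<open>isol\<close>): find X with chi X = 0 and q_x X = -c (e_a - e_b), where q_x collects the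
  coefficients of x_i x_j in the brackets {x_i, x_j}. Since the entries of q_x + nu are values of
  weights, nu X = c (e_a - e_b), so X = c nu^{-1} (e_a - e_b) (\<open>nu_solve\<close>); this yields
  uniqueness (\<open>gcol_unique\<close>). Existence and integrality come from a monomial: if u < v
  are consecutive in a level set and e is the leading exponent of the correction term in {x_v, x_u},
  then e - e_u - e_v is a solution (\<open>isol_lnk\<close>), and solutions add along a level set
  (\<open>isol_lkeq\<close>).

  Undoing the summation by parts shows that column c of M_\<tau> is E^t tau_bullet X with a and b
  the preimages of c and s(c) under tau_bullet (\<open>M_col\<close>). This is the first formula;
  the other two follow because Lambda is scalar on each level set and tau_bullet preserves level
  sets.\<close>

abbreviation exps :: "('a \<Rightarrow>\<^sub>0 'b::zero) \<Rightarrow> 'a set" where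
  "exps \<equiv> Poly_Mapping.keys"

abbreviation cf :: "('a \<Rightarrow>\<^sub>0 'b::zero) \<Rightarrow> 'a \<Rightarrow> 'b" where
  "cf \<equiv> Poly_Mapping.lookup"

abbreviation mon :: "(nat \<Rightarrow>\<^sub>0 nat) \<Rightarrow> 'k::field_char_0 mpoly" where
  "mon u \<equiv> Poly_Mapping.single u 1"

lemma Const_simps [simp]:
  "Const (0::'k::field_char_0) = 0" "Const (1::'k) = 1"
  by (simp_all add: Const_def)

lemma Const_add: "Const (a + b :: 'k::field_char_0) = Const a + Const b"
  by (simp add: Const_def single_add)

lemma Const_mult: "Const (a * b :: 'k::field_char_0) = Const a * Const b"
  by (simp add: Const_def mult_single)

lemma Const_minus: "Const (- a :: 'k::field_char_0) = - Const a"
  by (simp add: Const_def single_uminus)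

lemma Const_diff: "Const (a - b :: 'k::field_char_0) = Const a - Const b"
  by (simp add: Const_def single_diff)

lemma Const_sum: "Const (\<Sum>i\<in>A. f i :: 'k::field_char_0) = (\<Sum>i\<in>A. Const (f i))"
  by (induct A rule: infinite_finite_induct) (auto simp: Const_add)

lemma Const_prod: "Const (\<Prod>i\<in>A. f i :: 'k::field_char_0) = (\<Prod>i\<in>A. Const (f i))"
  by (induct A rule: infinite_finite_induct) (auto simp: Const_mult)

lemma Const_power: "Const (a ^ m :: 'k::field_char_0) = Const a ^ m"
  by (induct m) (auto simp: Const_mult)

lemma Const_eq_iff [simp]: "Const (a :: 'k::field_char_0) = Const b \<longleftrightarrow> a = b"
  unfolding Const_def by (metis lookup_single_eq)

lemma Const_eq_0_iff [simp]: "Const (a :: 'k::field_char_0) = 0 \<longleftrightarrow> a = 0"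
  using Const_eq_iff[of a 0] by simp

lemma cf_Const_mult [simp]: "cf (Const c * f) u = c * cf (f :: 'k::field_char_0 mpoly) u"
proof -
  have "Const c * f = Poly_Mapping.map ((*) c) f"
    by (simp add: mult_map_scale_conv_mult Const_def)
  then show ?thesis
    by (simp add: map.rep_eq when_def in_keys_iff)
qed

lemma mon_add: "mon (u + v) = mon u * mon v"
  by (simp add: mult_single)

lemma mon_zero [simp]: "mon 0 = 1"
  by simp

lemma mpoly_expand: "(f :: 'k::field_char_0 mpoly) = (\<Sum>u\<in>exps f. Const (cf f u) * mon u)"
proof (rule poly_mapping_eqI)
  fix v
  have "cf (\<Sum>u\<in>exps f. Const (cf f u) * mon u) v = (\<Sum>u\<in>exps f. if u = v then cf f u else 0)"
    unfolding lookup_sum by (rule sum.cong) (auto simp: lookup_single when_def)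
  also have "\<dots> = cf f v"
    by (simp add: in_keys_iff)
  finally show "cf f v = cf (\<Sum>u\<in>exps f. Const (cf f u) * mon u) v" ..
qed

lemma mpoly_induct [case_names mon add]:
  fixes f :: "'k::field_char_0 mpoly"
  assumes "\<And>c u. P (Const c * mon u)" and "\<And>f g. P f \<Longrightarrow> P g \<Longrightarrow> P (f + g)"
  shows "P f"
proof -
  have "P (\<Sum>u\<in>A. Const (c u) * mon u)" if "finite A" for A c
    using that
  proof induct
    case empty
    then show ?case using assms(1)[of 0 0] by simp
  qed (auto intro: assms)
  then show ?thesis by (subst mpoly_expand) simp
qed

lemma mon_single: "mon (Poly_Mapping.single i m) = (Var i :: 'k::field_char_0 mpoly) ^ m"
proof (induct m)
  case (Suc m)
  have "(mon (Poly_Mapping.single i (Suc m)) :: 'k mpoly) = mon (Poly_Mapping.single i 1 + Poly_Mapping.single i m)"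
    by (simp add: single_add[symmetric])
  then show ?case using Suc by (simp only: mon_add) (simp add: Var_def)
qed simp

lemma poly_mapping_expand_nat: "(u :: nat \<Rightarrow>\<^sub>0 nat) = (\<Sum>i\<in>exps u. Poly_Mapping.single i (cf u i))"
proof (rule poly_mapping_eqI)
  fix v
  have "cf (\<Sum>i\<in>exps u. Poly_Mapping.single i (cf u i)) v = (\<Sum>i\<in>exps u. if i = v then cf u i else 0)"
    unfolding lookup_sum by (rule sum.cong) (auto simp: lookup_single when_def)
  also have "\<dots> = cf u v"
    by (simp add: in_keys_iff)
  finally show "cf u v = cf (\<Sum>i\<in>exps u. Poly_Mapping.single i (cf u i)) v" ..
qed

lemma mon_sum: "mon (\<Sum>i\<in>A. f i) = (\<Prod>i\<in>A. mon (f i))"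
  by (induct A rule: infinite_finite_induct) (auto simp: mon_add)

lemma mon_eq_prod: "mon u = (\<Prod>i\<in>exps u. (Var i :: 'k::field_char_0 mpoly) ^ cf u i)"
  by (subst poly_mapping_expand_nat) (simp add: mon_sum mon_single)

lemma exps_add_nat: "exps (u + v :: nat \<Rightarrow>\<^sub>0 nat) = exps u \<union> exps v"
  by (auto simp: in_keys_iff lookup_add)

lemma polys_in_0 [simp]: "0 \<in> polys_in V"
  by (simp add: polys_in_def)

lemma polys_in_Const [simp]: "Const c \<in> polys_in V"
  by (auto simp: polys_in_def Const_def)

lemma polys_in_1 [simp]: "(1 :: 'k::field_char_0 mpoly) \<in> polys_in V"
  using polys_in_Const[of "1::'k" V] by (simp del: polys_in_Const)

lemma polys_in_Var [simp]: "(Var i :: 'k::field_char_0 mpoly) \<in> polys_in V \<longleftrightarrow> i \<in> V"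
  by (auto simp: polys_in_def Var_def)

lemma polys_in_mon [simp]: "(mon u :: 'k::field_char_0 mpoly) \<in> polys_in V \<longleftrightarrow> exps u \<subseteq> V"
  by (auto simp: polys_in_def)

lemma polys_in_add [simp]:
  "f \<in> polys_in V \<Longrightarrow> g \<in> polys_in V \<Longrightarrow> f + g \<in> polys_in V"
  using Poly_Mapping.keys_add[of f g] unfolding polys_in_def by blast

lemma polys_in_uminus [simp]: "- f \<in> polys_in V \<longleftrightarrow> (f :: 'k::field_char_0 mpoly) \<in> polys_in V"
  by (simp add: polys_in_def in_keys_iff)

lemma polys_in_diff [simp]:
  "f \<in> polys_in V \<Longrightarrow> g \<in> polys_in V \<Longrightarrow> (f - g :: 'k::field_char_0 mpoly) \<in> polys_in V"
  using polys_in_add[of f V "- g"] by simp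

lemma polys_in_mult [simp]:
  assumes "(f :: 'k::field_char_0 mpoly) \<in> polys_in V" "g \<in> polys_in V"
  shows "f * g \<in> polys_in V"
  unfolding polys_in_def
proof safe
  fix u i assume u: "u \<in> exps (f * g)" and i: "i \<in> exps u"
  then obtain a b where "u = a + b" "a \<in> exps f" "b \<in> exps g"
    using Poly_Mapping.keys_mult[of f g] by blast
  then show "i \<in> V"
    using i assms by (fastforce simp: exps_add_nat polys_in_def)
qed

lemma polys_in_power [simp]: "(f :: 'k::field_char_0 mpoly) \<in> polys_in V \<Longrightarrow> f ^ m \<in> polys_in V"
  by (induct m) auto

lemma polys_in_sum [simp]:
  "(\<And>i. i \<in> A \<Longrightarrow> (f i :: 'k::field_char_0 mpoly) \<in> polys_in V) \<Longrightarrow> (\<Sum>i\<in>A. f i) \<in> polys_in V"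
  by (induct A rule: infinite_finite_induct) auto

lemma polys_in_prod [simp]:
  "(\<And>i. i \<in> A \<Longrightarrow> (f i :: 'k::field_char_0 mpoly) \<in> polys_in V) \<Longrightarrow> (\<Prod>i\<in>A. f i) \<in> polys_in V"
  by (induct A rule: infinite_finite_induct) auto

lemma polys_in_mono: "V \<subseteq> W \<Longrightarrow> polys_in V \<subseteq> polys_in W"
  unfolding polys_in_def by blast

lemma polys_in_UNIV [simp]: "polys_in UNIV = UNIV"
  by (auto simp: polys_in_def)

text \<open>Multiplying by one variable at a time suits derivations: the product rule then involves
  only their values on generators.\<close>

lemma polys_in_induct [consumes 1, case_names Const add Var]:
  fixes f :: "'k::field_char_0 mpoly"
  assumes f: "f \<in> polys_in V"
    and C: "\<And>c. P (Const c)"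
    and A: "\<And>f g. f \<in> polys_in V \<Longrightarrow> g \<in> polys_in V \<Longrightarrow> P f \<Longrightarrow> P g \<Longrightarrow> P (f + g)"
    and M: "\<And>f i. f \<in> polys_in V \<Longrightarrow> i \<in> V \<Longrightarrow> P f \<Longrightarrow> P (f * Var i)"
  shows "P f"
proof -
  have pw: "P (g * Var i ^ m) \<and> g * Var i ^ m \<in> polys_in V"
    if "P g" "g \<in> polys_in V" "i \<in> V" for g i m
  proof (induct m)
    case (Suc m)
    then show ?case
      using M[of "g * Var i ^ m" i] that by (auto simp: ac_simps)
  qed (use that in auto)
  have mo: "P (Const c * (\<Prod>i\<in>B. Var i ^ e i)) \<and> Const c * (\<Prod>i\<in>B. Var i ^ e i) \<in> polys_in V"
    if "finite B" "B \<subseteq> V" for B e c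
    using that
  proof induct
    case (insert i B)
    then show ?case using pw[of "Const c * (\<Prod>i\<in>B. Var i ^ e i)" i "e i"] by (auto simp: ac_simps)
  qed (use C in auto)
  have su: "P (\<Sum>u\<in>B. Const (c u) * mon u) \<and> (\<Sum>u\<in>B. Const (c u) * mon u) \<in> polys_in V"
    if "finite B" "\<forall>u\<in>B. exps u \<subseteq> V" for B c
    using that
  proof induct
    case empty
    then show ?case using C[of 0] by simp
  next
    case (insert u B)
    then show ?case
      using A[of "Const (c u) * mon u"] mo[of "exps u" "c u" "cf u"] by (auto simp: mon_eq_prod)
  qed
  have "\<forall>u\<in>exps f. exps u \<subseteq> V"
    using f by (simp add: polys_in_def)
  from su[OF finite_keys this, of "cf f"] show ?thesis
    by (simp only: mpoly_expand[symmetric])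
qed

lemma mpoly_Var_induct [case_names Const add Var]:
  fixes f :: "'k::field_char_0 mpoly"
  assumes "\<And>c. P (Const c)" "\<And>f g. P f \<Longrightarrow> P g \<Longrightarrow> P (f + g)" "\<And>f i. P f \<Longrightarrow> P (f * Var i)"
  shows "P f"
  by (rule polys_in_induct[of f UNIV]) (use assms in auto)

subsection \<open>Substitution homomorphisms\<close>

text \<open>The monomial with exponent vector \<open>u\<close> in arbitrary elements
  \<open>y i\<close>; \<open>sub y\<close> is the algebra homomorphism sending the i-th variable to
  \<open>y i\<close>.\<close>

definition pmon :: "(nat \<Rightarrow> 'k::field_char_0 mpoly) \<Rightarrow> (nat \<Rightarrow>\<^sub>0 nat) \<Rightarrow> 'k mpoly" where
  "pmon y u = (\<Prod>i\<in>exps u. y i ^ cf u i)"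

definition sub :: "(nat \<Rightarrow> 'k::field_char_0 mpoly) \<Rightarrow> 'k mpoly \<Rightarrow> 'k mpoly" where
  "sub y f = (\<Sum>u\<in>exps f. Const (cf f u) * pmon y u)"

lemma pmon_superset:
  assumes "finite A" "exps u \<subseteq> A"
  shows "pmon y u = (\<Prod>i\<in>A. y i ^ cf u i)"
  unfolding pmon_def by (rule prod.mono_neutral_left) (use assms in \<open>auto simp: in_keys_iff\<close>)

lemma pmon_add: "pmon y (u + v) = pmon y u * pmon y v"
  by (subst (1 2 3) pmon_superset[of "exps u \<union> exps v"])
     (auto simp: exps_add_nat lookup_add power_add prod.distrib)

lemma pmon_0 [simp]: "pmon y 0 = 1"
  by (simp add: pmon_def)

lemma pmon_single [simp]: "pmon y (Poly_Mapping.single i m) = y i ^ m"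
  by (cases "m = 0") (auto simp: pmon_def)

lemma pmon_Var [simp]: "pmon Var u = mon u"
  by (simp add: pmon_def mon_eq_prod)

lemma pmon_in [simp]: "(\<And>i. i \<in> exps u \<Longrightarrow> y i \<in> polys_in V) \<Longrightarrow> pmon y u \<in> polys_in V"
  by (simp add: pmon_def)

lemma pmon_eq_0_iff: "pmon y u = 0 \<longleftrightarrow> (\<exists>i\<in>exps u. y i = 0)"
  by (auto simp: pmon_def in_keys_iff)

lemma sub_superset:
  assumes "finite A" "exps f \<subseteq> A"
  shows "sub y f = (\<Sum>u\<in>A. Const (cf f u) * pmon y u)"
  unfolding sub_def by (rule sum.mono_neutral_left) (use assms in \<open>auto simp: in_keys_iff\<close>)

lemma sub_add [simp]: "sub y (f + g) = sub y f + sub y g"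
  by (subst (1 2 3) sub_superset[of "exps f \<union> exps g"])
     (use Poly_Mapping.keys_add[of f g] in \<open>auto simp: lookup_add Const_add distrib_right sum.distrib\<close>)

lemma sub_mon: "sub y (Const c * mon u) = Const c * pmon y u"
  by (subst sub_superset[of "{u}"]) (auto simp: in_keys_iff lookup_single when_def split: if_splits)

lemma sub_mult [simp]: "sub y (f * g) = sub y f * sub y g"
proof (induct f rule: mpoly_induct)
  case (mon c u)
  show ?case
  proof (induct g rule: mpoly_induct)
    case (mon d v)
    have "sub y (Const c * mon u * (Const d * mon v)) = sub y (Const (c * d) * mon (u + v))"
      unfolding mon_add Const_mult by (simp only: ac_simps)
    also have "\<dots> = Const (c * d) * pmon y (u + v)"
      by (rule sub_mon)
    also have "\<dots> = sub y (Const c * mon u) * sub y (Const d * mon v)"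
      unfolding sub_mon pmon_add Const_mult by (simp only: ac_simps)
    finally show ?case .
  qed (simp add: distrib_left)
qed (simp add: distrib_right)

lemma sub_Const [simp]: "sub y (Const c) = Const c"
  using sub_mon[of y c 0] by simp

lemma sub_Var [simp]: "sub y (Var i) = y i"
  using sub_mon[of y 1 "Poly_Mapping.single i 1"] by (simp add: mon_single)

lemma sub_0 [simp]: "sub y 0 = 0"
  by (simp add: sub_def)

lemma sub_uminus [simp]: "sub y (- f) = - sub y f"
  using sub_add[of y f "- f"] by (simp add: eq_neg_iff_add_eq_0 add.commute)

lemma sub_diff [simp]: "sub y (f - g) = sub y f - sub y g"
  using sub_add[of y f "- g"] by simp

lemma sub_sum [simp]: "sub y (\<Sum>i\<in>A. f i) = (\<Sum>i\<in>A. sub y (f i))"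
  by (induct A rule: infinite_finite_induct) auto

lemma sub_in:
  "f \<in> polys_in V \<Longrightarrow> (\<And>i. i \<in> V \<Longrightarrow> y i \<in> polys_in W) \<Longrightarrow> sub y f \<in> polys_in W"
  unfolding sub_def polys_in_def[of V] by (intro polys_in_sum polys_in_mult pmon_in) auto

text \<open>A retraction onto \<open>polys_in V\<close>. Being multiplicative and the identity on
  this subalgebra, it pushes a factorization from the full ring into the subalgebra, so divisibility
  can be treated in one ambient ring.\<close>

definition retr :: "nat set \<Rightarrow> 'k::field_char_0 mpoly \<Rightarrow> 'k mpoly" where
  "retr V = sub (\<lambda>i. if i \<in> V then Var i else 0)"

lemma retr_in [simp]: "retr V f \<in> polys_in V"
  unfolding retr_def by (rule sub_in[of _ UNIV]) auto

lemma retr_ident: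
  assumes "f \<in> polys_in V"
  shows "retr V f = f"
  using assms by (induct rule: polys_in_induct) (auto simp: retr_def)

lemma quotient_in_polys_in:
  assumes "a \<in> polys_in V" "b \<in> polys_in V" "b = a * c" "a \<noteq> (0 :: 'k::field_char_0 mpoly)"
  shows "c \<in> polys_in V"
proof -
  have "b = retr V (a * c)"
    using retr_ident[OF assms(2)] assms(3) by metis
  also have "\<dots> = a * retr V c"
    using retr_ident[OF assms(1)] by (simp add: retr_def)
  finally have "c = retr V c"
    using assms(3,4) by (metis mult_left_cancel)
  then show ?thesis
    by (metis retr_in)
qed

lemma dvd_on_polys_in:
  assumes "a \<in> polys_in V" "b \<in> polys_in V"
  shows "dvd_on (polys_in V) a b \<longleftrightarrow> a dvd (b :: 'k::field_char_0 mpoly)"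
proof
  assume "a dvd b"
  then obtain c where c: "b = a * c" ..
  show "dvd_on (polys_in V) a b"
  proof (cases "a = 0")
    case True
    then show ?thesis using c unfolding dvd_on_def by (intro bexI[of _ 0]) auto
  next
    case False
    then show ?thesis
      using quotient_in_polys_in[OF assms c False] c unfolding dvd_on_def by metis
  qed
qed (auto simp: dvd_on_def)

lemma prime_elem_on_polys_in:
  assumes "a \<in> polys_in V" "prime_elem (a :: 'k::field_char_0 mpoly)"
  shows "prime_elem_on (polys_in V) a"
  using assms prime_elem_not_unit[OF assms(2)] unfolding prime_elem_on_def
  by (auto simp: dvd_on_polys_in prime_elem_dvd_mult_iff)

section \<open>Primality of polynomials that are linear in one variable\<close>

subsection \<open>Polynomials of degree one in a variable\<close>

lemma Var_neq_0 [simp]: "(Var i :: 'k::field_char_0 mpoly) \<noteq> 0"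
  by (metis Var_def keys_single keys_zero insert_not_empty zero_neq_one)

lemma exps_multE:
  assumes "u \<in> exps (f * g :: 'k::field_char_0 mpoly)"
  obtains a b where "u = a + b" "a \<in> exps f" "b \<in> exps g"
  using assms Poly_Mapping.keys_mult[of f g] by blast

text \<open>Compare degrees in \<open>x\<close>. If \<open>g\<close> has degree D with top part
  \<open>g1\<close>, the product contains the terms of \<open>v * Var x * g1\<close>, of degree D +
  1, and nothing else reaches that degree to cancel them.\<close>

lemma linear_mult_free_imp_0:
  fixes v w g :: "'k::field_char_0 mpoly"
  assumes v: "v \<in> polys_in (- {x})" "v \<noteq> 0" and w: "w \<in> polys_in (- {x})"
    and f: "(v * Var x + w) * g \<in> polys_in (- {x})"
  shows "g = 0"
proof (rule ccontr)
  assume g: "g \<noteq> 0"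
  define D where "D = Max ((\<lambda>u. cf u x) ` exps g)"
  define A where "A = {u \<in> exps g. cf u x = D}"
  define B where "B = {u \<in> exps g. cf u x < D}"
  define g1 where "g1 = (\<Sum>u\<in>A. Const (cf g u) * mon u)"
  define g2 where "g2 = (\<Sum>u\<in>B. Const (cf g u) * mon u)"
  have le: "cf u x \<le> D" if "u \<in> exps g" for u
    unfolding D_def using that by (intro Max_ge) auto
  have "D \<in> (\<lambda>u. cf u x) ` exps g"
    unfolding D_def using g by (intro Max_in) auto
  then obtain u0 where u0: "u0 \<in> exps g" "cf u0 x = D" by auto
  have AB: "exps g = A \<union> B" "A \<inter> B = {}" "finite A" "finite B"
  proof -
    show "exps g = A \<union> B"
    proof (intro equalityI subsetI)
      fix u assume "u \<in> exps g"
      then show "u \<in> A \<union> B"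
        using le[of u] by (cases "cf u x = D") (simp_all add: A_def B_def)
    qed (auto simp: A_def B_def)
  qed (auto simp: A_def B_def)
  have "(\<Sum>u\<in>exps g. Const (cf g u) * mon u) = g1 + g2"
    unfolding g1_def g2_def AB(1) by (rule sum.union_disjoint) (use AB in auto)
  then have gs: "g = g1 + g2"
    by (simp only: mpoly_expand[symmetric])
  have cfg: "cf (\<Sum>u\<in>E. Const (cf g u) * mon u) t = (if t \<in> E then cf g t else 0)" if "finite E" for E t
  proof -
    have "cf (\<Sum>u\<in>E. Const (cf g u) * mon u) t = (\<Sum>u\<in>E. if u = t then cf g u else 0)"
      unfolding lookup_sum by (rule sum.cong) (auto simp: lookup_single when_def)
    then show ?thesis using that by simp
  qed
  have e1: "exps g1 \<subseteq> A" and e2: "exps g2 \<subseteq> B"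
    unfolding g1_def g2_def subset_iff in_keys_iff cfg[OF AB(3)] cfg[OF AB(4)] by metis+
  have "u0 \<in> A"
    using u0 by (simp add: A_def)
  then have "cf g1 u0 \<noteq> 0"
    using u0 unfolding g1_def cfg[OF AB(3)] by (simp add: in_keys_iff)
  then have g1: "g1 \<noteq> 0"
    by auto
  have free: "cf u x = 0" if "h \<in> polys_in (- {x})" "u \<in> exps h" for h :: "'k mpoly" and u
    using that by (fastforce simp: polys_in_def in_keys_iff)
  have top: "cf u x = Suc D" if u: "u \<in> exps (v * Var x * g1)" for u
  proof -
    obtain a b where ab: "u = a + b" "a \<in> exps (v * Var x)" "b \<in> exps g1"
      using u by (rule exps_multE)
    obtain a1 a2 where a: "a = a1 + a2" "a1 \<in> exps v" "a2 \<in> exps (Var x :: 'k mpoly)"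
      using ab(2) by (rule exps_multE)
    have "a2 = Poly_Mapping.single x 1" using a(3) by (simp add: Var_def)
    then show ?thesis
      using ab a free[OF v(1)] e1 by (auto simp: lookup_add A_def)
  qed
  have low: "cf u x \<le> D" if u: "u \<in> exps (v * Var x * g2 + w * g)" for u
  proof -
    consider "u \<in> exps (v * Var x * g2)" | "u \<in> exps (w * g)"
      using u Poly_Mapping.keys_add[of "v * Var x * g2" "w * g"] by blast
    then show ?thesis
    proof cases
      case 1
      obtain a b where ab: "u = a + b" "a \<in> exps (v * Var x)" "b \<in> exps g2"
        using 1 by (rule exps_multE)
      obtain a1 a2 where a: "a = a1 + a2" "a1 \<in> exps v" "a2 \<in> exps (Var x :: 'k mpoly)"
        using ab(2) by (rule exps_multE)
      have "a2 = Poly_Mapping.single x 1" using a(3) by (simp add: Var_def)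
      then show ?thesis
        using ab a free[OF v(1)] e2 by (fastforce simp: lookup_add B_def)
    next
      case 2
      obtain a b where ab: "u = a + b" "a \<in> exps w" "b \<in> exps g"
        using 2 by (rule exps_multE)
      then show ?thesis using free[OF w] le by (auto simp: lookup_add)
    qed
  qed
  have eq: "(v * Var x + w) * g = v * Var x * g1 + (v * Var x * g2 + w * g)"
    by (simp add: gs algebra_simps)
  have "v * Var x * g1 \<noteq> 0"
    using v g1 Var_neq_0 by simp
  then obtain u where u: "u \<in> exps (v * Var x * g1)"
    by (metis keys_eq_empty ex_in_conv)
  have "u \<notin> exps (v * Var x * g2 + w * g)"
    using top[OF u] low by fastforce
  then have "u \<in> exps ((v * Var x + w) * g)"
    using u unfolding eq by (simp add: in_keys_iff lookup_add)
  then show False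
    using free[OF f] top[OF u] by simp
qed

text \<open>Pseudo-division by f = \<open>v * Var x + w\<close>: a power of \<open>v\<close> times
  any polynomial is congruent modulo f to one free of \<open>x\<close> (\<open>red\<close>). If f
  divides a product, it divides the product of the two remainders, which then vanishes by
  \<open>linear_mult_free_imp_0\<close>. The powers of \<open>v\<close> cancel because
  \<open>v\<close> is 1 or a prime not dividing f (\<open>cancel\<close>).\<close>

lemma prime_elem_linear:
  fixes v w :: "'k::field_char_0 mpoly"
  assumes v: "v \<in> polys_in (- {x})" and w: "w \<in> polys_in (- {x})"
    and vw: "v = 1 \<or> prime_elem v \<and> \<not> v dvd w"
  shows "prime_elem (v * Var x + w)"
proof -
  define f where "f = v * Var x + w"
  have v0: "v \<noteq> 0" using vw by auto
  note free0 = linear_mult_free_imp_0[OF v v0 w, folded f_def]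
  have red: "\<exists>m g c. v ^ m * a = f * g + c \<and> c \<in> polys_in (- {x})" for a
  proof (induct a rule: mpoly_Var_induct)
    case (Const c)
    show ?case by (intro exI[of _ 0] exI[of _ "Const c"]) auto
  next
    case (add a b)
    then obtain m g c m' g' c' where h: "v ^ m * a = f * g + c" "c \<in> polys_in (- {x})"
      "v ^ m' * b = f * g' + c'" "c' \<in> polys_in (- {x})" by blast
    have "v ^ (m + m') * (a + b) = v ^ m' * (v ^ m * a) + v ^ m * (v ^ m' * b)"
      by (simp add: power_add algebra_simps)
    also have "\<dots> = f * (v ^ m' * g + v ^ m * g') + (v ^ m' * c + v ^ m * c')"
      unfolding h by (simp add: algebra_simps)
    finally have "v ^ (m + m') * (a + b) = f * (v ^ m' * g + v ^ m * g') + (v ^ m' * c + v ^ m * c')" .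
    moreover have "v ^ m' * c + v ^ m * c' \<in> polys_in (- {x})"
      using v h by simp
    ultimately show ?case by blast
  next
    case (Var a i)
    then obtain m g c where h: "v ^ m * a = f * g + c" "c \<in> polys_in (- {x})" by blast
    show ?case
    proof (cases "i = x")
      case False
      have "v ^ m * (a * Var i) = (v ^ m * a) * Var i"
        by (simp add: ac_simps)
      also have "\<dots> = f * (g * Var i) + c * Var i"
        unfolding h by (simp add: algebra_simps)
      finally have "v ^ m * (a * Var i) = f * (g * Var i) + c * Var i" .
      moreover have "c * Var i \<in> polys_in (- {x})"
        using h False by simp
      ultimately show ?thesis by blast
    next
      case True
      have "v ^ Suc m * (a * Var i) = v * Var x * (v ^ m * a)"
        using True by (simp add: ac_simps)
      also have "\<dots> = f * (v * Var x * g + c) + (- (c * w))"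
        unfolding h f_def by (simp add: algebra_simps)
      finally have "v ^ Suc m * (a * Var i) = f * (v * Var x * g + c) + (- (c * w))" .
      moreover have "- (c * w) \<in> polys_in (- {x})"
        using h w by simp
      ultimately show ?thesis by blast
    qed
  qed
  have nz: "f \<noteq> 0" using free0[of 1] by auto
  have cancel: "f dvd a" if "v ^ m * a = f * g" for m a g
    using that
  proof (induct m arbitrary: g)
    case (Suc m)
    show ?case
    proof (cases "v = 1")
      case False
      then have p: "prime_elem v" "\<not> v dvd w" using vw by auto
      have "v dvd f * g" using Suc.prems by (metis dvd_mult2 dvd_triv_left power_Suc)
      moreover have "\<not> v dvd f"
        using p by (simp add: f_def dvd_add_right_iff)
      ultimately obtain g' where "g = v * g'"
        using p prime_elem_dvd_multD by (metis dvdE)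
      then have "v * (v ^ m * a) = v * (f * g')"
        using Suc.prems by (simp add: ac_simps)
      then show ?thesis using Suc.hyps[of g'] v0 by simp
    qed (use Suc in simp)
  qed simp
  show ?thesis
    unfolding f_def[symmetric]
  proof (rule prime_elemI[OF nz])
    show "\<not> f dvd 1"
      using free0 by (metis dvdE mult_zero_right polys_in_1 zero_neq_one)
    fix a b assume "f dvd a * b"
    obtain m g c m' g' c' where h: "v ^ m * a = f * g + c" "c \<in> polys_in (- {x})"
      "v ^ m' * b = f * g' + c'" "c' \<in> polys_in (- {x})"
      using red by blast
    have "f dvd (v ^ m * a) * (v ^ m' * b)"
      using dvd_mult[OF \<open>f dvd a * b\<close>, of "v ^ m * v ^ m'"] by (simp add: ac_simps)
    then have "f dvd f * (g * (f * g' + c') + c * g') + c * c'"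
      unfolding h by (simp add: algebra_simps)
    then have "f dvd c * c'"
      by (simp add: dvd_add_right_iff)
    then obtain t where "c * c' = f * t" ..
    then have "t = 0" using free0[of t] h by (metis polys_in_mult)
    then have "c = 0 \<or> c' = 0" using \<open>c * c' = f * t\<close> by simp
    then show "f dvd a \<or> f dvd b"
      using h cancel by fastforce
  qed
qed

lemma prime_elem_dvd_prime_elem:
  "prime_elem (p :: 'k::field_char_0 mpoly) \<Longrightarrow> prime_elem q \<Longrightarrow> p dvd q \<Longrightarrow> q dvd p"
proof -
  assume p: "prime_elem p" and q: "prime_elem q" and "p dvd q"
  then obtain r where r: "q = p * r" by blast
  then have "q dvd p \<or> q dvd r" using prime_elem_dvd_multD[OF q, of p r] by simp
  moreover have False if "q dvd r"
  proof -
    obtain t where "r = q * t" using \<open>q dvd r\<close> by (rule dvdE)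
    then have "q * 1 = q * (p * t)" using r by (metis mult.left_commute mult.right_neutral)
    then have "1 = p * t" using q by (metis mult_left_cancel not_prime_elem_zero)
    then show False using p by (metis dvd_triv_left prime_elem_not_unit)
  qed
  ultimately show "q dvd p" by blast
qed

text \<open>The condition on \<open>u\<close> says that it is coprime to the product.\<close>

lemma prime_product_dvd:
  fixes u b :: "'k::field_char_0 mpoly"
  assumes "\<And>i. i \<in> exps N \<Longrightarrow> prime_elem (y i)" and "\<And>i. i \<in> exps N \<Longrightarrow> \<not> y i dvd u"
    and "pmon y N dvd u * b"
  shows "pmon y N dvd b"
  using assms
proof (induct "\<Sum>i\<in>exps N. cf N i" arbitrary: N b rule: less_induct)
  case less
  show ?case
  proof (cases "N = 0")
    case False
    then obtain i where i: "i \<in> exps N" by (metis keys_eq_empty ex_in_conv)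
    define N' where "N' = N - Poly_Mapping.single i 1"
    have N: "N = N' + Poly_Mapping.single i 1"
      using i by (intro poly_mapping_eqI) (auto simp: N'_def lookup_add lookup_minus lookup_single when_def in_keys_iff)
    have sb: "exps N' \<subseteq> exps N" using N by (metis Un_upper1 exps_add_nat)
    have "(\<Sum>j\<in>exps N'. cf N' j) = (\<Sum>j\<in>exps N. cf N' j)"
      by (rule sum.mono_neutral_left) (use sb in \<open>auto simp: in_keys_iff\<close>)
    also have "\<dots> < (\<Sum>j\<in>exps N. cf N j)"
      by (rule sum_strict_mono_ex1) (use N i in \<open>auto simp: lookup_add intro!: bexI[of _ i]\<close>)
    finally have lt: "(\<Sum>j\<in>exps N'. cf N' j) < (\<Sum>j\<in>exps N. cf N j)" .
    have pN: "pmon y N = pmon y N' * y i"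
      by (subst N) (simp add: pmon_add)
    then have "y i dvd u * b" using less.prems(3) by (metis dvd_mult_right)
    then obtain b' where b: "b = y i * b'"
      using less.prems(1,2)[OF i] prime_elem_dvd_multD by blast
    have "y i * pmon y N' dvd y i * (u * b')"
      using less.prems(3) unfolding pN b by (simp add: ac_simps)
    moreover have "y i \<noteq> 0" using less.prems(1)[OF i] by auto
    ultimately have "pmon y N' dvd u * b'" by simp
    then have "pmon y N' dvd b'"
      using less.hyps[OF lt] less.prems sb by blast
    then show ?thesis unfolding pN b by (simp add: ac_simps mult_dvd_mono)
  qed simp
qed

section \<open>Derivations, and the eigenvalue calculus for diagonal ones\<close>

section \<open>Derivations\<close>

text \<open>Unlike \<open>derivation_on\<close>, the values need not lie in the domain.\<close>

definition drv :: "'k::field_char_0 mpoly set \<Rightarrow> ('k mpoly \<Rightarrow> 'k mpoly) \<Rightarrow> bool" where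
  "drv S d \<longleftrightarrow>
     (\<forall>a\<in>S. \<forall>b\<in>S. d (a + b) = d a + d b) \<and>
     (\<forall>c. \<forall>a\<in>S. d (Const c * a) = Const c * d a) \<and>
     (\<forall>a\<in>S. \<forall>b\<in>S. d (a * b) = d a * b + a * d b)"

lemma derivation_on_iff: "derivation_on S d \<longleftrightarrow> drv S d \<and> (\<forall>a\<in>S. d a \<in> S)"
  by (auto simp: derivation_on_def drv_def)

lemma drv_subset: "drv S d \<Longrightarrow> T \<subseteq> S \<Longrightarrow> drv T d"
  unfolding drv_def by blast

lemma drv_cong:
  assumes d: "drv S d" and eq: "\<And>a. a \<in> S \<Longrightarrow> d a = d' a" and S: "S = polys_in V"
  shows "drv S d'"
proof -
  have "a + b \<in> S" "Const c * a \<in> S" "a * b \<in> S" if "a \<in> S" "b \<in> S" for a b c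
    using that S by simp_all
  with d show ?thesis
    unfolding drv_def by (simp add: eq[symmetric])
qed

lemma drv_add: "drv S d \<Longrightarrow> a \<in> S \<Longrightarrow> b \<in> S \<Longrightarrow> d (a + b) = d a + d b"
  by (simp add: drv_def)

lemma drv_mult: "drv S d \<Longrightarrow> a \<in> S \<Longrightarrow> b \<in> S \<Longrightarrow> d (a * b) = d a * b + a * d b"
  by (simp add: drv_def)

lemma drv_scale: "drv S d \<Longrightarrow> a \<in> S \<Longrightarrow> d (Const c * a) = Const c * d a"
  by (simp add: drv_def)

context
  fixes V :: "nat set" and S :: "'k::field_char_0 mpoly set"
  assumes S: "S = polys_in V"
begin

lemma drv_Const: "drv S d \<Longrightarrow> d (Const c) = 0"
  using drv_mult[of S d 1 1] drv_scale[of S d 1 c] S by simp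

lemma drv_0: "drv S d \<Longrightarrow> d 0 = 0"
  using drv_Const[of d 0] by simp

lemma drv_1: "drv S d \<Longrightarrow> d 1 = 0"
  using drv_Const[of d 1] by simp

lemma drv_uminus: "drv S d \<Longrightarrow> a \<in> S \<Longrightarrow> d (- a) = - d a"
  using drv_scale[of S d a "-1"] by (simp add: Const_minus)

lemma drv_diff: "drv S d \<Longrightarrow> a \<in> S \<Longrightarrow> b \<in> S \<Longrightarrow> d (a - b) = d a - d b"
  using drv_add[of S d a "- b"] drv_uminus S by simp

lemma drv_sum: "drv S d \<Longrightarrow> (\<And>i. i \<in> A \<Longrightarrow> f i \<in> S) \<Longrightarrow> d (\<Sum>i\<in>A. f i) = (\<Sum>i\<in>A. d (f i))"
proof (induct A rule: infinite_finite_induct)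
  case (insert x A)
  then have "(\<Sum>i\<in>A. f i) \<in> S" by (simp add: S)
  with insert show ?case by (simp add: drv_add)
qed (simp_all add: drv_0)

lemma drv_eq_0:
  assumes d: "drv S d" and 0: "\<And>i. i \<in> V \<Longrightarrow> d (Var i) = 0" and a: "a \<in> S"
  shows "d a = 0"
  using a unfolding S
proof (induct rule: polys_in_induct)
  case (Const c)
  show ?case using drv_Const[OF d] .
next
  case (add f g)
  then show ?case using drv_add[OF d] S by simp
next
  case (Var f i)
  then show ?case using drv_mult[OF d, of f "Var i"] 0 S by simp
qed

lemma drv_in:
  assumes d: "drv S d" and W: "\<And>i. i \<in> V \<Longrightarrow> d (Var i) \<in> polys_in W" "V \<subseteq> W" and a: "a \<in> S"
  shows "d a \<in> polys_in W"
  using a unfolding S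
proof (induct rule: polys_in_induct)
  case (Const c)
  show ?case using drv_Const[OF d] by simp
next
  case (add f g)
  then show ?case using drv_add[OF d] S by simp
next
  case (Var f i)
  then have "f \<in> polys_in W" "(Var i :: 'k mpoly) \<in> polys_in W" using W polys_in_mono[OF W(2)] by auto
  with Var show ?case using drv_mult[OF d, of f "Var i"] W S by simp
qed

lemma drv_eqI:
  assumes "drv S d" "drv S e" "\<And>i. i \<in> V \<Longrightarrow> d (Var i) = e (Var i)" "a \<in> S"
  shows "d a = e a"
proof -
  have "drv S (\<lambda>a. d a - e a)"
    using assms(1,2) by (auto simp: drv_def algebra_simps)
  from drv_eq_0[OF this _ assms(4)] show ?thesis using assms(3) by simp
qed

text \<open>The factor \<open>b\<close> covers both weight derivations (\<open>b = 1\<close>) and brackets with an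
  element that has log-canonical brackets with the \<open>y i\<close>.\<close>

lemma drv_pmon:
  assumes d: "drv S d" and y: "\<And>i. i \<in> exps u \<Longrightarrow> y i \<in> S"
    and e: "\<And>i. i \<in> exps u \<Longrightarrow> d (y i) = Const (c i) * b * y i"
  shows "d (pmon y u) = Const (\<Sum>i\<in>exps u. of_nat (cf u i) * c i) * b * pmon y u"
proof -
  have pw: "d (y i ^ m) = Const (of_nat m * c i) * b * y i ^ m" if "i \<in> exps u" for i m
  proof (induct m)
    case (Suc m)
    then show ?case
      using drv_mult[OF d, of "y i" "y i ^ m"] y[OF that] e[OF that] S
      by (simp add: algebra_simps Const_add)
  qed (simp add: drv_1[OF d])
  have "d (\<Prod>i\<in>A. y i ^ cf u i) = Const (\<Sum>i\<in>A. of_nat (cf u i) * c i) * b * (\<Prod>i\<in>A. y i ^ cf u i)"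
    if "finite A" "A \<subseteq> exps u" for A
    using that
  proof induct
    case (insert i A)
    have yA: "y j \<in> polys_in V" if "j \<in> insert i A" for j
      using that insert y S by auto
    then have "(\<Prod>i\<in>A. y i ^ cf u i) \<in> S" "y i ^ cf u i \<in> S"
      using S by auto
    then have "d (y i ^ cf u i * (\<Prod>i\<in>A. y i ^ cf u i))
        = d (y i ^ cf u i) * (\<Prod>i\<in>A. y i ^ cf u i) + y i ^ cf u i * d (\<Prod>i\<in>A. y i ^ cf u i)"
      by (rule drv_mult[OF d, rotated -1, of _ "y i ^ cf u i"])
    then show ?case
      using insert pw[of i "cf u i"] by (simp add: algebra_simps Const_add)
  qed (simp add: drv_1[OF d])
  then show ?thesis
    by (simp add: pmon_def)
qed

end

subsection \<open>Weight derivations\<close>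

definition wdot :: "(nat \<Rightarrow> 'k::field_char_0) \<Rightarrow> (nat \<Rightarrow>\<^sub>0 nat) \<Rightarrow> 'k" where
  "wdot \<phi> u = (\<Sum>i\<in>exps u. of_nat (cf u i) * \<phi> i)"

text \<open>The Euler derivation that multiplies each monomial by its weight
  \<open>wdot \<phi> u\<close>, hence the i-th variable by \<open>\<phi> i\<close>.\<close>

definition wder :: "(nat \<Rightarrow> 'k::field_char_0) \<Rightarrow> 'k mpoly \<Rightarrow> 'k mpoly" where
  "wder \<phi> f = (\<Sum>u\<in>exps f. Const (wdot \<phi> u * cf f u) * mon u)"

lemma wdot_superset:
  assumes "finite A" "exps u \<subseteq> A"
  shows "wdot \<phi> u = (\<Sum>i\<in>A. of_nat (cf u i) * \<phi> i)"
  unfolding wdot_def by (rule sum.mono_neutral_left) (use assms in \<open>auto simp: in_keys_iff\<close>)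

lemma wdot_add: "wdot \<phi> (u + v) = wdot \<phi> u + wdot \<phi> v"
  by (subst (1 2 3) wdot_superset[of "exps u \<union> exps v"])
     (auto simp: exps_add_nat lookup_add distrib_right sum.distrib)

lemma wdot_0 [simp]: "wdot \<phi> 0 = 0"
  by (simp add: wdot_def)

lemma wdot_single [simp]: "wdot \<phi> (Poly_Mapping.single i m) = of_nat m * \<phi> i"
  by (subst wdot_superset[of "{i}"]) (auto simp: in_keys_iff lookup_single when_def split: if_splits)

lemma cf_wder [simp]: "cf (wder \<phi> f) u = wdot \<phi> u * cf f u"
proof -
  have "cf (wder \<phi> f) u = (\<Sum>v\<in>exps f. if v = u then wdot \<phi> v * cf f v else 0)"
    unfolding wder_def lookup_sum by (rule sum.cong) (auto simp: lookup_single when_def)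
  then show ?thesis
    by (simp add: in_keys_iff)
qed

lemma wder_in [simp]: "f \<in> polys_in V \<Longrightarrow> wder \<phi> f \<in> polys_in V"
  by (auto simp: polys_in_def in_keys_iff)

lemma wder_add [simp]: "wder \<phi> (f + g) = wder \<phi> f + wder \<phi> g"
  by (rule poly_mapping_eqI) (simp add: lookup_add distrib_left)

lemma wder_scale [simp]: "wder \<phi> (Const c * f) = Const c * wder \<phi> f"
  by (rule poly_mapping_eqI) simp

lemma wder_mon: "wder \<phi> (mon u) = Const (wdot \<phi> u) * mon u"
  by (rule poly_mapping_eqI) (simp add: lookup_single when_def)

lemma wder_mult: "wder \<phi> (f * g) = wder \<phi> f * g + f * wder \<phi> g"
proof (induct f rule: mpoly_induct)
  case (mon c u)
  show ?case
  proof (induct g rule: mpoly_induct)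
    case (mon d v)
    have eq: "Const c * mon u * (Const d * mon v) = Const (c * d) * mon (u + v)"
      unfolding Const_mult mon_add by (simp only: ac_simps)
    have "wder \<phi> (Const c * mon u * (Const d * mon v)) = Const (c * d) * (Const (wdot \<phi> u + wdot \<phi> v) * mon (u + v))"
      unfolding eq wder_scale wder_mon wdot_add ..
    also have "\<dots> = Const c * (Const (wdot \<phi> u) * mon u) * (Const d * mon v)
        + Const c * mon u * (Const d * (Const (wdot \<phi> v) * mon v))"
      unfolding Const_add Const_mult mon_add by (simp only: algebra_simps)
    finally show ?case
      unfolding wder_scale wder_mon .
  qed (simp add: distrib_left)
qed (simp add: distrib_right)

lemma drv_wder: "drv S (wder \<phi>)"
  unfolding drv_def using wder_add wder_scale wder_mult by blast

lemma wder_Var [simp]: "wder \<phi> (Var i) = Const (\<phi> i) * Var i"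
  using wder_mon[of \<phi> "Poly_Mapping.single i 1"] by (simp add: Var_def)

lemma wder_eigen_iff: "wder \<phi> f = Const c * f \<longleftrightarrow> (\<forall>u\<in>exps f. wdot \<phi> u = c)"
proof
  assume "wder \<phi> f = Const c * f"
  then have "wdot \<phi> u * cf f u = c * cf f u" for u
    by (metis cf_Const_mult cf_wder)
  then show "\<forall>u\<in>exps f. wdot \<phi> u = c"
    by (auto simp: in_keys_iff)
next
  assume "\<forall>u\<in>exps f. wdot \<phi> u = c"
  then show "wder \<phi> f = Const c * f"
    by (intro poly_mapping_eqI) (auto simp: in_keys_iff)
qed

text \<open>A derivation acting diagonally on the \<open>y i\<close> acts on \<open>sub y g\<close> as a weight derivation
  on \<open>g\<close>.\<close>

lemma drv_sub:
  assumes S: "S = polys_in V" and d: "drv S d" and y: "\<And>i. i \<in> J \<Longrightarrow> y i \<in> S"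
    and e: "\<And>i. i \<in> J \<Longrightarrow> d (y i) = Const (c i) * b * y i" and g: "g \<in> polys_in J"
  shows "d (sub y g) = b * sub y (wder c g)"
proof -
  have sb: "exps u \<subseteq> J" if "u \<in> exps g" for u
    using g that by (auto simp: polys_in_def)
  have yS: "pmon y u \<in> S" if "u \<in> exps g" for u
    unfolding S by (rule pmon_in) (use sb[OF that] y S in auto)
  have "d (sub y g) = (\<Sum>u\<in>exps g. d (Const (cf g u) * pmon y u))"
    unfolding sub_def by (rule drv_sum[OF S d]) (use yS S in auto)
  also have "\<dots> = (\<Sum>u\<in>exps g. Const (cf g u) * (Const (wdot c u) * b * pmon y u))"
  proof (rule sum.cong[OF refl])
    fix u assume u: "u \<in> exps g"
    show "d (Const (cf g u) * pmon y u) = Const (cf g u) * (Const (wdot c u) * b * pmon y u)"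
      unfolding drv_scale[OF d yS[OF u]] wdot_def
      by (subst drv_pmon[OF S d, of u y c b]) (use sb[OF u] y e in auto)
  qed
  also have "\<dots> = b * (\<Sum>u\<in>exps g. Const (wdot c u * cf g u) * pmon y u)"
    by (simp add: sum_distrib_left Const_mult ac_simps)
  also have "\<dots> = b * sub y (wder c g)"
    by (subst sub_superset[of "exps g" "wder c g"]) (auto simp: in_keys_iff)
  finally show ?thesis .
qed

section \<open>The degree function of a locally nilpotent derivation\<close>

subsection \<open>Locally nilpotent derivations\<close>

lemma drv_leibniz:
  assumes S: "S = polys_in V" and d: "drv S d" and i: "\<And>a. a \<in> S \<Longrightarrow> d a \<in> S"
    and a: "a \<in> S" and b: "b \<in> S"
  shows "(d ^^ m) (a * b) = (\<Sum>i\<le>m. of_nat (m choose i) * (d ^^ i) a * (d ^^ (m - i)) b)"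
proof (induct m)
  case (Suc m)
  have dp: "(d ^^ j) c \<in> S" if "c \<in> S" for j c
    by (induct j) (use that i in auto)
  have ofn: "(of_nat j :: 'a mpoly) = Const (of_nat j)" for j
    by (induct j) (auto simp: Const_add)
  have "(d ^^ Suc m) (a * b) = d (\<Sum>i\<le>m. of_nat (m choose i) * (d ^^ i) a * (d ^^ (m - i)) b)"
    using Suc by simp
  also have "\<dots> = (\<Sum>i\<le>m. d (of_nat (m choose i) * (d ^^ i) a * (d ^^ (m - i)) b))"
    by (rule drv_sum[OF S d]) (use dp a b S in \<open>simp add: ofn\<close>)
  also have "\<dots> = (\<Sum>i\<le>m. of_nat (m choose i) * ((d ^^ Suc i) a * (d ^^ (m - i)) b + (d ^^ i) a * (d ^^ (Suc m - i)) b))"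
  proof (rule sum.cong[OF refl])
    fix i assume "i \<in> {..m}"
    then have "Suc m - i = Suc (m - i)" by simp
    moreover have "d (of_nat (m choose i) * ((d ^^ i) a * (d ^^ (m - i)) b))
       = of_nat (m choose i) * d ((d ^^ i) a * (d ^^ (m - i)) b)"
      unfolding ofn by (rule drv_scale[OF d]) (use dp a b S in simp)
    ultimately show "d (of_nat (m choose i) * (d ^^ i) a * (d ^^ (m - i)) b)
       = of_nat (m choose i) * ((d ^^ Suc i) a * (d ^^ (m - i)) b + (d ^^ i) a * (d ^^ (Suc m - i)) b)"
      using drv_mult[OF d dp[OF a] dp[OF b]] by (simp add: mult.assoc)
  qed
  also have "\<dots> = (\<Sum>i\<le>m. of_nat (m choose i) * ((d ^^ Suc i) a * (d ^^ (m - i)) b))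
      + (\<Sum>i\<le>m. of_nat (m choose i) * ((d ^^ i) a * (d ^^ (Suc m - i)) b))"
    by (simp only: distrib_left sum.distrib)
  also have "(\<Sum>i\<le>m. of_nat (m choose i) * ((d ^^ i) a * (d ^^ (Suc m - i)) b))
      = (\<Sum>i\<le>Suc m. of_nat (m choose i) * ((d ^^ i) a * (d ^^ (Suc m - i)) b))"
    by simp
  also have "\<dots> = a * (d ^^ Suc m) b
      + (\<Sum>i\<le>m. of_nat (m choose Suc i) * ((d ^^ Suc i) a * (d ^^ (m - i)) b))"
    by (subst sum.atMost_Suc_shift) simp
  also have "(\<Sum>i\<le>m. of_nat (m choose i) * ((d ^^ Suc i) a * (d ^^ (m - i)) b))
      + (a * (d ^^ Suc m) b + (\<Sum>i\<le>m. of_nat (m choose Suc i) * ((d ^^ Suc i) a * (d ^^ (m - i)) b)))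
      = (\<Sum>i\<le>Suc m. of_nat (Suc m choose i) * (d ^^ i) a * (d ^^ (Suc m - i)) b)"
    by (subst sum.atMost_Suc_shift) (simp add: sum.distrib distrib_right mult.assoc)
  finally show ?case .
qed simp

locale lnd =
  fixes V :: "nat set" and S :: "'k::field_char_0 mpoly set" and d :: "'k mpoly \<Rightarrow> 'k mpoly"
  assumes S: "S = polys_in V" and d: "drv S d" and into: "\<And>a. a \<in> S \<Longrightarrow> d a \<in> S"
    and nil: "\<And>a. a \<in> S \<Longrightarrow> \<exists>m. (d ^^ m) a = 0"
begin

text \<open>The degree attached to a locally nilpotent derivation, kept as a relation so that the
  zero polynomial needs no value.\<close>

definition ndeg :: "'k mpoly \<Rightarrow> nat \<Rightarrow> bool" where
  "ndeg a m \<longleftrightarrow> (d ^^ m) a \<noteq> 0 \<and> (d ^^ Suc m) a = 0"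

lemma pow_0: "(d ^^ m) 0 = 0"
  by (induct m) (auto simp: drv_0[OF S d])

lemma ndeg_ex:
  assumes "a \<in> S" "a \<noteq> 0"
  shows "\<exists>m. ndeg a m"
proof -
  define m where "m = (LEAST m. (d ^^ m) a = 0)"
  have m: "(d ^^ m) a = 0"
    unfolding m_def using nil[OF assms(1)] by (rule LeastI_ex)
  then obtain m' where "m = Suc m'" using assms(2) by (cases m) auto
  moreover have "(d ^^ m') a \<noteq> 0"
    using not_less_Least[of m' "\<lambda>m. (d ^^ m) a = 0"] \<open>m = Suc m'\<close> m_def by auto
  ultimately show ?thesis
    using m unfolding ndeg_def by blast
qed

lemma ndeg_pow_0: "ndeg a m \<Longrightarrow> m < j \<Longrightarrow> (d ^^ j) a = 0"
proof -
  assume "ndeg a m" "m < j"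
  then have "(d ^^ j) a = (d ^^ (j - Suc m)) ((d ^^ Suc m) a)"
    by (metis Suc_leI le_add_diff_inverse2 comp_apply funpow_add)
  moreover have "(d ^^ Suc m) a = 0"
    using \<open>ndeg a m\<close> unfolding ndeg_def by blast
  ultimately show ?thesis by (simp only: pow_0)
qed

lemma ndeg_unique: "ndeg a m \<Longrightarrow> ndeg a m' \<Longrightarrow> m = m'"
  by (metis ndeg_def ndeg_pow_0 linorder_neqE_nat)

text \<open>In the Leibniz expansion of order m + m' a single term survives. Its binomial
  coefficient is nonzero in characteristic 0 and its two factors multiply to a nonzero element of a
  domain.\<close>

lemma ndeg_mult:
  assumes a: "a \<in> S" "ndeg a m" and b: "b \<in> S" "ndeg b m'"
  shows "ndeg (a * b) (m + m')"
proof -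
  have leib: "(d ^^ j) (a * b) = (\<Sum>i\<le>j. of_nat (j choose i) * (d ^^ i) a * (d ^^ (j - i)) b)" for j
    by (rule drv_leibniz[OF S d]) (use into a b in auto)
  have z: "(d ^^ i) a * (d ^^ (j - i)) b = 0" if "i \<le> j" "j \<ge> m + m'" "i \<noteq> m \<or> j > m + m'" for i j
  proof (cases "m < i")
    case True
    then show ?thesis using ndeg_pow_0[OF a(2)] by simp
  next
    case False
    then have "m' < j - i" using that by linarith
    then show ?thesis using ndeg_pow_0[OF b(2)] by simp
  qed
  have "(d ^^ (m + m')) (a * b)
      = (\<Sum>i\<le>m+m'. if i = m then of_nat ((m + m') choose m) * (d ^^ m) a * (d ^^ m') b else 0)"
    unfolding leib
    by (rule sum.cong) (use z in \<open>auto simp: mult.assoc\<close>)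
  also have "\<dots> = of_nat ((m + m') choose m) * (d ^^ m) a * (d ^^ m') b"
    by simp
  also have "\<dots> \<noteq> 0"
    using a(2) b(2) by (simp add: ndeg_def)
  finally have "(d ^^ (m + m')) (a * b) \<noteq> 0" .
  moreover have "(d ^^ Suc (m + m')) (a * b) = 0"
    unfolding leib
    by (rule sum.neutral) (use z[of _ "Suc (m + m')"] in \<open>auto simp: mult.assoc\<close>)
  ultimately show ?thesis
    by (simp add: ndeg_def)
qed

text \<open>If \<open>d a = a * w\<close> were nonzero, its degree would be one less than that of
  \<open>a\<close>, but also the sum of the degrees of \<open>a\<close> and
  \<open>w\<close>.\<close>

lemma dvd_image_imp_0:
  assumes a: "a \<in> S" "a dvd d a"
  shows "d a = 0"
proof (rule ccontr)
  assume nz: "d a \<noteq> 0"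
  then have "a \<noteq> 0" using drv_0[OF S d] by auto
  then obtain m where m: "ndeg a m" using a ndeg_ex by blast
  obtain w where w: "d a = a * w" using a(2) ..
  have wS: "w \<in> S"
    using quotient_in_polys_in[OF _ _ w \<open>a \<noteq> 0\<close>, of V] a into S by blast
  then obtain m' where m': "ndeg w m'" using w nz ndeg_ex by auto
  have "m \<noteq> 0" using m nz by (cases m) (auto simp: ndeg_def)
  then obtain l where l: "m = Suc l" by (cases m) auto
  have "ndeg (d a) l"
    using m unfolding l ndeg_def by (simp add: funpow_swap1)
  moreover have "ndeg (d a) (m + m')"
    unfolding w using ndeg_mult[OF a(1) m wS m'] .
  ultimately have "l = m + m'"
    by (rule ndeg_unique)
  then show False
    using l by simp
qed

text \<open>The degree of \<open>a * b\<close> is at most 1 while that of \<open>a\<close> is at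
  least 1; additivity leaves degree 1 for \<open>a\<close> and 0 for \<open>b\<close>.\<close>

lemma square_kernel_mult:
  assumes "a \<in> S" "b \<in> S" "d (d (a * b)) = 0" "d a \<noteq> 0" "b \<noteq> 0"
  shows "d b = 0" "d (d a) = 0"
proof -
  have "a \<noteq> 0" using assms(4) drv_0[OF S d] by auto
  then obtain m where m: "ndeg a m" using assms ndeg_ex by blast
  obtain m' where m': "ndeg b m'" using assms ndeg_ex by blast
  have "m \<noteq> 0" using m assms(4) by (cases m) (auto simp: ndeg_def)
  have "m + m' < 2"
  proof (rule ccontr)
    assume "\<not> m + m' < 2"
    then have e: "m + m' = (m + m' - 2) + 2" by simp
    have "(d ^^ (m + m')) (a * b) = (d ^^ (m + m' - 2)) ((d ^^ 2) (a * b))"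
      by (subst e) (simp only: funpow_add comp_apply)
    also have "(d ^^ 2) (a * b) = 0"
      using assms(3) by (simp add: numeral_2_eq_2)
    finally show False
      using ndeg_mult[OF assms(1) m assms(2) m'] by (simp add: pow_0 ndeg_def)
  qed
  then have "m = 1" "m' = 0" using \<open>m \<noteq> 0\<close> by auto
  then show "d b = 0" "d (d a) = 0"
    using m m' by (auto simp: ndeg_def)
qed

end

text \<open>Local nilpotency may be checked on generators.\<close>

lemma locally_nilpotentI:
  assumes S: "S = polys_in V" and d: "drv S d" and into: "\<And>a. a \<in> S \<Longrightarrow> d a \<in> S"
    and gen: "\<And>i. i \<in> V \<Longrightarrow> \<exists>m. (d ^^ m) (Var i) = 0" and a: "a \<in> S"
  shows "\<exists>m. (d ^^ m) a = 0"
proof -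
  have 0: "(d ^^ m) 0 = 0" for m
    by (induct m) (auto simp: drv_0[OF S d])
  have up: "(d ^^ j) c = 0" if "(d ^^ m) c = 0" "m \<le> j" for c m j
  proof -
    have "(d ^^ j) c = (d ^^ (j - m)) ((d ^^ m) c)"
      using that(2) by (metis le_add_diff_inverse2 comp_apply funpow_add)
    then show ?thesis using that(1) 0 by simp
  qed
  have dp: "(d ^^ j) c \<in> S" if "c \<in> S" for j c
    by (induct j) (use that into in auto)
  have ad: "(d ^^ j) (f + g) = (d ^^ j) f + (d ^^ j) g" if "f \<in> S" "g \<in> S" for f g j
    by (induct j) (use that dp drv_add[OF d] in auto)
  show ?thesis
    using a unfolding S
  proof (induct rule: polys_in_induct)
    case (Const c)
    show ?case by (rule exI[of _ 1]) (simp add: drv_Const[OF S d])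
  next
    case (add f g)
    then obtain m m' where m: "(d ^^ m) f = 0" "(d ^^ m') g = 0" by blast
    have "(d ^^ max m m') (f + g) = 0"
      using add(1,2) S by (simp add: ad up[OF m(1)] up[OF m(2)])
    then show ?case ..
  next
    case (Var f i)
    then obtain m m' where m: "(d ^^ m) f = 0" "(d ^^ m') (Var i) = 0" using gen by blast
    have leib: "(d ^^ j) (f * Var i) = (\<Sum>l\<le>j. of_nat (j choose l) * (d ^^ l) f * (d ^^ (j - l)) (Var i))" for j
      by (rule drv_leibniz[OF S d]) (use into Var S in auto)
    have "(d ^^ (m + m')) (f * Var i) = 0"
      unfolding leib
    proof (rule sum.neutral, rule ballI)
      fix j
      consider "m \<le> j" | "m' \<le> m + m' - j" by linarith
      then show "of_nat (m + m' choose j) * (d ^^ j) f * (d ^^ (m + m' - j)) (Var i) = 0"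
        by cases (simp_all add: up[OF m(1)] up[OF m(2)])
    qed
    then show ?case ..
  qed
qed

section \<open>A single CGL extension: bracket identities, torus weights, and the Ore form of the
  bracket\<close>

section \<open>Weights, brackets and the derivations of a CGL extension\<close>

text \<open>Index sets are written \<open>{1..n}\<close> throughout and should not be rewritten to \<open>{Suc 0..n}\<close>.\<close>

declare One_nat_def [simp del]

lemma drv_plus: "drv S d \<Longrightarrow> drv S e \<Longrightarrow> drv S (\<lambda>a. d a + e a)"
  unfolding drv_def by (simp add: distrib_left distrib_right add_ac)

lemma drv_times: "drv S d \<Longrightarrow> drv S (\<lambda>a. c * d a)"
  unfolding drv_def by (simp add: distrib_left mult.left_commute mult.assoc)

lemma char_eval_add: "t \<in> torus \<Longrightarrow> char_eval (w + w') t = char_eval w t * char_eval w' t"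
  by (simp add: char_eval_def torus_def power_int_add prod.distrib)

lemma char_eval_0 [simp]: "char_eval 0 t = 1"
  by (simp add: char_eval_def)

lemma char_eval_inj:
  fixes w w' :: "int ^ 'r::finite"
  assumes "\<And>t :: 'k::field_char_0 ^ 'r. t \<in> torus \<Longrightarrow> char_eval w t = char_eval w' t"
  shows "w = w'"
proof (rule vec_eq_iff[THEN iffD2], rule allI)
  fix i :: 'r
  \<comment> \<open>A torus point that reads off the i-th exponent, since 2 has infinite
    multiplicative order in characteristic 0.\<close>
  define t :: "'k ^ 'r" where "t = (\<chi> j. if j = i then 2 else 1)"
  have ce: "char_eval v t = 2 powi (v $ i)" for v :: "int ^ 'r"
  proof -
    have "char_eval v t = (\<Prod>j\<in>UNIV. if j = i then 2 powi (v $ i) else 1)"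
      unfolding char_eval_def t_def by (rule prod.cong) auto
    then show ?thesis by simp
  qed
  have "t \<in> torus" by (simp add: torus_def t_def)
  then have eq: "(2::'k) powi (w $ i) = 2 powi (w' $ i)"
    using assms[of t] ce by simp
  have two: "(2::'k) ^ a = 2 ^ b \<longleftrightarrow> a = b" for a b :: nat
  proof -
    have "(2::'k) ^ m = of_nat (2 ^ m)" for m by simp
    then have "(2::'k) ^ a = 2 ^ b \<longleftrightarrow> (2::nat) ^ a = 2 ^ b"
      by (simp only: of_nat_eq_iff)
    then show ?thesis by simp
  qed
  have "a = b" if "(2::'k) powi a = 2 powi b" "a \<le> b" for a b
  proof -
    have "(2::'k) powi b = 2 powi a * 2 powi (b - a)"
      by (simp flip: power_int_add)
    then have "(2::'k) powi (b - a) = 1"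
      using that(1) by simp
    then have "(2::'k) ^ nat (b - a) = 2 ^ 0"
      using that(2) by (simp add: power_int_def)
    then show ?thesis
      using two[of "nat (b - a)" 0] that(2) by simp
  qed
  then show "w $ i = w' $ i"
    using eq by (metis linear)
qed

lemma char_diff_add: "char_diff (w + w') h = char_diff w h + char_diff w' (h :: 'k::field_char_0 ^ 'r)"
  by (simp add: char_diff_def distrib_right sum.distrib)

lemma char_diff_add_right: "char_diff w (h + h') = char_diff w h + char_diff w (h' :: 'k::field_char_0 ^ 'r)"
  by (simp add: char_diff_def distrib_left sum.distrib)

lemma char_diff_0 [simp]: "char_diff 0 h = 0"
  by (simp add: char_diff_def)

lemma char_diff_inj:
  assumes "\<And>h :: 'k::field_char_0 ^ 'r::finite. char_diff w h = char_diff w' h"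
  shows "w = w'"
proof (rule vec_eq_iff[THEN iffD2], rule allI)
  fix i :: 'r
  have "char_diff v (axis i (1::'k)) = of_int (v $ i)" for v :: "int ^ 'r"
  proof -
    have "char_diff v (axis i (1::'k)) = (\<Sum>j\<in>UNIV. if j = i then of_int (v $ i) else 0)"
      unfolding char_diff_def axis_def by (rule sum.cong) auto
    then show ?thesis by simp
  qed
  then show "w $ i = w' $ i"
    using assms[of "axis i 1"] by simp
qed

locale cgl =
  fixes C :: "('k::field_char_0, 'r::finite) cgl"
  assumes cgl: "cgl_extension C"
begin

abbreviation "x \<equiv> gen C"
abbreviation "br \<equiv> bracket C"
abbreviation "wv \<equiv> weight_vector C"
abbreviation "dl \<equiv> delta C"
abbreviation "A \<equiv> alg C"

text \<open>The subalgebra generated by the generators before the \<open>k\<close>-th one.\<close>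

abbreviation "R k \<equiv> subalg C {1..<k}"

lemma var_inj: "inj_on (var C) (idx C)"
  and taction: "torus_action C"
  and poisson: "poisson_bracket_on A br"
  and act_br: "t \<in> torus \<Longrightarrow> a \<in> A \<Longrightarrow> b \<in> A \<Longrightarrow> act C t (br a b) = br (act C t a) (act C t b)"
  and wv_gen: "j \<in> idx C \<Longrightarrow> wv (wt C j) (x j)"
  and lam_neq_0: "j \<in> idx C \<Longrightarrow> lam C j \<noteq> 0"
  and ex_delta: "j \<in> idx C \<Longrightarrow> \<exists>d. is_delta C j d"
  using cgl unfolding cgl_extension_def by blast+

lemma is_delta_dl: "j \<in> idx C \<Longrightarrow> is_delta C j (dl j)"
  unfolding delta_def using ex_delta by (rule someI_ex)

lemma A_eq: "A = polys_in (var C ` idx C)"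
  by (simp add: subalg_def)

lemma R_eq: "R k = polys_in (var C ` {1..<k})"
  by (simp add: subalg_def)

lemma subalg_mono: "I \<subseteq> K \<Longrightarrow> subalg C I \<subseteq> subalg C K"
  unfolding subalg_def by (intro polys_in_mono image_mono)

lemma R_Suc_len: "R (Suc (len C)) = A"
  by (simp add: atLeastLessThanSuc_atLeastAtMost)

lemma R_subset_A: "k \<le> Suc (len C) \<Longrightarrow> R k \<subseteq> A"
  by (rule subalg_mono) auto

lemma R_mono: "j \<le> k \<Longrightarrow> R j \<subseteq> R k"
  by (rule subalg_mono) auto

lemma x_in [simp]: "j \<in> J \<Longrightarrow> x j \<in> subalg C J"
  by (simp add: gen_def subalg_def)

lemma x_neq_0 [simp]: "x j \<noteq> 0"
  by (simp add: gen_def)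

lemma subalg_ring [simp]:
  "Const c \<in> subalg C J" "0 \<in> subalg C J" "1 \<in> subalg C J"
  "a \<in> subalg C J \<Longrightarrow> b \<in> subalg C J \<Longrightarrow> a + b \<in> subalg C J"
  "a \<in> subalg C J \<Longrightarrow> b \<in> subalg C J \<Longrightarrow> a - b \<in> subalg C J"
  "a \<in> subalg C J \<Longrightarrow> b \<in> subalg C J \<Longrightarrow> a * b \<in> subalg C J"
  "a \<in> subalg C J \<Longrightarrow> - a \<in> subalg C J"
  by (simp_all add: subalg_def)

lemma br_in: "a \<in> A \<Longrightarrow> b \<in> A \<Longrightarrow> br a b \<in> A"
  using poisson unfolding poisson_bracket_on_def derivation_on_def by blast

lemma drv_br: "a \<in> A \<Longrightarrow> drv A (br a)"
  and drv_br_left: "b \<in> A \<Longrightarrow> drv A (\<lambda>a. br a b)"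
  using poisson unfolding poisson_bracket_on_def derivation_on_iff by blast+

lemma br_self: "a \<in> A \<Longrightarrow> br a a = 0"
  and br_jacobi: "a \<in> A \<Longrightarrow> b \<in> A \<Longrightarrow> c \<in> A \<Longrightarrow> br a (br b c) + br b (br c a) + br c (br a b) = 0"
  using poisson unfolding poisson_bracket_on_def by blast+

lemma br_add: "a \<in> A \<Longrightarrow> b \<in> A \<Longrightarrow> c \<in> A \<Longrightarrow> br a (b + c) = br a b + br a c"
  using drv_add[OF drv_br] .

lemma br_add_left: "a \<in> A \<Longrightarrow> b \<in> A \<Longrightarrow> c \<in> A \<Longrightarrow> br (a + b) c = br a c + br b c"
  using drv_add[OF drv_br_left, of c a b] by simp

lemma br_mult: "a \<in> A \<Longrightarrow> b \<in> A \<Longrightarrow> c \<in> A \<Longrightarrow> br a (b * c) = br a b * c + b * br a c"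
  using drv_mult[OF drv_br, of a b c] .

lemma br_mult_left: "a \<in> A \<Longrightarrow> b \<in> A \<Longrightarrow> c \<in> A \<Longrightarrow> br (a * b) c = br a c * b + a * br b c"
  using drv_mult[OF drv_br_left, of c a b] .

lemma br_scale: "a \<in> A \<Longrightarrow> b \<in> A \<Longrightarrow> br a (Const c * b) = Const c * br a b"
  using drv_scale[OF drv_br, of a b c] .

lemma br_scale_left: "a \<in> A \<Longrightarrow> b \<in> A \<Longrightarrow> br (Const c * a) b = Const c * br a b"
  using drv_scale[OF drv_br_left, of b a c] .

lemma br_Const: "a \<in> A \<Longrightarrow> br a (Const c) = 0" and br_1: "a \<in> A \<Longrightarrow> br a 1 = 0"
  and br_Const_left: "a \<in> A \<Longrightarrow> br (Const c) a = 0" and br_1_left: "a \<in> A \<Longrightarrow> br 1 a = 0"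
  using drv_Const[OF A_eq drv_br] drv_1[OF A_eq drv_br]
    drv_Const[OF A_eq drv_br_left] drv_1[OF A_eq drv_br_left] by auto

lemma br_uminus: "a \<in> A \<Longrightarrow> b \<in> A \<Longrightarrow> br a (- b) = - br a b"
  and br_uminus_left: "a \<in> A \<Longrightarrow> b \<in> A \<Longrightarrow> br (- a) b = - br a b"
  and br_diff: "a \<in> A \<Longrightarrow> b \<in> A \<Longrightarrow> c \<in> A \<Longrightarrow> br a (b - c) = br a b - br a c"
  and br_diff_left: "a \<in> A \<Longrightarrow> b \<in> A \<Longrightarrow> c \<in> A \<Longrightarrow> br (a - b) c = br a c - br b c"
  using drv_uminus[OF A_eq drv_br, of a b] drv_uminus[OF A_eq drv_br_left, of b a]
    drv_diff[OF A_eq drv_br, of a b c] drv_diff[OF A_eq drv_br_left, of c a b] by simp_all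

lemma br_anti: "a \<in> A \<Longrightarrow> b \<in> A \<Longrightarrow> br a b = - br b a"
proof -
  assume ab: "a \<in> A" "b \<in> A"
  have "br (a + b) (a + b) = br (a + b) a + br (a + b) b"
    by (rule br_add) (use ab in auto)
  also have "\<dots> = br a b + br b a"
    using ab by (simp add: br_add_left br_self)
  finally have "br (a + b) (a + b) = br a b + br b a" .
  moreover have "br (a + b) (a + b) = 0"
    by (rule br_self) (use ab in simp)
  ultimately show ?thesis
    by (simp add: eq_neg_iff_add_eq_0)
qed

lemma br_jacobi': "a \<in> A \<Longrightarrow> b \<in> A \<Longrightarrow> c \<in> A \<Longrightarrow> br a (br b c) = br (br a b) c + br b (br a c)"
proof -
  assume abc: "a \<in> A" "b \<in> A" "c \<in> A"
  have "br b (br c a) = - br b (br a c)"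
    using br_anti[OF abc(3,1)] br_uminus[OF abc(2) br_in[OF abc(1,3)]] by simp
  moreover have "br c (br a b) = - br (br a b) c"
    by (rule br_anti) (use abc br_in in auto)
  ultimately show ?thesis
    using br_jacobi[OF abc] by (simp add: algebra_simps)
qed

subsection \<open>Weights\<close>

lemma act_simps:
  "t \<in> torus \<Longrightarrow> act C t (Const c) = Const c"
  "t \<in> torus \<Longrightarrow> a \<in> A \<Longrightarrow> b \<in> A \<Longrightarrow> act C t (a + b) = act C t a + act C t b"
  "t \<in> torus \<Longrightarrow> a \<in> A \<Longrightarrow> b \<in> A \<Longrightarrow> act C t (a * b) = act C t a * act C t b"
  using taction unfolding torus_action_def by blast+

lemma wv_Const: "wv 0 (Const c)"
  by (simp add: weight_vector_def act_simps)

lemma wv_1: "wv 0 1"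
  using wv_Const[of 1] by simp

lemma wv_0: "wv w 0"
  using act_simps(1)[of _ 0] by (simp add: weight_vector_def)

lemma wv_mult: "wv w a \<Longrightarrow> wv w' b \<Longrightarrow> a \<in> A \<Longrightarrow> b \<in> A \<Longrightarrow> wv (w + w') (a * b)"
  by (simp add: weight_vector_def act_simps char_eval_add Const_mult ac_simps)

lemma wv_add: "wv w a \<Longrightarrow> wv w b \<Longrightarrow> a \<in> A \<Longrightarrow> b \<in> A \<Longrightarrow> wv w (a + b)"
  by (simp add: weight_vector_def act_simps algebra_simps)

lemma wv_scale: "wv w a \<Longrightarrow> a \<in> A \<Longrightarrow> wv w (Const c * a)"
  using wv_mult[OF wv_Const, of w a c] by simp

lemma wv_uminus: "wv w a \<Longrightarrow> a \<in> A \<Longrightarrow> wv w (- a)"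
  using wv_scale[of w a "-1"] by (simp add: Const_minus)

lemma wv_diff: "wv w a \<Longrightarrow> wv w b \<Longrightarrow> a \<in> A \<Longrightarrow> b \<in> A \<Longrightarrow> wv w (a - b)"
  using wv_add[of w a "- b"] wv_uminus by simp

lemma wv_br: "wv w a \<Longrightarrow> wv w' b \<Longrightarrow> a \<in> A \<Longrightarrow> b \<in> A \<Longrightarrow> wv (w + w') (br a b)"
  unfolding weight_vector_def
proof
  fix t :: "'k ^ 'r"
  assume a: "\<forall>t\<in>torus. act C t a = Const (char_eval w t) * a"
    and b: "\<forall>t\<in>torus. act C t b = Const (char_eval w' t) * b" and ab: "a \<in> A" "b \<in> A" and t: "t \<in> torus"
  have "act C t (br a b) = br (Const (char_eval w t) * a) (Const (char_eval w' t) * b)"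
    using act_br[OF t ab] a b t by simp
  also have "\<dots> = Const (char_eval w t) * br a (Const (char_eval w' t) * b)"
    by (rule br_scale_left) (use ab in auto)
  also have "\<dots> = Const (char_eval (w + w') t) * br a b"
    using br_scale[OF ab] by (simp add: char_eval_add[OF t] Const_mult mult.assoc)
  finally show "act C t (br a b) = Const (char_eval (w + w') t) * br a b" .
qed

text \<open>The torus weight of the monomial with exponent \<open>u\<close>. The function
  \<open>wtf h\<close> below holds the values at \<open>h\<close> of the differentials of the
  weights, indexed by variable names instead of positions.\<close>

definition mwt :: "(nat \<Rightarrow>\<^sub>0 nat) \<Rightarrow> int ^ 'r" where
  "mwt u = (\<Sum>j\<in>idx C. of_nat (cf u (var C j)) * wt C j)"

definition wtf :: "'k ^ 'r \<Rightarrow> nat \<Rightarrow> 'k" where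
  "wtf h i = char_diff (wt C (inv_into (idx C) (var C) i)) h"

text \<open>The derivation by which an element of the Lie algebra acts.\<close>

definition sg :: "'k ^ 'r \<Rightarrow> 'k mpoly \<Rightarrow> 'k mpoly" where
  "sg h = wder (wtf h)"

lemma wtf_var [simp]: "j \<in> idx C \<Longrightarrow> wtf h (var C j) = char_diff (wt C j) h"
  by (simp add: wtf_def inv_into_f_f[OF var_inj])

lemma drv_sg: "drv S (sg h)"
  by (simp add: sg_def drv_wder)

lemma sg_in: "a \<in> subalg C J \<Longrightarrow> sg h a \<in> subalg C J"
  by (simp add: sg_def subalg_def)

lemma sg_x: "j \<in> idx C \<Longrightarrow> sg h (x j) = Const (char_diff (wt C j) h) * x j"
  by (simp add: sg_def gen_def)

lemma of_nat_vec_component: "((of_nat m :: int ^ 'r) $ i) = int m"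
  by (induct m) (auto)

lemma char_diff_mult_of_nat: "char_diff (of_nat m * w) h = of_nat m * char_diff w (h :: 'k ^ 'r)"
  by (simp add: char_diff_def of_nat_vec_component sum_distrib_left mult.assoc)

lemma char_diff_sum: "char_diff (\<Sum>i\<in>B. f i) h = (\<Sum>i\<in>B. char_diff (f i) (h :: 'k ^ 'r))"
  by (induct B rule: infinite_finite_induct) (auto simp: char_diff_add)

lemma char_diff_mwt:
  assumes "exps u \<subseteq> var C ` idx C"
  shows "char_diff (mwt u) h = wdot (wtf h) u"
proof -
  have "char_diff (mwt u) h = (\<Sum>j\<in>idx C. of_nat (cf u (var C j)) * wtf h (var C j))"
    by (simp add: mwt_def char_diff_sum char_diff_mult_of_nat)
  also have "\<dots> = (\<Sum>i\<in>var C ` idx C. of_nat (cf u i) * wtf h i)"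
    by (simp add: sum.reindex[OF var_inj])
  also have "\<dots> = wdot (wtf h) u"
    by (rule wdot_superset[symmetric]) (use assms in auto)
  finally show ?thesis .
qed

lemma wv_power: "wv w a \<Longrightarrow> a \<in> A \<Longrightarrow> wv (of_nat m * w) (a ^ m) \<and> a ^ m \<in> A"
proof (induct m)
  case (Suc m)
  then show ?case using wv_mult[of w a "of_nat m * w" "a ^ m"] by (simp add: distrib_right)
qed (simp add: wv_1)

lemma wv_prod:
  assumes "\<And>i. i \<in> B \<Longrightarrow> wv (w i) (f i) \<and> f i \<in> A"
  shows "wv (\<Sum>i\<in>B. w i) (\<Prod>i\<in>B. f i) \<and> (\<Prod>i\<in>B. f i) \<in> A"
  using assms by (induct B rule: infinite_finite_induct) (auto simp: wv_1 wv_mult)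

lemma wv_mon:
  assumes "exps u \<subseteq> var C ` idx C"
  shows "wv (mwt u) (mon u)"
proof -
  have "mon u = (\<Prod>i\<in>var C ` idx C. (Var i :: 'k mpoly) ^ cf u i)"
    using pmon_superset[of "var C ` idx C" u Var] assms by simp
  also have "\<dots> = (\<Prod>j\<in>idx C. x j ^ cf u (var C j))"
    by (simp add: prod.reindex[OF var_inj] gen_def)
  finally have m: "mon u = (\<Prod>j\<in>idx C. x j ^ cf u (var C j))" .
  have "wv (\<Sum>j\<in>idx C. of_nat (cf u (var C j)) * wt C j) (\<Prod>j\<in>idx C. x j ^ cf u (var C j))
      \<and> (\<Prod>j\<in>idx C. x j ^ cf u (var C j)) \<in> A"
    by (rule wv_prod) (rule wv_power[OF wv_gen x_in])
  then show ?thesis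
    unfolding mwt_def m by (rule conjunct1)
qed

lemma act_expand:
  assumes t: "t \<in> torus" and a: "a \<in> A"
  shows "act C t a = (\<Sum>u\<in>exps a. Const (char_eval (mwt u) t * cf a u) * mon u)"
proof -
  have sb: "exps u \<subseteq> var C ` idx C" if "u \<in> exps a" for u
    using a that by (auto simp: A_eq polys_in_def)
  have "act C t (\<Sum>u\<in>B. Const (cf a u) * mon u) = (\<Sum>u\<in>B. Const (char_eval (mwt u) t * cf a u) * mon u)
     \<and> (\<Sum>u\<in>B. Const (cf a u) * mon u) \<in> A" if "finite B" "B \<subseteq> exps a" for B
    using that
  proof induct
    case empty
    then show ?case using act_simps(1)[OF t, of 0] by simp
  next
    case (insert u B)
    have m: "mon u \<in> A" "act C t (mon u) = Const (char_eval (mwt u) t) * mon u"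
      using wv_mon[OF sb] t insert by (auto simp: weight_vector_def A_eq sb)
    then have "act C t (Const (cf a u) * mon u) = Const (char_eval (mwt u) t * cf a u) * mon u"
      using act_simps(1)[OF t] act_simps(3)[OF t, of "Const (cf a u)" "mon u"]
      by (simp add: Const_mult ac_simps)
    then show ?case
      using insert act_simps(2)[OF t, of "Const (cf a u) * mon u"] m by simp
  qed
  from this[of "exps a"] show ?thesis
    by (simp only: mpoly_expand[symmetric] finite_keys)
qed

text \<open>The torus acts diagonally on monomials (\<open>act_expand\<close>). Comparing
  coefficients at all torus points forces each monomial of a weight vector to carry its weight; this
  transfers statements from the group to its Lie algebra in \<open>sg_wv\<close>.\<close>

lemma mwt_of_wv:
  assumes a: "a \<in> A" "wv w a" and u: "u \<in> exps a"
  shows "mwt u = w"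
proof (rule char_eval_inj)
  fix t :: "'k ^ 'r" assume t: "t \<in> torus"
  have "cf (act C t a) u = (\<Sum>v\<in>exps a. if v = u then char_eval (mwt v) t * cf a v else 0)"
    unfolding act_expand[OF t a(1)] lookup_sum by (rule sum.cong) (auto simp: lookup_single when_def)
  then have "cf (act C t a) u = char_eval (mwt u) t * cf a u"
    using u by simp
  moreover have "cf (act C t a) u = char_eval w t * cf a u"
    using a(2) t by (simp add: weight_vector_def)
  ultimately show "char_eval (mwt u) t = char_eval w t"
    using u by (auto simp: in_keys_iff)
qed

lemma sg_wv: "a \<in> A \<Longrightarrow> wv w a \<Longrightarrow> sg h a = Const (char_diff w h) * a"
  unfolding sg_def wder_eigen_iff
proof
  fix u assume a: "a \<in> A" "wv w a" and u: "u \<in> exps a"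
  have "exps u \<subseteq> var C ` idx C"
    using a u by (auto simp: A_eq polys_in_def)
  then show "wdot (wtf h) u = char_diff w h"
    using char_diff_mwt mwt_of_wv[OF a u] by metis
qed

lemma wv_unique: "a \<in> A \<Longrightarrow> a \<noteq> 0 \<Longrightarrow> wv w a \<Longrightarrow> wv w' a \<Longrightarrow> w = w'"
  using mwt_of_wv by (metis ex_in_conv keys_eq_empty)

lemma weight_of_eq: "a \<in> A \<Longrightarrow> a \<noteq> 0 \<Longrightarrow> wv w a \<Longrightarrow> weight_of C a = w"
  unfolding weight_of_def using wv_unique by blast

subsection \<open>The derivations\<close>

lemma drv_dl: "k \<in> idx C \<Longrightarrow> drv (R k) (dl k)"
  and dl_in: "k \<in> idx C \<Longrightarrow> a \<in> R k \<Longrightarrow> dl k a \<in> R k"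
  and br_gen_gen: "k \<in> idx C \<Longrightarrow> i \<in> {1..<k} \<Longrightarrow>
    br (x i) (x k) = - Const (char_diff (wt C i) (lie C k)) * x i * x k - dl k (x i)"
  using is_delta_dl[of k] unfolding is_delta_def derivation_on_iff by blast+

lemma lnd_dl: "k \<in> idx C \<Longrightarrow> lnd (var C ` {1..<k}) (R k) (dl k)"
  using is_delta_dl[of k] drv_dl[of k] dl_in[of k]
  by unfold_locales (auto simp: R_eq is_delta_def locally_nilpotent_on_def)

text \<open>Both sides are derivations in \<open>a\<close> that agree on generators. This is the
  Poisson-Ore form of the bracket with \<open>x k\<close>, on the whole algebra before
  \<open>k\<close>.\<close>

lemma br_gen:
  assumes k: "k \<in> idx C" and a: "a \<in> R k"
  shows "br (x k) a = sg (lie C k) a * x k + dl k a"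
proof (rule drv_eqI[OF R_eq _ _ _ a])
  have sub: "R k \<subseteq> A" using k by (intro R_subset_A) auto
  show "drv (R k) (br (x k))"
    using drv_subset[OF drv_br sub] k by simp
  have d: "drv (R k) (sg (lie C k))" "drv (R k) (dl k)"
    using drv_sg drv_dl[OF k] by auto
  show "drv (R k) (\<lambda>a. sg (lie C k) a * x k + dl k a)"
    using drv_plus[OF drv_times[OF d(1), of "x k"] d(2)] by (simp add: mult.commute)
  fix i assume "i \<in> var C ` {1..<k}"
  then obtain j where j: "j \<in> {1..<k}" "Var i = x j" by (auto simp: gen_def)
  then have jn: "j \<in> idx C" using k by auto
  have "br (x k) (x j) = - br (x j) (x k)"
    by (rule br_anti) (use jn k in auto)
  also have "\<dots> = sg (lie C k) (x j) * x k + dl k (x j)"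
    unfolding br_gen_gen[OF k j(1)] sg_x[OF jn] by (simp add: algebra_simps)
  finally show "br (x k) (Var i) = sg (lie C k) (Var i) * x k + dl k (Var i)"
    unfolding j .
qed

lemma dl_eq: "k \<in> idx C \<Longrightarrow> a \<in> R k \<Longrightarrow> dl k a = br (x k) a - sg (lie C k) a * x k"
  using br_gen by simp

lemma R_br:
  assumes k: "k \<le> Suc (len C)" and a: "a \<in> R k" and b: "b \<in> R k"
  shows "br a b \<in> R k"
proof -
  have sub: "R k \<subseteq> A" using k by (rule R_subset_A)
  have xx: "br (x i) (x j) \<in> R k" if "i \<in> {1..<k}" "j \<in> {1..<k}" for i j
  proof -
    have lt: "br (x i) (x j) \<in> R k" if "i < j" "1 \<le> i" "j < k" for i j
    proof -
      have j: "j \<in> idx C" using that k by auto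
      have "dl j (x i) \<in> R k"
        using dl_in[OF j, of "x i"] R_mono[of j k] that by auto
      then show ?thesis
        using br_gen_gen[OF j, of i] that by simp
    qed
    have ij: "x i \<in> A" "x j \<in> A" using that k by auto
    show ?thesis
      using lt[of i j] lt[of j i] br_anti[OF ij] br_self[OF ij(1)] that
      by (cases i j rule: linorder_cases) auto
  qed
  have xb: "br (x i) b \<in> R k" if i: "i \<in> {1..<k}" for i
    unfolding R_eq
  proof (rule drv_in[OF R_eq _ _ subset_refl b])
    show "drv (R k) (br (x i))"
      by (rule drv_subset[OF drv_br sub]) (use i k in auto)
  qed (use xx i in \<open>auto simp: R_eq gen_def\<close>)
  show ?thesis
    unfolding R_eq
  proof (rule drv_in[OF R_eq _ _ subset_refl a, where d = "\<lambda>a. br a b"])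
    show "drv (R k) (\<lambda>a. br a b)"
      by (rule drv_subset[OF drv_br_left sub]) (use b sub in auto)
  qed (use xb in \<open>auto simp: R_eq gen_def\<close>)
qed

lemma wv_dl:
  assumes k: "k \<in> idx C" and a: "a \<in> R k" "wv w a"
  shows "wv (w + wt C k) (dl k a)"
proof -
  have aA: "a \<in> A" using a R_subset_A[of k] k by auto
  have xA: "x k \<in> A" using k by simp
  have "wv (w + wt C k) (br (x k) a)"
    using wv_br[OF wv_gen[OF k] a(2) xA aA] by (simp add: add.commute)
  moreover have "wv (w + wt C k) (sg (lie C k) a * x k)"
    unfolding sg_wv[OF aA a(2)] mult.assoc
    by (intro wv_scale wv_mult a(2) wv_gen[OF k] aA xA subalg_ring)
  ultimately show ?thesis
    unfolding dl_eq[OF k a(1)] using aA xA by (intro wv_diff br_in subalg_ring sg_in)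
qed

end

section \<open>The Poisson primes below a given stage: primality, log-canonical brackets, Laurent
  coordinates\<close>

section \<open>The sequence of homogeneous Poisson primes\<close>

context cgl
begin

abbreviation "hpp \<equiv> homogeneous_poisson_prime C"
abbreviation "Y \<equiv> prime_seq C"

text \<open>\<open>Y j = Yp j * x j + Yr j\<close>, with \<open>Yp j = 1\<close> if \<open>j\<close> has no predecessor.\<close>

definition Yp :: "nat \<Rightarrow> 'k mpoly" where
  "Yp j = (case pred C j of None \<Rightarrow> 1 | Some p \<Rightarrow> Y p)"

definition Yr :: "nat \<Rightarrow> 'k mpoly" where
  "Yr j = (case pred C j of None \<Rightarrow> 0 | Some p \<Rightarrow> - (Const (1 / lam C j) * dl j (Y p)))"

lemma prime_seq_upto_eq: "j \<in> {1..k} \<Longrightarrow> prime_seq_upto C k j = Y j"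
  by (induct k) (auto simp: prime_seq_def le_Suc_eq)

lemma pred_from_cong:
  assumes "\<And>j. j \<in> {1..<k} \<Longrightarrow> y j = y' j"
  shows "pred_from C k y = pred_from C k y'"
proof -
  have "(\<lambda>p. p \<in> {1..<k} \<and> hpp (R k) (y p) \<and> dl k (y p) \<noteq> 0)
      = (\<lambda>p. p \<in> {1..<k} \<and> hpp (R k) (y' p) \<and> dl k (y' p) \<noteq> 0)"
    using assms by auto
  then show ?thesis
    unfolding pred_from_def by simp
qed

lemma Y_eq:
  assumes "1 \<le> k" and "\<And>p. pred C k = Some p \<Longrightarrow> p \<in> {1..<k}"
  shows "Y k = Yp k * x k + Yr k"
proof -
  obtain l where l: "k = Suc l" using assms(1) by (cases k) auto
  have "pred_from C k (prime_seq_upto C l) = pred C k"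
    unfolding pred_def by (rule pred_from_cong) (auto simp: l prime_seq_upto_eq)
  then have "Y k = (case pred C k of None \<Rightarrow> x k
      | Some p \<Rightarrow> prime_seq_upto C l p * x k - Const (1 / lam C k) * dl k (prime_seq_upto C l p))"
    unfolding l by (simp add: prime_seq_def next_prime_def)
  also have "\<dots> = Yp k * x k + Yr k"
    using assms(2) unfolding l by (auto simp: Yp_def Yr_def prime_seq_upto_eq split: option.split)
  finally show ?thesis .
qed

lemma hppD:
  assumes "k \<le> Suc (len C)" "hpp (R k) y"
  shows "y \<in> R k" "\<exists>w. wv w y" "\<And>a. a \<in> R k \<Longrightarrow> y dvd br y a" "y \<noteq> 0"
proof -
  show y: "y \<in> R k" "y \<noteq> 0" "\<exists>w. wv w y"
    using assms(2) by (auto simp: homogeneous_poisson_prime_def prime_elem_on_def)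
  show "y dvd br y a" if "a \<in> R k" for a
    using assms(2) that by (auto simp: homogeneous_poisson_prime_def dvd_on_def)
qed

lemma hppI:
  assumes "k \<le> Suc (len C)" "prime_elem y" "y \<in> R k" "wv w y" "\<And>a. a \<in> R k \<Longrightarrow> y dvd br y a"
  shows "hpp (R k) y"
proof -
  have "dvd_on (R k) y (br y a)" if "a \<in> R k" for a
    using assms(5)[OF that] R_br[OF assms(1,3) that] assms(3) dvd_on_polys_in[of y "var C ` {1..<k}"]
    by (simp add: R_eq)
  then show ?thesis
    using assms prime_elem_on_polys_in[of y "var C ` {1..<k}"]
    unfolding homogeneous_poisson_prime_def R_eq by auto
qed

text \<open>The invariant proved by induction on \<open>j\<close>. It says that the definite
  description behind \<open>pred\<close> picks a genuine prime with the properties needed later. The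
  last clause, after division by \<open>Yp j\<close>, says that z = \<open>Y j\<close> /
  \<open>Yp j\<close> satisfies {z, a} = z (h_j . a), so all higher correction terms have been
  absorbed.\<close>

definition stp :: "nat \<Rightarrow> bool" where
  "stp j \<longleftrightarrow>
     (case pred C j of
        None \<Rightarrow> \<forall>a\<in>R j. dl j a = 0
      | Some p \<Rightarrow> p \<in> {1..<j} \<and> hpp (R j) (Y p) \<and> dl j (Y p) \<noteq> 0 \<and> \<not> Y p dvd dl j (Y p)
          \<and> dl j (dl j (Y p)) = 0 \<and> (\<forall>y. hpp (R j) y \<and> dl j y \<noteq> 0 \<longrightarrow> y dvd Y p)) \<and>
     (\<forall>a\<in>R j. Yp j * br (Y j) a = Y j * (br (Yp j) a + Yp j * sg (lie C j) a))"

end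

text \<open>What is available once the invariant holds below \<open>k\<close>. It serves the
  induction step, and with \<open>k\<close> one beyond the length it covers all indices.\<close>

locale cgl_stage = cgl C for C :: "('k::field_char_0, 'r::finite) cgl" +
  fixes k :: nat
  assumes k: "1 \<le> k" "k \<le> Suc (len C)"
    and stp: "\<And>j. j \<in> {1..<k} \<Longrightarrow> stp j"
begin

abbreviation "J \<equiv> {1..<k}"

lemma J_idx: "j \<in> J \<Longrightarrow> j \<in> idx C"
  using k by auto

lemma S_A: "R k \<subseteq> A"
  using k by (intro R_subset_A)

lemma pred_SomeD:
  assumes "j \<in> J" "pred C j = Some p"
  shows "p \<in> {1..<j}" "p \<in> J" "hpp (R j) (Y p)" "dl j (Y p) \<noteq> 0" "\<not> Y p dvd dl j (Y p)"
    "dl j (dl j (Y p)) = 0" "\<And>y. hpp (R j) y \<Longrightarrow> dl j y \<noteq> 0 \<Longrightarrow> y dvd Y p"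
proof -
  show "p \<in> {1..<j}"
    using stp[OF assms(1)] unfolding stp_def assms(2) option.case by blast
  then show "p \<in> J" using assms(1) by simp
qed (use stp[OF assms(1)] in \<open>unfold stp_def assms(2) option.case, blast+\<close>)

lemma pred_NoneD: "j \<in> J \<Longrightarrow> pred C j = None \<Longrightarrow> a \<in> R j \<Longrightarrow> dl j a = 0"
  using stp[of j] unfolding stp_def by simp

lemma br_Y_rel:
  "j \<in> J \<Longrightarrow> a \<in> R j \<Longrightarrow> Yp j * br (Y j) a = Y j * (br (Yp j) a + Yp j * sg (lie C j) a)"
  using stp[of j] unfolding stp_def by blast

lemma YE: "j \<in> J \<Longrightarrow> Y j = Yp j * x j + Yr j"
  by (rule Y_eq) (simp, erule (1) pred_SomeD(1))

lemma Yp_in_nz: "j \<in> J \<Longrightarrow> Yp j \<in> R j \<and> Yp j \<noteq> 0"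
proof (cases "pred C j")
  case (Some p)
  assume j: "j \<in> J"
  then have "j \<le> Suc (len C)" using k by auto
  from hppD[OF this pred_SomeD(3)[OF j Some]] show ?thesis
    using Some by (simp add: Yp_def)
qed (simp add: Yp_def)

lemma Yp_in: "j \<in> J \<Longrightarrow> Yp j \<in> R j" and Yp_nz: "j \<in> J \<Longrightarrow> Yp j \<noteq> 0"
  using Yp_in_nz by blast+

lemma Yr_in: "j \<in> J \<Longrightarrow> Yr j \<in> R j"
  using Yp_in[of j] dl_in[OF J_idx, of j "Yp j"] by (auto simp: Yr_def Yp_def split: option.split)

lemma Y_in_Suc: "j \<in> J \<Longrightarrow> Y j \<in> R (Suc j)"
  unfolding YE using Yp_in[of j] Yr_in[of j] R_mono[of j "Suc j"]
  by (intro subalg_ring x_in) auto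

lemma Y_in: "j \<in> J \<Longrightarrow> Y j \<in> R k"
  using Y_in_Suc[of j] R_mono[of "Suc j" k] by auto

lemma Y_in_A: "j \<in> J \<Longrightarrow> Y j \<in> A"
  using Y_in S_A by auto

lemma R_free: "j \<in> idx C \<Longrightarrow> R j \<subseteq> polys_in (- {var C j})"
proof -
  assume j: "j \<in> idx C"
  have "var C j \<notin> var C ` {1..<j}"
  proof
    assume "var C j \<in> var C ` {1..<j}"
    then obtain i where "i \<in> {1..<j}" "var C j = var C i" by auto
    then show False using inj_onD[OF var_inj, of j i] j by auto
  qed
  then show ?thesis
    unfolding R_eq by (intro polys_in_mono) auto
qed

text \<open>\<open>Y j\<close> is linear in \<open>x j\<close>; its coefficient is 1 or an earlier
  prime that does not divide the remaining term, so \<open>prime_elem_linear\<close>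
  applies.\<close>

lemma Y_prime: "j \<in> J \<Longrightarrow> prime_elem (Y j)"
proof (induct j rule: less_induct)
  case (less j)
  have F: "Yp j \<in> polys_in (- {var C j})" "Yr j \<in> polys_in (- {var C j})"
    using Yp_in Yr_in R_free J_idx less.prems by blast+
  have "Yp j = 1 \<or> prime_elem (Yp j) \<and> \<not> Yp j dvd Yr j"
  proof (cases "pred C j")
    case (Some p)
    have "\<not> Y p dvd Const (1 / lam C j) * dl j (Y p)"
    proof
      assume "Y p dvd Const (1 / lam C j) * dl j (Y p)"
      then have "Y p dvd Const (lam C j) * (Const (1 / lam C j) * dl j (Y p))"
        by (rule dvd_mult)
      also have "\<dots> = dl j (Y p)"
        using lam_neq_0[OF J_idx[OF less.prems]] by (simp flip: mult.assoc Const_mult)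
      finally show False using pred_SomeD(5)[OF less.prems Some] by simp
    qed
    moreover have "prime_elem (Y p)"
      using less.hyps pred_SomeD(1,2)[OF less.prems Some] by auto
    ultimately show ?thesis
      using Some by (simp add: Yp_def Yr_def)
  qed (simp add: Yp_def)
  from prime_elem_linear[OF F this] show ?case
    using YE[OF less.prems] by (simp add: gen_def)
qed

lemma Y_nz: "j \<in> J \<Longrightarrow> Y j \<noteq> 0"
  using Y_prime by force

definition W :: "nat \<Rightarrow> int ^ 'r" where "W j = weight_of C (Y j)"

definition Wp :: "nat \<Rightarrow> int ^ 'r" where
  "Wp j = (case pred C j of None \<Rightarrow> 0 | Some p \<Rightarrow> W p)"

lemma wv_Y_aux: "j \<in> J \<Longrightarrow> wv w (Y j) \<Longrightarrow> wv (W j) (Y j) \<and> w = W j"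
  unfolding W_def using weight_of_eq[OF Y_in_A Y_nz] by blast

lemma wv_Yp: "j \<in> J \<Longrightarrow> wv (Wp j) (Yp j)"
proof (cases "pred C j")
  case (Some p)
  assume j: "j \<in> J"
  then have "j \<le> Suc (len C)" using k by auto
  then obtain w where "wv w (Y p)"
    using hppD(2)[OF _ pred_SomeD(3)[OF j Some]] by blast
  then show ?thesis
    using wv_Y_aux[OF pred_SomeD(2)[OF j Some]] Some by (simp add: Yp_def Wp_def)
qed (simp add: Yp_def Wp_def wv_1)

lemma
  assumes j: "j \<in> J"
  shows wv_Y: "wv (W j) (Y j)" and W_eq: "W j = Wp j + wt C j"
proof -
  have in_A: "Yp j \<in> A" "Yr j \<in> A" "x j \<in> A"
    using Yp_in[OF j] Yr_in[OF j] R_subset_A[of j] J_idx[OF j] by auto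
  have "wv (Wp j + wt C j) (Yr j)"
  proof (cases "pred C j")
    case (Some p)
    have "wv (W p + wt C j) (dl j (Y p))"
      using wv_dl[OF J_idx[OF j] _ wv_Yp[OF j]] Yp_in[OF j] Some by (simp add: Yp_def Wp_def)
    moreover have "dl j (Y p) \<in> A"
      using dl_in[OF J_idx[OF j] Yp_in[OF j]] R_subset_A[of j] J_idx[OF j] Some by (auto simp: Yp_def)
    ultimately show ?thesis
      using Some by (simp add: Yr_def Wp_def wv_uminus wv_scale)
  qed (simp add: Yr_def wv_0)
  then have "wv (Wp j + wt C j) (Y j)"
    unfolding YE[OF j] using wv_mult[OF wv_Yp[OF j] wv_gen[OF J_idx[OF j]]] in_A
    by (intro wv_add) auto
  then show "wv (W j) (Y j)" "W j = Wp j + wt C j"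
    using wv_Y_aux[OF j] by auto
qed

lemma sg_Y: "j \<in> J \<Longrightarrow> sg h (Y j) = Const (char_diff (W j) h) * Y j"
  using sg_wv[OF Y_in_A wv_Y] .

text \<open>The coefficients of the log-canonical brackets of the \<open>Y j\<close>.\<close>

definition eq :: "nat \<Rightarrow> nat \<Rightarrow> 'k" where "eq = q_mat C Y"

definition eqp :: "nat \<Rightarrow> nat \<Rightarrow> 'k" where
  "eqp j i = (case pred C j of None \<Rightarrow> 0 | Some p \<Rightarrow> eq p i)"

lemma eqI: "i \<in> J \<Longrightarrow> j \<in> J \<Longrightarrow> br (Y i) (Y j) = Const c * (Y i * Y j) \<Longrightarrow> eq i j = c"
  unfolding eq_def q_mat_def using Y_nz by (intro the_equality) auto

text \<open>Induction on \<open>j\<close>: the last clause of \<open>stp\<close> expresses the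
  bracket of \<open>Y j\<close> and \<open>Y i\<close> through that of the predecessor of
  \<open>Y j\<close> with \<open>Y i\<close> and the weight of \<open>Y i\<close>.\<close>

lemma br_Y_ex: "i < j \<Longrightarrow> i \<in> J \<Longrightarrow> j \<in> J \<Longrightarrow> \<exists>c. br (Y i) (Y j) = Const c * (Y i * Y j)"
proof (induct j arbitrary: i rule: less_induct)
  case (less j)
  have sym: "\<exists>c. br (Y i) (Y j') = Const c * (Y i * Y j')" if j': "j' \<in> J" "j' < j" for j'
  proof -
    have A: "Y i \<in> A" "Y j' \<in> A" using Y_in_A less.prems j' by auto
    consider "i < j'" | "i = j'" | "j' < i" by linarith
    then show ?thesis
    proof cases
      case 1
      then show ?thesis using less.hyps[OF j'(2)] less.prems j' by blast
    next
      case 2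
      then show ?thesis using br_self[OF A(1)] by (intro exI[of _ 0]) simp
    next
      case 3
      then obtain c where "br (Y j') (Y i) = Const c * (Y j' * Y i)"
        using less.hyps[OF less.prems(1) 3 j'(1)] less.prems by blast
      then show ?thesis
        using br_anti[OF A] by (intro exI[of _ "- c"]) (simp add: Const_minus ac_simps)
    qed
  qed
  have iR: "Y i \<in> R j"
    using Y_in_Suc[OF less.prems(2)] R_mono[of "Suc i" j] less.prems by auto
  have iA: "Y i \<in> A" and pA: "Yp j \<in> A" and jA: "Y j \<in> A"
    using Y_in_A less.prems Yp_in[OF less.prems(3)] R_subset_A[of j] J_idx[of j] by auto
  obtain c where c: "br (Yp j) (Y i) = Const c * (Y i * Yp j)"
  proof (cases "pred C j")
    case None
    then have "br (Yp j) (Y i) = Const 0 * (Y i * Yp j)"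
      using br_1_left[OF iA] by (simp add: Yp_def)
    then show ?thesis using that by blast
  next
    case (Some p)
    obtain c where "br (Y i) (Y p) = Const c * (Y i * Y p)"
      using sym[of p] pred_SomeD(1,2)[OF less.prems(3) Some] by auto
    then have "br (Yp j) (Y i) = Const (- c) * (Y i * Yp j)"
      using br_anti[OF iA pA] br_anti[OF pA iA] Some by (simp add: Yp_def Const_minus)
    then show ?thesis using that by blast
  qed
  have "Yp j * br (Y j) (Y i) = Yp j * (Const (c + char_diff (W i) (lie C j)) * (Y j * Y i))"
    unfolding br_Y_rel[OF less.prems(3) iR] c sg_Y[OF less.prems(2)]
    by (simp add: algebra_simps Const_add)
  then have "br (Y j) (Y i) = Const (c + char_diff (W i) (lie C j)) * (Y j * Y i)"
    using Yp_nz[OF less.prems(3)] by simp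
  then show ?case
    using br_anti[OF iA jA] by (intro exI[of _ "- (c + char_diff (W i) (lie C j))"])
      (simp only: Const_minus, simp add: ac_simps)
qed

lemma br_YY: assumes "i \<in> J" "j \<in> J" shows "br (Y i) (Y j) = Const (eq i j) * (Y i * Y j)"
proof -
  have A: "Y i \<in> A" "Y j \<in> A" using Y_in_A assms by auto
  have "\<exists>c. br (Y i) (Y j) = Const c * (Y i * Y j)"
  proof (cases i j rule: linorder_cases)
    case less
    then show ?thesis using br_Y_ex assms by blast
  next
    case equal
    then show ?thesis using br_self[OF A(1)] by (intro exI[of _ 0]) simp
  next
    case greater
    then obtain c where "br (Y j) (Y i) = Const c * (Y j * Y i)" using br_Y_ex assms by blast
    then show ?thesis
      using br_anti[OF A] by (intro exI[of _ "- c"]) (simp add: Const_minus ac_simps)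
  qed
  then show ?thesis using eqI[OF assms] by blast
qed

lemma eq_anti: "i \<in> J \<Longrightarrow> j \<in> J \<Longrightarrow> eq i j = - eq j i"
proof -
  assume i: "i \<in> J" and j: "j \<in> J"
  show ?thesis
    by (rule eqI[OF i j]) (simp add: br_anti[OF Y_in_A[OF i] Y_in_A[OF j]] br_YY[OF j i] Const_minus ac_simps)
qed

lemma eq_self: "i \<in> J \<Longrightarrow> eq i i = 0"
  by (rule eqI) (simp_all add: br_self[OF Y_in_A])

lemma br_Yp_Y: "i \<in> J \<Longrightarrow> j \<in> J \<Longrightarrow> br (Yp j) (Y i) = Const (eqp j i) * (Yp j * Y i)"
proof (cases "pred C j")
  case (Some p)
  assume "i \<in> J" "j \<in> J"
  then show ?thesis
    using br_YY[OF pred_SomeD(2)[OF _ Some]] Some by (simp add: eqp_def Yp_def)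
qed (simp add: eqp_def Yp_def br_1_left[OF Y_in_A])

text \<open>The recursion that makes the coefficient matrix accessible: its differences along
  predecessors are values of weights.\<close>

lemma eq_rec:
  assumes i: "i \<in> J" and j: "j \<in> J" and "i < j"
  shows "eq j i = eqp j i + char_diff (W i) (lie C j)"
proof (rule eqI[OF j i])
  have iR: "Y i \<in> R j"
    using Y_in_Suc[OF i] R_mono[of "Suc i" j] assms by auto
  have "Yp j * br (Y j) (Y i) = Yp j * (Const (eqp j i + char_diff (W i) (lie C j)) * (Y j * Y i))"
    unfolding br_Y_rel[OF j iR] br_Yp_Y[OF i j] sg_Y[OF i] by (simp add: algebra_simps Const_add)
  then show "br (Y j) (Y i) = Const (eqp j i + char_diff (W i) (lie C j)) * (Y j * Y i)"
    using Yp_nz[OF j] by simp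
qed

text \<open>For the last index \<open>l\<close> where two exponents differ, \<open>Y l / Yp l\<close> tells the two
  monomials apart, because \<open>lam C l\<close> is not zero.\<close>

lemma eigenvalues_separate:
  assumes m: "exps m \<subseteq> J" "exps m' \<subseteq> J" "m \<noteq> m'"
  shows "(\<exists>i\<in>J. wdot (eq i) m \<noteq> wdot (eq i) m') \<or>
    (\<exists>h :: 'k ^ 'r. wdot (\<lambda>j. char_diff (W j) h) m \<noteq> wdot (\<lambda>j. char_diff (W j) h) m')"
proof (rule ccontr)
  assume "\<not> ?thesis"
  then have e: "\<And>i. i \<in> J \<Longrightarrow> wdot (eq i) m = wdot (eq i) m'"
    and w: "\<And>h :: 'k ^ 'r. wdot (\<lambda>j. char_diff (W j) h) m = wdot (\<lambda>j. char_diff (W j) h) m'" by auto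
  define f where "f j = (of_nat (cf m j) - of_nat (cf m' j) :: 'k)" for j
  have wd: "wdot \<phi> m - wdot \<phi> m' = (\<Sum>j\<in>J. f j * \<phi> j)" for \<phi>
    using m by (simp add: wdot_superset[of J] f_def left_diff_distrib sum_subtractf)
  define B where "B = {j \<in> J. f j \<noteq> 0}"
  have "B \<noteq> {}"
  proof
    assume "B = {}"
    then have "cf m j = cf m' j" if "j \<in> J" for j
      using that by (auto simp: B_def f_def)
    then have "m = m'"
      using m(1,2) by (intro poly_mapping_eqI) (metis in_keys_iff subsetD)
    then show False using m(3) by simp
  qed
  define l where "l = Max B"
  have "l \<in> B" unfolding l_def by (rule Max_in) (use \<open>B \<noteq> {}\<close> in \<open>auto simp: B_def\<close>)
  then have l: "l \<in> J" "f l \<noteq> 0" by (auto simp: B_def)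
  have above: "f j = 0" if "j \<in> J" "l < j" for j
  proof (rule ccontr)
    assume "f j \<noteq> 0"
    then have "j \<le> l"
      unfolding l_def using that(1) by (intro Max_ge) (auto simp: B_def)
    then show False using that(2) by simp
  qed
  define h where "h = lie C l"
  have "(\<Sum>i\<in>J. f i * eq l i) = 0"
    using e[OF l(1)] wd by (metis right_minus_eq)
  moreover have "(\<Sum>i\<in>J. f i * eqp l i) = 0"
  proof (cases "pred C l")
    case (Some p)
    then show ?thesis
      using e[OF pred_SomeD(2)[OF l(1) Some]] wd[of "eq p"] by (simp add: eqp_def)
  qed (simp add: eqp_def)
  ultimately have 0: "(\<Sum>i\<in>J. f i * (eq l i - eqp l i)) = 0"
    by (simp add: right_diff_distrib sum_subtractf)
  have eqpll: "eqp l l = - char_diff (Wp l) h"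
  proof (cases "pred C l")
    case (Some p)
    note p = pred_SomeD(1,2)[OF l(1) Some]
    have "eqp l l = - eq l p" using Some eq_anti[OF p(2) l(1)] by (simp add: eqp_def)
    also have "eq l p = eqp l p + char_diff (W p) h"
      using eq_rec[OF p(2) l(1)] p(1) by (simp add: h_def)
    also have "eqp l p = 0" using Some eq_self[OF p(2)] by (simp add: eqp_def)
    finally show ?thesis using Some by (simp add: Wp_def)
  qed (simp add: eqp_def Wp_def)
  have "f i * (eq l i - eqp l i) = f i * char_diff (W i) h - (if i = l then f l * lam C l else 0)"
    if i: "i \<in> J" for i
  proof (cases i l rule: linorder_cases)
    case less
    then show ?thesis using eq_rec[OF i l(1)] by (simp add: h_def)
  next
    case equal
    have "char_diff (W l) h = char_diff (Wp l) h + lam C l"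
      unfolding W_eq[OF l(1)] char_diff_add by (simp add: lam_def h_def)
    then show ?thesis using equal eq_self[OF l(1)] eqpll by (simp add: algebra_simps)
  next
    case greater
    then show ?thesis using above[OF i] by simp
  qed
  then have "(\<Sum>i\<in>J. f i * (eq l i - eqp l i))
      = (\<Sum>i\<in>J. f i * char_diff (W i) h - (if i = l then f l * lam C l else 0))"
    by (rule sum.cong[OF refl])
  also have "\<dots> = (wdot (\<lambda>j. char_diff (W j) h) m - wdot (\<lambda>j. char_diff (W j) h) m') - f l * lam C l"
    using l(1) by (simp add: sum_subtractf wd)
  finally show False
    using 0 w[of h] l lam_neq_0[OF J_idx[OF l(1)]] by simp
qed

lemma drv_br_Y: "i \<in> J \<Longrightarrow> drv (R k) (br (Y i))"
  using drv_subset[OF drv_br[OF Y_in_A] S_A] .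

lemma br_Y_sub: "i \<in> J \<Longrightarrow> g \<in> polys_in J \<Longrightarrow> br (Y i) (sub Y g) = Y i * sub Y (wder (eq i) g)"
  by (rule drv_sub[OF R_eq drv_br_Y]) (use Y_in br_YY in \<open>auto simp: ac_simps\<close>)

lemma sg_sub: "g \<in> polys_in J \<Longrightarrow> sg h (sub Y g) = sub Y (wder (\<lambda>j. char_diff (W j) h) g)"
  using drv_sub[OF R_eq drv_sg, of J Y k h "\<lambda>j. char_diff (W j) h" 1 g] Y_in sg_Y by simp

lemma br_Y_pmon:
  assumes "i \<in> J" "exps N \<subseteq> J"
  shows "br (Y i) (pmon Y N) = Const (wdot (eq i) N) * Y i * pmon Y N"
  unfolding wdot_def
  by (rule drv_pmon[OF R_eq drv_br_Y[OF assms(1)]]) (use assms Y_in br_YY in \<open>auto simp: ac_simps\<close>)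

lemma sg_pmon: "exps N \<subseteq> J \<Longrightarrow> sg h (pmon Y N) = Const (wdot (\<lambda>j. char_diff (W j) h) N) * pmon Y N"
  using drv_pmon[OF R_eq drv_sg, of N Y k h "\<lambda>j. char_diff (W j) h" 1] Y_in sg_Y
  unfolding wdot_def by (simp add: subset_iff)

lemma pmon_in_R: "exps N \<subseteq> J \<Longrightarrow> pmon Y N \<in> R k"
  unfolding R_eq by (rule pmon_in) (use Y_in R_eq in auto)

lemma pmon_nz: "exps N \<subseteq> J \<Longrightarrow> pmon Y N \<noteq> 0"
  using Y_nz by (auto simp: pmon_eq_0_iff)

lemma sub_in_R: "g \<in> polys_in J \<Longrightarrow> sub Y g \<in> R k"
  unfolding R_eq by (erule sub_in) (use Y_in R_eq in auto)

text \<open>Algebraic independence of the \<open>Y j\<close>. Two monomials of a shortest relation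
  are separated by a diagonal operator (\<open>eigenvalues_separate\<close>): a bracket with some
  \<open>Y i\<close> or the action of some \<open>h\<close>. Applying it and subtracting a multiple
  of the relation removes one monomial and keeps the other.\<close>

lemma sub_eq_0D:
  assumes "g \<in> polys_in J" "sub Y g = 0"
  shows "g = 0"
  using assms
proof (induct "card (exps g)" arbitrary: g rule: less_induct)
  case less
  have sb: "exps m \<subseteq> J" if "m \<in> exps g" for m
    using less.prems(1) that unfolding polys_in_def by blast
  show ?case
  proof (rule ccontr)
    assume "g \<noteq> 0"
    then obtain m where m: "m \<in> exps g" by (metis ex_in_conv keys_eq_empty)
    show False
    proof (cases "exps g = {m}")
      case True
      then have "sub Y g = Const (cf g m) * pmon Y m" by (simp add: sub_def)
      then show False
        using less.prems(2) m pmon_nz[OF sb[OF m]] by (auto simp: in_keys_iff)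
    next
      case False
      then obtain m' where m': "m' \<in> exps g" "m \<noteq> m'" using m by auto
      obtain c where c: "sub Y (wder c g) = 0" "wdot c m \<noteq> wdot c m'"
      proof (cases "\<exists>i\<in>J. wdot (eq i) m \<noteq> wdot (eq i) m'")
        case True
        then obtain i where i: "i \<in> J" "wdot (eq i) m \<noteq> wdot (eq i) m'" by blast
        have "Y i * sub Y (wder (eq i) g) = 0"
          using br_Y_sub[OF i(1) less.prems(1)] less.prems(2) drv_0[OF R_eq drv_br_Y[OF i(1)]] by simp
        then show ?thesis using that i Y_nz[OF i(1)] by auto
      next
        case False
        then obtain h :: "'k ^ 'r" where h: "wdot (\<lambda>j. char_diff (W j) h) m \<noteq> wdot (\<lambda>j. char_diff (W j) h) m'"
          using eigenvalues_separate[OF sb[OF m] sb[OF m'(1)] m'(2)] by blast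
        have "sub Y (wder (\<lambda>j. char_diff (W j) h) g) = 0"
          using sg_sub[OF less.prems(1)] less.prems(2) drv_0[OF R_eq drv_sg] by metis
        then show ?thesis using that h by blast
      qed
      define g' where "g' = wder c g - Const (wdot c m) * g"
      have cfg': "cf g' u = (wdot c u - wdot c m) * cf g u" for u
        by (simp add: g'_def lookup_minus left_diff_distrib)
      have "exps g' \<subseteq> exps g - {m}"
        by (auto simp: in_keys_iff cfg')
      then have "card (exps g') < card (exps g)"
        using m by (metis Diff_subset card_Diff1_less finite_keys card_mono finite_Diff le_less_trans)
      moreover have "sub Y g' = 0"
        using c(1) less.prems(2) by (simp add: g'_def)
      moreover have "g' \<in> polys_in J"
        using less.prems(1) by (simp add: g'_def)
      ultimately have "g' = 0" using less.hyps by blast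
      then have "cf g' m' = 0" by simp
      then show False using c(2) m' cfg' by (auto simp: in_keys_iff)
    qed
  qed
qed

lemma sub_inj: "g \<in> polys_in J \<Longrightarrow> g' \<in> polys_in J \<Longrightarrow> sub Y g = sub Y g' \<Longrightarrow> g = g'"
  using sub_eq_0D[of "g - g'"] by simp

text \<open>Every element of \<open>R k\<close> is a Laurent polynomial in the \<open>Y j\<close>.\<close>

definition laurent :: "'k mpoly \<Rightarrow> bool" where
  "laurent a \<longleftrightarrow> (\<exists>N g. exps N \<subseteq> J \<and> g \<in> polys_in J \<and> pmon Y N * a = sub Y g)"

lemma laurentI: "exps N \<subseteq> J \<Longrightarrow> g \<in> polys_in J \<Longrightarrow> pmon Y N * a = sub Y g \<Longrightarrow> laurent a"
  unfolding laurent_def by blast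

lemma pmon_eq_sub: "pmon Y N = sub Y (mon N)"
  using sub_mon[of Y 1 N] by simp

lemma laurent_Const: "laurent (Const c)"
  by (rule laurentI[of 0 "Const c"]) auto

lemma laurent_Y: "i \<in> J \<Longrightarrow> laurent (Y i)"
  by (rule laurentI[of 0 "Var i"]) auto

lemma laurent_add: assumes "laurent a" "laurent b" shows "laurent (a + b)"
proof -
  obtain N g N' g' where h: "exps N \<subseteq> J" "g \<in> polys_in J" "pmon Y N * a = sub Y g"
    "exps N' \<subseteq> J" "g' \<in> polys_in J" "pmon Y N' * b = sub Y g'"
    using assms unfolding laurent_def by blast
  have "pmon Y (N + N') * (a + b) = pmon Y N' * (pmon Y N * a) + pmon Y N * (pmon Y N' * b)"
    by (simp add: pmon_add algebra_simps)
  also have "\<dots> = sub Y (mon N' * g + mon N * g')"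
    unfolding h by (simp add: pmon_eq_sub)
  finally show ?thesis
    by (rule laurentI[rotated 2]) (use h in \<open>auto simp: exps_add_nat\<close>)
qed

lemma laurent_mult: assumes "laurent a" "laurent b" shows "laurent (a * b)"
proof -
  obtain N g N' g' where h: "exps N \<subseteq> J" "g \<in> polys_in J" "pmon Y N * a = sub Y g"
    "exps N' \<subseteq> J" "g' \<in> polys_in J" "pmon Y N' * b = sub Y g'"
    using assms unfolding laurent_def by blast
  have "pmon Y (N + N') * (a * b) = (pmon Y N * a) * (pmon Y N' * b)"
    by (simp add: pmon_add ac_simps)
  also have "\<dots> = sub Y (g * g')"
    unfolding h by simp
  finally show ?thesis
    by (rule laurentI[rotated 2]) (use h in \<open>auto simp: exps_add_nat\<close>)
qed

lemma laurent_cancel: assumes "i \<in> J" "laurent (Y i * a)" shows "laurent a"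
proof -
  obtain N g where h: "exps N \<subseteq> J" "g \<in> polys_in J" "pmon Y N * (Y i * a) = sub Y g"
    using assms unfolding laurent_def by blast
  then have "pmon Y (N + Poly_Mapping.single i 1) * a = sub Y g"
    by (simp add: pmon_add ac_simps)
  then show ?thesis
    by (rule laurentI[rotated 2]) (use h assms in \<open>auto simp: exps_add_nat\<close>)
qed

text \<open>The equation \<open>Y j = Yp j * x j + Yr j\<close> is solved for \<open>x j\<close>:
  \<open>Yr j\<close> involves only earlier generators and \<open>Yp j\<close> is 1 or an earlier
  \<open>Y\<close>.\<close>

lemma laurent_R:
  assumes "a \<in> R k"
  shows "laurent a"
proof -
  have gens: "laurent b" if "\<And>i. i \<in> {1..<j} \<Longrightarrow> laurent (x i)" "b \<in> R j" for j b
    using that(2) unfolding R_eq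
  proof (induct rule: polys_in_induct)
    case (Var f i)
    then show ?case using that(1) laurent_mult by (auto simp: gen_def)
  qed (use laurent_Const laurent_add in auto)
  have "laurent (x j)" if "j \<in> J" for j
    using that
  proof (induct j rule: less_induct)
    case (less j)
    have IH: "laurent b" if "b \<in> R j" for b
      by (rule gens[OF _ that]) (use less in auto)
    have "laurent (Y j + Const (- 1) * Yr j)"
      using laurent_Y less.prems IH[OF Yr_in] laurent_Const by (intro laurent_add laurent_mult) auto
    moreover have "Y j + Const (- 1) * Yr j = Yp j * x j"
      using YE[OF less.prems] by (simp add: Const_minus)
    ultimately have "laurent (Yp j * x j)" by simp
    then show ?case
      using laurent_cancel[OF pred_SomeD(2)[OF less.prems]]
      by (cases "pred C j") (simp_all add: Yp_def)
  qed
  then show ?thesis using gens assms by blast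
qed

text \<open>Apply the product rule to \<open>pmon Y N * a = sub Y g\<close> and cancel the nonzero
  denominator.\<close>

lemma drv_eq_0_Y:
  assumes d: "drv (R k) d" and 0: "\<And>j. j \<in> J \<Longrightarrow> d (Y j) = 0" and a: "a \<in> R k"
  shows "d a = 0"
proof -
  obtain N g where h: "exps N \<subseteq> J" "g \<in> polys_in J" "pmon Y N * a = sub Y g"
    using laurent_R[OF a] unfolding laurent_def by blast
  have "d (pmon Y N) = 0"
    using drv_pmon[OF R_eq d, of N Y "\<lambda>_. 0" 0] Y_in 0 h(1) by (simp add: subset_iff)
  moreover have "d (sub Y g) = 0"
    using drv_sub[OF R_eq d, of J Y "\<lambda>_. 0" 0 g] Y_in 0 h(2) by simp
  moreover have "d (pmon Y N * a) = d (pmon Y N) * a + pmon Y N * d a"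
    by (rule drv_mult[OF d pmon_in_R[OF h(1)] a])
  ultimately show ?thesis
    using h pmon_nz[OF h(1)] by simp
qed

lemma drv_eq_Y:
  assumes "drv (R k) d" "drv (R k) e" "\<And>j. j \<in> J \<Longrightarrow> d (Y j) = e (Y j)" "a \<in> R k"
  shows "d a = e a"
  using drv_eq_0_Y[OF drv_plus[OF assms(1) drv_times[OF assms(2), of "-1"]] _ assms(4)] assms(3) by simp

end

section \<open>The induction step: the derivation at stage k is inner up to a twist, and this
  determines the predecessor\<close>

locale cgl_step = cgl_stage +
  assumes kn: "k \<in> idx C"
begin

abbreviation "d \<equiv> dl k"
abbreviation "h \<equiv> lie C k"
abbreviation "lamk \<equiv> lam C k"

definition s :: "nat \<Rightarrow> 'a" where "s i = char_diff (W i) h"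

lemma sg_Y_s: "i \<in> J \<Longrightarrow> sg h (Y i) = Const (s i) * Y i"
  using sg_Y by (simp add: s_def)

lemma sg_sub_s: "g \<in> polys_in J \<Longrightarrow> sg h (sub Y g) = sub Y (wder s g)"
  using sg_sub unfolding s_def[abs_def] by blast

lemma sg_pmon_s: "exps N \<subseteq> J \<Longrightarrow> sg h (pmon Y N) = Const (wdot s N) * pmon Y N"
  using sg_pmon unfolding s_def[abs_def] by blast

lemma x_A: "x k \<in> A"
  using kn by simp

lemma d_Y_in: "i \<in> J \<Longrightarrow> d (Y i) \<in> R k"
  using dl_in[OF kn Y_in] .

lemma sg_d_Y: "i \<in> J \<Longrightarrow> sg h (d (Y i)) = Const (s i + lamk) * d (Y i)"
  using sg_wv[OF _ wv_dl[OF kn Y_in wv_Y]] d_Y_in S_A by (auto simp: s_def lam_def char_diff_add)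

text \<open>The Jacobi identity for \<open>x k\<close>, \<open>Y i\<close> and \<open>Y j\<close>.\<close>

lemma d_Y_compat:
  assumes i: "i \<in> J" and j: "j \<in> J"
  shows "Const (eq i j) * (d (Y i) * Y j + Y i * d (Y j))
    = Const (s i) * (Y i * d (Y j)) - Const (s j) * (Y j * d (Y i)) - br (Y j) (d (Y i)) + br (Y i) (d (Y j))"
proof -
  have A: "Y i \<in> A" "Y j \<in> A" "d (Y i) \<in> A" "d (Y j) \<in> A"
    using Y_in_A d_Y_in S_A i j by auto
  note xi = br_gen[OF kn Y_in[OF i], unfolded sg_Y_s[OF i]]
  note xj = br_gen[OF kn Y_in[OF j], unfolded sg_Y_s[OF j]]
  have ix: "br (Y i) (x k) = - (Const (s i) * Y i * x k + d (Y i))"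
    using br_anti[OF A(1) x_A] xi by simp
  have jx: "br (Y j) (x k) = - (Const (s j) * Y j * x k + d (Y j))"
    using br_anti[OF A(2) x_A] xj by simp
  have "br (x k) (br (Y i) (Y j)) = br (br (x k) (Y i)) (Y j) + br (Y i) (br (x k) (Y j))"
    by (rule br_jacobi') (use A x_A in auto)
  also have "br (br (x k) (Y i)) (Y j) = - br (Y j) (Const (s i) * (Y i * x k) + d (Y i))"
    unfolding xi mult.assoc by (rule br_anti) (use A x_A in auto)
  also have "br (Y j) (Const (s i) * (Y i * x k) + d (Y i))
      = Const (s i) * (br (Y j) (Y i) * x k + Y i * br (Y j) (x k)) + br (Y j) (d (Y i))"
    using A x_A by (simp add: br_add br_scale br_mult br_Const)
  also have "br (Y i) (br (x k) (Y j))
      = Const (s j) * (br (Y i) (Y j) * x k + Y j * br (Y i) (x k)) + br (Y i) (d (Y j))"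
    unfolding xj mult.assoc using A x_A by (simp add: br_add br_scale br_mult br_Const)
  also have "br (x k) (br (Y i) (Y j))
      = Const (eq i j) * ((Const (s i) * Y i * x k + d (Y i)) * Y j + Y i * (Const (s j) * Y j * x k + d (Y j)))"
    unfolding br_YY[OF i j] using A x_A by (simp add: br_scale br_mult xi xj br_Const)
  finally show ?thesis
    unfolding ix jx br_YY[OF i j] br_YY[OF j i] eq_anti[OF j i] Const_minus
    by (simp add: algebra_simps)
qed

text \<open>\<open>rel u v\<close> says that \<open>u / v\<close> has the weight of \<open>x k\<close> and that \<open>x k + u / v\<close> has
  the same brackets as \<open>x k\<close>, up to the term \<open>d\<close>.\<close>

definition rel :: "'a mpoly \<Rightarrow> 'a mpoly \<Rightarrow> bool" where
  "rel u v \<longleftrightarrow> u \<in> R k \<and> v \<in> R k \<and> v \<noteq> 0 \<and>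
     sg h u * v - u * sg h v = Const lamk * u * v \<and>
     (\<forall>a\<in>R k. v * v * d a = u * v * sg h a - v * br u a + u * br v a)"

lemma common_denominator:
  "\<exists>N g. exps N \<subseteq> J \<and> (\<forall>i\<in>J. g i \<in> polys_in J \<and> pmon Y N * d (Y i) = Y i * sub Y (g i))"
proof -
  have "\<exists>N. exps N \<subseteq> J \<and> (\<forall>i\<in>B. \<exists>g\<in>polys_in J. pmon Y N * d (Y i) = sub Y g)"
    if "finite B" "B \<subseteq> J" for B
    using that
  proof induct
    case (insert i B)
    then obtain N where N: "exps N \<subseteq> J" "\<forall>i\<in>B. \<exists>g\<in>polys_in J. pmon Y N * d (Y i) = sub Y g" by auto
    obtain N' g' where N': "exps N' \<subseteq> J" "g' \<in> polys_in J" "pmon Y N' * d (Y i) = sub Y g'"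
      using laurent_R[OF d_Y_in] insert.prems unfolding laurent_def by blast
    have "\<exists>g\<in>polys_in J. pmon Y (N + N') * d (Y l) = sub Y g" if l: "l \<in> insert i B" for l
    proof (cases "l = i")
      case True
      have "pmon Y (N + N') * d (Y l) = pmon Y N * (pmon Y N' * d (Y i))"
        using True by (simp add: pmon_add ac_simps)
      also have "\<dots> = sub Y (mon N * g')"
        unfolding N'(3) by (simp add: pmon_eq_sub)
      finally show ?thesis using N N' by (intro bexI[of _ "mon N * g'"]) auto
    next
      case False
      then obtain g where g: "g \<in> polys_in J" "pmon Y N * d (Y l) = sub Y g" using N l by blast
      have "pmon Y (N + N') * d (Y l) = pmon Y N' * (pmon Y N * d (Y l))"
        by (simp add: pmon_add ac_simps)
      also have "\<dots> = sub Y (mon N' * g)"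
        unfolding g by (simp add: pmon_eq_sub)
      finally show ?thesis using N' g by (intro bexI[of _ "mon N' * g"]) auto
    qed
    then show ?case using N N' by (intro exI[of _ "N + N'"]) (auto simp: exps_add_nat)
  qed (intro exI[of _ 0], auto)
  from this[of J] obtain N where N: "exps N \<subseteq> J" "\<forall>i\<in>J. \<exists>g\<in>polys_in J. pmon Y N * d (Y i) = sub Y g"
    by auto
  then obtain g where g: "\<And>i. i \<in> J \<Longrightarrow> g i \<in> polys_in J \<and> pmon Y N * d (Y i) = sub Y (g i)" by metis
  \<comment> \<open>Enlarging the denominator by the product of all \<open>Y l\<close> makes room
    for the factor \<open>Y i\<close> on the right; \<open>rest i\<close> is what is left of that
    product once \<open>Y i\<close> is split off.\<close>
  define ones where "ones = (\<Sum>i\<in>J. Poly_Mapping.single i (1::nat))"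
  define rest where "rest i = (\<Sum>l\<in>J-{i}. Poly_Mapping.single l (1::nat))" for i
  have ex: "exps (\<Sum>l\<in>B. Poly_Mapping.single l (1::nat)) \<subseteq> B" for B
    using Poly_Mapping.keys_sum[of "\<lambda>l. Poly_Mapping.single l (1::nat)" B] by (auto split: if_splits)
  have "pmon Y (N + ones) * d (Y i) = Y i * sub Y (mon (rest i) * g i)" if i: "i \<in> J" for i
  proof -
    have "ones = Poly_Mapping.single i 1 + rest i"
      unfolding ones_def rest_def using i by (subst sum.remove[of J i]) auto
    then have "pmon Y (N + ones) * d (Y i) = Y i * (pmon Y (rest i) * (pmon Y N * d (Y i)))"
      by (simp add: pmon_add ac_simps)
    also have "\<dots> = Y i * sub Y (mon (rest i) * g i)"
      using g[OF i] by (simp add: pmon_eq_sub)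
    finally show ?thesis .
  qed
  moreover have "exps (N + ones) \<subseteq> J" using N ex[of J] by (auto simp: exps_add_nat ones_def)
  moreover have "mon (rest i) * g i \<in> polys_in J" if "i \<in> J" for i
  proof -
    have "exps (rest i) \<subseteq> J" using ex[of "J - {i}"] unfolding rest_def by blast
    then show ?thesis using g[OF that] by simp
  qed
  ultimately show ?thesis
    by (intro exI[of _ "N + ones"] exI[of _ "\<lambda>i. mon (rest i) * g i"] conjI ballI)
qed

text \<open>Write \<open>d (Y i)\<close> = \<open>Y i\<close> g_i / v with g_i a polynomial in the Y
  and v a monomial. The goal is u with numerator G such that U_i(m) G(m) = g_i(m) for all
  \<open>i\<close> and all monomials m. The Jacobi identity makes the g_i compatible: U_i(m) g_j(m)
  = U_j(m) g_i(m). The weight of \<open>x k\<close> gives the sum over l of (m_l - N_l) U_l(m) the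
  value \<open>lamk\<close>, which is nonzero, so the system can be solved by a weighted average of
  the g_l.\<close>

lemma rel_exists: "\<exists>u N. exps N \<subseteq> J \<and> rel u (pmon Y N)"
proof -
  obtain N g where N: "exps N \<subseteq> J"
    and g: "\<And>i. i \<in> J \<Longrightarrow> g i \<in> polys_in J" "\<And>i. i \<in> J \<Longrightarrow> pmon Y N * d (Y i) = Y i * sub Y (g i)"
    using common_denominator by blast
  define v where "v = pmon Y N"
  \<comment> \<open>The scalar by which a -> \<open>Y i\<close> times a under (twist minus bracket)
    acts: for a Laurent monomial w = Y^m / Y^N one has w (h . \<open>Y i\<close>) - {w,
    \<open>Y i\<close>} = U_i(m) \<open>Y i\<close> w.\<close>
  define U where "U i m = s i + wdot (eq i) m - wdot (eq i) N" for i m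
  have vR: "v \<in> R k" "v \<in> A" and v0: "v \<noteq> 0"
    using pmon_in_R[OF N] pmon_nz[OF N] S_A by (auto simp: v_def)
  have brv: "br (Y i) v = Const (wdot (eq i) N) * Y i * v" if "i \<in> J" for i
    unfolding v_def by (rule br_Y_pmon[OF that N])
  have sgv: "sg h v = Const (wdot s N) * v"
    unfolding v_def by (rule sg_pmon_s[OF N])
  note gv = g(2)[folded v_def]
  have weight: "wder s (g i) = Const (wdot s N + lamk) * g i" if i: "i \<in> J" for i
  proof -
    have "sg h (v * d (Y i)) = sg h v * d (Y i) + v * sg h (d (Y i))"
      by (rule drv_mult[OF drv_sg]) (rule UNIV_I)+
    also have "\<dots> = Const (wdot s N + s i + lamk) * (v * d (Y i))"
      unfolding sgv sg_d_Y[OF i] by (simp add: Const_add algebra_simps)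
    finally have "sg h (Y i * sub Y (g i)) = Const (wdot s N + s i + lamk) * (Y i * sub Y (g i))"
      unfolding gv[OF i] .
    moreover have "sg h (Y i * sub Y (g i)) = sg h (Y i) * sub Y (g i) + Y i * sg h (sub Y (g i))"
      by (rule drv_mult[OF drv_sg]) (rule UNIV_I)+
    ultimately have "Y i * sub Y (wder s (g i)) = Y i * sub Y (Const (wdot s N + lamk) * g i)"
      unfolding sg_Y_s[OF i] sg_sub_s[OF g(1)[OF i]] by (simp add: Const_add algebra_simps)
    then have "sub Y (wder s (g i)) = sub Y (Const (wdot s N + lamk) * g i)"
      using Y_nz[OF i] by simp
    then show ?thesis
      by (rule sub_inj[rotated 2]) (use g(1)[OF i] in auto)
  qed
  have brd: "v * br (Y i) (d (Y j)) = Y i * Y j * sub Y (Const (eq i j - wdot (eq i) N) * g j + wder (eq i) (g j))"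
    if i: "i \<in> J" and j: "j \<in> J" for i j
  proof -
    have A: "Y i \<in> A" "Y j \<in> A" "d (Y j) \<in> A" "sub Y (g j) \<in> A"
      using Y_in_A i j d_Y_in sub_in_R[OF g(1)] S_A by auto
    have "br (Y i) (v * d (Y j)) = br (Y i) v * d (Y j) + v * br (Y i) (d (Y j))"
      by (rule br_mult) (use A vR in auto)
    then have "v * br (Y i) (d (Y j)) = br (Y i) (v * d (Y j)) - Const (wdot (eq i) N) * Y i * (v * d (Y j))"
      unfolding brv[OF i] by (simp add: algebra_simps)
    also have "\<dots> = br (Y i) (Y j * sub Y (g j)) - Const (wdot (eq i) N) * Y i * (Y j * sub Y (g j))"
      unfolding gv[OF j] ..
    also have "br (Y i) (Y j * sub Y (g j)) = br (Y i) (Y j) * sub Y (g j) + Y j * br (Y i) (sub Y (g j))"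
      by (rule br_mult) (use A in auto)
    finally show ?thesis
      unfolding br_YY[OF i j] br_Y_sub[OF i g(1)[OF j]] by (simp add: algebra_simps Const_diff)
  qed
  have compat: "U i m * cf (g j) m = U j m * cf (g i) m" if i: "i \<in> J" and j: "j \<in> J" for i j m
  proof -
    define L where "L = Const (eq i j) * (g i + g j)"
    define R' where "R' = Const (s i) * g j - Const (s j) * g i
         - (Const (eq j i - wdot (eq j) N) * g i + wder (eq j) (g i))
         + (Const (eq i j - wdot (eq i) N) * g j + wder (eq i) (g j))"
    have "(Y i * Y j) * sub Y L = Const (eq i j) * ((Y i * sub Y (g i)) * Y j + Y i * (Y j * sub Y (g j)))"
      by (simp add: L_def algebra_simps)
    also have "\<dots> = v * (Const (eq i j) * (d (Y i) * Y j + Y i * d (Y j)))"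
      unfolding gv[OF i, symmetric] gv[OF j, symmetric] by (simp add: algebra_simps)
    also have "\<dots> = v * (Const (s i) * (Y i * d (Y j)) - Const (s j) * (Y j * d (Y i)) - br (Y j) (d (Y i)) + br (Y i) (d (Y j)))"
      unfolding d_Y_compat[OF i j] ..
    also have "\<dots> = Const (s i) * (Y i * (v * d (Y j))) - Const (s j) * (Y j * (v * d (Y i))) - v * br (Y j) (d (Y i)) + v * br (Y i) (d (Y j))"
      by (simp add: algebra_simps)
    also have "\<dots> = (Y i * Y j) * sub Y R'"
      unfolding brd[OF i j] brd[OF j i] gv[OF i] gv[OF j] by (simp add: R'_def algebra_simps)
    finally have "sub Y L = sub Y R'"
      using Y_nz i j by simp
    then have "L = R'"
      by (rule sub_inj[rotated 2]) (use g(1) i j in \<open>auto simp: L_def R'_def\<close>)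
    then have "cf L m = cf R' m" by simp
    then have "eq i j * (cf (g i) m + cf (g j) m) = s i * cf (g j) m - s j * cf (g i) m
         - ((eq j i - wdot (eq j) N) * cf (g i) m + wdot (eq j) m * cf (g i) m)
         + ((eq i j - wdot (eq i) N) * cf (g j) m + wdot (eq i) m * cf (g j) m)"
      by (simp only: L_def R'_def lookup_add lookup_minus cf_Const_mult cf_wder)
    then show ?thesis
      unfolding U_def eq_anti[OF j i] by (simp add: algebra_simps)
  qed
  \<comment> \<open>The weight derivation of the indicator of \<open>l\<close> multiplies the
    coefficient at m by m_l, so G(m) is the sum of (m_l - N_l) g_l(m), divided by
    \<open>lamk\<close>.\<close>
  define G where "G = Const (1 / lamk) *
    (\<Sum>l\<in>J. wder (\<lambda>i. if i = l then 1 else 0) (g l) - Const (of_nat (cf N l)) * g l)"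
  have wind: "wdot (\<lambda>i. if i = l then 1 else 0) m = of_nat (cf m l)" for m l
    unfolding wdot_def by (simp add: if_distrib in_keys_iff cong: if_cong)
  have cfG: "cf G m = (1 / lamk) * (\<Sum>l\<in>J. (of_nat (cf m l) - of_nat (cf N l)) * cf (g l) m)" for m
    unfolding G_def cf_Const_mult lookup_sum lookup_minus cf_wder wind by (simp add: algebra_simps)
  have GJ: "G \<in> polys_in J"
    unfolding G_def by (intro polys_in_mult polys_in_sum polys_in_diff wder_in g(1)) auto
  have exps_G: "\<exists>l\<in>J. m \<in> exps (g l)" if "m \<in> exps G" for m
  proof (rule ccontr)
    assume "\<not> ?thesis"
    then have "cf (g l) m = 0" if "l \<in> J" for l using that by (auto simp: in_keys_iff)
    then have "cf G m = 0" unfolding cfG by simp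
    then show False using \<open>m \<in> exps G\<close> by (simp add: in_keys_iff)
  qed
  have wm: "wdot s m = wdot s N + lamk" if "l \<in> J" "m \<in> exps (g l)" for l m
    using weight[OF that(1)] that(2) unfolding wder_eigen_iff by blast
  have UG: "U j m * cf G m = cf (g j) m" if j: "j \<in> J" for j m
  proof -
    define f where "f l = (of_nat (cf m l) - of_nat (cf N l) :: 'a)" for l
    have "U j m * cf G m = (1 / lamk) * (\<Sum>l\<in>J. f l * (U j m * cf (g l) m))"
      unfolding cfG f_def by (simp add: sum_distrib_left ac_simps)
    also have "\<dots> = (1 / lamk) * (\<Sum>l\<in>J. f l * (U l m * cf (g j) m))"
      using compat[OF j] by (metis (mono_tags, lifting) sum.cong)
    also have "\<dots> = (1 / lamk) * (\<Sum>l\<in>J. f l * U l m) * cf (g j) m"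
      by (simp add: sum_distrib_left ac_simps)
    also have "\<dots> = cf (g j) m"
    proof (cases "m \<in> exps (g j)")
      case True
      have mJ: "exps m \<subseteq> J" using True g(1)[OF j] by (auto simp: polys_in_def)
      have wd: "wdot \<phi> m - wdot \<phi> N = (\<Sum>j\<in>J. f j * \<phi> j)" for \<phi>
        using mJ N by (simp add: wdot_superset[of J] f_def left_diff_distrib sum_subtractf)
      have "(\<Sum>l\<in>J. f l * U l m) = (\<Sum>l\<in>J. f l * s l) + (\<Sum>l\<in>J. f l * (wdot (eq l) m - wdot (eq l) N))"
        by (simp add: U_def algebra_simps sum.distrib sum_subtractf)
      also have "(\<Sum>l\<in>J. f l * s l) = lamk"
        using wd[of s] wm[OF j True] by simp
      \<comment> \<open>This is the value at m - N of the quadratic form of the antisymmetric matrix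
        \<open>eq\<close>.\<close>
      also have "(\<Sum>l\<in>J. f l * (wdot (eq l) m - wdot (eq l) N)) = 0"
      proof -
        define T where "T = (\<Sum>l\<in>J. \<Sum>p\<in>J. f l * (f p * eq l p))"
        have "T = (\<Sum>p\<in>J. \<Sum>l\<in>J. f l * (f p * eq l p))"
          unfolding T_def by (rule sum.swap)
        also have "\<dots> = (\<Sum>p\<in>J. \<Sum>l\<in>J. - (f p * (f l * eq p l)))"
        proof (intro sum.cong refl)
          fix p l assume "p \<in> J" "l \<in> J"
          then show "f l * (f p * eq l p) = - (f p * (f l * eq p l))"
            using eq_anti[of l p] by simp
        qed
        also have "\<dots> = - T"
          unfolding T_def by (simp add: sum_negf)
        finally have "T = 0" by (simp add: eq_neg_iff_add_eq_0 flip: mult_2)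
        then show ?thesis unfolding wd T_def by (simp add: sum_distrib_left)
      qed
      finally show ?thesis using lam_neq_0[OF kn] by simp
    qed (simp add: in_keys_iff)
    finally show ?thesis .
  qed
  define u where "u = sub Y G"
  have uR: "u \<in> R k" "u \<in> A" using sub_in_R[OF GJ] S_A by (auto simp: u_def)
  have gG: "g j = Const (s j - wdot (eq j) N) * G + wder (eq j) G" if "j \<in> J" for j
    by (rule poly_mapping_eqI)
      (simp only: lookup_add cf_Const_mult cf_wder UG[OF that, symmetric] U_def, simp add: algebra_simps)
  have bru: "br (Y j) u = Y j * sub Y (wder (eq j) G)" if "j \<in> J" for j
    unfolding u_def by (rule br_Y_sub[OF that GJ])
  have "v * v * d a = u * v * sg h a - v * br u a + u * br v a" if a: "a \<in> R k" for a
  proof (rule drv_eq_Y[OF _ _ _ a])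
    show "drv (R k) (\<lambda>a. v * v * d a)"
      by (rule drv_times[OF drv_dl[OF kn]])
    have "drv (R k) (\<lambda>a. (u * v * sg h a + (- v) * br u a) + u * br v a)"
      by (intro drv_plus drv_times drv_sg drv_subset[OF drv_br S_A] uR vR)
    then show "drv (R k) (\<lambda>a. u * v * sg h a - v * br u a + u * br v a)"
      by simp
    fix j assume j: "j \<in> J"
    have "v * v * d (Y j) = v * (Y j * sub Y (g j))"
      using gv[OF j] by (simp add: mult.assoc)
    also have "\<dots> = v * (Const (s j - wdot (eq j) N) * Y j * u + br (Y j) u)"
      unfolding gG[OF j] bru[OF j] by (simp add: u_def algebra_simps)
    also have "\<dots> = u * v * sg h (Y j) - v * (- br (Y j) u) + u * (- br (Y j) v)"
      unfolding sg_Y_s[OF j] brv[OF j] by (simp add: algebra_simps Const_diff)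
    also have "- br (Y j) u = br u (Y j)" by (rule br_anti[symmetric]) (use uR Y_in_A j in auto)
    also have "- br (Y j) v = br v (Y j)" by (rule br_anti[symmetric]) (use vR Y_in_A j in auto)
    finally show "v * v * d (Y j) = u * v * sg h (Y j) - v * br u (Y j) + u * br v (Y j)" .
  qed
  moreover have "sg h u = Const (wdot s N + lamk) * u"
  proof -
    have "wder s G = Const (wdot s N + lamk) * G"
      unfolding wder_eigen_iff using exps_G wm by blast
    then show ?thesis unfolding u_def sg_sub_s[OF GJ] by simp
  qed
  then have "sg h u * v - u * sg h v = Const lamk * u * v"
    unfolding sgv by (simp add: Const_add algebra_simps)
  ultimately have "rel u v"
    using uR vR v0 unfolding rel_def by blast
  then show ?thesis using N unfolding v_def by blast
qed

end

context cgl_step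
begin

lemma rel_cancel:
  assumes r: "rel (y * u) (y * v)" and y: "y \<in> R k" "y \<noteq> 0" and u: "u \<in> R k" and v: "v \<in> R k"
  shows "rel u v"
proof -
  have A: "y \<in> A" "u \<in> A" "v \<in> A" using y u v S_A by auto
  have v0: "v \<noteq> 0" using r by (auto simp: rel_def)
  have sgm: "sg h (y * b) = sg h y * b + y * sg h b" for b
    by (rule drv_mult[OF drv_sg]) (rule UNIV_I)+
  have "(y * y) * (sg h u * v - u * sg h v) = sg h (y * u) * (y * v) - (y * u) * sg h (y * v)"
    unfolding sgm by (simp add: algebra_simps)
  also have "\<dots> = (y * y) * (Const lamk * u * v)"
    using r by (simp add: rel_def algebra_simps)
  finally have "sg h u * v - u * sg h v = Const lamk * u * v" using y by simp
  moreover have "v * v * d a = u * v * sg h a - v * br u a + u * br v a" if a: "a \<in> R k" for a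
  proof -
    have aA: "a \<in> A" using a S_A by auto
    have "(y * y) * (v * v * d a) = (y * v) * (y * v) * d a" by (simp add: ac_simps)
    also have "\<dots> = (y * u) * (y * v) * sg h a - (y * v) * br (y * u) a + (y * u) * br (y * v) a"
      using r a by (simp add: rel_def)
    also have "\<dots> = (y * y) * (u * v * sg h a - v * br u a + u * br v a)"
      using A aA by (simp add: br_mult_left algebra_simps)
    finally show ?thesis using y by simp
  qed
  ultimately show ?thesis using u v v0 by (simp add: rel_def)
qed

text \<open>Lowest terms: a denominator of least total degree admits no further cancellation by
  \<open>rel_cancel\<close>.\<close>

lemma rel_coprime_exists:
  "\<exists>u N. exps N \<subseteq> J \<and> rel u (pmon Y N) \<and> (\<forall>i\<in>exps N. \<not> Y i dvd u)"
proof -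
  define P where "P = (\<lambda>(u, N). exps N \<subseteq> J \<and> rel u (pmon Y N))"
  define size where "size = (\<lambda>(u :: 'a mpoly, N :: nat \<Rightarrow>\<^sub>0 nat). \<Sum>i\<in>J. cf N i)"
  obtain t0 where "P t0" using rel_exists by (auto simp: P_def)
  then obtain t where t: "P t" "\<And>t'. P t' \<Longrightarrow> size t \<le> size t'"
    using ex_has_least_nat[of P t0 size] by blast
  obtain u N where uN: "t = (u, N)" by (cases t)
  have N: "exps N \<subseteq> J" and r: "rel u (pmon Y N)" using t(1) by (auto simp: P_def uN)
  have "\<not> Y i dvd u" if i: "i \<in> exps N" for i
  proof
    assume "Y i dvd u"
    then obtain u' where u': "u = Y i * u'" ..
    define N' where "N' = N - Poly_Mapping.single i 1"
    have NN: "N = N' + Poly_Mapping.single i 1"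
      using i by (intro poly_mapping_eqI)
        (auto simp: N'_def lookup_add lookup_minus lookup_single when_def in_keys_iff)
    have iJ: "i \<in> J" using i N by auto
    have N'J: "exps N' \<subseteq> J" using N NN by (auto simp: exps_add_nat)
    have "u' \<in> R k"
      using quotient_in_polys_in[of "Y i" "var C ` J" u u'] u' r Y_in[OF iJ] Y_nz[OF iJ]
      by (simp add: rel_def R_eq)
    then have "rel u' (pmon Y N')"
      using rel_cancel[of "Y i" u' "pmon Y N'"] r u' Y_in[OF iJ] Y_nz[OF iJ] pmon_in_R[OF N'J]
      by (simp add: NN pmon_add mult.commute)
    then have "size t \<le> size (u', N')"
      using t(2) N'J by (simp add: P_def)
    moreover have "size (u', N') < size t"
      unfolding size_def uN using iJ
      by (simp add: NN lookup_add sum.distrib lookup_single when_def)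
    ultimately show False by simp
  qed
  then show ?thesis using N r by blast
qed

text \<open>With u/v in lowest terms, the relation evaluated at u and at v gives v d(u) - u d(v) =
  \<open>lamk\<close> u^2. Coprimality makes v divide d(v) + \<open>lamk\<close> u, hence u divides
  d(u), hence d(u) = 0 by local nilpotency; then d(v) = -\<open>lamk\<close> u and d(d(v)) = 0. So
  exactly one prime factor Y_p of v is moved by d, and d kills the cofactor. Any prime in the
  cofactor would divide d(v), hence u, against coprimality; so v = Y_p.\<close>

lemma predecessor_exists:
  assumes nz: "\<exists>a\<in>R k. d a \<noteq> 0"
  shows "\<exists>p\<in>J. (\<forall>a\<in>R k. Y p dvd br (Y p) a) \<and> d (Y p) \<noteq> 0 \<and> \<not> Y p dvd d (Y p) \<and>
    d (d (Y p)) = 0 \<and> rel (- (Const (1 / lamk) * d (Y p))) (Y p)"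
proof -
  interpret L: lnd "var C ` J" "R k" d by (rule lnd_dl[OF kn])
  obtain u N where N: "exps N \<subseteq> J" and r: "rel u (pmon Y N)" and cop: "\<And>i. i \<in> exps N \<Longrightarrow> \<not> Y i dvd u"
    using rel_coprime_exists by blast
  define v where "v = pmon Y N"
  have uR: "u \<in> R k" and vR: "v \<in> R k" and v0: "v \<noteq> 0" and wt: "sg h u * v - u * sg h v = Const lamk * u * v"
    and rl: "\<And>a. a \<in> R k \<Longrightarrow> v * v * d a = u * v * sg h a - v * br u a + u * br v a"
    using r by (auto simp: rel_def v_def)
  have A: "u \<in> A" "v \<in> A" using uR vR S_A by auto
  have u0: "u \<noteq> 0"
  proof
    assume u: "u = 0"
    obtain a where a: "a \<in> R k" "d a \<noteq> 0" using nz by blast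
    have "br 0 a = 0" using br_Const_left[of a 0] a S_A by auto
    then show False using rl[OF a(1)] a(2) v0 u by simp
  qed
  have pN: "prime_elem (Y i)" if "i \<in> exps N" for i
    using Y_prime N that by auto
  have dvd: "v dvd b" if "v dvd u * b" for b
    unfolding v_def by (rule prime_product_dvd[OF pN cop that[unfolded v_def]])
  have vn: "v dvd br v a" if a: "a \<in> R k" for a
  proof (rule dvd)
    have "u * br v a = v * (v * d a - u * sg h a + br u a)"
      using rl[OF a] by (simp add: algebra_simps)
    then show "v dvd u * br v a" by simp
  qed
  have "(v * v) * (v * d u - u * d v) = v * (v * v * d u) - u * (v * v * d v)"
    by (simp add: algebra_simps)
  also have "\<dots> = (v * v) * (Const lamk * u * u)"
  proof -
    have "v * (v * v * d u) - u * (v * v * d v)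
        = v * u * (sg h u * v - u * sg h v) + v * u * (br v u + br u v)"
      unfolding rl[OF uR] rl[OF vR] by (simp add: br_self A algebra_simps)
    also have "br v u + br u v = 0" using br_anti[OF A] by simp
    finally show ?thesis unfolding wt by (simp add: ac_simps)
  qed
  finally have uv: "v * d u - u * d v = Const lamk * u * u" using v0 by simp
  then have uv': "u * (d v + Const lamk * u) = v * d u" by (simp add: algebra_simps)
  have "v dvd u * (d v + Const lamk * u)" unfolding uv' by (rule dvd_triv_left)
  then have "v dvd d v + Const lamk * u" by (rule dvd)
  then obtain w where w: "d v + Const lamk * u = v * w" ..
  have "v * d u = v * (u * w)" unfolding uv'[symmetric] w by (simp add: ac_simps)
  then have "u dvd d u" using v0 by simp
  then have du: "d u = 0" by (rule L.dvd_image_imp_0[OF uR])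
  then have dv: "d v = - (Const lamk * u)"
  proof -
    have "u * (d v + Const lamk * u) = 0" unfolding uv' du by simp
    then show ?thesis using u0 by (simp add: eq_neg_iff_add_eq_0)
  qed
  have lk: "lamk \<noteq> 0" using lam_neq_0[OF kn] .
  have dvnz: "d v \<noteq> 0" unfolding dv using u0 lk by simp
  have ddv: "d (d v) = 0"
    unfolding dv using drv_uminus[OF R_eq drv_dl[OF kn], of "Const lamk * u"]
      drv_scale[OF drv_dl[OF kn] uR] uR du by simp
  have "\<exists>p\<in>exps N. d (Y p) \<noteq> 0"
  proof (rule ccontr)
    assume "\<not> ?thesis"
    then have "d v = 0"
      unfolding v_def using drv_pmon[OF R_eq drv_dl[OF kn], of N Y "\<lambda>_. 0" 0] Y_in N by (simp add: subset_iff)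
    then show False using dvnz by simp
  qed
  then obtain p where p: "p \<in> exps N" "d (Y p) \<noteq> 0" by blast
  have pJ: "p \<in> J" using p N by auto
  define N' where "N' = N - Poly_Mapping.single p 1"
  have NN: "N = N' + Poly_Mapping.single p 1"
    using p by (intro poly_mapping_eqI)
      (auto simp: N'_def lookup_add lookup_minus lookup_single when_def in_keys_iff)
  have N'J: "exps N' \<subseteq> J" using N NN by (auto simp: exps_add_nat)
  define v' where "v' = pmon Y N'"
  have v'R: "v' \<in> R k" and v'0: "v' \<noteq> 0" using pmon_in_R[OF N'J] pmon_nz[OF N'J] by (auto simp: v'_def)
  have vv: "v = Y p * v'" by (simp add: v_def v'_def NN pmon_add mult.commute)
  have dv': "d v' = 0" and ddY: "d (d (Y p)) = 0"
    using L.square_kernel_mult[OF Y_in[OF pJ] v'R _ p(2) v'0] ddv vv by auto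
  have "N' = 0"
  proof (rule ccontr)
    assume "N' \<noteq> 0"
    then obtain l where l: "l \<in> exps N'" by (metis keys_eq_empty ex_in_conv)
    then have "Y l dvd v'"
      unfolding v'_def pmon_def by (intro dvd_trans[OF _ dvd_prodI[OF finite_keys l]]) (simp add: in_keys_iff dvd_power)
    moreover have "d v = d (Y p) * v' + Y p * d v'"
      unfolding vv by (rule drv_mult[OF drv_dl[OF kn] Y_in[OF pJ] v'R])
    ultimately have "Y l dvd d v" using dv' by simp
    then have "Y l dvd Const lamk * u" unfolding dv by simp
    then have "Y l dvd Const (1 / lamk) * (Const lamk * u)" by (rule dvd_mult)
    then have "Y l dvd u" using lk by (simp flip: mult.assoc Const_mult)
    moreover have "l \<in> exps N" using l NN by (auto simp: exps_add_nat)
    ultimately show False using cop by blast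
  qed
  then have v: "v = Y p" by (simp add: vv v'_def)
  have u: "u = - (Const (1 / lamk) * d (Y p))"
    unfolding v[symmetric] dv using lk by (simp flip: mult.assoc Const_mult)
  have nd: "\<not> Y p dvd d (Y p)"
  proof
    assume "Y p dvd d (Y p)"
    then have "Y p dvd u" unfolding u by simp
    then show False using cop p by blast
  qed
  have "rel u v" using r by (simp only: v_def)
  then have "rel (- (Const (1 / lamk) * d (Y p))) (Y p)"
    unfolding v by (subst (asm) u)
  moreover have "\<forall>a\<in>R k. Y p dvd br (Y p) a"
    using vn unfolding v by blast
  ultimately show ?thesis
    using p(2) nd ddY by (intro bexI[OF _ pJ] conjI)
qed

text \<open>At a = \<open>y\<close>, every term on the right of the relation is divisible by
  \<open>y\<close>, since \<open>y\<close> is a weight vector and a Poisson prime. So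
  \<open>y\<close> divides v^2 d(y); if it does not divide v, it divides d(y), which then vanishes
  by \<open>dvd_image_imp_0\<close>.\<close>

lemma hpp_dvd:
  assumes r: "rel u v" and y: "hpp (R k) y" "d y \<noteq> 0"
  shows "y dvd v"
proof (rule ccontr)
  interpret L: lnd "var C ` J" "R k" d by (rule lnd_dl[OF kn])
  assume nd: "\<not> y dvd v"
  note yy = hppD[OF k(2) y(1)]
  have A: "u \<in> A" "v \<in> A" "y \<in> A" and R: "u \<in> R k" "v \<in> R k" using r yy(1) S_A by (auto simp: rel_def)
  have dd: "dvd_on (R k) y b \<longleftrightarrow> y dvd b" if "b \<in> R k" for b
    using dvd_on_polys_in[of y "var C ` J" b] that yy(1) by (simp add: R_eq)
  obtain w where "wv w y" using yy(2) by blast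
  then have "y dvd sg h y" using sg_wv[OF A(3)] by simp
  moreover have "y dvd br u y" "y dvd br v y"
    using yy(3)[OF R(1)] yy(3)[OF R(2)] br_anti[OF A(1,3)] br_anti[OF A(2,3)] by simp_all
  ultimately have "y dvd u * v * sg h y - v * br u y + u * br v y"
    by (intro dvd_add dvd_diff dvd_mult)
  then have "y dvd v * (v * d y)"
    using r yy(1) by (simp add: rel_def mult.assoc)
  moreover have dR: "d y \<in> R k" "v * d y \<in> R k" using L.into[OF yy(1)] R by auto
  ultimately have "y dvd d y"
    using y(1) nd R dd unfolding homogeneous_poisson_prime_def prime_elem_on_def
    by (metis subalg_ring(6))
  then have "d y = 0" by (rule L.dvd_image_imp_0[OF yy(1)])
  then show False using y(2) by simp
qed

lemma Y_not_dvd: "i < j \<Longrightarrow> i \<in> J \<Longrightarrow> j \<in> J \<Longrightarrow> \<not> Y j dvd Y i"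
proof
  assume ij: "i < j" "i \<in> J" "j \<in> J" and "Y j dvd Y i"
  then obtain g where g: "Y i = (Yp j * Var (var C j) + Yr j) * g"
    using YE[OF ij(3)] by (auto simp: gen_def)
  have "Y i \<in> R j" using Y_in_Suc[OF ij(2)] R_mono[of "Suc i" j] ij by auto
  then have "g = 0"
    using linear_mult_free_imp_0[of "Yp j" "var C j" "Yr j" g] R_free[OF J_idx[OF ij(3)]]
      Yp_in[OF ij(3)] Yp_nz[OF ij(3)] Yr_in[OF ij(3)] g by auto
  then show False using g Y_nz[OF ij(2)] by simp
qed

text \<open>The candidate from \<open>predecessor_exists\<close> is the only one: any other divides
  it by \<open>hpp_dvd\<close>, and mutually divisible \<open>Y i\<close> have equal indices by
  \<open>Y_not_dvd\<close>. The bracket rule for \<open>Y k\<close> is the relation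
  \<open>rel\<close> multiplied out.\<close>

lemma stp_k: "stp k"
proof (cases "\<forall>a\<in>R k. d a = 0")
  case True
  then have p: "pred C k = None" by (simp add: pred_def pred_from_def)
  have "Yp k * br (Y k) a = Y k * (br (Yp k) a + Yp k * sg h a)" if a: "a \<in> R k" for a
  proof -
    have "Y k = x k" using Y_eq[OF k(1)] p by (simp add: Yp_def Yr_def)
    then show ?thesis
      using br_gen[OF kn a] True a p br_1_left[of a] S_A by (auto simp: Yp_def)
  qed
  then show ?thesis using True p by (simp add: stp_def)
next
  case False
  then obtain p where p: "p \<in> J" "\<And>a. a \<in> R k \<Longrightarrow> Y p dvd br (Y p) a" "d (Y p) \<noteq> 0"
    "\<not> Y p dvd d (Y p)" "d (d (Y p)) = 0" and r: "rel (- (Const (1 / lamk) * d (Y p))) (Y p)"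
    using predecessor_exists by blast
  have hp: "hpp (R k) (Y p)"
    by (rule hppI[OF k(2) Y_prime[OF p(1)] Y_in[OF p(1)] wv_Y[OF p(1)] p(2)])
  have uq: "p' = p" if "p' \<in> J" "hpp (R k) (Y p')" "d (Y p') \<noteq> 0" for p'
  proof -
    have "Y p' dvd Y p" using hpp_dvd[OF r] that by blast
    moreover from this have "Y p dvd Y p'"
      using prime_elem_dvd_prime_elem Y_prime p(1) that(1) by blast
    ultimately show ?thesis
      using Y_not_dvd[of p p'] Y_not_dvd[of p' p] p(1) that(1) by (metis linorder_neqE_nat)
  qed
  have "(THE p. p \<in> J \<and> hpp (R k) (Y p) \<and> d (Y p) \<noteq> 0) = p"
  proof (rule the_equality)
    show "p \<in> J \<and> hpp (R k) (Y p) \<and> d (Y p) \<noteq> 0"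
      using p(1,3) hp by blast
  qed (use uq in blast)
  then have pr: "pred C k = Some p"
    using False by (simp add: pred_def pred_from_def)
  have Yp: "Yp k = Y p" and Yr: "Yr k = - (Const (1 / lamk) * d (Y p))"
    by (simp_all add: Yp_def Yr_def pr)
  have Yk: "Y k = Y p * x k + Yr k" using Y_eq[OF k(1)] pr p(1) Yp by simp
  have A: "Y p \<in> A" "Yr k \<in> A" using Y_in_A[OF p(1)] r S_A by (auto simp: Yr rel_def)
  have "Y p * br (Y k) a = Y k * (br (Y p) a + Y p * sg h a)" if a: "a \<in> R k" for a
  proof -
    have aA: "a \<in> A" using a S_A by auto
    have "Y p * br (Y k) a
        = Y p * br (Y p) a * x k + Y p * Y p * sg h a * x k + (Y p * Y p * d a + Y p * br (Yr k) a)"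
      unfolding Yk using A aA x_A br_gen[OF kn a]
      by (simp add: br_add_left br_mult_left algebra_simps)
    also have "Y p * Y p * d a + Y p * br (Yr k) a = Yr k * Y p * sg h a + Yr k * br (Y p) a"
      using r a by (simp add: rel_def Yr[symmetric])
    finally show ?thesis unfolding Yk by (simp add: algebra_simps)
  qed
  then show ?thesis
    unfolding stp_def pr option.case Yp using p(1,3-5) hp hpp_dvd[OF r] by blast
qed

end

context cgl
begin

lemma stp: "j \<in> idx C \<Longrightarrow> stp j"
proof (induct j rule: less_induct)
  case (less j)
  interpret cgl_step C j
    by unfold_locales (use less in auto)
  show ?case by (rule stp_k)
qed

lemma stage: "cgl_stage C (Suc (len C))"
  by unfold_locales (use stp in auto)

end

section \<open>Symmetric extensions: both one-sided derivations of a generator, and nilpotency on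
  either side\<close>

section \<open>Re-orderings\<close>

sublocale cgl \<subseteq> F: cgl_stage C "Suc (len C)"
  by (rule stage)

context cgl
begin

lemma normal_subalg:
  assumes y: "y \<in> A" and K: "K \<subseteq> idx C" and g: "\<And>l. l \<in> K \<Longrightarrow> y dvd br y (x l)" and a: "a \<in> subalg C K"
  shows "y dvd br y a"
proof -
  have KA: "polys_in (var C ` K) \<subseteq> A"
    using subalg_mono[OF K] by (simp add: subalg_def)
  show ?thesis
    using a unfolding subalg_def
  proof (induct rule: polys_in_induct)
    case (Const c)
    then show ?case using br_Const[OF y] by simp
  next
    case (add f g)
    then have "f \<in> A" "g \<in> A" using KA by blast+
    then show ?case using br_add[OF y, of f g] add by simp
  next
    case (Var f i)
    then obtain l where l: "l \<in> K" "Var i = x l" by (auto simp: gen_def)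
    have "f \<in> A" "x l \<in> A" using Var KA l K by auto
    then show ?case using br_mult[OF y, of f "x l"] g[OF l(1)] Var l by (auto intro: dvd_add)
  qed
qed

lemma subalg_free: "v \<in> idx C \<Longrightarrow> v \<notin> K \<Longrightarrow> K \<subseteq> idx C \<Longrightarrow> subalg C K \<subseteq> polys_in (- {var C v})"
proof -
  assume v: "v \<in> idx C" "v \<notin> K" "K \<subseteq> idx C"
  have "var C v \<notin> var C ` K"
  proof
    assume "var C v \<in> var C ` K"
    then obtain i where "i \<in> K" "var C v = var C i" by auto
    then show False using inj_onD[OF var_inj, of v i] v by auto
  qed
  then show ?thesis
    unfolding subalg_def by (intro polys_in_mono) auto
qed

lemma linear_not_dvd:
  assumes "v \<in> idx C" "v \<notin> K" "K \<subseteq> idx C" and p: "p \<in> subalg C K" "p \<noteq> 0" and q: "q \<in> subalg C K"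
    and a: "a \<in> subalg C K" "a \<noteq> 0"
  shows "\<not> p * x v + q dvd a"
proof
  assume "p * x v + q dvd a"
  then obtain g where g: "a = (p * Var (var C v) + q) * g" by (auto simp: gen_def)
  note f = subalg_free[OF assms(1-3)]
  have "g = 0"
    using linear_mult_free_imp_0[of p "var C v" q g] f p q a g by auto
  then show False using g a by simp
qed

lemma x_not_dvd:
  assumes "v \<in> idx C" "v \<notin> K" "K \<subseteq> idx C" "a \<in> subalg C K" "a \<noteq> 0"
  shows "\<not> x v dvd a"
  using linear_not_dvd[OF assms(1-3), of 1 0 a] assms(4,5) by simp

lemma x_prime: "prime_elem (x v)"
  using prime_elem_linear[of 1 "var C v" 0] by (simp add: gen_def)

text \<open>The chosen predecessor is divisible by every Poisson prime that the derivation moves;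
  mutual divisibility pins down the index.\<close>

lemma pred_eqI:
  assumes k: "k \<in> idx C" and j: "j \<in> {1..<k}" and h: "hpp (R k) (Y j)" "dl k (Y j) \<noteq> 0"
  shows "pred C k = Some j"
proof (cases "pred C k")
  case None
  have "Y j \<in> R k" using hppD(1)[OF _ h(1)] k by auto
  then show ?thesis using F.pred_NoneD[OF _ None, of "Y j"] k h(2) by auto
next
  case (Some p)
  have kJ: "k \<in> {1..<Suc (len C)}" using k by auto
  interpret K: cgl_step C k
    by unfold_locales (use k stp in auto)
  note p = F.pred_SomeD(1)[OF kJ Some]
  have "Y j dvd Y p" by (rule F.pred_SomeD(7)[OF kJ Some h])
  moreover from this have "Y p dvd Y j"
    using prime_elem_dvd_prime_elem K.Y_prime p j by blast
  ultimately have "p = j"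
    using K.Y_not_dvd[of p j] K.Y_not_dvd[of j p] p j by (metis linorder_neqE_nat)
  then show ?thesis using Some by simp
qed

end

locale sym =
  fixes C :: "('k::field_char_0, 'r::finite) cgl" and hs :: "nat \<Rightarrow> 'k ^ 'r"
  assumes symm: "symmetric_cgl_extension C hs"

sublocale sym \<subseteq> cgl C
  using symm by unfold_locales (simp add: symmetric_cgl_extension_def)

context sym
begin

abbreviation "n \<equiv> len C"

lemma hs_nz: "j \<in> idx C \<Longrightarrow> char_diff (wt C j) (hs j) \<noteq> 0"
  and sym_wt: "j \<in> idx C \<Longrightarrow> i \<in> {1..<j} \<Longrightarrow> char_diff (wt C i) (lie C j) = - char_diff (wt C j) (hs i)"
  and sym_dl: "j \<in> idx C \<Longrightarrow> i \<in> {1..<j} \<Longrightarrow> dl j (x i) \<in> subalg C {i<..<j}"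
  using symm unfolding symmetric_cgl_extension_def by blast+

definition D :: "'k ^ 'r \<Rightarrow> nat \<Rightarrow> 'k mpoly \<Rightarrow> 'k mpoly" where
  "D h v a = br (x v) a - sg h a * x v"

text \<open>The derivation attached to \<open>x v\<close> on the algebra generated by variables
  on the same side of \<open>v\<close> as \<open>w\<close>.\<close>

definition dd :: "nat \<Rightarrow> nat \<Rightarrow> 'k mpoly \<Rightarrow> 'k mpoly" where
  "dd v w = D (if w < v then lie C v else hs v) v"

lemma drv_D: "v \<in> idx C \<Longrightarrow> drv A (D h v)"
  using drv_plus[OF drv_br drv_times[OF drv_sg, of _ "- x v"], of "x v"]
  by (simp add: D_def[abs_def] mult.commute)

lemma drv_dd: "v \<in> idx C \<Longrightarrow> drv A (dd v w)"
  by (simp add: dd_def drv_D)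

lemma br_x_dd: "br (x v) a = sg (if w < v then lie C v else hs v) a * x v + dd v w a"
  by (simp add: dd_def D_def)

lemma dd_side: "w < v \<longleftrightarrow> w' < v \<Longrightarrow> dd v w = dd v w'"
  by (simp add: dd_def)

lemma dd_eq_dl: "v \<in> idx C \<Longrightarrow> i < v \<Longrightarrow> a \<in> R v \<Longrightarrow> dd v i a = dl v a"
  by (simp add: dd_def D_def dl_eq)

lemma dd_x_below: "v \<in> idx C \<Longrightarrow> i \<in> {1..<v} \<Longrightarrow> dd v i (x i) = dl v (x i)"
  by (rule dd_eq_dl) auto

text \<open>The condition \<open>sym_wt\<close> makes the monomial parts of the bracket seen from
  either variable coincide, so the two correction terms differ only by the antisymmetry of the
  bracket.\<close>

lemma dd_x_swap:
  assumes "v \<in> idx C" "i \<in> idx C" "i \<noteq> v"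
  shows "dd v i (x i) = - dd i v (x v)"
proof -
  have *: "dd v i (x i) = - dd i v (x v)" if "i < v" "v \<in> idx C" "i \<in> idx C" for i v
  proof -
    have A: "x i \<in> A" "x v \<in> A" using that by auto
    show ?thesis
      using that br_anti[OF A] sym_wt[of v i]
      by (simp add: dd_def D_def sg_x Const_minus algebra_simps)
  qed
  show ?thesis
    using *[of i v] *[of v i] assms by (cases "i < v") auto
qed

definition btw :: "nat \<Rightarrow> nat \<Rightarrow> nat set" where
  "btw e v = {min e v<..<max e v}"

lemma btw_commute: "btw e v = btw v e"
  by (simp add: btw_def min.commute max.commute)

lemma btw_idx: "e \<in> idx C \<Longrightarrow> v \<in> idx C \<Longrightarrow> btw e v \<subseteq> idx C"
  by (auto simp: btw_def)

lemma btw_notin: "e \<notin> btw e v" "v \<notin> btw e v"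
  by (auto simp: btw_def)

lemma btw_side: "l \<in> btw e v \<Longrightarrow> l < v \<longleftrightarrow> e < v"
  by (auto simp: btw_def min_def max_def split: if_splits)

lemma dd_x_in:
  assumes "v \<in> idx C" "i \<in> idx C" "i \<noteq> v"
  shows "dd v i (x i) \<in> subalg C (btw i v)"
proof (cases "i < v")
  case True
  then show ?thesis
    using sym_dl[of v i] dd_x_below[of v i] assms by (simp add: btw_def)
next
  case False
  then show ?thesis
    using sym_dl[of i v] dd_x_below[of i v] dd_x_swap[OF assms] assms by (simp add: btw_def)
qed

lemma dd_in:
  assumes v: "v \<in> idx C" and K: "K \<subseteq> idx C" "v \<notin> K" and side: "\<And>i. i \<in> K \<Longrightarrow> i < v \<longleftrightarrow> w < v"
    and cl: "\<And>i. i \<in> K \<Longrightarrow> btw i v \<subseteq> K" and a: "a \<in> subalg C K"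
  shows "dd v w a \<in> subalg C K"
  unfolding subalg_def
proof (rule drv_in[OF subalg_def _ _ subset_refl a])
  show "drv (subalg C K) (dd v w)"
    by (rule drv_subset[OF drv_dd[OF v] subalg_mono[OF K(1)]])
  fix i assume "i \<in> var C ` K"
  then obtain l where l: "l \<in> K" "Var i = x l" by (auto simp: gen_def)
  have "dd v w = dd v l" by (rule dd_side) (use side[OF l(1)] in simp)
  then have "dd v w (x l) \<in> subalg C (btw l v)"
    using dd_x_in[OF v, of l] l(1) K by (metis subsetD)
  then show "dd v w (Var i) \<in> polys_in (var C ` K)"
    using subalg_mono[OF cl[OF l(1)]] l by (auto simp: subalg_def)
qed

lemma dd_eq_0:
  assumes v: "v \<in> idx C" and K: "K \<subseteq> idx C" and 0: "\<And>i. i \<in> K \<Longrightarrow> dd v w (x i) = 0" and a: "a \<in> subalg C K"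
  shows "dd v w a = 0"
  by (rule drv_eq_0[OF subalg_def drv_subset[OF drv_dd[OF v] subalg_mono[OF K]] _ a])
     (use 0 in \<open>auto simp: gen_def\<close>)

lemma dd_nilpotent_below:
  assumes v: "v \<in> idx C" "w < v" and a: "a \<in> R v"
  shows "\<exists>m. (dd v w ^^ m) a = 0"
proof -
  have "(dd v w ^^ m) a = (dl v ^^ m) a \<and> (dl v ^^ m) a \<in> R v" for m
    by (induct m) (use v a dd_eq_dl[OF v(1) v(2)] dl_in in auto)
  then show ?thesis
    using lnd.nil[OF lnd_dl[OF v(1)] a] by auto
qed

text \<open>Above \<open>v\<close> nilpotency is derived by induction on the upper end
  \<open>l\<close>: the last variable is mapped into the algebra of variables strictly between,
  where the induction hypothesis applies, and it suffices to check generators.\<close>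

lemma dd_nilpotent_above:
  assumes v: "v \<in> idx C" "\<not> w < v" and "l \<le> n" "a \<in> subalg C {v<..l}"
  shows "\<exists>m. (dd v w ^^ m) a = 0"
  using assms(3,4)
proof (induct l arbitrary: a)
  case 0
  have "dd v w a = 0"
    by (rule dd_eq_0[OF v(1) _ _ 0(2)]) auto
  then show ?case by (intro exI[of _ "Suc 0"]) simp
next
  case (Suc l)
  have sb: "{v<..Suc l} \<subseteq> idx C" using Suc.prems by auto
  have sd: "i < v \<longleftrightarrow> w < v" if "i \<in> {v<..j}" for i j using that v by auto
  have ddin: "dd v w b \<in> subalg C {v<..Suc l}" if "b \<in> subalg C {v<..Suc l}" for b
    by (rule dd_in[OF v(1) sb _ sd _ that]) (auto simp: btw_def)
  show ?case
  proof (rule locally_nilpotentI[OF subalg_def _ ddin _ Suc.prems(2)])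
    show "drv (subalg C {v<..Suc l}) (dd v w)"
      by (rule drv_subset[OF drv_dd[OF v(1)] subalg_mono[OF sb]])
    fix i assume "i \<in> var C ` {v<..Suc l}"
    then obtain j where j: "j \<in> {v<..Suc l}" "Var i = x j" by (auto simp: gen_def)
    show "\<exists>m. (dd v w ^^ m) (Var i) = 0"
    proof (cases "j = Suc l")
      case False
      then show ?thesis using Suc.hyps[of "x j"] Suc.prems j by auto
    next
      case True
      have "dd v w = dd v j" by (rule dd_side) (use sd[OF j(1)] in simp)
      then have "dd v w (x j) \<in> subalg C (btw j v)"
        using dd_x_in[OF v(1), of j] j(1) sb by auto
      moreover have "btw j v \<subseteq> {v<..l}" using True j by (auto simp: btw_def)
      ultimately obtain m where "(dd v w ^^ m) (dd v w (x j)) = 0"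
        using Suc.hyps[of "dd v w (x j)"] Suc.prems subalg_mono by (meson Suc_leD subsetD)
      then have "(dd v w ^^ Suc m) (x j) = 0"
        by (simp only: funpow_Suc_right comp_apply)
      then show ?thesis unfolding j(2) by blast
    qed
  qed
qed

end

section \<open>Interval orders, and the extensions they define\<close>

subsection \<open>Permutations whose initial segments are intervals\<close>

lemma Xi_interval:
  assumes "\<tau> \<in> Xi n" "m \<le> Suc n"
  shows "\<exists>a b. \<tau> ` {1..<m} = {a..b}"
proof (cases "m \<le> 1")
  case True
  then have "\<tau> ` {1..<m} = {1..0}" by auto
  then show ?thesis by blast
next
  case False
  then have "{1..<m} = {1..m - 1}" "m - 1 \<in> {1..n}" using assms by auto
  then show ?thesis using assms(1) by (auto simp: Xi_def)
qed

lemma Xi_permutes: "\<tau> \<in> Xi n \<Longrightarrow> \<tau> permutes {1..n}"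
  by (simp add: Xi_def)

lemma Xi_inj: "\<tau> \<in> Xi n \<Longrightarrow> inj \<tau>"
  using Xi_permutes permutes_inj by blast

text \<open>The earlier indices form an interval that misses \<open>\<tau> m\<close>, hence lie on
  one side of it. So a single one-sided derivation of \<open>x (\<tau> m)\<close> serves all of
  them.\<close>

lemma Xi_side:
  assumes t: "\<tau> \<in> Xi n" and m: "m \<le> n" "i \<in> {1..<m}" "j \<in> {1..<m}"
  shows "\<tau> i < \<tau> m \<longleftrightarrow> \<tau> j < \<tau> m"
proof -
  obtain a b where ab: "\<tau> ` {1..<m} = {a..b}" using Xi_interval[OF t, of m] m by auto
  have "\<tau> i \<in> {a..b}" "\<tau> j \<in> {a..b}" using ab m by auto
  moreover have "\<tau> m \<notin> \<tau> ` {1..<m}"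
    using inj_image_mem_iff[OF Xi_inj[OF t]] by simp
  ultimately show ?thesis unfolding ab by auto
qed

text \<open>Initial pieces of length \<open>m\<close> of orders in \<open>Xi n\<close>, so that an
  order can be prescribed at the start and then completed by adding one neighbour at a time.\<close>

definition ordr :: "nat \<Rightarrow> (nat \<Rightarrow> nat) \<Rightarrow> nat \<Rightarrow> bool" where
  "ordr n f m \<longleftrightarrow> inj_on f {1..m} \<and> f ` {1..m} \<subseteq> {1..n} \<and> (\<forall>j\<in>{1..m}. \<exists>a b. f ` {1..j} = {a..b})"

lemma ordr_extend:
  assumes "ordr n f m" "1 \<le> m"
  shows "\<exists>\<tau>\<in>Xi n. \<forall>j\<in>{1..m}. \<tau> j = f j"
  using assms
proof (induct "n - m" arbitrary: f m)
  case 0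
  have inj: "inj_on f {1..m}" and im: "f ` {1..m} \<subseteq> {1..n}" using 0 by (auto simp: ordr_def)
  have "m \<le> n" using card_inj_on_le[OF inj im] by simp
  with 0 have mn: "m = n" by simp
  define \<tau> where "\<tau> j = (if j \<in> {1..n} then f j else j)" for j
  have "f ` {1..n} = {1..n}"
    using endo_inj_surj[of "{1..n}" f] inj im mn by simp
  then have "bij_betw f {1..n} {1..n}" using inj mn by (simp add: bij_betw_def)
  then have bb: "bij_betw \<tau> {1..n} {1..n}"
    by (subst bij_betw_cong[of _ \<tau> f]) (auto simp: \<tau>_def)
  have "\<tau> permutes {1..n}"
    by (rule bij_imp_permutes[OF bb]) (auto simp: \<tau>_def)
  moreover have "\<exists>a b. \<tau> ` {1..j} = {a..b}" if "j \<in> {1..n}" for j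
  proof -
    have "\<tau> ` {1..j} = f ` {1..j}" using that by (intro image_cong) (auto simp: \<tau>_def)
    then show ?thesis using 0(2) that mn by (auto simp: ordr_def)
  qed
  ultimately have "\<tau> \<in> Xi n" by (simp add: Xi_def)
  then show ?case by (rule bexI[rotated]) (auto simp: \<tau>_def mn)
next
  case (Suc d)
  have inj: "inj_on f {1..m}" and im: "f ` {1..m} \<subseteq> {1..n}" using Suc by (auto simp: ordr_def)
  obtain a b where ab: "f ` {1..m} = {a..b}" using Suc.prems by (force simp: ordr_def)
  have c: "Suc b - a = m" using card_image[OF inj] ab by simp
  then have le: "a \<le> b" "1 \<le> a" "b \<le> n" using ab im Suc.prems(2) by auto
  define v where "v = (if b < n then Suc b else a - 1)"
  have v: "v \<notin> {a..b}" "v \<in> {1..n}" "insert v {a..b} = {min v a..max v b}"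
    using le c Suc.hyps(2) by (auto simp: v_def)
  define f' where "f' = f(Suc m := v)"
  have eq: "f' ` {1..j} = f ` {1..j}" if "j \<le> m" for j
    using that by (intro image_cong) (auto simp: f'_def)
  have eqS: "f' ` {1..Suc m} = {min v a..max v b}"
  proof -
    have "f' ` {1..Suc m} = insert (f' (Suc m)) (f' ` {1..m})" by (simp add: atLeastAtMostSuc_conv)
    then show ?thesis using eq[of m] ab v(3) by (simp add: f'_def)
  qed
  have "inj_on f' {1..Suc m}"
  proof -
    have S: "{1..Suc m} = insert (Suc m) {1..m}" by (simp add: atLeastAtMostSuc_conv)
    have "inj_on f' {1..m}" by (subst inj_on_cong[of _ f' f]) (auto simp: f'_def inj)
    moreover have "f' (Suc m) \<notin> f' ` {1..m}" using eq[of m] ab v(1) by (simp add: f'_def)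
    ultimately show ?thesis unfolding S by simp
  qed
  moreover have "f' ` {1..Suc m} \<subseteq> {1..n}" using eqS le v(2) by auto
  moreover have "\<exists>a b. f' ` {1..j} = {a..b}" if "j \<in> {1..Suc m}" for j
    using that eq eqS Suc.prems(1) by (cases "j = Suc m") (auto simp: ordr_def)
  ultimately have "ordr n f' (Suc m)" by (simp add: ordr_def)
  moreover have "d = n - Suc m" using Suc.hyps(2) by simp
  ultimately obtain \<tau> where "\<tau> \<in> Xi n" "\<forall>j\<in>{1..Suc m}. \<tau> j = f' j"
    using Suc.hyps(1)[of "Suc m" f'] by auto
  then show ?case by (intro bexI[of _ \<tau>]) (auto simp: f'_def)
qed

text \<open>An order that runs through the open interval between two indices first.\<close>

lemma Xi_between:
  assumes ev: "e \<in> {1..n}" "v \<in> {1..n}" "e \<noteq> v"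
  defines "u \<equiv> min e v" and "L \<equiv> max e v - min e v - 1"
  shows "\<exists>\<tau>\<in>Xi n. (\<forall>j\<in>{1..L}. \<tau> j = u + j) \<and> \<tau> (L + 1) = e \<and> \<tau> (L + 2) = v"
proof -
  define f where "f j = (if j \<le> L then u + j else if j = L + 1 then e else v)" for j
  define w where "w = max e v"
  have uw: "u < w" "w = u + L + 1" "{e, v} = {u, w}" "1 \<le> u" "w \<le> n"
    using ev by (auto simp: u_def w_def L_def)
  have im: "f ` {1..j} = {u + 1..u + j}" if "j \<le> L" for j
  proof -
    have "f ` {1..j} = (\<lambda>i. i + u) ` {1..j}"
      using that by (intro image_cong) (auto simp: f_def)
    then show ?thesis by (simp add: add.commute)
  qed
  have fe: "f (L + 1) = e" "f (L + 2) = v" by (simp_all add: f_def)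
  have im1: "f ` {1..L + 1} = insert e {u + 1..u + L}"
  proof -
    have "{1..L + 1} = insert (L + 1) {1..L}" by auto
    then show ?thesis by (simp only: image_insert im[OF order_refl] fe)
  qed
  have im2: "f ` {1..L + 2} = {u..w}"
  proof -
    have "{1..L + 2} = insert (L + 2) {1..L + 1}" by auto
    then have "f ` {1..L + 2} = insert v (insert e {u + 1..u + L})"
      by (simp only: image_insert im1 fe)
    also have "\<dots> = {u, w} \<union> {u + 1..u + L}" using uw(3) by auto
    also have "\<dots> = {u..w}" unfolding uw(2) by auto
    finally show ?thesis .
  qed
  have iv1: "insert e {u + 1..u + L} = (if e = u then {u..u + L} else {u + 1..w})"
  proof -
    have "e = u \<or> e = w" using uw(3) by blast
    then show ?thesis unfolding uw(2) by auto
  qed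
  have "ordr n f (L + 2)"
    unfolding ordr_def
  proof (intro conjI ballI)
    show "f ` {1..L + 2} \<subseteq> {1..n}" using im2 uw by auto
    have "card (f ` {1..L + 2}) = card {1..L + 2}" unfolding im2 using uw by simp
    then show "inj_on f {1..L + 2}" by (rule eq_card_imp_inj_on[rotated]) simp
    fix j assume "j \<in> {1..L + 2}"
    then consider "j \<le> L" | "j = L + 1" | "j = L + 2" by fastforce
    then show "\<exists>a b. f ` {1..j} = {a..b}"
      using im im1 im2 iv1 by cases (auto split: if_splits)
  qed
  then obtain \<tau> where t: "\<tau> \<in> Xi n" "\<And>j. j \<in> {1..L + 2} \<Longrightarrow> \<tau> j = f j"
    using ordr_extend[of n f "L + 2"] by auto
  have "\<tau> (L + 1) = e" "\<tau> (L + 2) = v" "\<forall>j\<in>{1..L}. \<tau> j = u + j"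
    using t(2) by (auto simp: f_def)
  then show ?thesis using t(1) by blast
qed

lemma wder_cong:
  assumes "\<And>i. i \<in> V \<Longrightarrow> \<phi> i = \<psi> i" "a \<in> polys_in V"
  shows "wder \<phi> a = wder \<psi> a"
  by (rule drv_eqI[OF refl drv_wder drv_wder _ assms(2)]) (simp add: assms(1))

context sym
begin

lemma reorder_simps [simp]:
  "len (reorder C hs \<tau>) = n" "act (reorder C hs \<tau>) = act C" "bracket (reorder C hs \<tau>) = br"
  "wt (reorder C hs \<tau>) m = wt C (\<tau> m)" "var (reorder C hs \<tau>) m = var C (\<tau> m)"
  "gen (reorder C hs \<tau>) m = x (\<tau> m)" "subalg (reorder C hs \<tau>) J = subalg C (\<tau> ` J)"
  by (simp_all add: reorder_def gen_def subalg_def image_image)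

lemma weight_vector_reorder [simp]: "weight_vector (reorder C hs \<tau>) = wv"
  by (simp add: weight_vector_def[abs_def])

lemma weight_of_reorder [simp]: "weight_of (reorder C hs \<tau>) = weight_of C"
  by (simp add: weight_of_def[abs_def])

lemma hpp_reorder [simp]: "homogeneous_poisson_prime (reorder C hs \<tau>) = hpp"
  by (simp add: homogeneous_poisson_prime_def[abs_def])

lemma Xi_image: "\<tau> \<in> Xi n \<Longrightarrow> \<tau> ` idx C = idx C"
  using Xi_permutes permutes_image by blast

lemma Xi_idx: "\<tau> \<in> Xi n \<Longrightarrow> m \<in> idx C \<Longrightarrow> \<tau> m \<in> idx C"
  using Xi_image by blast

lemma Xi_initial: "\<tau> \<in> Xi n \<Longrightarrow> m \<in> idx C \<Longrightarrow> \<tau> ` {1..<m} \<subseteq> idx C \<and> \<tau> m \<notin> \<tau> ` {1..<m}"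
  using Xi_image[of \<tau>] inj_image_mem_iff[OF Xi_inj, of \<tau> n m "{1..<m}"] by auto

text \<open>The set \<open>tau_minus\<close> compares with the first position only; by
  \<open>Xi_side\<close> any earlier position gives the same side.\<close>

lemma D_lie_reorder:
  assumes t: "\<tau> \<in> Xi n" and m: "m \<in> idx C" and j: "j \<in> {1..<m}"
  shows "D (lie (reorder C hs \<tau>) m) (\<tau> m) = dd (\<tau> m) (\<tau> j)"
proof -
  have "m \<in> tau_minus n \<tau> \<longleftrightarrow> \<not> \<tau> j < \<tau> m"
  proof -
    have "\<tau> 1 \<noteq> \<tau> m" using injD[OF Xi_inj[OF t], of 1 m] j by auto
    moreover have "\<tau> 1 < \<tau> m \<longleftrightarrow> \<tau> j < \<tau> m" using Xi_side[OF t, of m 1 j] m j by auto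
    ultimately show ?thesis using m j by (auto simp: tau_minus_def)
  qed
  then show ?thesis by (auto simp: reorder_def dd_def)
qed

lemma initial_between:
  assumes t: "\<tau> \<in> Xi n" and m: "m \<in> idx C" and i: "i \<in> \<tau> ` {1..<m}"
  shows "btw i (\<tau> m) \<subseteq> \<tau> ` {1..<m}"
proof -
  obtain a b where "\<tau> ` {1..<Suc m} = {a..b}" using Xi_interval[OF t, of "Suc m"] m by auto
  moreover have "{1..<Suc m} = insert m {1..<m}" using m by auto
  ultimately have eq: "insert (\<tau> m) (\<tau> ` {1..<m}) = {a..b}" by simp
  then have "i \<in> {a..b}" "\<tau> m \<in> {a..b}" using i by auto
  then have "btw i (\<tau> m) \<subseteq> {a..b} - {\<tau> m}" by (auto simp: btw_def min_def max_def)
  then show ?thesis using eq by auto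
qed

lemma dd_initial_in:
  assumes t: "\<tau> \<in> Xi n" and m: "m \<in> idx C" and j: "j \<in> {1..<m}" and a: "a \<in> subalg C (\<tau> ` {1..<m})"
  shows "dd (\<tau> m) (\<tau> j) a \<in> subalg C (\<tau> ` {1..<m})"
proof (rule dd_in[OF _ _ _ _ _ a])
  show "i < \<tau> m \<longleftrightarrow> \<tau> j < \<tau> m" if "i \<in> \<tau> ` {1..<m}" for i
    using that Xi_side[OF t _ _ j] m by auto
qed (use Xi_idx[OF t m] Xi_initial[OF t m] initial_between[OF t m] in auto)

lemma dd_initial_nilpotent:
  assumes t: "\<tau> \<in> Xi n" and m: "m \<in> idx C" and j: "j \<in> {1..<m}" and a: "a \<in> subalg C (\<tau> ` {1..<m})"
  shows "\<exists>l. (dd (\<tau> m) (\<tau> j) ^^ l) a = 0"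
proof (cases "\<tau> j < \<tau> m")
  case True
  have "\<tau> ` {1..<m} \<subseteq> {1..<\<tau> m}"
    using True Xi_initial[OF t m] Xi_side[OF t _ _ j] m by fastforce
  then show ?thesis
    using dd_nilpotent_below[OF Xi_idx[OF t m] True] a subalg_mono by blast
next
  case False
  have "\<tau> ` {1..<m} \<subseteq> {\<tau> m<..n}"
  proof
    fix i assume i: "i \<in> \<tau> ` {1..<m}"
    then have "i \<in> idx C" "i \<noteq> \<tau> m" using Xi_initial[OF t m] by blast+
    moreover have "\<not> i < \<tau> m" using i False Xi_side[OF t _ _ j] m by auto
    ultimately have "\<not> i < \<tau> m" "i \<noteq> \<tau> m" "i \<le> n" by auto
    then show "i \<in> {\<tau> m<..n}" by simp
  qed
  then show ?thesis
    using dd_nilpotent_above[OF Xi_idx[OF t m] False order_refl] a subalg_mono by blast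
qed

text \<open>Bracket, action and weights are unchanged. What needs an argument is that each new
  derivation preserves the algebra of the earlier generators and is locally nilpotent there: the
  earlier indices contain everything between them and the new one, and they lie on one side of
  it.\<close>

lemma cgl_reorder:
  assumes t: "\<tau> \<in> Xi n"
  shows "cgl (reorder C hs \<tau>)"
proof
  let ?T = "reorder C hs \<tau>"
  have A: "subalg C (\<tau> ` {1..n}) = A" using Xi_image[OF t] by simp
  have "inj_on (var ?T) {1..n}"
  proof -
    have "inj_on (var C \<circ> \<tau>) {1..n}"
      by (rule comp_inj_on[OF inj_on_subset[OF Xi_inj[OF t] subset_UNIV]]) (simp add: Xi_image[OF t] var_inj)
    moreover have "var ?T = var C \<circ> \<tau>" by (simp add: fun_eq_iff)
    ultimately show ?thesis by simp
  qed
  moreover have "torus_action ?T"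
    using taction A by (simp add: torus_action_def)
  moreover have "lam ?T m \<noteq> 0" if m: "m \<in> {1..n}" for m
    using lam_neq_0[OF Xi_idx[OF t m]] hs_nz[OF Xi_idx[OF t m]]
    by (simp add: lam_def) (simp add: reorder_def)
  moreover have "\<exists>d. is_delta ?T m d" if m: "m \<in> {1..n}" for m
  proof -
    define d where "d = D (lie ?T m) (\<tau> m)"
    let ?S = "subalg C (\<tau> ` {1..<m})"
    have sA: "?S \<subseteq> A" using Xi_initial[OF t m] by (intro subalg_mono) auto
    have dr: "drv ?S d"
      unfolding d_def by (rule drv_subset[OF drv_D[OF Xi_idx[OF t m]] sA])
    have "(\<forall>a\<in>?S. d a \<in> ?S) \<and> locally_nilpotent_on ?S d"
    \<comment> \<open>At the first position no earlier index selects a side; the algebra consists of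
      constants, which every derivation kills.\<close>
    proof (cases "m = 1")
      case True
      have "d a = 0" if "a \<in> ?S" for a
        by (rule drv_eq_0[OF subalg_def dr _ that]) (simp add: True)
      then have "d a \<in> ?S \<and> (d ^^ Suc 0) a = 0" if "a \<in> ?S" for a using that by simp
      then show ?thesis unfolding locally_nilpotent_on_def by blast
    next
      case False
      then have "1 \<in> {1..<m}" using m by simp
      from D_lie_reorder[OF t m this] dd_initial_in[OF t m this] dd_initial_nilpotent[OF t m this]
      show ?thesis unfolding d_def locally_nilpotent_on_def by simp
    qed
    moreover have "br (x (\<tau> i)) (x (\<tau> m)) = - Const (char_diff (wt C (\<tau> i)) (lie ?T m)) * x (\<tau> i) * x (\<tau> m) - d (x (\<tau> i))"
      if "i \<in> {1..<m}" for i
    proof -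
      have "\<tau> i \<in> idx C" "\<tau> m \<in> idx C" using Xi_idx[OF t] that m by auto
      then show ?thesis
        using br_anti[of "x (\<tau> i)" "x (\<tau> m)"] by (simp add: d_def D_def sg_x Const_minus)
    qed
    ultimately have "is_delta ?T m d"
      using dr by (simp add: is_delta_def derivation_on_iff)
    then show ?thesis by blast
  qed
  ultimately show "cgl_extension ?T"
    unfolding cgl_extension_def using poisson act_br wv_gen[OF Xi_idx[OF t]] by (simp add: A)
qed

end

locale sym_tau = sym C hs for C :: "('k::field_char_0, 'r::finite) cgl" and hs +
  fixes \<tau> :: "nat \<Rightarrow> nat"
  assumes tau: "\<tau> \<in> Xi (len C)"

sublocale sym_tau \<subseteq> T: cgl "reorder C hs \<tau>"
  by (rule cgl_reorder[OF tau])

context sym_tau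
begin

abbreviation "CT \<equiv> reorder C hs \<tau>"
abbreviation "YT \<equiv> prime_seq (reorder C hs \<tau>)"
abbreviation "pt \<equiv> pred (reorder C hs \<tau>)"

text \<open>The algebra generated by the first \<open>m - 1\<close> generators of the re-ordered extension.\<close>

abbreviation "RT m \<equiv> subalg C (\<tau> ` {1..<m})"

lemma sg_T: "a \<in> A \<Longrightarrow> T.sg h a = sg h a"
  unfolding T.sg_def sg_def
proof (rule wder_cong[of "var C ` idx C"])
  fix i assume "i \<in> var C ` idx C"
  then obtain j where j: "j \<in> idx C" "i = var C j" by auto
  then obtain m where m: "m \<in> idx C" "j = \<tau> m" using Xi_image[OF tau] by blast
  have "T.wtf h (var CT m) = char_diff (wt CT m) h" by (rule T.wtf_var) (use m in simp)
  then show "T.wtf h i = wtf h i" using j m by simp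
qed (simp add: A_eq)

lemma RT_A: "m \<le> Suc n \<Longrightarrow> RT m \<subseteq> A"
  using T.R_subset_A[of m] Xi_image[OF tau] by simp

lemma delta_T:
  assumes m: "m \<in> idx C" and j: "j \<in> {1..<m}" and a: "a \<in> RT m"
  shows "delta CT m a = dd (\<tau> m) (\<tau> j) a"
proof -
  have "a \<in> A" using RT_A[of m] m a by auto
  then show ?thesis
    using T.dl_eq[of m a] m a sg_T[of a] D_lie_reorder[OF tau m j, symmetric] by (simp add: D_def)
qed

lemma pt_Some:
  assumes m: "m \<in> idx C" and p: "pt m = Some j"
  shows "j \<in> {1..<m}" "hpp (RT m) (YT j)" "dd (\<tau> m) (\<tau> j) (YT j) \<noteq> 0"
    "\<not> YT j dvd dd (\<tau> m) (\<tau> j) (YT j)"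
    "\<And>y. hpp (RT m) y \<Longrightarrow> dd (\<tau> m) (\<tau> j) y \<noteq> 0 \<Longrightarrow> y dvd YT j"
    "YT m = YT j * x (\<tau> m) - Const (1 / lam CT m) * dd (\<tau> m) (\<tau> j) (YT j)"
proof -
  have mJ: "m \<in> {1..<Suc (len CT)}" using m by simp
  note F = T.F.pred_SomeD[OF mJ p, simplified]
  show j: "j \<in> {1..<m}" and h: "hpp (RT m) (YT j)" using T.F.pred_SomeD(1)[OF mJ p] F(3) by auto
  have YR: "YT j \<in> RT m" using T.hppD(1)[of m "YT j"] h m by simp
  note dY = delta_T[OF m j]
  show "dd (\<tau> m) (\<tau> j) (YT j) \<noteq> 0" "\<not> YT j dvd dd (\<tau> m) (\<tau> j) (YT j)"
    using F(4,5) dY[OF YR] by auto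
  show "y dvd YT j" if "hpp (RT m) y" "dd (\<tau> m) (\<tau> j) y \<noteq> 0" for y
  proof (rule F(7)[OF that(1)])
    have "y \<in> RT m" using T.hppD(1)[of m y] that m by simp
    then show "delta CT m y \<noteq> 0" using dY that by simp
  qed
  show "YT m = YT j * x (\<tau> m) - Const (1 / lam CT m) * dd (\<tau> m) (\<tau> j) (YT j)"
    using T.F.YE[OF mJ] p dY[OF YR] by (simp add: T.Yp_def T.Yr_def)
qed

lemma pt_None:
  assumes m: "m \<in> idx C" and p: "pt m = None"
  shows "YT m = x (\<tau> m)" "\<And>j a. j \<in> {1..<m} \<Longrightarrow> a \<in> RT m \<Longrightarrow> dd (\<tau> m) (\<tau> j) a = 0"
proof -
  have mJ: "m \<in> {1..<Suc (len CT)}" using m by simp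
  show "YT m = x (\<tau> m)" using T.F.YE[OF mJ] p by (simp add: T.Yp_def T.Yr_def)
  show "dd (\<tau> m) (\<tau> j) a = 0" if "j \<in> {1..<m}" "a \<in> RT m" for j a
    using T.F.pred_NoneD[OF mJ p, of a] delta_T[OF m that] that by simp
qed

lemma pt_eqI:
  assumes m: "m \<in> idx C" and j: "j \<in> {1..<m}" "hpp (RT m) (YT j)" "dd (\<tau> m) (\<tau> i) (YT j) \<noteq> 0" "i \<in> {1..<m}"
  shows "pt m = Some j"
proof (rule T.pred_eqI)
  have "YT j \<in> RT m" using T.hppD(1)[of m "YT j"] j m by simp
  then show "delta CT m (YT j) \<noteq> 0" using delta_T[OF m j(4)] j by simp
qed (use m j in auto)

lemma YT_prime: "m \<in> idx C \<Longrightarrow> prime_elem (YT m)"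
  using T.F.Y_prime[of m] by simp

lemma YT_in: "j \<in> {1..<m} \<Longrightarrow> m \<le> Suc n \<Longrightarrow> YT j \<in> RT m"
  using T.F.Y_in_Suc[of j] T.R_mono[of "Suc j" m] by auto

lemma YT_wv: "m \<in> idx C \<Longrightarrow> wv (weight_of C (YT m)) (YT m)"
  using T.F.wv_Y[of m] by (simp add: T.F.W_def)

lemma hpp_RT_I:
  assumes m: "m \<le> Suc n" and y: "prime_elem y" "y \<in> RT m" "wv w y"
    and g: "\<And>l. l \<in> {1..<m} \<Longrightarrow> y dvd br y (x (\<tau> l))"
  shows "hpp (RT m) y"
proof -
  have "y \<in> T.A" using y(2) T.R_subset_A[of m] m by auto
  moreover have "{1..<m} \<subseteq> idx CT" using m by auto
  ultimately have "y dvd br y a" if "a \<in> RT m" for a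
    using T.normal_subalg[of y "{1..<m}" a] g that by simp
  then show ?thesis
    using T.hppI[of m y w] m y by simp
qed

end

text \<open>Used to identify primes of two orders that start alike and differ in the last positions
  only.\<close>

lemma (in sym) reorder_prefix:
  assumes t: "\<tau> \<in> Xi n" and s: "\<sigma> \<in> Xi n" and eq: "\<And>j. j \<in> {1..m} \<Longrightarrow> \<tau> j = \<sigma> j" and m: "m \<le> n"
    and j: "j \<in> {1..m}"
  shows "prime_seq (reorder C hs \<tau>) j = prime_seq (reorder C hs \<sigma>) j"
    and "pred (reorder C hs \<tau>) j = pred (reorder C hs \<sigma>) j"
proof -
  let ?T = "reorder C hs \<tau>" and ?S = "reorder C hs \<sigma>"
  have lie: "lie ?T i = lie ?S i" if "i \<in> {1..m}" for i
    using eq[OF that] eq[of 1] that by (auto simp: reorder_def tau_minus_def)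
  have im: "\<tau> ` {1..<i} = \<sigma> ` {1..<i}" if "i \<in> {1..m}" for i
    by (rule image_cong) (use eq that in auto)
  have dl: "delta ?T i = delta ?S i" if i: "i \<in> {1..m}" for i
  proof -
    have "\<tau> l = \<sigma> l" if "l \<in> {1..<i}" for l using eq that i by auto
    then have "is_delta ?T i = is_delta ?S i"
      using im[OF i] lie[OF i] eq[OF i] by (auto simp: is_delta_def fun_eq_iff)
    then show ?thesis by (simp add: delta_def)
  qed
  have pf: "pred_from ?T i y = pred_from ?S i y" if "i \<in> {1..m}" for i y
    using im[OF that] dl[OF that] by (simp add: pred_from_def)
  have np: "next_prime ?T i y = next_prime ?S i y" if "i \<in> {1..m}" for i y
    using pf[OF that] dl[OF that] eq[OF that] lie[OF that]
    by (simp add: next_prime_def lam_def split: option.split)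
  have up: "prime_seq_upto ?T i = prime_seq_upto ?S i" if "i \<le> m" for i
    using that by (induct i) (auto simp: np)
  have ps: "prime_seq ?T i = prime_seq ?S i" if "i \<in> {1..m}" for i
    using up[of i] that by (simp add: prime_seq_def)
  show "prime_seq ?T j = prime_seq ?S j" by (rule ps[OF j])
  have "pred_from ?T j (prime_seq ?T) = pred_from ?T j (prime_seq ?S)"
    by (rule cgl.pred_from_cong[OF cgl_reorder[OF t]]) (use ps j in auto)
  then show "pred ?T j = pred ?S j"
    using pf[OF j] by (simp add: pred_def)
qed

section \<open>Lexicographic leading exponents and derivations that lower them\<close>

section \<open>Leading exponents\<close>

context cgl
begin

text \<open>The lexicographic order in which variables with larger index are more significant. It is
  transported from the order on \<open>nat \<Rightarrow>\<^sub>0 nat\<close>, in which smaller keys are more significant.\<close>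

definition rk :: "(nat \<Rightarrow>\<^sub>0 nat) \<Rightarrow> (nat \<Rightarrow>\<^sub>0 nat)" where
  "rk u = (\<Sum>j\<in>idx C. Poly_Mapping.single (len C - j) (cf u (var C j)))"

abbreviation exv :: "nat \<Rightarrow> (nat \<Rightarrow>\<^sub>0 nat)" where
  "exv v \<equiv> Poly_Mapping.single (var C v) 1"

lemma cf_rk: "j \<in> idx C \<Longrightarrow> cf (rk u) (len C - j) = cf u (var C j)"
proof -
  assume j: "j \<in> idx C"
  have "cf (rk u) (len C - j) = (\<Sum>i\<in>idx C. if i = j then cf u (var C i) else 0)"
    unfolding rk_def lookup_sum by (rule sum.cong) (use j in \<open>auto simp: lookup_single when_def\<close>)
  then show ?thesis using j by simp
qed

lemma rk_add: "rk (u + v) = rk u + rk v"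
  by (simp add: rk_def lookup_add single_add sum.distrib)

lemma rk_inj:
  assumes "exps u \<subseteq> var C ` idx C" "exps v \<subseteq> var C ` idx C" "rk u = rk v"
  shows "u = v"
proof (rule poly_mapping_eqI)
  fix i
  show "cf u i = cf v i"
  proof (cases "i \<in> var C ` idx C")
    case True
    then show ?thesis using cf_rk assms(3) by (metis imageE)
  next
    case False
    then have "i \<notin> exps u" "i \<notin> exps v" using assms by auto
    then show ?thesis by (simp add: in_keys_iff)
  qed
qed

lemma rk_exv: "v \<in> idx C \<Longrightarrow> rk (exv v) = Poly_Mapping.single (len C - v) 1"
proof -
  assume v: "v \<in> idx C"
  have "rk (exv v) = (\<Sum>j\<in>idx C. if j = v then Poly_Mapping.single (len C - v) 1 else 0)"
    unfolding rk_def
  proof (rule sum.cong[OF refl])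
    fix j assume "j \<in> idx C"
    then have "var C v = var C j \<longleftrightarrow> j = v" using inj_onD[OF var_inj, of v j] v by auto
    then show "Poly_Mapping.single (len C - j) (cf (exv v) (var C j)) = (if j = v then Poly_Mapping.single (len C - v) 1 else 0)"
      by (auto simp: lookup_single when_def)
  qed
  then show ?thesis using v by simp
qed

lemma rk_exv_nonneg: "v \<in> idx C \<Longrightarrow> 0 \<le> rk (exv v)"
  unfolding rk_exv less_eq_poly_mapping.rep_eq less_fun_def
  by (intro disjI1 exI[of _ "len C - v"]) (simp add: lookup_single when_def)

lemma rk_less_exv:
  assumes v: "v \<in> idx C" and w: "exps w \<subseteq> var C ` {1..<v}"
  shows "rk w < rk (exv v)"
proof -
  have z: "cf w (var C j) = 0" if "j \<in> idx C" "v \<le> j" for j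
  proof -
    have "var C j \<notin> exps w"
    proof
      assume "var C j \<in> exps w"
      then obtain i where "i \<in> {1..<v}" "var C j = var C i" using w by auto
      then show False using inj_onD[OF var_inj, of j i] that v by auto
    qed
    then show ?thesis by (simp add: in_keys_iff)
  qed
  have rkz: "cf (rk w) i = 0" if "i \<le> len C - v" for i
  proof (cases "i = len C - (len C - i) \<and> len C - i \<in> idx C")
    case True
    then show ?thesis using cf_rk[of "len C - i" w] z[of "len C - i"] that v by auto
  next
    case False
    then show ?thesis using that v by auto
  qed
  have "cf (rk w) (len C - v) < cf (rk (exv v)) (len C - v)"
    using rkz rk_exv[OF v] by simp
  moreover have "cf (rk w) i = cf (rk (exv v)) i" if "i < len C - v" for i
    using rkz[of i] that rk_exv[OF v] by (simp add: lookup_single when_def)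
  ultimately show ?thesis
    unfolding less_poly_mapping.rep_eq less_fun_def by blast
qed

definition lead :: "'k mpoly \<Rightarrow> (nat \<Rightarrow>\<^sub>0 nat) \<Rightarrow> bool" where
  "lead P e \<longleftrightarrow> e \<in> exps P \<and> (\<forall>w\<in>exps P. w = e \<or> rk w < rk e)"

lemma lead_unique: "lead P e \<Longrightarrow> lead P f \<Longrightarrow> e = f"
  unfolding lead_def using less_asym by blast

lemma exps_A: "P \<in> A \<Longrightarrow> w \<in> exps P \<Longrightarrow> exps w \<subseteq> var C ` idx C"
  by (auto simp: A_eq polys_in_def)

lemma lead_exists:
  assumes "P \<in> A" "P \<noteq> 0"
  shows "\<exists>e. lead P e"
proof -
  have ne: "finite (rk ` exps P)" "rk ` exps P \<noteq> {}" using assms by auto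
  then obtain e where e: "e \<in> exps P" "rk e = Max (rk ` exps P)"
    using Max_in[OF ne] by (metis imageE)
  have "w = e \<or> rk w < rk e" if "w \<in> exps P" for w
  proof (cases "rk w = rk e")
    case True
    then show ?thesis using rk_inj exps_A[OF assms(1)] that e(1) by blast
  next
    case False
    have "rk w \<le> rk e" unfolding e(2) by (rule Max_ge[OF ne(1)]) (use that in simp)
    with False show ?thesis by (simp add: less_le)
  qed
  then show ?thesis using e(1) by (auto simp: lead_def)
qed

lemma lead_split:
  assumes "lead P e"
  obtains P' where "P = Const (cf P e) * mon e + P'" "\<And>w. w \<in> exps P' \<Longrightarrow> rk w < rk e" "cf P e \<noteq> 0"
proof
  define P' where "P' = P - Const (cf P e) * mon e"
  show "P = Const (cf P e) * mon e + P'" by (simp add: P'_def)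
  show "cf P e \<noteq> 0" using assms by (auto simp: lead_def in_keys_iff)
  fix w assume w: "w \<in> exps P'"
  have "cf P' w = cf P w - (if w = e then cf P e else 0)" 
    by (simp add: P'_def lookup_minus lookup_single when_def)
  then have "w \<noteq> e" "w \<in> exps P" using w by (auto simp: in_keys_iff split: if_splits)
  then show "rk w < rk e" using assms by (auto simp: lead_def)
qed

lemma lead_of_sum:
  assumes "P = Const c * mon e + P'" "c \<noteq> 0" "\<And>w. w \<in> exps P' \<Longrightarrow> rk w < rk e"
  shows "lead P e" "cf P e = c"
proof -
  have "e \<notin> exps P'" using assms(3) by blast
  then have cP: "cf P w = (if w = e then c else cf P' w)" for w
    by (auto simp: assms(1) lookup_add lookup_single when_def in_keys_iff)
  then show "cf P e = c" by simp
  show "lead P e"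
    unfolding lead_def
  proof (intro conjI ballI)
    show "e \<in> exps P" using cP assms(2) by (simp add: in_keys_iff)
    fix w assume "w \<in> exps P"
    then show "w = e \<or> rk w < rk e"
      using cP[of w] assms(3)[of w] by (auto simp: in_keys_iff split: if_splits)
  qed
qed

text \<open>\<open>below P B\<close>: all exponents of \<open>P\<close> are smaller than \<open>B\<close>.\<close>

definition below :: "'k mpoly \<Rightarrow> (nat \<Rightarrow>\<^sub>0 nat) \<Rightarrow> bool" where
  "below P B \<longleftrightarrow> (\<forall>w\<in>exps P. rk w < B)"

lemma below_add: "below P B \<Longrightarrow> below Q B \<Longrightarrow> below (P + Q) B"
  unfolding below_def using Poly_Mapping.keys_add[of P Q] by blast

lemma below_0 [simp]: "below 0 B"
  by (simp add: below_def)

lemma below_Const: "below P B \<Longrightarrow> below (Const c * P) B"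
  by (auto simp: below_def in_keys_iff)

lemma below_uminus: "below P B \<Longrightarrow> below (- P) B"
  by (auto simp: below_def in_keys_iff)

lemma below_mult:
  assumes "below P B" "\<And>w. w \<in> exps Q \<Longrightarrow> rk w \<le> B'"
  shows "below (P * Q) (B + B')"
  unfolding below_def
proof
  fix w assume "w \<in> exps (P * Q)"
  then obtain a b where ab: "w = a + b" "a \<in> exps P" "b \<in> exps Q" by (rule exps_multE)
  then show "rk w < B + B'"
    using assms add_less_le_mono[of "rk a" B "rk b" B'] by (auto simp: below_def rk_add)
qed

lemma lead_mult:
  assumes "lead P e" "lead Q f"
  shows "lead (P * Q) (e + f)"
proof -
  obtain P' where P: "P = Const (cf P e) * mon e + P'" "below P' (rk e)" "cf P e \<noteq> 0"
    using lead_split[OF assms(1)] unfolding below_def by metis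
  obtain Q' where Q: "Q = Const (cf Q f) * mon f + Q'" "below Q' (rk f)" "cf Q f \<noteq> 0"
    using lead_split[OF assms(2)] unfolding below_def by metis
  define c where "c = cf P e" define c' where "c' = cf Q f"
  have "P * Q = (Const c * mon e + P') * Q" using P(1) c_def by simp
  also have "\<dots> = Const c * mon e * (Const c' * mon f + Q') + P' * Q"
    using Q(1) c'_def by (simp add: distrib_right)
  also have "\<dots> = Const (c * c') * mon (e + f) + (Q' * (Const c * mon e) + P' * Q)"
    unfolding mon_add Const_mult by (simp only: algebra_simps)
  finally have eq: "P * Q = Const (c * c') * mon (e + f) + (Q' * (Const c * mon e) + P' * Q)" .
  have "below (Q' * (Const c * mon e)) (rk f + rk e)"
    by (rule below_mult[OF Q(2)]) (auto simp: in_keys_iff lookup_single when_def split: if_splits)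
  moreover have "below (P' * Q) (rk e + rk f)"
    by (rule below_mult[OF P(2)]) (use assms(2) in \<open>auto simp: lead_def\<close>)
  ultimately have "below (Q' * (Const c * mon e) + P' * Q) (rk (e + f))"
    by (simp add: rk_add add.commute below_add)
  then show ?thesis
    using lead_of_sum(1)[OF eq] P(3) Q(3) by (simp add: below_def c_def c'_def)
qed

lemma lead_dvd:
  assumes "lead P e" "lead Q f" "P dvd Q" "P \<in> A" "Q \<in> A"
  shows "exps e \<subseteq> exps f"
proof -
  obtain g where g: "Q = P * g" using assms(3) ..
  have nz: "P \<noteq> 0" "Q \<noteq> 0" using assms(1,2) by (auto simp: lead_def)
  have "g \<in> A" using quotient_in_polys_in[OF _ _ g nz(1), of "var C ` idx C"] assms(4,5) unfolding A_eq by blast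
  then obtain e' where "lead g e'" using lead_exists[of g] nz(2) g mult_zero_right by blast
  then have "lead Q (e + e')" unfolding g by (rule lead_mult[OF assms(1)])
  then have "f = e + e'" by (rule lead_unique[OF assms(2)])
  then show ?thesis by (simp add: exps_add_nat)
qed

text \<open>A derivation lowers leading exponents, up to the factor \<open>x v\<close>, if it does so on generators.\<close>

lemma drv_below_mon:
  assumes d: "drv A d" and K: "K \<subseteq> idx C"
    and g: "\<And>i. i \<in> K \<Longrightarrow> below (d (x i)) (rk (exv i) + B)" and u: "exps u \<subseteq> var C ` K"
  shows "below (d (mon u)) (rk u + B)"
  using u
proof (induct "\<Sum>i\<in>exps u. cf u i" arbitrary: u rule: less_induct)
  case less
  show ?case
  proof (cases "u = 0")
    case True
    then show ?thesis using drv_1[OF A_eq d] by simp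
  next
    case False
    then obtain i where i: "i \<in> exps u" by (metis keys_eq_empty ex_in_conv)
    then obtain l where l: "l \<in> K" "i = var C l" using less.prems by auto
    define u' where "u' = u - exv l"
    have uu: "u = exv l + u'"
      using i l by (intro poly_mapping_eqI) (auto simp: u'_def lookup_add lookup_minus lookup_single when_def in_keys_iff)
    have sb: "exps u' \<subseteq> exps u" by (subst uu) (simp only: exps_add_nat Un_upper2)
    have "(\<Sum>j\<in>exps u'. cf u' j) = (\<Sum>j\<in>exps u. cf u' j)"
      by (rule sum.mono_neutral_left) (use sb in \<open>auto simp: in_keys_iff\<close>)
    also have "\<dots> < (\<Sum>j\<in>exps u. cf u j)"
    proof (rule sum_strict_mono_ex1)
      show "\<exists>j\<in>exps u. cf u' j < cf u j" using i l by (intro bexI[of _ i]) (simp_all add: uu lookup_add)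
    qed (simp_all add: uu lookup_add)
    finally have IH: "below (d (mon u')) (rk u' + B)" using less.hyps less.prems sb by auto
    have mA: "mon u' \<in> A" unfolding A_eq polys_in_mon using less.prems sb image_mono[OF K, of "var C"] by (meson order_trans)
    have "mon u = x l * mon u'" by (subst uu) (simp only: mon_add gen_def Var_def)
    then have eq: "d (mon u) = d (x l) * mon u' + d (mon u') * x l"
      using drv_mult[OF d _ mA, of "x l"] l K by (simp add: mult.commute subset_iff)
    have "below (d (x l) * mon u') (rk (exv l) + B + rk u')"
      by (rule below_mult[OF g[OF l(1)]]) simp
    moreover have "below (d (mon u') * x l) (rk u' + B + rk (exv l))"
      by (rule below_mult[OF IH]) (simp add: gen_def Var_def)
    ultimately show ?thesis
      unfolding eq by (subst uu) (simp add: rk_add below_add add_ac)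
  qed
qed

lemma drv_below:
  assumes d: "drv A d" and K: "K \<subseteq> idx C"
    and g: "\<And>i. i \<in> K \<Longrightarrow> below (d (x i)) (rk (exv i) + B)" and P: "P \<in> subalg C K"
    and E: "\<And>w. w \<in> exps P \<Longrightarrow> rk w \<le> E"
  shows "below (d P) (E + B)"
proof -
  have sb: "exps u \<subseteq> var C ` K" if "u \<in> exps P" for u using P that by (auto simp: subalg_def polys_in_def)
  have mA: "mon u \<in> A" if "u \<in> exps P" for u using sb[OF that] K by (auto simp: A_eq)
  have "d P = d (\<Sum>u\<in>exps P. Const (cf P u) * mon u)" by (simp only: mpoly_expand[symmetric])
  also have "\<dots> = (\<Sum>u\<in>exps P. d (Const (cf P u) * mon u))"
    by (rule drv_sum[OF A_eq d]) (use mA in simp)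
  also have "\<dots> = (\<Sum>u\<in>exps P. Const (cf P u) * d (mon u))"
    by (rule sum.cong[OF refl]) (use drv_scale[OF d] mA in simp)
  finally have eq: "d P = (\<Sum>u\<in>exps P. Const (cf P u) * d (mon u))" .
  have bm: "below (d (mon u)) (E + B)" if "u \<in> exps P" for u
    using drv_below_mon[OF d K g sb[OF that]] add_right_mono[OF E[OF that], of B]
    unfolding below_def by (meson less_le_trans)
  have "below (\<Sum>u\<in>U. Const (cf P u) * d (mon u)) (E + B)" if "finite U" "U \<subseteq> exps P" for U
    using that by (induct U rule: finite_induct) (auto intro!: below_add below_Const bm)
  from this[of "exps P"] show ?thesis unfolding eq by simp
qed

end

text \<open>The correction term involves only variables strictly between \<open>i\<close> and
  \<open>v\<close>, so its monomials already lie below the larger of these two variables.\<close>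

lemma (in sym) dd_x_below_rk:
  assumes v: "v \<in> idx C" and i: "i \<in> idx C" "i \<noteq> v"
  shows "below (dd v i (x i)) (rk (exv i) + rk (exv v))"
  unfolding below_def
proof
  fix w assume "w \<in> exps (dd v i (x i))"
  then have w: "exps w \<subseteq> var C ` btw i v" using dd_x_in[OF assms] by (auto simp: subalg_def polys_in_def)
  show "rk w < rk (exv i) + rk (exv v)"
  proof (cases "i < v")
    case True
    then have "rk w < rk (exv v)"
      using w v i(1) by (intro rk_less_exv) (auto simp: btw_def)
    then show ?thesis using add_le_less_mono[OF rk_exv_nonneg[OF i(1)]] by force
  next
    case False
    then have "rk w < rk (exv i)"
      using w v i by (intro rk_less_exv) (auto simp: btw_def)
    then show ?thesis using add_less_le_mono[OF _ rk_exv_nonneg[OF v]] by force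
  qed
qed

section \<open>An order-free description of consecutive indices of a level set\<close>

section \<open>Linked variables\<close>

context sym_tau
begin

text \<open>By \<open>drv_below\<close> the correction term stays below the leading term of
  \<open>YT j * x (\<tau> m)\<close>. Thus leading monomials are products of the variables along a
  chain of predecessors.\<close>

lemma YT_lead_step:
  assumes m: "m \<in> idx C" and p: "pt m = Some j" and l: "lead (YT j) e"
  shows "lead (YT m) (e + exv (\<tau> m))"
proof -
  have mi: "\<tau> m \<in> idx C" by (rule Xi_idx[OF tau m])
  note ps = pt_Some[OF m p]
  have ini: "\<tau> ` {1..<m} \<subseteq> idx C" "\<tau> m \<notin> \<tau> ` {1..<m}" using Xi_initial[OF tau m] by auto
  have "below (dd (\<tau> m) (\<tau> j) (YT j)) (rk e + rk (exv (\<tau> m)))"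
  proof (rule drv_below[OF drv_dd[OF mi] ini(1)])
    show "YT j \<in> RT m" using YT_in[OF ps(1)] m by auto
    show "rk w \<le> rk e" if "w \<in> exps (YT j)" for w using l that by (auto simp: lead_def)
    fix i assume i: "i \<in> \<tau> ` {1..<m}"
    have "dd (\<tau> m) (\<tau> j) = dd (\<tau> m) i"
      by (rule dd_side) (use i Xi_side[OF tau _ ps(1)] m in auto)
    moreover have "i \<in> idx C" "i \<noteq> \<tau> m" using i ini by blast+
    ultimately show "below (dd (\<tau> m) (\<tau> j) (x i)) (rk (exv i) + rk (exv (\<tau> m)))"
      using dd_x_below_rk[OF mi, of i] by simp
  qed
  then have b: "below (- (Const (1 / lam CT m) * dd (\<tau> m) (\<tau> j) (YT j))) (rk (e + exv (\<tau> m)))"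
    unfolding rk_add by (intro below_uminus below_Const)
  have "lead (x (\<tau> m)) (exv (\<tau> m))" by (simp add: lead_def gen_def Var_def)
  then have "lead (YT j * x (\<tau> m)) (e + exv (\<tau> m))" by (rule lead_mult[OF l])
  from lead_split[OF this]
  obtain P' where P'0: "YT j * x (\<tau> m) = Const (cf (YT j * x (\<tau> m)) (e + exv (\<tau> m))) * mon (e + exv (\<tau> m)) + P'"
      "\<And>w. w \<in> exps P' \<Longrightarrow> rk w < rk (e + exv (\<tau> m))" "cf (YT j * x (\<tau> m)) (e + exv (\<tau> m)) \<noteq> 0"
    by metis
  have P': "below P' (rk (e + exv (\<tau> m)))" unfolding below_def using P'0(2) by blast
  have eq: "YT m = Const (cf (YT j * x (\<tau> m)) (e + exv (\<tau> m))) * mon (e + exv (\<tau> m))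
      + (P' + - (Const (1 / lam CT m) * dd (\<tau> m) (\<tau> j) (YT j)))"
    unfolding ps(6) by (subst P'0(1)) simp
  show ?thesis
    using lead_of_sum(1)[OF eq P'0(3)] below_add[OF P' b] unfolding below_def by blast
qed

end

context sym
begin

text \<open>\<open>u\<close> and \<open>v\<close> are consecutive in a level set, independently of the order of the generators.\<close>

definition lnk :: "nat \<Rightarrow> nat \<Rightarrow> bool" where
  "lnk u v \<longleftrightarrow> u \<in> idx C \<and> v \<in> idx C \<and> u < v \<and> dd v u (x u) \<noteq> 0 \<and>
     (\<forall>a\<in>subalg C (btw u v). dd v u a = 0) \<and> (\<forall>a\<in>subalg C (btw u v). dd u v a = 0)"

abbreviation lkeq :: "nat \<Rightarrow> nat \<Rightarrow> bool" (infix "\<approx>" 50) where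
  "u \<approx> v \<equiv> equivclp lnk u v"

lemmas lkeq_sym = equivclp_sym[of lnk]
lemmas lkeq_trans = equivclp_trans[of lnk]

lemma lnk_lkeq: "lnk u v \<Longrightarrow> u \<approx> v"
  by (rule r_into_equivclp)

lemma lkI:
  assumes "e \<in> idx C" "v \<in> idx C" "e \<noteq> v" "dd v e (x e) \<noteq> 0"
    "\<And>a. a \<in> subalg C (btw e v) \<Longrightarrow> dd v e a = 0" "\<And>a. a \<in> subalg C (btw e v) \<Longrightarrow> dd e v a = 0"
  shows "lnk e v \<or> lnk v e"
proof (cases "e < v")
  case True
  then show ?thesis unfolding lnk_def using assms by blast
next
  case False
  then have "v < e" using assms(3) by simp
  moreover have "dd e v (x v) \<noteq> 0" using dd_x_swap[OF assms(2,1)] assms(3,4) by simp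
  ultimately show ?thesis unfolding lnk_def btw_commute[of v e] using assms(1,2,5,6) by blast
qed

lemma order_between:
  assumes "e \<in> idx C" "v \<in> idx C" "e \<noteq> v"
  shows "\<exists>\<tau> L. sym_tau C hs \<tau> \<and> L = max e v - min e v - 1 \<and> (\<forall>j\<in>{1..L}. \<tau> j = min e v + j) \<and>
    \<tau> (L + 1) = e \<and> \<tau> (L + 2) = v \<and> L + 2 \<in> idx C \<and>
    \<tau> ` {1..<L + 1} = btw e v \<and> \<tau> ` {1..<L + 2} = insert e (btw e v)"
proof -
  define L where "L = max e v - min e v - 1"
  obtain \<tau> where t: "\<tau> \<in> Xi n" "\<forall>j\<in>{1..L}. \<tau> j = min e v + j" "\<tau> (L + 1) = e" "\<tau> (L + 2) = v"
    using Xi_between[OF assms] unfolding L_def by blast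
  have 1: "sym_tau C hs \<tau>" by unfold_locales (rule t)
  have "{1..<L + 1} = {1..L}" by auto
  then have "\<tau> ` {1..<L + 1} = (\<lambda>j. j + min e v) ` {1..L}"
    using t(2) by (intro image_cong) auto
  also have "\<dots> = btw e v"
    using assms(3) by (auto simp: btw_def L_def min_def max_def)
  finally have 2: "\<tau> ` {1..<L + 1} = btw e v" .
  have "{1..<L + 2} = insert (L + 1) {1..<L + 1}" by auto
  then have 3: "\<tau> ` {1..<L + 2} = insert e (btw e v)" using 2 t(3) by simp
  have 4: "L + 2 \<in> idx C" using assms by (auto simp: L_def min_def max_def)
  show ?thesis by (intro exI conjI) (rule 1 L_def t(2-4) 4 2 3)+
qed

lemma dd_between_side: "l \<in> btw e v \<Longrightarrow> dd v l = dd v e"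
  by (rule dd_side) (rule btw_side)

text \<open>Otherwise \<open>x v\<close> and a Poisson prime of the algebra between \<open>e\<close> and \<open>v\<close> would
  both be moved by the derivation attached to \<open>e\<close>, in the order that ends with \<open>v\<close>, \<open>e\<close>.\<close>

lemma one_sided_zero:
  assumes e: "e \<in> idx C" and v: "v \<in> idx C" "e \<noteq> v"
    and 0: "\<And>a. a \<in> subalg C (btw e v) \<Longrightarrow> dd v e a = 0"
    and 1: "\<exists>a\<in>subalg C (btw e v). dd e v a \<noteq> 0"
  shows "dd v e (x e) = 0"
proof (rule ccontr)
  assume nz: "dd v e (x e) \<noteq> 0"
  obtain \<omega> L where \<omega>: "sym_tau C hs \<omega>" and L: "L = max e v - min e v - 1"
    and "\<forall>j\<in>{1..L}. \<omega> j = min e v + j" and \<omega>1: "\<omega> (L + 1) = e" and "\<omega> (L + 2) = v"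
    and Ln: "L + 2 \<in> idx C" and \<omega>I: "\<omega> ` {1..<L + 1} = btw e v" and "\<omega> ` {1..<L + 2} = insert e (btw e v)"
    using order_between[OF e v] by (elim exE conjE) (rule that)
  obtain \<tau> L' where \<tau>: "sym_tau C hs \<tau>" and L': "L' = max v e - min v e - 1"
    and "\<forall>j\<in>{1..L'}. \<tau> j = min v e + j" and \<tau>1: "\<tau> (L' + 1) = v" and \<tau>2: "\<tau> (L' + 2) = e"
    and "L' + 2 \<in> idx C" and \<tau>I': "\<tau> ` {1..<L' + 1} = btw v e" "\<tau> ` {1..<L' + 2} = insert v (btw v e)"
    using order_between[OF v(1) e v(2)[symmetric]] by (elim exE conjE) (rule that)
  have LL: "L' = L" unfolding L L' by (simp only: max.commute min.commute)
  have \<tau>I: "\<tau> ` {1..<L + 1} = btw e v" "\<tau> ` {1..<L + 2} = insert v (btw e v)"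
    using \<tau>I' unfolding LL btw_commute[of v e] by blast+
  interpret O: sym_tau C hs \<omega> by (rule \<omega>)
  interpret P: sym_tau C hs \<tau> by (rule \<tau>)
  have L1: "L + 1 \<in> idx C" using Ln by auto
  have bi: "btw e v \<subseteq> idx C" by (rule btw_idx[OF e v(1)])
  obtain l where l: "l \<in> btw e v"
  proof -
    have "btw e v \<noteq> {}"
    proof
      assume "btw e v = {}"
      then have "dd e v a = 0" if "a \<in> subalg C (btw e v)" for a
        by (intro dd_eq_0[OF e _ _ that]) auto
      then show False using 1 by blast
    qed
    then show thesis using that by blast
  qed
  have Lpos: "L \<ge> 1" using l L by (auto simp: btw_def)
  obtain j where j: "O.pt (L + 1) = Some j"
  proof (cases "O.pt (L + 1)")
    case None
    have "\<omega> 1 \<in> btw e v" using \<omega>I Lpos by auto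
    then have "dd e (\<omega> 1) = dd e v" using dd_between_side[of _ v e] by (simp add: btw_commute)
    then show ?thesis using O.pt_None(2)[OF L1 None, of 1] 1 \<omega>1 \<omega>I Lpos by auto
  qed (rule that)
  note js = O.pt_Some[OF L1 j]
  \<comment> \<open>The predecessor prime of \<open>x e\<close> over the algebra between
    \<open>e\<close> and \<open>v\<close>. It stays a Poisson prime when \<open>x v\<close> is
    adjoined, because the derivation of \<open>v\<close> kills that algebra.\<close>
  define \<pi> where "\<pi> = O.YT j"
  have "\<omega> j \<in> btw e v" using js(1) \<omega>I by auto
  then have "dd e (\<omega> j) = dd e v" using dd_between_side[of _ v e] by (simp add: btw_commute)
  then have \<pi>: "hpp (subalg C (btw e v)) \<pi>" "dd e v \<pi> \<noteq> 0"
    using js(2,3) \<omega>1 \<omega>I by (auto simp: \<pi>_def)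
  have jn: "j \<in> idx C" using js(1) L1 by auto
  have \<pi>R: "\<pi> \<in> subalg C (btw e v)" and \<pi>p: "prime_elem \<pi>" and \<pi>w: "wv (weight_of C \<pi>) \<pi>"
    using O.YT_in[OF js(1)] \<omega>I L1 O.YT_prime[OF jn] O.YT_wv[OF jn] by (auto simp: \<pi>_def)
  have \<pi>A: "\<pi> \<in> A" using \<pi>R subalg_mono[OF bi] by auto
  have hS: "\<pi> dvd br \<pi> a" if "a \<in> subalg C (btw e v)" for a
    using O.T.hppD(3)[of "L + 1" \<pi> a] \<pi>(1) that L1 \<omega>I by simp
  have \<pi>': "hpp (P.RT (L + 2)) \<pi>"
  proof (rule P.hpp_RT_I[OF _ \<pi>p _ \<pi>w])
    show "\<pi> \<in> P.RT (L + 2)" using \<pi>R subalg_mono[of "btw e v" "insert v (btw e v)"] \<tau>I by auto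
    fix i assume "i \<in> {1..<L + 2}"
    then have "\<tau> i \<in> insert v (btw e v)" using \<tau>I by blast
    then show "\<pi> dvd br \<pi> (x (\<tau> i))"
    proof
      assume "\<tau> i = v"
      then have "br \<pi> (x (\<tau> i)) = - br (x v) \<pi>" using br_anti[OF \<pi>A, of "x v"] v by simp
      also have "\<dots> = - (sg (if e < v then lie C v else hs v) \<pi> * x v)"
        using br_x_dd[of v \<pi> e] 0[OF \<pi>R] by simp
      finally show ?thesis using sg_wv[OF \<pi>A \<pi>w] by simp
    qed (use hS in simp)
  qed (use Ln in simp)
  have pv: "P.pt (L + 1) = None"
  proof (rule ccontr)
    assume "P.pt (L + 1) \<noteq> None"
    then obtain i where i: "P.pt (L + 1) = Some i" by auto
    note ips = P.pt_Some[OF L1 i]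
    have "dd v (\<tau> i) = dd v e" by (rule dd_between_side) (use ips(1) \<tau>I in auto)
    moreover have "P.YT i \<in> subalg C (btw e v)" using P.YT_in[OF ips(1)] \<tau>I L1 by auto
    ultimately show False using ips(3) 0 \<tau>1 LL by simp
  qed
  have Yv: "P.YT (L + 1) = x v" using P.pt_None(1)[OF L1 pv] \<tau>1 LL by simp
  have "hpp (P.RT (L + 2)) (P.YT (L + 1))"
    unfolding Yv
  proof (rule P.hpp_RT_I[OF _ x_prime _ wv_gen[OF v(1)]])
    show "x v \<in> P.RT (L + 2)" using \<tau>I by simp
    fix i assume "i \<in> {1..<L + 2}"
    then have "\<tau> i \<in> insert v (btw e v)" using \<tau>I by blast
    then show "x v dvd br (x v) (x (\<tau> i))"
    proof
      assume "\<tau> i = v"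
      then show ?thesis using br_self[of "x v"] v by simp
    next
      assume "\<tau> i \<in> btw e v"
      then show ?thesis using 0[of "x (\<tau> i)"] br_x_dd[of v "x (\<tau> i)" e] by simp
    qed
  qed (use Ln in simp)
  moreover have "dd (\<tau> (L + 2)) (\<tau> (L + 1)) (P.YT (L + 1)) \<noteq> 0"
    using nz dd_x_swap[OF v(1) e v(2)] Yv \<tau>1 \<tau>2 LL by simp
  ultimately have "P.pt (L + 2) = Some (L + 1)"
    by (intro P.pt_eqI[OF Ln]) auto
  then have "\<pi> dvd x v"
    using P.pt_Some(5)[OF Ln, of "L + 1" \<pi>] \<pi>' \<pi>(2) \<tau>1 \<tau>2 LL Yv by simp
  then have "x v dvd \<pi>" using prime_elem_dvd_prime_elem[OF \<pi>p x_prime] by blast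
  then show False
    using x_not_dvd[OF v(1) btw_notin(2) bi \<pi>R] \<pi>p by auto
qed

end

text \<open>Among the earlier indices whose generators are moved by the derivation of
  \<open>\<tau> m\<close>, one nearest to \<open>\<tau> m\<close> is linked to it: that derivation
  vanishes in between by the choice, and the opposite one by \<open>one_sided_zero\<close>.\<close>

lemma (in sym_tau) pt_not_None_iff:
  assumes m: "m \<in> idx C"
  shows "pt m \<noteq> None \<longleftrightarrow> (\<exists>i\<in>{1..<m}. lnk (\<tau> i) (\<tau> m) \<or> lnk (\<tau> m) (\<tau> i))"
proof
  have mi: "\<tau> m \<in> idx C" by (rule Xi_idx[OF tau m])
  have ini: "\<tau> ` {1..<m} \<subseteq> idx C" "\<tau> m \<notin> \<tau> ` {1..<m}" using Xi_initial[OF tau m] by auto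
  show "pt m \<noteq> None" if lk: "\<exists>i\<in>{1..<m}. lnk (\<tau> i) (\<tau> m) \<or> lnk (\<tau> m) (\<tau> i)"
  proof
    assume N: "pt m = None"
    obtain i where i: "i \<in> {1..<m}" "lnk (\<tau> i) (\<tau> m) \<or> lnk (\<tau> m) (\<tau> i)" using lk by blast
    have "dd (\<tau> m) (\<tau> i) (x (\<tau> i)) \<noteq> 0"
      using i(2)
    proof
      assume "lnk (\<tau> m) (\<tau> i)"
      then have "\<tau> m \<in> idx C" "\<tau> i \<in> idx C" "\<tau> i \<noteq> \<tau> m" "dd (\<tau> i) (\<tau> m) (x (\<tau> m)) \<noteq> 0"
        by (simp_all add: lnk_def)
      then show ?thesis using dd_x_swap[of "\<tau> m" "\<tau> i"] by simp
    qed (simp add: lnk_def)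
    then show False using pt_None(2)[OF m N i(1), of "x (\<tau> i)"] i by auto
  qed
  show "\<exists>i\<in>{1..<m}. lnk (\<tau> i) (\<tau> m) \<or> lnk (\<tau> m) (\<tau> i)" if nN: "pt m \<noteq> None"
  proof -
    obtain p where p: "pt m = Some p" using nN by auto
    note ps = pt_Some[OF m p]
    have sd: "dd (\<tau> m) i = dd (\<tau> m) (\<tau> p)" if i: "i \<in> \<tau> ` {1..<m}" for i
    proof -
      obtain l where l: "l \<in> {1..<m}" "i = \<tau> l" using i by blast
      have "m \<le> n" using m by simp
      from Xi_side[OF tau this l(1) ps(1)] show ?thesis unfolding l(2) by (rule dd_side)
    qed
    define B where "B = {i \<in> \<tau> ` {1..<m}. dd (\<tau> m) i (x i) \<noteq> 0}"
    have "B \<noteq> {}"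
    proof
      assume "B = {}"
      have "dd (\<tau> m) (\<tau> p) (YT p) = 0"
      proof (rule dd_eq_0[OF mi ini(1)])
        show "YT p \<in> RT m" using YT_in[OF ps(1)] m by simp
        fix i assume i: "i \<in> \<tau> ` {1..<m}"
        then have "dd (\<tau> m) i (x i) = 0" using \<open>B = {}\<close> unfolding B_def by blast
        then show "dd (\<tau> m) (\<tau> p) (x i) = 0" using sd[OF i] by simp
      qed
      then show False using ps(3) by simp
    qed
    define dist where "dist i = max i (\<tau> m) - min i (\<tau> m)" for i
    obtain u where u: "u \<in> B" "\<And>i. i \<in> B \<Longrightarrow> dist u \<le> dist i"
      using ex_has_least_nat[of "\<lambda>i. i \<in> B" _ dist] \<open>B \<noteq> {}\<close> by blast
    have ui: "u \<in> idx C" "u \<noteq> \<tau> m" "u \<in> \<tau> ` {1..<m}" "dd (\<tau> m) u (x u) \<noteq> 0"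
      using u(1) ini unfolding B_def by blast+
    have z: "dd (\<tau> m) u a = 0" if "a \<in> subalg C (btw u (\<tau> m))" for a
    proof (rule dd_eq_0[OF mi btw_idx[OF ui(1) mi] _ that])
      fix i assume i: "i \<in> btw u (\<tau> m)"
      then have "i \<in> \<tau> ` {1..<m}" using initial_between[OF tau m ui(3)] by auto
      moreover have "dist i < dist u" using i by (auto simp: dist_def btw_def min_def max_def split: if_splits)
      ultimately have "dd (\<tau> m) i (x i) = 0" using u(2)[of i] by (auto simp: B_def)
      then show "dd (\<tau> m) u (x i) = 0" using dd_between_side[OF i] by simp
    qed
    have "dd u (\<tau> m) a = 0" if "a \<in> subalg C (btw u (\<tau> m))" for a
      using one_sided_zero[OF ui(1) mi ui(2) z] ui(4) that by blast
    then have "lnk u (\<tau> m) \<or> lnk (\<tau> m) u"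
      by (intro lkI[OF ui(1) mi ui(2) ui(4) z])
    then show ?thesis using ui(3) by auto
  qed
qed

section \<open>Every order has the same level sets, and they determine its predecessor map\<close>

section \<open>The level sets of a re-ordering\<close>

lemma (in sym) lkeq_refl [simp]: "u \<approx> u"
  by (rule equivclp_refl)

context sym_tau
begin

definition chain_ok :: "nat \<Rightarrow> bool" where
  "chain_ok m \<longleftrightarrow> (\<forall>j. pt m = Some j \<longrightarrow> \<tau> j \<approx> \<tau> m)"

text \<open>Leading exponents remember the class of an index, so by \<open>lead_dvd\<close> a
  divisibility between primes of two different orders identifies their classes.\<close>

lemma YT_lead:
  assumes "m \<in> idx C" and "\<And>i. i \<in> {1..m} \<Longrightarrow> chain_ok i"
  shows "\<exists>e. lead (YT m) e \<and> var C (\<tau> m) \<in> exps e \<and> (\<forall>v\<in>idx C. var C v \<in> exps e \<longrightarrow> v \<approx> \<tau> m)"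
  using assms
proof (induct m rule: less_induct)
  case (less m)
  have mi: "\<tau> m \<in> idx C" by (rule Xi_idx[OF tau less.prems(1)])
  have var_eq: "v = \<tau> m" if "v \<in> idx C" "var C v = var C (\<tau> m)" for v
    using inj_onD[OF var_inj that(2) that(1) mi] .
  show ?case
  proof (cases "pt m")
    case None
    then have "lead (YT m) (exv (\<tau> m))"
      using pt_None(1)[OF less.prems(1)] by (simp add: lead_def gen_def Var_def)
    moreover have "v \<approx> \<tau> m" if "v \<in> idx C" "var C v \<in> exps (exv (\<tau> m))" for v
      using that var_eq[of v] by simp
    ultimately show ?thesis by (intro exI[of _ "exv (\<tau> m)"]) simp
  next
    case (Some j)
    note j = pt_Some(1)[OF less.prems(1) Some]
    have jm: "\<tau> j \<approx> \<tau> m" using less.prems(2)[of m] less.prems(1) Some by (auto simp: chain_ok_def)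
    obtain e where e: "lead (YT j) e" "\<forall>v\<in>idx C. var C v \<in> exps e \<longrightarrow> v \<approx> \<tau> j"
      using less.hyps[of j] less.prems j by auto
    have "v \<approx> \<tau> m" if "v \<in> idx C" "var C v \<in> exps (e + exv (\<tau> m))" for v
    proof -
      from that(2) have "var C v \<in> exps e \<or> var C v = var C (\<tau> m)" by (auto simp: exps_add_nat)
      then show ?thesis
      proof
        assume "var C v \<in> exps e"
        then show ?thesis using e(2) that(1) lkeq_trans[OF _ jm] by blast
      qed (use var_eq[OF that(1)] in simp)
    qed
    moreover have "var C (\<tau> m) \<in> exps (e + exv (\<tau> m))" by (simp add: exps_add_nat)
    ultimately show ?thesis using YT_lead_step[OF less.prems(1) Some e(1)] by blast
  qed
qed

end

text \<open>Induction on \<open>m\<close> for all orders at once. The order \<open>\<tau>\<close> is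
  first replaced by a standard order \<open>\<sigma>\<close> with the same initial set, which ends
  in the far end e of the interval followed by v = \<open>\<tau> m\<close>; divisibility shows that
  the class of the predecessor is unchanged. Then \<open>\<sigma>\<close> is compared with the order
  in which v comes before e, where v has a smaller position and the induction hypothesis
  applies.\<close>

lemma (in sym) pred_linked:
  assumes "sym_tau C hs \<tau>" "m \<in> idx C"
  shows "sym_tau.chain_ok C hs \<tau> m"
  using assms
proof (induct m arbitrary: \<tau> rule: less_induct)
  case (less m)
  interpret T: sym_tau C hs \<tau> by (rule less.prems)
  note mn = less.prems(2)
  have mi: "\<tau> m \<in> idx C" by (rule Xi_idx[OF T.tau mn])
  show ?case
    unfolding T.chain_ok_def
  proof (intro allI impI)
    fix j assume j: "T.pt m = Some j"
    note js = T.pt_Some[OF mn j]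
    define v where "v = \<tau> m"
    obtain a b where ab: "\<tau> ` {1..<m} = {a..b}" using Xi_interval[OF T.tau, of m] mn by auto
    obtain a' b' where ab': "\<tau> ` {1..<Suc m} = {a'..b'}" using Xi_interval[OF T.tau, of "Suc m"] mn by auto
    have ini: "\<tau> ` {1..<m} \<subseteq> idx C" "\<tau> m \<notin> \<tau> ` {1..<m}" using Xi_initial[OF T.tau mn] by auto
    have "{1..<Suc m} = insert m {1..<m}" using mn by auto
    then have ins: "insert v {a..b} = {a'..b'}" using ab ab' by (simp add: v_def)
    have ne: "a \<le> b" using js(1) ab by (metis atLeastatMost_empty_iff2 empty_iff image_eqI)
    have vn: "v \<notin> {a..b}" using ini ab by (simp add: v_def)
    \<comment> \<open>The index v is adjacent to the interval of earlier indices; \<open>e\<close>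
      is the end of that interval away from v, so the rest of it lies between.\<close>
    define e where "e = (if b < v then a else b)"
    have adj: "v = Suc b \<or> Suc v = a"
    proof (rule ccontr)
      assume h: "\<not> ?thesis"
      have hh: "a' \<le> v" "v \<le> b'" "a' \<le> a" "b \<le> b'" using ins ne by (metis atLeastAtMost_iff insertI1 insertI2 order_refl)+
      then have "(if b < v then Suc b else Suc v) \<in> {a'..b'}" using hh vn ne by auto
      then have "(if b < v then Suc b else Suc v) \<in> insert v {a..b}" using ins by simp
      then show False using h vn ne by (auto split: if_splits)
    qed
    have eab: "e \<in> {a..b}" "e \<noteq> v" "insert e (btw e v) = {a..b}"
      using adj ne vn by (auto simp: e_def btw_def min_def max_def)
    have ei: "e \<in> idx C" and vi: "v \<in> idx C" using eab(1) ab ini(1) mi by (auto simp: v_def)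
    have bi: "btw e v \<subseteq> idx C" by (rule btw_idx[OF ei vi])
    \<comment> \<open>\<open>\<sigma>\<close> runs through the indices between, then
      \<open>e\<close>, then \<open>v\<close>; \<open>\<omega>\<close>, obtained next, exchanges the
      last two. They agree in the first \<open>L\<close> positions.\<close>
    obtain \<sigma> L where \<sigma>: "sym_tau C hs \<sigma>" and L: "L = max e v - min e v - 1"
      and \<sigma>L: "\<forall>j\<in>{1..L}. \<sigma> j = min e v + j" and \<sigma>1: "\<sigma> (L + 1) = e" and \<sigma>2: "\<sigma> (L + 2) = v"
      and Ln: "L + 2 \<in> idx C" and \<sigma>I: "\<sigma> ` {1..<L + 1} = btw e v" "\<sigma> ` {1..<L + 2} = insert e (btw e v)"
      using order_between[OF ei vi eab(2)] by (elim exE conjE) (rule that)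
    obtain \<omega> L' where \<omega>: "sym_tau C hs \<omega>" and L': "L' = max v e - min v e - 1"
      and \<omega>L: "\<forall>j\<in>{1..L'}. \<omega> j = min v e + j" and \<omega>1: "\<omega> (L' + 1) = v" and \<omega>2: "\<omega> (L' + 2) = e"
      and "L' + 2 \<in> idx C" and \<omega>I: "\<omega> ` {1..<L' + 1} = btw v e" "\<omega> ` {1..<L' + 2} = insert v (btw v e)"
      using order_between[OF vi ei eab(2)[symmetric]] by (elim exE conjE) (rule that)
    have LL: "L' = L" unfolding L L' by (simp only: max.commute min.commute)
    note \<omega>1 = \<omega>1[unfolded LL] and \<omega>I = \<omega>I[unfolded LL btw_commute[of v e]]
    have \<omega>\<sigma>: "\<omega> j = \<sigma> j" if "j \<in> {1..L}" for j
      using \<omega>L \<sigma>L that unfolding LL min.commute[of v e] by simp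
    interpret P: sym_tau C hs \<sigma> by (rule \<sigma>)
    interpret O: sym_tau C hs \<omega> by (rule \<omega>)
    have "card (\<tau> ` {1..<m}) = m - 1"
      using card_image[OF inj_on_subset[OF Xi_inj[OF T.tau] subset_UNIV], of "{1..<m}"] by simp
    moreover have "card (\<sigma> ` {1..<L + 2}) = L + 1"
      using card_image[OF inj_on_subset[OF Xi_inj[OF P.tau] subset_UNIV], of "{1..<L + 2}"] by simp
    ultimately have mL: "m = L + 2" using \<sigma>I(2) eab(3) ab mn by simp
    have L1: "L + 1 \<in> idx C" using Ln by auto
    have RTm: "P.RT m = T.RT m" using \<sigma>I(2) eab(3) ab mL by simp
    have "\<tau> j \<in> {a..b}" using js(1) ab by blast
    then have ddv: "dd v (\<tau> j) = dd v e"
      using adj eab(1) by (intro dd_side) auto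
    have IH: "sym_tau.chain_ok C hs \<rho> i" if "sym_tau C hs \<rho>" "i < m" "i \<in> idx C" for \<rho> i
      using less.hyps that by blast
    have "P.pt m \<noteq> None"
    proof
      assume "P.pt m = None"
      then have "dd v e (T.YT j) = 0"
        using P.pt_None(2)[of m "L + 1" "T.YT j"] mn mL \<sigma>1 \<sigma>2 RTm T.YT_in[OF js(1)] by auto
      then show False using js(3) ddv by (simp add: v_def)
    qed
    then obtain j' where j': "P.pt m = Some j'" by auto
    note js' = P.pt_Some[OF mn j']
    have \<sigma>m: "\<sigma> m = v" using \<sigma>2 mL by simp
    have side': "dd v (\<sigma> i) = dd v e" if "i \<in> {1..<m}" for i
    proof -
      have "\<sigma> i \<in> insert e (btw e v)" using that \<sigma>I(2) mL by blast
      then show ?thesis using dd_between_side by auto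
    qed
    \<comment> \<open>Both orders have the same initial algebra, and a predecessor prime is
      divisible by every homogeneous Poisson prime that the derivation moves.\<close>
    have "T.YT j dvd P.YT j'"
      using js'(5)[of "T.YT j"] js(2,3) RTm side'[OF js'(1)] ddv by (simp add: \<sigma>m v_def)
    have jn: "j \<in> idx C" "j' \<in> idx C" "j < m" "j' < m" using js(1) js'(1) mn by auto
    have IHj: "T.chain_ok i" if "i \<in> {1..j}" for i
      using IH[of \<tau> i] that jn T.sym_tau_axioms by auto
    have IHj': "P.chain_ok i" if "i \<in> {1..j'}" for i
      using IH[of \<sigma> i] that jn P.sym_tau_axioms by auto
    obtain f where f: "lead (T.YT j) f" "var C (\<tau> j) \<in> exps f"
      using T.YT_lead[OF jn(1) IHj] by blast
    obtain f' where f': "lead (P.YT j') f'" "\<forall>w\<in>idx C. var C w \<in> exps f' \<longrightarrow> w \<approx> \<sigma> j'"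
      using P.YT_lead[OF jn(2) IHj'] by blast
    have "T.YT j \<in> A" "P.YT j' \<in> A"
      using T.YT_in[OF js(1)] P.YT_in[OF js'(1)] T.RT_A[of m] P.RT_A[of m] mn by auto
    then have "exps f \<subseteq> exps f'" by (intro lead_dvd[OF f(1) f'(1) \<open>T.YT j dvd P.YT j'\<close>])
    then have step1: "\<tau> j \<approx> \<sigma> j'" using f(2) f'(2) Xi_idx[OF T.tau jn(1)] by blast
    have "\<sigma> j' \<approx> v"
    proof (cases "\<forall>a\<in>subalg C (btw e v). dd v e a = 0")
      case True
      \<comment> \<open>Here only \<open>x e\<close> can be moved by the derivation of
        \<open>v\<close>, so \<open>e\<close> and \<open>v\<close> are linked, and
        \<open>x e\<close> itself becomes the predecessor prime of \<open>v\<close>.\<close>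
      have nz: "dd v e (x e) \<noteq> 0"
      proof
        assume z: "dd v e (x e) = 0"
        have "dd v e (P.YT j') = 0"
        proof (rule dd_eq_0[OF vi _ _ P.YT_in[OF js'(1)]])
          show "\<sigma> ` {1..<m} \<subseteq> idx C" using RTm \<sigma>I(2) mL bi ei by auto
          fix i assume "i \<in> \<sigma> ` {1..<m}"
          then have "i \<in> insert e (btw e v)" using \<sigma>I(2) mL by blast
          then show "dd v e (x i) = 0" using z True by auto
        qed (use mn in auto)
        then show False using js'(3) side'[OF js'(1)] by (simp add: \<sigma>m)
      qed
      have ze: "dd e v a = 0" if "a \<in> subalg C (btw e v)" for a
        using one_sided_zero[OF ei vi eab(2)] True nz that by blast
      have lk: "lnk e v \<or> lnk v e"
        by (rule lkI[OF ei vi eab(2) nz _ ze]) (use True in blast)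
      have pN: "P.pt (L + 1) = None"
      proof (rule ccontr)
        assume "P.pt (L + 1) \<noteq> None"
        then obtain i where i: "P.pt (L + 1) = Some i" by auto
        note ips = P.pt_Some[OF L1 i]
        have "\<sigma> i \<in> btw e v" using ips(1) \<sigma>I(1) by blast
        then have "dd e (\<sigma> i) = dd e v" using dd_between_side[of _ v e] by (simp add: btw_commute)
        moreover have "P.YT i \<in> subalg C (btw e v)" using P.YT_in[OF ips(1)] \<sigma>I L1 by auto
        ultimately show False using ips(3) ze \<sigma>1 by simp
      qed
      have Ye: "P.YT (L + 1) = x e" using P.pt_None(1)[OF L1 pN] \<sigma>1 by simp
      have "hpp (P.RT m) (P.YT (L + 1))"
        unfolding Ye
      proof (rule P.hpp_RT_I[OF _ x_prime _ wv_gen[OF ei]])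
        show "x e \<in> P.RT m" using \<sigma>I mL by simp
        fix i assume "i \<in> {1..<m}"
        then have "\<sigma> i \<in> insert e (btw e v)" using \<sigma>I(2) mL by blast
        then show "x e dvd br (x e) (x (\<sigma> i))"
        proof
          assume "\<sigma> i = e"
          then show ?thesis using br_self[of "x e"] ei by simp
        next
          assume "\<sigma> i \<in> btw e v"
          then show ?thesis using ze[of "x (\<sigma> i)"] br_x_dd[of e "x (\<sigma> i)" v] by simp
        qed
      qed (use mn in simp)
      then have "P.pt m = Some (L + 1)"
        by (intro P.pt_eqI[OF mn, of "L + 1" "L + 1"]) (use mL nz \<sigma>m \<sigma>1 Ye in auto)
      then have "\<sigma> j' = e" using j' \<sigma>1 by simp
      then show ?thesis using lk lnk_lkeq lkeq_sym by blast
    next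
      case False
      then obtain a0 where a0: "a0 \<in> subalg C (btw e v)" "dd v e a0 \<noteq> 0" by blast
      have "L \<noteq> 0"
      proof
        assume "L = 0"
        then have "btw e v = {}" using \<omega>I(1) by simp
        then have "a0 \<in> subalg C {}" using a0(1) by simp
        then have "dd v e a0 = 0" by (rule dd_eq_0[OF vi empty_subsetI, rotated]) simp
        then show False using a0(2) by simp
      qed
      then have one: "1 \<in> {1..<L + 1}" by simp
      then have "\<omega> 1 \<in> btw e v" using \<omega>I(1) by blast
      then have "dd (\<omega> (L + 1)) (\<omega> 1) a0 \<noteq> 0" using dd_between_side a0(2) \<omega>1 by simp
      then have "O.pt (L + 1) \<noteq> None"
      proof (intro notI)
        assume "O.pt (L + 1) = None"
        from O.pt_None(2)[OF L1 this one, of a0] show False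
          using a0(1) \<omega>I(1) \<open>dd (\<omega> (L + 1)) (\<omega> 1) a0 \<noteq> 0\<close> by simp
      qed
      then obtain j0 where j0: "O.pt (L + 1) = Some j0" by auto
      note j0s = O.pt_Some[OF L1 j0]
      have j0L: "j0 \<in> {1..L}" using j0s(1) by auto
      have \<omega>j0: "\<omega> j0 \<in> btw e v" using j0s(1) \<omega>I(1) by blast
      have chain0: "\<sigma> j0 \<approx> v"
        using IH[OF \<omega> _ L1] j0 \<omega>1 \<omega>\<sigma>[OF j0L] mL unfolding O.chain_ok_def by auto
      have YY: "O.YT i = P.YT i" if "i \<in> {1..L}" for i
        using reorder_prefix(1)[OF O.tau P.tau, of L i] \<omega>\<sigma> that L1 by auto
      \<comment> \<open>The predecessor prime of \<open>v\<close> before \<open>e\<close> is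
        adjoined, taken from \<open>\<omega>\<close>. By the induction hypothesis its index lies in
        the class of \<open>v\<close>.\<close>
      define \<pi> where "\<pi> = P.YT j0"
      have \<pi>h: "hpp (subalg C (btw e v)) \<pi>" and \<pi>nz: "dd v e \<pi> \<noteq> 0"
        using j0s(2,3) YY[OF j0L] \<omega>1 \<omega>I(1) dd_between_side[OF \<omega>j0] by (auto simp: \<pi>_def)
      have j0n: "j0 \<in> idx C" "j0 \<in> {1..<m}" "j0 \<in> {1..<L + 1}" using j0L L1 mL by auto
      have \<pi>R: "\<pi> \<in> subalg C (btw e v)" using P.YT_in[OF j0n(3)] \<sigma>I(1) L1 by (auto simp: \<pi>_def)
      have \<pi>A: "\<pi> \<in> A" using \<pi>R subalg_mono[OF bi] by auto
      have \<sigma>j0: "\<sigma> j0 \<in> btw e v" using \<omega>j0 \<omega>\<sigma>[OF j0L] by simp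
      have dde: "dd e (\<sigma> i) = dd e v" if "\<sigma> i \<in> btw e v" for i
        using dd_between_side[of "\<sigma> i" v e] that by (simp add: btw_commute)
      have hppS: "hpp (subalg C (btw e v)) y" if y: "hpp (P.RT m) y" "y \<in> subalg C (btw e v)" "prime_elem y" for y
      proof -
        have mS: "m \<le> Suc n" using mn by simp
        obtain w where w: "wv w y" using P.T.hppD(2)[of m y] y(1) mS by auto
        have sb: "subalg C (btw e v) \<subseteq> P.RT m" using subalg_mono[of "btw e v" "insert e (btw e v)"] \<sigma>I(2) mL by auto
        have "hpp (P.RT (L + 1)) y"
        proof (rule P.hpp_RT_I[OF _ y(3) _ w])
          fix l assume "l \<in> {1..<L + 1}"
          then have "x (\<sigma> l) \<in> subalg C (btw e v)" using \<sigma>I(1) by (intro x_in) blast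
          then show "y dvd br y (x (\<sigma> l))" using P.T.hppD(3)[of m y "x (\<sigma> l)"] y(1) sb mS by auto
        qed (use y(2) \<sigma>I(1) L1 in auto)
        then show ?thesis using \<sigma>I(1) by simp
      qed
      have j'cases: "j' = L + 1 \<or> j' \<in> {1..L}" using js'(1) mL by auto
      show ?thesis
      proof (cases "P.pt (L + 1) = Some j0")
        case True
        \<comment> \<open>Otherwise \<open>j'\<close> would be the predecessor of \<open>v\<close>
          in \<open>\<omega>\<close> too, so its prime would be \<open>\<pi>\<close>. But
          \<open>\<pi>\<close> also precedes \<open>e\<close>, so it does not divide its image under
          the derivation of \<open>e\<close> and is not Poisson once \<open>x e\<close> is
          present.\<close>
        have "j' \<notin> {1..L}"
        proof
          assume j'L: "j' \<in> {1..L}"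
          have j'L1: "j' \<in> {1..<L + 1}" using j'L by auto
          have "hpp (subalg C (btw e v)) (P.YT j')"
            by (rule hppS[OF js'(2)]) (use P.YT_in[OF j'L1] \<sigma>I(1) L1 P.YT_prime[OF jn(2)] in auto)
          moreover have "dd v e (P.YT j') \<noteq> 0" using js'(3) side'[OF js'(1)] by (simp add: \<sigma>m)
          ultimately have "O.pt (L + 1) = Some j'"
            using O.pt_eqI[OF L1 j'L1, of j0] YY[OF j'L] \<omega>I(1) \<omega>1 dd_between_side[OF \<omega>j0] j0s(1) by simp
          then have "j' = j0" using j0 by simp
          then have h: "hpp (P.RT m) \<pi>" using js'(2) by (simp add: \<pi>_def)
          have "x e \<in> P.RT m" using \<sigma>I(2) mL by simp
          then have "\<pi> dvd br \<pi> (x e)" using P.T.hppD(3)[of m \<pi> "x e"] h mn by simp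
          also have "br \<pi> (x e) = - br (x e) \<pi>" by (rule br_anti) (use \<pi>A ei in auto)
          finally have "\<pi> dvd br (x e) \<pi>" by simp
          moreover have "br (x e) \<pi> = sg (if v < e then lie C e else hs e) \<pi> * x e + dd e v \<pi>" by (rule br_x_dd)
          moreover have "\<pi> dvd sg (if v < e then lie C e else hs e) \<pi> * x e"
            using sg_wv[OF \<pi>A] P.YT_wv[OF j0n(1)] by (simp add: \<pi>_def)
          ultimately have "\<pi> dvd dd e v \<pi>" using dvd_add_right_iff by metis
          then show False using P.pt_Some(4)[OF L1 True] dde[OF \<sigma>j0] \<sigma>1 by (simp add: \<pi>_def)
        qed
        then have "j' = L + 1" using j'cases by blast
        moreover have "\<sigma> j0 \<approx> e"
          using IH[OF \<sigma> _ L1] True \<sigma>1 mL unfolding P.chain_ok_def by auto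
        ultimately show ?thesis using \<sigma>1 chain0 lkeq_sym lkeq_trans by metis
      next
        case False
        \<comment> \<open>As \<open>\<pi>\<close> does not precede \<open>e\<close>, the derivation
          of \<open>e\<close> kills it. It therefore remains a Poisson prime after adjoining
          \<open>x e\<close>, and is the predecessor prime of \<open>v\<close> in
          \<open>\<sigma>\<close>.\<close>
        have dz: "dd e v \<pi> = 0"
        proof (cases "P.pt (L + 1)")
          case None
          then show ?thesis
            using P.pt_None(2)[OF L1 None j0n(3), of \<pi>] \<pi>R \<sigma>I(1) \<sigma>1 dde[OF \<sigma>j0] by simp
        next
          case (Some i)
          show ?thesis
          proof (rule ccontr)
            assume "dd e v \<pi> \<noteq> 0"
            then have "P.pt (L + 1) = Some j0"
              using P.pt_eqI[OF L1 j0n(3), of j0] \<pi>h \<sigma>I(1) \<sigma>1 dde[OF \<sigma>j0] j0n(3) by (simp add: \<pi>_def)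
            then show False using False by simp
          qed
        qed
        have dv: "\<pi> dvd br \<pi> (x (\<sigma> l))" if "l \<in> {1..<m}" for l
        proof -
          have "\<sigma> l \<in> insert e (btw e v)" using that \<sigma>I(2) mL by blast
          then show ?thesis
          proof
            assume "\<sigma> l = e"
            then have "br \<pi> (x (\<sigma> l)) = - (sg (if v < e then lie C e else hs e) \<pi> * x e)"
              using br_anti[OF \<pi>A, of "x e"] ei br_x_dd[of e \<pi> v] dz by simp
            then show ?thesis using sg_wv[OF \<pi>A] P.YT_wv[OF j0n(1)] by (simp add: \<pi>_def)
          next
            assume "\<sigma> l \<in> btw e v"
            then show ?thesis
              using P.T.hppD(3)[of "L + 1" \<pi> "x (\<sigma> l)"] \<pi>h \<sigma>I(1) L1 by simp
          qed
        qed
        have mS: "m \<le> Suc n" using mn by simp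
        have "hpp (P.RT m) \<pi>"
          using P.hpp_RT_I[OF mS P.YT_prime[OF j0n(1)] P.YT_in[OF j0n(2) mS] P.YT_wv[OF j0n(1)]] dv
          unfolding \<pi>_def by blast
        then have "P.pt m = Some j0"
          using P.pt_eqI[OF mn j0n(2), of j0] \<pi>nz side'[OF j0n(2)] j0n(2) by (simp add: \<pi>_def \<sigma>m)
        then show ?thesis using j' chain0 by simp
      qed
    qed
    then show "\<tau> j \<approx> \<tau> m" using step1 lkeq_trans unfolding v_def by blast
  qed
qed

text \<open>Of two such indices the one nearer to \<open>v\<close> lies between the other and
  \<open>v\<close>, where the derivation of \<open>v\<close> vanishes, yet it is moved by
  it.\<close>

lemma (in sym) lnk_unique_left: "lnk u v \<Longrightarrow> lnk u' v \<Longrightarrow> u = u'"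
proof -
  have *: "\<not> (lnk u v \<and> lnk u' v \<and> u < u')" for u u'
  proof
    assume h: "lnk u v \<and> lnk u' v \<and> u < u'"
    then have "u' \<in> btw u v" by (auto simp: lnk_def btw_def)
    then have "dd v u (x u') = 0" using h by (simp add: lnk_def)
    moreover have "dd v u = dd v u'" by (rule dd_side) (use h in \<open>simp add: lnk_def\<close>)
    ultimately show False using h by (simp add: lnk_def)
  qed
  assume "lnk u v" "lnk u' v"
  then show ?thesis using *[of u u'] *[of u' u] by (metis linorder_neqE_nat)
qed

lemma (in sym) lnk_unique_right: "lnk u v \<Longrightarrow> lnk u v' \<Longrightarrow> v = v'"
proof -
  have *: "\<not> (lnk u v \<and> lnk u v' \<and> v < v')" for v v'
  proof
    assume h: "lnk u v \<and> lnk u v' \<and> v < v'"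
    then have uv: "u \<in> idx C" "v \<in> idx C" "u < v" "dd v u (x u) \<noteq> 0" by (auto simp: lnk_def)
    have "v \<in> btw u v'" using h by (auto simp: lnk_def btw_def)
    then have "dd u v' (x v) = 0" using h by (simp add: lnk_def)
    moreover have "dd u v' = dd u v" by (rule dd_side) (use h in \<open>auto simp: lnk_def\<close>)
    ultimately show False using dd_x_swap[of v u] uv by simp
  qed
  assume "lnk u v" "lnk u v'"
  then show ?thesis using *[of v v'] *[of v' v] by (metis linorder_neqE_nat)
qed

context sym
begin

lemma lnk_less: "lnk u v \<Longrightarrow> u < v"
  by (simp add: lnk_def)

lemma lnk_idx: "lnk u v \<Longrightarrow> u \<in> idx C \<and> v \<in> idx C"
  by (simp add: lnk_def)

text \<open>Uniqueness on both sides makes \<open>lnk\<close> a disjoint union of chains, so two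
  equivalent indices are joined by a monotone path.\<close>

lemma lkeq_path: "u \<approx> v \<Longrightarrow> lnk\<^sup>*\<^sup>* u v \<or> lnk\<^sup>*\<^sup>* v u"
proof (induct rule: equivclp_induct)
  case (step y z)
  then consider "lnk\<^sup>*\<^sup>* u y" "lnk y z" | "lnk\<^sup>*\<^sup>* u y" "lnk z y" | "lnk\<^sup>*\<^sup>* y u" "lnk y z" | "lnk\<^sup>*\<^sup>* y u" "lnk z y"
    by blast
  then show ?case
  proof cases
    case 1
    then show ?thesis by (meson rtranclp.rtrancl_into_rtrancl)
  next
    case 2
    then show ?thesis
      by (cases rule: rtranclp.cases) (auto dest: lnk_unique_left)
  next
    case 3
    then show ?thesis
      by (cases rule: converse_rtranclpE) (auto dest: lnk_unique_right)
  next
    case 4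
    then show ?thesis by (meson converse_rtranclp_into_rtranclp)
  qed
qed simp

lemma path_le: "lnk\<^sup>*\<^sup>* u v \<Longrightarrow> u \<le> v"
  by (induct rule: rtranclp_induct) (auto dest: lnk_less)

lemma lkeq_less_path: "u \<approx> v \<Longrightarrow> u < v \<Longrightarrow> lnk\<^sup>*\<^sup>* u v"
  using lkeq_path[of u v] path_le[of v u] by auto

lemma path_lkeq: "lnk\<^sup>*\<^sup>* u v \<Longrightarrow> u \<approx> v"
  by (induct rule: rtranclp_induct) (auto intro: lkeq_trans lnk_lkeq)

lemma lkeq_below: assumes "u \<approx> v" "u < v" shows "\<exists>w. lnk w v \<and> u \<le> w \<and> w < v \<and> w \<approx> v"
proof -
  have "lnk\<^sup>*\<^sup>* u v" by (rule lkeq_less_path[OF assms])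
  then obtain w where w: "lnk\<^sup>*\<^sup>* u w" "lnk w v" using assms(2) by (cases rule: rtranclp.cases) auto
  then show ?thesis using path_le[OF w(1)] lnk_less[OF w(2)] lnk_lkeq[OF w(2)] by blast
qed

lemma lkeq_above: assumes "u \<approx> v" "u < v" shows "\<exists>w. lnk u w \<and> u < w \<and> w \<le> v \<and> u \<approx> w"
proof -
  have "lnk\<^sup>*\<^sup>* u v" by (rule lkeq_less_path[OF assms])
  then obtain w where w: "lnk u w" "lnk\<^sup>*\<^sup>* w v" using assms(2) by (cases rule: converse_rtranclpE) auto
  then show ?thesis using path_le[OF w(2)] lnk_less[OF w(1)] lnk_lkeq[OF w(1)] by blast
qed

end

context sym_tau
begin

lemma pt_lkeq: "m \<in> idx C \<Longrightarrow> pt m = Some j \<Longrightarrow> \<tau> j \<approx> \<tau> m"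
  using pred_linked[OF sym_tau_axioms] by (simp add: chain_ok_def)

text \<open>If \<open>m < m'\<close> had the same predecessor \<open>j\<close>, then
  \<open>YT j\<close> would be a Poisson prime of an algebra containing \<open>x (\<tau> m)\<close>,
  hence divide its own image under the derivation of \<open>\<tau> m\<close>, contrary to
  \<open>pt_Some\<close>.\<close>

lemma pt_inj:
  assumes m: "m \<in> idx C" "m' \<in> idx C" and p: "pt m = Some j" "pt m' = Some j"
  shows "m = m'"
proof -
  have *: "\<not> (m < m')" if m: "m \<in> idx C" "m' \<in> idx C" and p: "pt m = Some j" "pt m' = Some j" for m m'
  proof
    assume lt: "m < m'"
    note ps = pt_Some[OF m(1) p(1)]
    note ps' = pt_Some[OF m(2) p(2)]
    have jn: "j \<in> idx C" using ps(1) m by auto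
    have A: "YT j \<in> A" using YT_in[OF ps(1)] RT_A[of m] m by auto
    have xR: "x (\<tau> m) \<in> RT m'" using lt m by (intro x_in) auto
    have "YT j dvd br (YT j) (x (\<tau> m))"
      using T.hppD(3)[of m' "YT j" "x (\<tau> m)"] ps'(2) xR m by simp
    also have "br (YT j) (x (\<tau> m)) = - br (x (\<tau> m)) (YT j)"
      using br_anti[OF A, of "x (\<tau> m)"] Xi_idx[OF tau m(1)] by simp
    finally have "YT j dvd br (x (\<tau> m)) (YT j)" by (simp only: dvd_minus_iff)
    then have "YT j dvd sg (if \<tau> j < \<tau> m then lie C (\<tau> m) else hs (\<tau> m)) (YT j) * x (\<tau> m) + dd (\<tau> m) (\<tau> j) (YT j)"
      unfolding br_x_dd[of "\<tau> m" "YT j" "\<tau> j"] .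
    moreover have "YT j dvd sg (if \<tau> j < \<tau> m then lie C (\<tau> m) else hs (\<tau> m)) (YT j) * x (\<tau> m)"
      using sg_wv[OF A YT_wv[OF jn]] by simp
    ultimately have "YT j dvd dd (\<tau> m) (\<tau> j) (YT j)" using dvd_add_right_iff by blast
    then show False using ps(4) by simp
  qed
  show ?thesis using *[OF m p] *[OF m(2,1) p(2,1)] by simp
qed

text \<open>On the way from \<open>\<tau> m\<close> to \<open>\<tau> i\<close>, the chain neighbour
  of \<open>\<tau> m\<close> lies between the two or equals \<open>\<tau> i\<close>, so it belongs
  to the interval of earlier indices.\<close>

lemma pt_ex:
  assumes m: "m \<in> idx C" and i: "i \<in> {1..<m}" "\<tau> i \<approx> \<tau> m"
  shows "\<exists>j. pt m = Some j"
proof -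
  obtain a b where ab: "\<tau> ` {1..<m} = {a..b}" using Xi_interval[OF tau, of m] m by auto
  have ini: "\<tau> i \<in> \<tau> ` {1..<m}" "\<tau> m \<notin> \<tau> ` {1..<m}" using Xi_initial[OF tau m] i by auto
  have bt: "btw (\<tau> i) (\<tau> m) \<subseteq> \<tau> ` {1..<m}" by (rule initial_between[OF tau m ini(1)])
  have "\<exists>w\<in>\<tau> ` {1..<m}. lnk w (\<tau> m) \<or> lnk (\<tau> m) w"
  proof (cases "\<tau> i < \<tau> m")
    case True
    then obtain w where w: "lnk w (\<tau> m)" "\<tau> i \<le> w" "w < \<tau> m" using lkeq_below[OF i(2)] by blast
    then have "w = \<tau> i \<or> w \<in> btw (\<tau> i) (\<tau> m)" by (auto simp: btw_def)
    then show ?thesis using w ini bt by blast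
  next
    case False
    then have "\<tau> m < \<tau> i" using ini by (metis linorder_neqE_nat)
    then obtain w where w: "lnk (\<tau> m) w" "\<tau> m < w" "w \<le> \<tau> i" using lkeq_above[OF lkeq_sym[OF i(2)]] by blast
    then have "w = \<tau> i \<or> w \<in> btw (\<tau> i) (\<tau> m)" by (auto simp: btw_def)
    then show ?thesis using w ini bt by blast
  qed
  then have "pt m \<noteq> None" using pt_not_None_iff[OF m] by blast
  then show ?thesis by blast
qed

text \<open>Let \<open>l\<close> be the first position after \<open>j\<close> and before
  \<open>m\<close> in the class. Its predecessor exists and is \<open>j\<close>: a smaller one
  contradicts the induction hypothesis, a larger one the choice of \<open>l\<close>. But then
  \<open>l\<close> and \<open>m\<close> share a predecessor.\<close>

lemma pt_latest:
  assumes "m \<in> idx C" "pt m = Some j" "j < i" "i < m"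
  shows "\<not> \<tau> i \<approx> \<tau> m"
  using assms
proof (induct m arbitrary: j i rule: less_induct)
  case (less m)
  show ?case
  proof
    assume im: "\<tau> i \<approx> \<tau> m"
    define P where "P i \<longleftrightarrow> j < i \<and> i < m \<and> \<tau> i \<approx> \<tau> m" for i
    have "P i" using less im by (simp add: P_def)
    define l where "l = (LEAST i. P i)"
    have l: "P l" unfolding l_def using \<open>P i\<close> by (rule LeastI)
    have lmin: "l \<le> i" if "P i" for i unfolding l_def using that by (rule Least_le)
    have j: "j \<in> {1..<m}" "\<tau> j \<approx> \<tau> m" using pt_Some(1)[OF less.prems(1,2)] pt_lkeq[OF less.prems(1,2)] by auto
    have ln: "l \<in> idx C" "l < m" "j < l" using l less.prems(1) by (auto simp: P_def)
    have jl: "\<tau> j \<approx> \<tau> l" using l j(2) lkeq_trans lkeq_sym unfolding P_def by blast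
    obtain p where p: "pt l = Some p" using pt_ex[OF ln(1), of j] jl j ln by auto
    have pl: "p < l" "\<tau> p \<approx> \<tau> l" using pt_Some(1)[OF ln(1) p] pt_lkeq[OF ln(1) p] by auto
    have "p = j"
    proof (cases p j rule: linorder_cases)
      case less
      then show ?thesis using less.hyps[OF ln(2,1) p _ ln(3)] jl by blast
    next
      case greater
      then have "P p" using pl ln l lkeq_trans unfolding P_def by (meson order.strict_trans)
      then show ?thesis using lmin pl by fastforce
    qed
    then show False using pt_inj[OF ln(1) less.prems(1) p] less.prems(2) ln by simp
  qed
qed

text \<open>From here on the predecessors of every order are governed by the classes alone.\<close>

lemma pt_iff:
  assumes m: "m \<in> idx C"
  shows "pt m = Some j \<longleftrightarrow> j \<in> {1..<m} \<and> \<tau> j \<approx> \<tau> m \<and> (\<forall>i. j < i \<and> i < m \<longrightarrow> \<not> \<tau> i \<approx> \<tau> m)"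
proof
  assume p: "pt m = Some j"
  then show "j \<in> {1..<m} \<and> \<tau> j \<approx> \<tau> m \<and> (\<forall>i. j < i \<and> i < m \<longrightarrow> \<not> \<tau> i \<approx> \<tau> m)"
    using pt_Some(1)[OF m p] pt_lkeq[OF m p] pt_latest[OF m p] by blast
next
  assume h: "j \<in> {1..<m} \<and> \<tau> j \<approx> \<tau> m \<and> (\<forall>i. j < i \<and> i < m \<longrightarrow> \<not> \<tau> i \<approx> \<tau> m)"
  then obtain j' where j': "pt m = Some j'" using pt_ex[OF m] by blast
  have "j' \<in> {1..<m}" "\<tau> j' \<approx> \<tau> m" using pt_Some(1)[OF m j'] pt_lkeq[OF m j'] by auto
  then have "j' = j" using h pt_latest[OF m j', of j] by (metis atLeastLessThan_iff linorder_neqE_nat)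
  then show "pt m = Some j" using j' by simp
qed

end

context sym
begin

lemma Xi_id: "id \<in> Xi n"
  by (auto simp: Xi_def intro: permutes_id)

lemma reorder_id: "reorder C hs id = C"
proof -
  have "tau_minus n id = {}" by (auto simp: tau_minus_def)
  then show ?thesis by (simp add: reorder_def)
qed

lemma sym_tau_id: "sym_tau C hs id"
  by unfold_locales (rule Xi_id)

lemma pred_eq_Some_iff: "v \<in> idx C \<Longrightarrow> pred C v = Some u \<longleftrightarrow> lnk u v"
proof -
  assume v: "v \<in> idx C"
  have iff: "pred C v = Some u \<longleftrightarrow> u \<in> {1..<v} \<and> u \<approx> v \<and> (\<forall>i. u < i \<and> i < v \<longrightarrow> \<not> i \<approx> v)"
    using sym_tau.pt_iff[OF sym_tau_id, of v u] v by (simp add: reorder_id)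
  show ?thesis
  proof
    assume "pred C v = Some u"
    then have u: "u < v" "u \<approx> v" "\<forall>i. u < i \<and> i < v \<longrightarrow> \<not> i \<approx> v" using iff by auto
    obtain w where w: "lnk w v" "u \<le> w" "w < v" "w \<approx> v" using lkeq_below[OF u(2,1)] by blast
    then have "w = u" using u(3) by (metis le_neq_implies_less)
    then show "lnk u v" using w by simp
  next
    assume lk: "lnk u v"
    have "\<not> i \<approx> v" if i: "u < i" "i < v" for i
    proof
      assume "i \<approx> v"
      then obtain w where "lnk w v" "i \<le> w" using lkeq_below i by blast
      then show False using lnk_unique_left[OF lk] i by auto
    qed
    then show "pred C v = Some u"
      using iff lnk_less[OF lk] lnk_idx[OF lk] lnk_lkeq[OF lk] by auto
  qed
qed

lemma succ_eq_Some_iff: "succ C u = Some v \<longleftrightarrow> lnk u v"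
proof
  assume s: "succ C u = Some v"
  then obtain k where k: "k \<in> idx C" "pred C k = Some u" by (auto simp: succ_def split: if_splits)
  have "(THE k. k \<in> idx C \<and> pred C k = Some u) = k"
    by (rule the_equality) (use k pred_eq_Some_iff lnk_unique_right in blast)+
  then have "v = k" using s k by (auto simp: succ_def split: if_splits)
  then show "lnk u v" using k pred_eq_Some_iff by blast
next
  assume lk: "lnk u v"
  then have v: "v \<in> idx C" "pred C v = Some u" using lnk_idx pred_eq_Some_iff by blast+
  have "(THE k. k \<in> idx C \<and> pred C k = Some u) = v"
    by (rule the_equality) (use v pred_eq_Some_iff lnk_unique_right in blast)+
  then show "succ C u = Some v" using v by (auto simp: succ_def)
qed

lemma level_set_eq: "level_set C j = {i \<in> idx C. j \<approx> i}"
proof -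
  have "(\<lambda>a b. a \<in> idx C \<and> succ C a = Some b) = lnk"
    using lnk_idx by (auto simp: fun_eq_iff succ_eq_Some_iff)
  then show ?thesis by (simp add: level_set_def)
qed

lemma ex_iff: "j \<in> ex C \<longleftrightarrow> (\<exists>v. lnk j v)"
  using succ_eq_Some_iff lnk_idx by (auto simp: ex_def)

end

lemma (in sym_tau) succ_T_iff:
  assumes j: "j \<in> idx C"
  shows "succ CT j = Some m \<longleftrightarrow> m \<in> idx C \<and> pt m = Some j"
proof -
  have the: "(THE k. k \<in> idx C \<and> pt k = Some j) = k" if "k \<in> idx C" "pt k = Some j" for k
    by (rule the_equality) (use that pt_inj in blast)+
  have su: "succ CT j = (if \<exists>k\<in>idx C. pt k = Some j then Some (THE k. k \<in> idx C \<and> pt k = Some j) else None)"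
    by (simp add: succ_def)
  show ?thesis
  proof
    assume s: "succ CT j = Some m"
    then obtain k where k: "k \<in> idx C" "pt k = Some j" using su by (metis option.distinct(1))
    then have "succ CT j = Some k" using su the[OF k] by (metis (no_types, lifting))
    then show "m \<in> idx C \<and> pt m = Some j" using s k by simp
  next
    assume m: "m \<in> idx C \<and> pt m = Some j"
    then show "succ CT j = Some m" using su the[of m] by (metis (no_types, lifting))
  qed
qed

section \<open>The eigenvalues attached to the indices of one level set\<close>

section \<open>Relations between the eigenvalues\<close>

context sym
begin

lemma wv_dd:
  assumes v: "v \<in> idx C" and a: "a \<in> A" "wv w a"
  shows "wv (w + wt C v) (dd v u a)"
proof -
  have xA: "x v \<in> A" using v by simp
  have "wv (w + wt C v) (br (x v) a)"
    using wv_br[OF wv_gen[OF v] a(2) xA a(1)] by (simp add: add.commute)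
  moreover have "wv (w + wt C v) (sg h a * x v)" for h
    unfolding sg_wv[OF a] mult.assoc by (intro wv_scale wv_mult a wv_gen[OF v] xA subalg_ring)
  ultimately show ?thesis
    unfolding dd_def D_def using a(1) xA by (intro wv_diff br_in subalg_ring sg_in)
qed

text \<open>With \<open>y\<close> the prime preceding \<open>x u\<close> and \<open>x w\<close> in the algebra between them
  (\<open>y = 1\<close> if there is none), consider \<open>yu\<close>, \<open>yw\<close> and \<open>yuw\<close>, the next primes after adjoining
  \<open>x u\<close>, \<open>x w\<close> or both. The element \<open>y * yuw - yu * yw\<close> lies in the algebra between \<open>u\<close> and \<open>w\<close> and is
  normal there; bracketing it with itself gives the relation.\<close>

lemma lam_relation:
  assumes uw: "u < w" "u \<approx> w" and u: "u \<in> idx C" and w: "w \<in> idx C"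
  shows "lam C w = - char_diff (wt C u) (hs u)"
proof -
  have ne: "u \<noteq> w" "w \<noteq> u" using uw by auto
  obtain \<sigma> L where \<sigma>: "sym_tau C hs \<sigma>" and L: "L = max u w - min u w - 1"
    and \<sigma>L: "\<forall>j\<in>{1..L}. \<sigma> j = min u w + j" and \<sigma>1: "\<sigma> (L + 1) = u" and \<sigma>2: "\<sigma> (L + 2) = w"
    and Ln: "L + 2 \<in> idx C" and \<sigma>I: "\<sigma> ` {1..<L + 1} = btw u w" "\<sigma> ` {1..<L + 2} = insert u (btw u w)"
    using order_between[OF u w ne(1)] by (elim exE conjE) (rule that)
  obtain \<omega> L' where \<omega>: "sym_tau C hs \<omega>" and L': "L' = max w u - min w u - 1"
    and \<omega>L: "\<forall>j\<in>{1..L'}. \<omega> j = min w u + j" and \<omega>1: "\<omega> (L' + 1) = w" and "\<omega> (L' + 2) = u"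
    and "L' + 2 \<in> idx C" and \<omega>I: "\<omega> ` {1..<L' + 1} = btw w u" and "\<omega> ` {1..<L' + 2} = insert w (btw w u)"
    using order_between[OF w u ne(2)] by (elim exE conjE) (rule that)
  have LL: "L' = L" unfolding L L' by (simp only: max.commute min.commute)
  note \<omega>1 = \<omega>1[unfolded LL] and \<omega>I = \<omega>I[unfolded LL btw_commute[of w u]]
  have \<omega>\<sigma>: "\<omega> j = \<sigma> j" if "j \<in> {1..L}" for j
    using \<omega>L \<sigma>L that unfolding LL min.commute[of w u] by simp
  interpret P: sym_tau C hs \<sigma> by (rule \<sigma>)
  interpret O: sym_tau C hs \<omega> by (rule \<omega>)
  have L1: "L + 1 \<in> idx C" using Ln by auto
  define S where "S = subalg C (btw u w)"
  have bi: "btw u w \<subseteq> idx C" by (rule btw_idx[OF u w])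
  have SA: "S \<subseteq> A" unfolding S_def by (rule subalg_mono[OF bi])
  have A: "x u \<in> A" "x w \<in> A" using u w by auto
  define hw where "hw = lie C w" define hu where "hu = hs u"
  define \<delta>u where "\<delta>u = dd u w" define \<delta>w where "\<delta>w = dd w u"
  have bu: "br (x u) a = sg hu a * x u + \<delta>u a" for a
    using br_x_dd[of u a w] uw by (simp add: \<delta>u_def hu_def)
  have bw: "br (x w) a = sg hw a * x w + \<delta>w a" for a
    using br_x_dd[of w a u] uw by (simp add: \<delta>w_def hw_def)
  have du: "drv A \<delta>u" and dw: "drv A \<delta>w" unfolding \<delta>u_def \<delta>w_def using drv_dd u w by auto
  have dS: "\<delta>w a \<in> S" if "a \<in> S" for a
    unfolding S_def \<delta>w_def
  proof (rule dd_in[OF w bi btw_notin(2)])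
    show "i < w \<longleftrightarrow> u < w" if "i \<in> btw u w" for i using that by (rule btw_side)
    show "btw i w \<subseteq> btw u w" if "i \<in> btw u w" for i using that uw by (auto simp: btw_def)
  qed (use that S_def in simp)
  have dxu: "\<delta>w (x u) \<in> S" using dd_x_in[OF w u ne(1)] by (simp add: \<delta>w_def S_def)
  have sgS: "sg h a \<in> S" if "a \<in> S" for a h using sg_in that by (simp add: S_def)
  have ddu: "dd u (\<sigma> j) = \<delta>u" if "\<sigma> j \<in> btw u w" for j
    using dd_between_side[of "\<sigma> j" w u] that by (simp add: \<delta>u_def btw_commute)
  have ddw: "dd w (\<omega> j) = \<delta>w" if "\<omega> j \<in> btw u w" for j
    using dd_between_side[of "\<omega> j" u w] that by (simp add: \<delta>w_def)
  \<comment> \<open>\<open>u\<close> and \<open>w\<close> are equivalent and follow the same initial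
    segment, so by \<open>pt_iff\<close> they have the same predecessor.\<close>
  have same: "P.pt (L + 1) = Some j \<longleftrightarrow> O.pt (L + 1) = Some j" for j
  proof -
    have E: "\<sigma> i \<approx> u \<longleftrightarrow> \<omega> i \<approx> w" if "i \<in> {1..<L + 1}" for i
    proof -
      have "\<omega> i = \<sigma> i" using \<omega>\<sigma>[of i] that by auto
      then show ?thesis using uw(2) by (auto intro: lkeq_trans dest: lkeq_sym)
    qed
    show ?thesis
    proof (cases "j \<in> {1..<L + 1}")
      case True
      then have "i \<in> {1..<L + 1}" if "j < i" "i < L + 1" for i using that by auto
      with E True show ?thesis unfolding P.pt_iff[OF L1] O.pt_iff[OF L1] \<sigma>1 \<omega>1 by blast
    next
      case False
      then show ?thesis unfolding P.pt_iff[OF L1] O.pt_iff[OF L1] by blast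
    qed
  qed
  define lu where "lu = lam P.CT (L + 1)" define lw where "lw = lam O.CT (L + 1)"
  obtain y wy A0 where y: "y \<in> S" "y \<noteq> 0" "wv wy y"
    and A0: "A0 \<in> S" and yu: "P.YT (L + 1) = y * x u + A0"
    and yw: "O.YT (L + 1) = y * x w - Const (1 / lw) * \<delta>w y"
    and YpE: "P.T.Yp (L + 1) = y"
    and ru: "\<And>a. a \<in> S \<Longrightarrow> y * br (P.YT (L + 1)) a = P.YT (L + 1) * (br y a + y * sg hu a)"
    and rw: "\<And>a. a \<in> S \<Longrightarrow> y * br (O.YT (L + 1)) a = O.YT (L + 1) * (br y a + y * sg hw a)"
  proof (cases "P.pt (L + 1)")
    case None
    then have None': "O.pt (L + 1) = None" using same by (cases "O.pt (L + 1)") auto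
    have z: "\<delta>w 1 = 0" using drv_1[OF A_eq dw] .
    have zu: "\<delta>u a = 0" if "a \<in> S" for a
    proof (cases "L = 0")
      case True
      then have "btw u w = {}" using \<sigma>I(1) by simp
      then have "a \<in> subalg C {}" using that unfolding S_def by simp
      then show ?thesis unfolding \<delta>u_def by (rule dd_eq_0[OF u empty_subsetI, rotated]) simp
    next
      case False
      then have 1: "1 \<in> {1..<L + 1}" by simp
      then have \<sigma>1b: "\<sigma> 1 \<in> btw u w" using \<sigma>I(1) by blast
      have "a \<in> P.RT (L + 1)" using that unfolding S_def \<sigma>I(1) .
      then have "dd u (\<sigma> 1) a = 0" by (rule P.pt_None(2)[OF L1 None 1, unfolded \<sigma>1])
      then show ?thesis unfolding ddu[OF \<sigma>1b] .
    qed
    have zw: "\<delta>w a = 0" if "a \<in> S" for a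
    proof (cases "L = 0")
      case True
      then have "btw u w = {}" using \<sigma>I(1) by simp
      then have "a \<in> subalg C {}" using that unfolding S_def by simp
      then show ?thesis unfolding \<delta>w_def by (rule dd_eq_0[OF w empty_subsetI, rotated]) simp
    next
      case False
      then have 1: "1 \<in> {1..<L + 1}" by simp
      then have \<omega>1b: "\<omega> 1 \<in> btw u w" using \<omega>I by blast
      have "a \<in> O.RT (L + 1)" using that unfolding S_def \<omega>I .
      then have "dd w (\<omega> 1) a = 0" by (rule O.pt_None(2)[OF L1 None' 1, unfolded \<omega>1])
      then show ?thesis unfolding ddw[OF \<omega>1b] .
    qed
    show thesis
    proof (rule that[of 1 0 0])
      show "P.YT (L + 1) = 1 * x u + 0" using P.pt_None(1)[OF L1 None] \<sigma>1 by simp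
      show "O.YT (L + 1) = 1 * x w - Const (1 / lw) * \<delta>w 1" using O.pt_None(1)[OF L1 None'] \<omega>1 z by simp
      show "P.T.Yp (L + 1) = 1" using None by (simp add: P.T.Yp_def)
      show "1 * br (P.YT (L + 1)) a = P.YT (L + 1) * (br 1 a + 1 * sg hu a)" if "a \<in> S" for a
        using P.pt_None(1)[OF L1 None] \<sigma>1 bu[of a] zu[OF that] br_1_left[of a] that SA by (auto simp: mult.commute)
      show "1 * br (O.YT (L + 1)) a = O.YT (L + 1) * (br 1 a + 1 * sg hw a)" if "a \<in> S" for a
        using O.pt_None(1)[OF L1 None'] \<omega>1 bw[of a] zw[OF that] br_1_left[of a] that SA by (auto simp: mult.commute)
    qed (auto simp: S_def wv_1)
  next
    case (Some j)
    have Some': "O.pt (L + 1) = Some j" using same Some by blast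
    note ps = P.pt_Some[OF L1 Some] and os = O.pt_Some[OF L1 Some']
    have jL: "j \<in> {1..L}" and jn: "j \<in> idx C" using ps(1) L1 by auto
    have YY: "O.YT j = P.YT j" using reorder_prefix(1)[OF O.tau P.tau, of L j] \<omega>\<sigma> jL L1 by auto
    have \<sigma>j: "\<sigma> j \<in> btw u w" using ps(1) \<sigma>I(1) by blast
    have \<omega>j: "\<omega> j \<in> btw u w" using os(1) \<omega>I by blast
    have yS: "P.YT j \<in> S" using P.YT_in[OF ps(1)] \<sigma>I(1) L1 by (auto simp: S_def)
    have duS: "\<delta>u a \<in> S" if "a \<in> S" for a
      unfolding S_def \<delta>u_def
    proof (rule dd_in[OF u bi btw_notin(1)])
      show "i < u \<longleftrightarrow> w < u" if "i \<in> btw u w" for i using that uw by (auto simp: btw_def)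
      show "btw i u \<subseteq> btw u w" if "i \<in> btw u w" for i using that uw by (auto simp: btw_def)
    qed (use that S_def in simp)
    have LJ: "L + 1 \<in> {1..<Suc (len P.CT)}" "L + 1 \<in> {1..<Suc (len O.CT)}" using L1 by auto
    have "1 \<in> {1..<L + 1}" using jL by auto
    then have one: "\<sigma> 1 \<in> btw u w" "\<omega> 1 \<in> btw u w" using \<sigma>I(1) \<omega>I by blast+
    have lieP: "lie P.CT (L + 1) = hu"
      using \<sigma>1 one L1 uw jL
      by (auto simp: reorder_def tau_minus_def hu_def btw_def)
    have lieO: "lie O.CT (L + 1) = hw"
      using \<omega>1 one L1 uw jL
      by (auto simp: reorder_def tau_minus_def hw_def btw_def)
    show thesis
    proof (rule that[of "P.YT j" "weight_of C (P.YT j)" "- (Const (1 / lu) * \<delta>u (P.YT j))"])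
      show "P.YT j \<in> S" "P.YT j \<noteq> 0" "wv (weight_of C (P.YT j)) (P.YT j)"
        using yS P.YT_prime[OF jn] P.YT_wv[OF jn] by auto
      show "- (Const (1 / lu) * \<delta>u (P.YT j)) \<in> S" using duS[OF yS] by (simp add: S_def)
      show "P.YT (L + 1) = P.YT j * x u + - (Const (1 / lu) * \<delta>u (P.YT j))"
        using ps(6) ddu[OF \<sigma>j] \<sigma>1 by (simp add: lu_def)
      show "O.YT (L + 1) = P.YT j * x w - Const (1 / lw) * \<delta>w (P.YT j)"
        using os(6) ddw[OF \<omega>j] \<omega>1 YY by (simp add: lw_def)
      show "P.T.Yp (L + 1) = P.YT j" using Some by (simp add: P.T.Yp_def)
      fix a assume a: "a \<in> S"
      have aA: "a \<in> A" using a SA by blast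
      show "P.YT j * br (P.YT (L + 1)) a = P.YT (L + 1) * (br (P.YT j) a + P.YT j * sg hu a)"
        using P.T.F.br_Y_rel[OF LJ(1), of a] a \<sigma>I(1) Some lieP P.sg_T[OF aA] by (simp add: S_def P.T.Yp_def)
      show "P.YT j * br (O.YT (L + 1)) a = O.YT (L + 1) * (br (P.YT j) a + P.YT j * sg hw a)"
        using O.T.F.br_Y_rel[OF LJ(2), of a] a \<omega>I Some' lieO O.sg_T[OF aA] YY by (simp add: S_def O.T.Yp_def)
    qed
  qed
  define Yu where "Yu = P.YT (L + 1)" define Yw where "Yw = O.YT (L + 1)" define Yuw where "Yuw = P.YT (L + 2)"
  have "P.pt (L + 2) = Some (L + 1)"
    unfolding P.pt_iff[OF Ln] \<sigma>1 \<sigma>2 using uw(2) by auto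
  note pu = P.pt_Some[OF Ln this]
  have LJ: "L + 2 \<in> {1..<Suc (len P.CT)}" using Ln by auto
  define lx where "lx = lam P.CT (L + 2)"
  have lx0: "lx \<noteq> 0" using P.T.lam_neq_0[of "L + 2"] Ln by (simp add: lx_def)
  have lie2: "lie P.CT (L + 2) = hw"
    using \<sigma>1 \<sigma>2 Xi_side[OF P.tau, of "L + 2" 1 "L + 1"] Ln uw by (auto simp: reorder_def tau_minus_def hw_def)
  have lxw: "lx = lam C w" unfolding lx_def lam_def reorder_simps lie2 \<sigma>2 hw_def ..
  have lo: "lie O.CT (L + 1) = hw"
  proof (cases "L = 0")
    case True
    then show ?thesis using \<omega>1 by (simp add: reorder_def tau_minus_def hw_def)
  next
    case False
    then have "1 \<in> {1..<L + 1}" by simp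
    then have "\<omega> 1 \<in> btw u w" using \<omega>I by blast
    then show ?thesis using \<omega>1 uw by (auto simp: reorder_def tau_minus_def hw_def btw_def)
  qed
  have lw: "lw = lx"
    unfolding lw_def lx_def lam_def reorder_simps lie2 lo \<omega>1 \<sigma>2 ..
  have yA: "y \<in> A" "A0 \<in> A" "\<delta>w y \<in> A" "\<delta>w A0 \<in> A" using y(1) A0 dS SA by auto
  have YA: "Yu \<in> A" "Yw \<in> A" using yA A by (auto simp: Yu_def Yw_def yu yw)
  have Yuw: "Yuw = Yu * x w - Const (1 / lx) * \<delta>w Yu"
    unfolding Yuw_def Yu_def lx_def \<delta>w_def using pu(6) unfolding \<sigma>1 \<sigma>2 .
  have dYu: "\<delta>w Yu = \<delta>w y * x u + (y * \<delta>w (x u) + \<delta>w A0)"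
    unfolding Yu_def yu using yA A by (simp add: drv_add[OF dw] drv_mult[OF dw])
  have dYuA: "\<delta>w Yu \<in> A" unfolding dYu using yA A dxu SA by (intro subalg_ring) auto
  have YuwA: "Yuw \<in> A" unfolding Yuw using YA A dYuA by simp
  define \<gamma> where "\<gamma> = y * Yuw - Yu * Yw"
  have "\<gamma> = Const (1 / lx) * (Yu * \<delta>w y - y * \<delta>w Yu)"
    unfolding \<gamma>_def Yuw Yw_def yw lw by (simp add: algebra_simps)
  also have "Yu * \<delta>w y - y * \<delta>w Yu = A0 * \<delta>w y - y * (y * \<delta>w (x u) + \<delta>w A0)"
    unfolding dYu unfolding Yu_def yu by (simp add: algebra_simps)
  finally have "\<gamma> = Const (1 / lx) * (A0 * \<delta>w y - y * (y * \<delta>w (x u) + \<delta>w A0))" .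
  then have \<gamma>S: "\<gamma> \<in> S" using dS dxu y(1) A0 unfolding S_def by simp
  have pr: "prime_elem Yuw" using P.YT_prime[OF Ln] by (simp add: Yuw_def)
  have Yu0: "Yu \<noteq> 0" and Yw0: "Yw \<noteq> 0" using P.YT_prime[OF L1] O.YT_prime[OF L1] by (auto simp: Yu_def Yw_def)
  \<comment> \<open>If it vanished, the prime \<open>Yuw\<close> would divide \<open>Yu\<close> or
    \<open>Yw\<close>. But it is linear in \<open>x w\<close> with coefficient \<open>Yu\<close>,
    and linear in \<open>x u\<close> with coefficient \<open>Yw\<close>.\<close>
  have \<gamma>0: "\<gamma> \<noteq> 0"
  proof
    assume "\<gamma> = 0"
    then have "Yuw dvd Yu * Yw" unfolding \<gamma>_def right_minus_eq by (metis dvd_triv_right)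
    then consider "Yuw dvd Yu" | "Yuw dvd Yw" using prime_elem_dvd_multD[OF pr] by blast
    then show False
    proof cases
      case 1
      have K: "insert u (btw u w) \<subseteq> idx C" "w \<notin> insert u (btw u w)" using bi u ne btw_notin by auto
      have sb: "S \<subseteq> subalg C (insert u (btw u w))" unfolding S_def by (rule subalg_mono) auto
      have YuK: "Yu \<in> subalg C (insert u (btw u w))" unfolding Yu_def yu using y(1) A0 sb by (intro subalg_ring x_in) auto
      have nq: "- (Const (1 / lx) * \<delta>w Yu) \<in> subalg C (insert u (btw u w))"
        unfolding dYu using dS dxu y(1) A0 sb by (intro subalg_ring x_in) auto
      then show False
        using linear_not_dvd[OF w K(2,1) YuK Yu0 nq YuK Yu0] 1 unfolding Yuw by simp
    next
      case 2
      have K: "insert w (btw u w) \<subseteq> idx C" "u \<notin> insert w (btw u w)" using bi w ne btw_notin by auto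
      have sb: "S \<subseteq> subalg C (insert w (btw u w))" unfolding S_def by (rule subalg_mono) auto
      have YwK: "Yw \<in> subalg C (insert w (btw u w))" unfolding Yw_def yw using y(1) dS sb by (intro subalg_ring x_in) auto
      define q where "q = A0 * x w - Const (1 / lx) * (y * \<delta>w (x u) + \<delta>w A0)"
      have "q \<in> subalg C (insert w (btw u w))"
        unfolding q_def using dS dxu y(1) A0 sb by (intro subalg_ring x_in) auto
      moreover have "Yuw = Yw * x u + q"
        unfolding Yuw dYu unfolding q_def Yw_def yw lw Yu_def yu by (simp add: algebra_simps)
      ultimately show False
        using linear_not_dvd[OF u K(2,1) YwK Yw0 _ YwK Yw0] 2 by simp
    qed
  qed
  have ruw: "Yu * br Yuw a = Yuw * (br Yu a + Yu * sg hw a)" if a: "a \<in> S" for a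
  proof -
    have aA: "a \<in> A" using a SA by blast
    have "a \<in> subalg C (insert u (btw u w))" using a subalg_mono[of "btw u w" "insert u (btw u w)"] by (auto simp: S_def)
    then show ?thesis
      using P.T.F.br_Y_rel[OF LJ, of a] \<sigma>I(2) \<open>P.pt (L + 2) = Some (L + 1)\<close> lie2 P.sg_T[OF aA]
      by (simp add: P.T.Yp_def Yuw_def Yu_def)
  qed
  define h where "h = hu + hw"
  have sgh: "sg h a = sg hu a + sg hw a" if "a \<in> A" "wv v a" for a v
    by (simp add: sg_wv[OF that] h_def char_diff_add_right Const_add distrib_right)
  \<comment> \<open>Both products in \<open>\<gamma>\<close> obey the same bracket rule, since each
    collects the twists by \<open>hu\<close> and \<open>hw\<close> once and the bracket with
    \<open>y\<close> twice; hence so does their difference.\<close>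
  have \<gamma>rel: "y * br \<gamma> a = \<gamma> * (2 * br y a + y * (sg hu a + sg hw a))" if a: "a \<in> S" for a
  proof -
    have aA: "a \<in> A" using a SA by blast
    have "Yu * (y * br (y * Yuw) a) = Yu * (y * Yuw) * br y a + y * y * (Yu * br Yuw a)"
      using br_mult_left[OF yA(1) YuwA aA] by (simp add: algebra_simps)
    also have "\<dots> = Yu * (y * Yuw) * br y a + y * Yuw * (y * br Yu a) + Yu * (y * y * Yuw * sg hw a)"
      unfolding ruw[OF a] by (simp add: algebra_simps)
    also have "\<dots> = Yu * (y * Yuw * (2 * br y a + y * (sg hu a + sg hw a)))"
      using ru[OF a] unfolding Yu_def[symmetric] by (simp add: algebra_simps)
    finally have 1: "y * br (y * Yuw) a = y * Yuw * (2 * br y a + y * (sg hu a + sg hw a))"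
      using Yu0 by simp
    have "y * br (Yu * Yw) a = Yw * (y * br Yu a) + Yu * (y * br Yw a)"
      using br_mult_left[OF YA aA] by (simp add: algebra_simps)
    also have "\<dots> = Yu * Yw * (2 * br y a + y * (sg hu a + sg hw a))"
      using ru[OF a] rw[OF a] unfolding Yu_def[symmetric] Yw_def[symmetric] by (simp add: algebra_simps)
    finally have 2: "y * br (Yu * Yw) a = Yu * Yw * (2 * br y a + y * (sg hu a + sg hw a))" .
    have "br \<gamma> a = br (y * Yuw) a - br (Yu * Yw) a"
      unfolding \<gamma>_def using yA YuwA YA aA by (intro br_diff_left) auto
    then have "y * br \<gamma> a = y * br (y * Yuw) a - y * br (Yu * Yw) a" by (simp add: right_diff_distrib)
    also have "\<dots> = (y * Yuw - Yu * Yw) * (2 * br y a + y * (sg hu a + sg hw a))"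
      unfolding 1 2 by (rule left_diff_distrib[symmetric])
    finally show ?thesis unfolding \<gamma>_def[symmetric] .
  qed
  have \<gamma>A: "\<gamma> \<in> A" using \<gamma>S SA by blast
  have w\<gamma>: "wv (wy + wy + wt C u + wt C w) \<gamma>"
  proof -
    have wYu: "wv (wy + wt C u) Yu"
    proof -
      have v: "wv (weight_of C Yu) Yu" using P.YT_wv[OF L1] by (simp add: Yu_def)
      have "P.T.F.W (L + 1) = P.T.F.Wp (L + 1) + wt C u"
        using P.T.F.W_eq[of "L + 1"] L1 \<sigma>1 by simp
      moreover have "P.T.F.Wp (L + 1) = wy"
      proof -
        show ?thesis
          using P.T.F.wv_Yp[of "L + 1"] L1 wv_unique[OF yA(1) y(2)] y(3) YpE by simp
      qed
      ultimately show ?thesis using v by (simp add: P.T.F.W_def Yu_def)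
    qed
    have wdy: "wv (wy + wt C w) (\<delta>w y)" unfolding \<delta>w_def by (rule wv_dd[OF w yA(1) y(3)])
    have wdYu: "wv (wy + wt C u + wt C w) (\<delta>w Yu)" unfolding \<delta>w_def by (rule wv_dd[OF w YA(1) wYu])
    have "wv (wy + (wy + wt C u + wt C w)) (y * Yuw)"
      unfolding Yuw using YA A dYuA yA wYu wdYu wv_gen[OF w] y(3)
      by (intro wv_mult wv_diff wv_scale subalg_ring) auto
    moreover have "wv ((wy + wt C u) + (wy + wt C w)) (Yu * Yw)"
      unfolding Yw_def yw using YA A yA wYu wdy wv_gen[OF w] y(3)
      by (intro wv_mult wv_diff wv_scale subalg_ring) auto
    ultimately show ?thesis
      unfolding \<gamma>_def using yA YuwA YA by (intro wv_diff) (auto simp: add_ac)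
  qed
  define \<eta> where "\<eta> = char_diff wy h"
  have "y * br \<gamma> y = y * (Const \<eta> * \<gamma> * y)"
    using \<gamma>rel[OF y(1)] sgh[OF yA(1) y(3)] sg_wv[OF yA(1) y(3), of h] br_self[OF yA(1)]
    by (simp add: \<eta>_def ac_simps)
  then have "br \<gamma> y = Const \<eta> * \<gamma> * y" using y(2) by simp
  then have by\<gamma>: "br y \<gamma> = - (Const \<eta> * \<gamma> * y)" using br_anti[OF yA(1) \<gamma>A] by simp
  \<comment> \<open>The rule at a = \<open>\<gamma>\<close>. With {\<open>y\<close>,
    \<open>\<gamma>\<close>} known it equates the weight of \<open>\<gamma>\<close> at
    \<open>h\<close> with twice that of \<open>y\<close>, so the weights of \<open>x u\<close> and
    \<open>x w\<close> at \<open>h\<close> add up to 0.\<close>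
  have "0 = \<gamma> * (2 * br y \<gamma> + y * sg h \<gamma>)"
    using \<gamma>rel[OF \<gamma>S] br_self[OF \<gamma>A] sgh[OF \<gamma>A w\<gamma>] by simp
  then have "0 = y * \<gamma> * (Const (char_diff (wy + wy + wt C u + wt C w) h) - 2 * Const \<eta>)"
    using \<gamma>0 by (simp add: by\<gamma> sg_wv[OF \<gamma>A w\<gamma>] algebra_simps)
  then have "Const (char_diff (wy + wy + wt C u + wt C w) h) = Const \<eta> + Const \<eta>"
    using y(2) \<gamma>0 by simp
  then have "char_diff (wt C u) h + char_diff (wt C w) h = 0"
    unfolding Const_add[symmetric] Const_eq_iff char_diff_add \<eta>_def by algebra
  moreover have "char_diff (wt C u) hw = - char_diff (wt C w) hu"
    using sym_wt[of w u] uw u w by (simp add: hw_def hu_def)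
  moreover have "lam C w + char_diff (wt C u) (hs u) = (char_diff (wt C u) h + char_diff (wt C w) h)
      - (char_diff (wt C u) hw + char_diff (wt C w) hu)"
    by (simp add: h_def char_diff_add_right lam_def hw_def hu_def algebra_simps)
  ultimately show ?thesis
    by (simp add: eq_neg_iff_add_eq_0)
qed

end

section \<open>Integral solutions of the equations in the coordinates x\<close>

section \<open>Integral solutions of the linear equations\<close>

context sym
begin

text \<open>The coefficient of \<open>x i * x j\<close> in the bracket of \<open>x i\<close> and \<open>x j\<close>.\<close>

definition qz :: "nat \<Rightarrow> nat \<Rightarrow> 'k" where
  "qz i j = (if i < j then - char_diff (wt C i) (lie C j) else if j < i then char_diff (wt C j) (lie C i) else 0)"

text \<open>By \<open>lam_relation\<close> all indices of a level set except its minimum have the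
  same \<open>lam\<close>; this is the common value, and for any level set the diagonal entry of
  \<open>Lam_bar_mat\<close>.\<close>

definition lamK :: "nat \<Rightarrow> 'k" where
  "lamK j = lam C (Max (level_set C j))"

text \<open>The equations for one GSV column in the x coordinates: a Laurent monomial of weight 0
  with exponent vector X whose coefficients against the generators, computed with \<open>qz\<close>,
  vanish except at \<open>a\<close> and \<open>b\<close>.\<close>

definition isol :: "(nat \<Rightarrow> 'k) \<Rightarrow> 'k \<Rightarrow> nat \<Rightarrow> nat \<Rightarrow> bool" where
  "isol X c a b \<longleftrightarrow> (\<forall>h. (\<Sum>l\<in>idx C. char_diff (wt C l) h * X l) = 0) \<and>
     (\<forall>i\<in>idx C. (\<Sum>l\<in>idx C. qz i l * X l) = - c * ((if i = a then 1 else 0) - (if i = b then 1 else 0)))"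

lemma qz_anti: "qz i j = - qz j i"
  by (simp add: qz_def)

text \<open>Row i of the sum consists of all weights evaluated at h_i. On vectors annihilated by the
  weights, \<open>nu_mat\<close> therefore acts as the negative of \<open>qz\<close>.\<close>

lemma qz_nu: "qz i j + nu_mat C i j = char_diff (wt C j) (lie C i)"
  by (simp add: qz_def nu_mat_def lam_def)

lemma lead_x: "lead (x l) (exv l)"
  by (simp add: lead_def gen_def Var_def)

text \<open>The bracket with \<open>x l\<close> differs from a weight derivation times
  \<open>x l\<close> only by a derivation that lowers exponents. So the leading monomial of
  \<open>\<theta>\<close> must have the eigenvalue \<open>c\<close>.\<close>

lemma lead_normal:
  assumes \<theta>: "\<theta> \<in> A" "lead \<theta> e" and l: "l \<in> idx C" and c: "br \<theta> (x l) = Const c * \<theta> * x l"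
  shows "(\<Sum>m\<in>idx C. of_nat (cf e (var C m)) * qz m l) = c"
proof -
  define \<phi> where "\<phi> = (\<lambda>v. qz (inv_into (idx C) (var C) v) l)"
  have \<phi>: "\<phi> (var C m) = qz m l" if "m \<in> idx C" for m
    using that by (simp add: \<phi>_def inv_into_f_f[OF var_inj])
  define d where "d = (\<lambda>a. br a (x l) - wder \<phi> a * x l)"
  have xl: "x l \<in> A" using l by simp
  have d: "drv A d"
    unfolding drv_def d_def
  proof (intro conjI ballI allI)
    fix a b assume a: "a \<in> A" "b \<in> A"
    show "br (a + b) (x l) - wder \<phi> (a + b) * x l = br a (x l) - wder \<phi> a * x l + (br b (x l) - wder \<phi> b * x l)"
      unfolding br_add_left[OF a xl] wder_add by algebra
    show "br (a * b) (x l) - wder \<phi> (a * b) * x l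
        = (br a (x l) - wder \<phi> a * x l) * b + a * (br b (x l) - wder \<phi> b * x l)"
      unfolding br_mult_left[OF a xl] wder_mult by algebra
  next
    fix c a assume a: "a \<in> A"
    show "br (Const c * a) (x l) - wder \<phi> (Const c * a) * x l = Const c * (br a (x l) - wder \<phi> a * x l)"
      unfolding br_scale_left[OF a xl] wder_scale by algebra
  qed
  have dx: "below (d (x i)) (rk (exv i) + rk (exv l))" if i: "i \<in> idx C" for i
  proof (cases "i = l")
    case True
    then show ?thesis using br_self[OF xl] \<phi>[OF l] by (simp add: d_def gen_def qz_def)
  next
    case False
    have xi: "x i \<in> A" using i by simp
    have "qz i l = - char_diff (wt C i) (if i < l then lie C l else hs l)"
      using False sym_wt[of i l] i l by (auto simp: qz_def)
    then have "d (x i) = - dd l i (x i)"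
      using br_anti[OF xi xl] br_x_dd[of l "x i" i] sg_x[OF i] \<phi>[OF i]
      by (simp add: d_def gen_def Const_minus algebra_simps)
    then show ?thesis using dd_x_below_rk[OF l i False] by (simp add: below_uminus)
  qed
  have "rk w \<le> rk e" if "w \<in> exps \<theta>" for w using \<theta>(2) that by (auto simp: lead_def)
  then have b: "below (d \<theta>) (rk e + rk (exv l))"
    using drv_below[OF d subset_refl dx \<theta>(1)] by blast
  define \<psi> where "\<psi> = Const c * \<theta> - wder \<phi> \<theta>"
  have d\<theta>: "d \<theta> = \<psi> * x l" by (simp add: d_def c \<psi>_def algebra_simps)
  have cf\<psi>: "cf \<psi> w = (c - wdot \<phi> w) * cf \<theta> w" for w
    by (simp add: \<psi>_def lookup_minus left_diff_distrib)
  have "wdot \<phi> e = c"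
  proof (rule ccontr)
    assume ne: "wdot \<phi> e \<noteq> c"
    have "w \<in> exps \<psi> \<longleftrightarrow> wdot \<phi> w \<noteq> c \<and> w \<in> exps \<theta>" for w
      unfolding in_keys_iff cf\<psi> by auto
    then have "lead \<psi> e" using \<theta>(2) ne unfolding lead_def by blast
    then have "lead (d \<theta>) (e + exv l)" unfolding d\<theta> by (intro lead_mult lead_x)
    then have "rk (e + exv l) < rk e + rk (exv l)" using b unfolding lead_def below_def by blast
    then show False by (simp add: rk_add)
  qed
  moreover have "exps e \<subseteq> var C ` idx C" using exps_A[OF \<theta>(1)] \<theta>(2) by (auto simp: lead_def)
  then have "wdot \<phi> e = (\<Sum>i\<in>var C ` idx C. of_nat (cf e i) * \<phi> i)" by (intro wdot_superset) auto
  ultimately show ?thesis using \<phi> by (simp add: sum.reindex[OF var_inj])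
qed

lemma isol_add: "isol X c a b \<Longrightarrow> isol X' c b d \<Longrightarrow> isol (\<lambda>l. X l + X' l) c a d"
  unfolding isol_def by (simp add: distrib_left sum.distrib right_diff_distrib)

lemma isol_uminus: "isol X c a b \<Longrightarrow> isol (\<lambda>l. - X l) c b a"
  unfolding isol_def by (simp add: sum_negf right_diff_distrib)

lemma isol_zero: "isol (\<lambda>l. 0) c a a"
  unfolding isol_def by simp

text \<open>The exponent of the leading monomial of the correction term in the bracket of \<open>x v\<close> and
  \<open>x u\<close> gives the solution.\<close>

lemma isol_lnk:
  assumes uv: "lnk u v"
  shows "\<exists>X. (\<forall>l. X l \<in> \<int>) \<and> isol X (lam C v) u v"
proof -
  have u: "u \<in> idx C" and v: "v \<in> idx C" and lt: "u < v" and nz: "dd v u (x u) \<noteq> 0"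
    and zv: "\<And>a. a \<in> subalg C (btw u v) \<Longrightarrow> dd v u a = 0" and zu: "\<And>a. a \<in> subalg C (btw u v) \<Longrightarrow> dd u v a = 0"
    using uv by (auto simp: lnk_def)
  define \<theta> where "\<theta> = dd v u (x u)"
  have bi: "btw u v \<subseteq> idx C" by (rule btw_idx[OF u v])
  have \<theta>S: "\<theta> \<in> subalg C (btw u v)" unfolding \<theta>_def by (rule dd_x_in[OF v u]) (use lt in simp)
  have \<theta>A: "\<theta> \<in> A" using \<theta>S subalg_mono[OF bi] by blast
  have xA: "x u \<in> A" "x v \<in> A" using u v by auto
  have w\<theta>: "wv (wt C u + wt C v) \<theta>" unfolding \<theta>_def by (rule wv_dd[OF v xA(1) wv_gen[OF u]])
  obtain e where e: "lead \<theta> e" using lead_exists[OF \<theta>A] nz by (auto simp: \<theta>_def)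
  have e\<theta>: "e \<in> exps \<theta>" using e by (simp add: lead_def)
  have me: "mwt e = wt C u + wt C v" by (rule mwt_of_wv[OF \<theta>A w\<theta> e\<theta>])
  have es: "exps e \<subseteq> var C ` btw u v" using \<theta>S e\<theta> by (auto simp: subalg_def polys_in_def)
  define E where "E = (\<lambda>l. cf e (var C l))"
  have E0: "E l = 0" if "l \<in> idx C" "l \<notin> btw u v" for l
  proof -
    have "var C l \<notin> exps e"
    proof
      assume "var C l \<in> exps e"
      then obtain m where m: "m \<in> btw u v" "var C l = var C m" using es by blast
      then have "l = m" using inj_onD[OF var_inj m(2) that(1)] bi by blast
      then show False using m that by blast
    qed
    then show ?thesis by (simp add: E_def in_keys_iff)
  qed
  have bvu: "br (x v) (x u) = Const (char_diff (wt C u) (lie C v)) * (x u * x v) + \<theta>"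
    using br_x_dd[of v "x u" u] lt sg_x[OF u] by (simp add: \<theta>_def mult.assoc)
  \<comment> \<open>The derivations of \<open>u\<close> and \<open>v\<close> vanish between, so the
    Jacobi identity for \<open>x v\<close>, \<open>x u\<close>, \<open>x l\<close> shows that
    \<open>\<theta>\<close> is log-canonical with \<open>x l\<close>; its leading monomial then has
    the same coefficient.\<close>
  have norm: "(\<Sum>m\<in>idx C. of_nat (E m) * qz m l) = char_diff (wt C l) (lie C v) + char_diff (wt C l) (hs u)"
    if l: "l \<in> btw u v" for l
  proof -
    have li: "l \<in> idx C" and xl: "x l \<in> A" using l bi by auto
    have xlS: "x l \<in> subalg C (btw u v)" using l by (rule x_in)
    define k where "k = char_diff (wt C u) (lie C v)"
    define cu where "cu = char_diff (wt C l) (hs u)" define cv where "cv = char_diff (wt C l) (lie C v)"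
    have bu: "br (x u) (x l) = Const cu * (x l * x u)"
      using br_x_dd[of u "x l" v] lt zu[OF xlS] sg_x[OF li] by (simp add: cu_def mult.assoc)
    have bv: "br (x v) (x l) = Const cv * (x l * x v)"
      using br_x_dd[of v "x l" u] lt zv[OF xlS] sg_x[OF li] by (simp add: cv_def mult.assoc)
    have buv: "br (x u) (x v) = - (Const k * (x u * x v) + \<theta>)"
      using br_anti[OF xA] bvu by (simp add: k_def)
    have bvu': "br (x v) (x u) = Const k * (x u * x v) + \<theta>" using bvu by (simp add: k_def)
    have P: "x u * x v \<in> A" "Const k * (x u * x v) \<in> A" "x l * x u \<in> A" "x l * x v \<in> A" using xA xl by auto
    have 1: "br (x v) (br (x u) (x l)) = Const cu * (Const cv * (x l * x v) * x u + x l * (Const k * (x u * x v) + \<theta>))"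
      unfolding bu br_scale[OF xA(2) P(3)] br_mult[OF xA(2) xl xA(1)] bv bvu' ..
    have 2: "br (x u) (br (x v) (x l)) = Const cv * (Const cu * (x l * x u) * x v - x l * (Const k * (x u * x v) + \<theta>))"
      unfolding bv br_scale[OF xA(1) P(4)] br_mult[OF xA(1) xl xA(2)] bu buv by (simp only: mult_minus_right add_uminus_conv_diff)
    have 3: "br (br (x v) (x u)) (x l) = Const k * (Const cu * (x l * x u) * x v + x u * (Const cv * (x l * x v))) + br \<theta> (x l)"
      unfolding bvu' br_add_left[OF P(2) \<theta>A xl] br_scale_left[OF P(1) xl] br_mult_left[OF xA xl] bu bv ..
    have "br \<theta> (x l) = (Const cv + Const cu) * \<theta> * x l"
      using br_jacobi'[OF xA(2,1) xl] unfolding 1 2 3 by algebra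
    then have "br \<theta> (x l) = Const (cv + cu) * \<theta> * x l" by (simp add: Const_add)
    from lead_normal[OF \<theta>A e li this] show ?thesis unfolding E_def cu_def cv_def .
  qed
  \<comment> \<open>The exponent of the Laurent monomial x^e / (x_u x_v), which has weight 0 because
    \<open>\<theta>\<close> has the weight of x_u x_v.\<close>
  define X :: "nat \<Rightarrow> 'k" where "X l = of_nat (E l) - (if l = u then 1 else 0) - (if l = v then 1 else 0)" for l
  have split: "(\<Sum>l\<in>idx C. f l * X l) = (\<Sum>l\<in>idx C. f l * of_nat (E l)) - f u - f v" for f
  proof -
    have "(\<Sum>l\<in>idx C. f l * X l) = (\<Sum>l\<in>idx C. f l * of_nat (E l) - (if l = u then f l else 0) - (if l = v then f l else 0))"
      by (rule sum.cong) (auto simp: X_def algebra_simps)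
    then show ?thesis using u v by (simp add: sum_subtractf)
  qed
  have chi: "(\<Sum>l\<in>idx C. char_diff (wt C l) h * X l) = 0" for h
  proof -
    have "(\<Sum>l\<in>idx C. char_diff (wt C l) h * of_nat (E l)) = char_diff (mwt e) h"
      by (simp add: mwt_def char_diff_sum char_diff_mult_of_nat E_def) (simp add: mult.commute)
    then show ?thesis unfolding split me char_diff_add by simp
  qed
  have Xb: "X l = 0" if "l \<in> idx C" "l < u \<or> v < l" for l
    using E0[of l] that lt by (auto simp: X_def btw_def)
  have Xuv: "X u = - 1" "X v = - 1" using E0[OF u] E0[OF v] btw_notin lt by (auto simp: X_def)
  have lamv: "lam C v = - char_diff (wt C u) (hs u)"
    by (rule lam_relation[OF lt lnk_lkeq[OF uv] u v])
  \<comment> \<open>Strictly between, \<open>norm\<close> cancels the contributions of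
    \<open>u\<close> and \<open>v\<close>. At or outside the ends, the rest of the support of
    \<open>X\<close> lies on one side of \<open>i\<close>, so the row is a weight, which annihilates
    \<open>X\<close>, minus its diagonal term; only \<open>u\<close> and \<open>v\<close> leave
    something over.\<close>
  have eq: "(\<Sum>l\<in>idx C. qz i l * X l) = - lam C v * ((if i = u then 1 else 0) - (if i = v then 1 else 0))"
    if i: "i \<in> idx C" for i
  proof -
    consider "u < i \<and> i < v" | "i \<le> u" | "v \<le> i" by linarith
    then show ?thesis
    proof cases
      case 1
      then have o: "u < i" "i < v" by auto
      then have 1: "i \<in> btw u v" by (simp add: btw_def)
      have "(\<Sum>l\<in>idx C. qz i l * of_nat (E l)) = - (\<Sum>m\<in>idx C. of_nat (E m) * qz m i)"
        unfolding sum_negf[symmetric]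
        by (rule sum.cong[OF refl]) (subst qz_anti, simp)
      moreover have "char_diff (wt C u) (lie C i) = - char_diff (wt C i) (hs u)"
        using o u by (intro sym_wt[OF i]) auto
      ultimately show ?thesis
        unfolding split norm[OF 1] using o by (simp add: qz_def)
    next
      case 2
      have "(\<Sum>l\<in>idx C. qz i l * X l) = (\<Sum>l\<in>idx C. char_diff (wt C l) (hs i) * X l - (if l = i then char_diff (wt C i) (hs i) * X i else 0))"
      proof (rule sum.cong[OF refl])
        fix l assume l: "l \<in> idx C"
        show "qz i l * X l = char_diff (wt C l) (hs i) * X l - (if l = i then char_diff (wt C i) (hs i) * X i else 0)"
          using 2 l Xb[of l] sym_wt[OF l, of i] i by (cases l i rule: linorder_cases) (auto simp: qz_def)
      qed
      also have "\<dots> = - (char_diff (wt C i) (hs i) * X i)" using i by (simp add: sum_subtractf chi)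
      also have "\<dots> = - lam C v * ((if i = u then 1 else 0) - (if i = v then 1 else 0))"
        using 2 lt Xuv Xb[OF i] lamv by (cases "i = u") auto
      finally show ?thesis .
    next
      case 3
      have "(\<Sum>l\<in>idx C. qz i l * X l) = (\<Sum>l\<in>idx C. char_diff (wt C l) (lie C i) * X l - (if l = i then lam C i * X i else 0))"
      proof (rule sum.cong[OF refl])
        fix l assume l: "l \<in> idx C"
        show "qz i l * X l = char_diff (wt C l) (lie C i) * X l - (if l = i then lam C i * X i else 0)"
          using 3 l Xb[of l] by (cases l i rule: linorder_cases) (auto simp: qz_def lam_def)
      qed
      also have "\<dots> = - (lam C i * X i)" using i by (simp add: sum_subtractf chi)
      also have "\<dots> = - lam C v * ((if i = u then 1 else 0) - (if i = v then 1 else 0))"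
        using 3 lt Xuv Xb[OF i] by (cases "i = v") auto
      finally show ?thesis .
    qed
  qed
  have "isol X (lam C v) u v" unfolding isol_def using chi eq by blast
  moreover have "X l \<in> \<int>" for l by (simp add: X_def)
  ultimately show ?thesis by blast
qed

lemma Max_level:
  assumes j: "j \<in> idx C"
  shows "Max (level_set C j) \<in> idx C" "j \<approx> Max (level_set C j)" "\<And>i. i \<in> idx C \<Longrightarrow> j \<approx> i \<Longrightarrow> i \<le> Max (level_set C j)"
proof -
  have f: "finite (level_set C j)" by (simp add: level_set_eq)
  have "j \<in> level_set C j" using j by (simp add: level_set_eq)
  then have "Max (level_set C j) \<in> level_set C j" using f Max_in by blast
  then show "Max (level_set C j) \<in> idx C" "j \<approx> Max (level_set C j)" unfolding level_set_eq by blast+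
  show "i \<le> Max (level_set C j)" if "i \<in> idx C" "j \<approx> i" for i
    by (rule Max_ge[OF f]) (use that in \<open>simp add: level_set_eq\<close>)
qed

lemma lamK_cong: "i \<approx> j \<Longrightarrow> lamK i = lamK j"
proof -
  assume "i \<approx> j"
  then have "level_set C i = level_set C j"
    unfolding level_set_eq using lkeq_trans lkeq_sym by blast
  then show ?thesis by (simp add: lamK_def)
qed

lemma lamK_upper:
  assumes uw: "u < w" "u \<approx> w" and u: "u \<in> idx C" and w: "w \<in> idx C"
  shows "lam C w = lamK u"
proof (cases "w = Max (level_set C u)")
  case False
  note M = Max_level[OF u]
  have "u < Max (level_set C u)" using M(3)[OF w uw(2)] uw(1) by simp
  then have "lamK u = - char_diff (wt C u) (hs u)"
    unfolding lamK_def using lam_relation M(1,2) u by blast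
  then show ?thesis using lam_relation[OF uw u w] by simp
qed (simp add: lamK_def)

lemma lamK_lower:
  assumes "u < w" "u \<approx> w" "u \<in> idx C" "w \<in> idx C"
  shows "char_diff (wt C u) (hs u) = - lamK u"
  using lam_relation[OF assms] lamK_upper[OF assms] by simp

lemma lamK_nz: "j \<in> idx C \<Longrightarrow> lamK j \<noteq> 0"
  unfolding lamK_def by (rule lam_neq_0) (rule Max_level)

text \<open>Solutions for consecutive pairs add up along a path, backward steps entering with a
  sign; the constant is the same all along the level set.\<close>

lemma isol_lkeq:
  assumes "a \<approx> b"
  shows "\<exists>X. (\<forall>l. X l \<in> \<int>) \<and> isol X (lamK a) a b"
  using assms
proof (induct rule: equivclp_induct)
  case base
  show ?case by (intro exI[of _ "\<lambda>l. 0"]) (simp add: isol_zero)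
next
  case (step y z)
  obtain X where X: "\<forall>l. X l \<in> \<int>" "isol X (lamK a) a y" using step by blast
  have *: "\<exists>X. (\<forall>l. X l \<in> \<int>) \<and> isol X (lamK u) u v" if "lnk u v" for u v
    using isol_lnk[OF that] lamK_upper[OF lnk_less[OF that] lnk_lkeq[OF that]] lnk_idx[OF that] by simp
  have ay: "lamK a = lamK y" by (rule lamK_cong) (rule step(1))
  obtain Z where Z: "\<forall>l. Z l \<in> \<int>" "isol Z (lamK y) y z"
    using step(2)
  proof
    assume "lnk y z"
    from *[OF this] show thesis using that by blast
  next
    assume zy: "lnk z y"
    from *[OF this] obtain Z where Z: "\<forall>l. Z l \<in> \<int>" "isol Z (lamK z) z y" by blast
    show thesis
    proof (rule that)
      show "isol (\<lambda>l. - Z l) (lamK y) y z" using isol_uminus[OF Z(2)] lamK_cong[OF lnk_lkeq[OF zy]] by simp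
    qed (use Z(1) in simp)
  qed
  have "isol (\<lambda>l. X l + Z l) (lamK a) a z" using isol_add[OF X(2)] Z(2) ay by simp
  moreover have "\<forall>l. X l + Z l \<in> \<int>" using X(1) Z(1) by simp
  ultimately show ?case by (intro exI[of _ "\<lambda>l. X l + Z l"] conjI)
qed

end

section \<open>Sorting positions within level sets: existence, uniqueness and effect of
  tau_bullet\<close>

section \<open>The permutation \<open>\<tau>\<^sub>\<bullet>\<close>\<close>

lemma strict_mono_bij_exists:
  fixes S T :: "nat set"
  assumes "finite S" "finite T" "card S = card T"
  shows "\<exists>g. bij_betw g S T \<and> strict_mono_on S g"
proof -
  obtain h where h: "bij_betw h {..<card S} S" "strict_mono_on {..<card S} h"
    using ex_bij_betw_strict_mono_card[OF assms(1)] .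
  obtain k where k: "bij_betw k {..<card T} T" "strict_mono_on {..<card T} k"
    using ex_bij_betw_strict_mono_card[OF assms(2)] .
  define h' where "h' = the_inv_into {..<card S} h"
  have h': "bij_betw h' S {..<card S}" unfolding h'_def by (rule bij_betw_the_inv_into[OF h(1)])
  have inv: "h (h' s) = s" if "s \<in> S" for s
    unfolding h'_def using f_the_inv_into_f_bij_betw[OF h(1)] that by blast
  have "bij_betw (k \<circ> h') S T" by (rule bij_betw_trans[OF h']) (use k(1) assms(3) in simp)
  moreover have "strict_mono_on S (k \<circ> h')"
  proof (rule strict_mono_onI)
    fix r s assume rs: "r \<in> S" "s \<in> S" "r < s"
    have m: "h' r \<in> {..<card S}" "h' s \<in> {..<card S}" using h' rs bij_betwE by blast+
    have "h' r < h' s"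
    proof (rule ccontr)
      assume "\<not> h' r < h' s"
      then have "h' s < h' r \<or> h' s = h' r" by auto
      then show False
      proof
        assume "h' s < h' r"
        then have "h (h' s) < h (h' r)" using strict_mono_onD[OF h(2) m(2,1)] by simp
        then show False using inv rs by simp
      next
        assume "h' s = h' r"
        then show False using inv[OF rs(1)] inv[OF rs(2)] rs(3) by simp
      qed
    qed
    then show "(k \<circ> h') r < (k \<circ> h') s" using strict_mono_onD[OF k(2)] m assms(3) by simp
  qed
  ultimately show ?thesis by blast
qed

lemma strict_mono_onto_unique:
  fixes f g :: "nat \<Rightarrow> nat"
  assumes f: "strict_mono_on S f" "f ` S = T" and g: "strict_mono_on S g" "g ` S = T" and m: "m \<in> S"
  shows "f m = g m"
  using m
proof (induct m rule: less_induct)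
  case (less m)
  have *: "\<not> f m < g m" if f: "strict_mono_on S f" "f ` S = T" and g: "strict_mono_on S g" "g ` S = T"
    and eq: "\<And>k. k < m \<Longrightarrow> k \<in> S \<Longrightarrow> f k = g k" for f g :: "nat \<Rightarrow> nat"
  proof
    assume lt: "f m < g m"
    have "f m \<in> g ` S" using f(2) g(2) less.prems by blast
    then obtain k where k: "k \<in> S" "f m = g k" by blast
    have "k < m"
    proof (rule ccontr)
      assume "\<not> k < m"
      then have "g m \<le> g k" using strict_mono_onD[OF g(1) less.prems k(1)] by (cases "k = m") auto
      then show False using lt k by simp
    qed
    then have "f k = f m" using eq k by simp
    then show False using strict_mono_onD[OF f(1) k(1) less.prems \<open>k < m\<close>] by simp
  qed
  show ?case using *[OF f g] *[OF g f] less.hyps by (metis linorder_less_linear)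
qed

context sym
begin

lemma lnk_iff:
  "lnk a b \<longleftrightarrow> a \<in> idx C \<and> b \<in> idx C \<and> a < b \<and> a \<approx> b \<and> \<not> (\<exists>c. a < c \<and> c < b \<and> a \<approx> c)"
proof
  assume l: "lnk a b"
  have "\<not> (a < c \<and> c < b \<and> a \<approx> c)" for c
  proof
    assume c: "a < c \<and> c < b \<and> a \<approx> c"
    then obtain w where w: "lnk a w" "w \<le> c" using lkeq_above by blast
    then show False using lnk_unique_right[OF l w(1)] c by simp
  qed
  then show "a \<in> idx C \<and> b \<in> idx C \<and> a < b \<and> a \<approx> b \<and> \<not> (\<exists>c. a < c \<and> c < b \<and> a \<approx> c)"
    using l lnk_idx lnk_less lnk_lkeq by blast
next
  assume a: "a \<in> idx C \<and> b \<in> idx C \<and> a < b \<and> a \<approx> b \<and> \<not> (\<exists>c. a < c \<and> c < b \<and> a \<approx> c)"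
  then obtain w where w: "lnk a w" "a < w" "w \<le> b" "a \<approx> w" using lkeq_above by blast
  then have "w = b" using a by (meson le_neq_implies_less)
  then show "lnk a b" using w by simp
qed

end

context sym_tau
begin

lemma tau_perm: "\<tau> permutes idx C"
  by (rule Xi_permutes[OF tau])

lemma vimage_level: "\<tau> -` level_set C j = {m \<in> idx C. j \<approx> \<tau> m}"
  unfolding level_set_eq using permutes_in_image[OF tau_perm] by auto

lemma card_vimage_level: "card (\<tau> -` level_set C j) = card (level_set C j)"
  by (rule card_vimage_inj) (use Xi_inj[OF tau] permutes_surj[OF tau_perm] in auto)

lemma level_in: "m \<in> idx C \<Longrightarrow> level_set C (\<tau> m) \<in> level_sets C"
  using Xi_idx[OF tau] by (auto simp: level_sets_def)

definition bullet_spec :: "(nat \<Rightarrow> nat) \<Rightarrow> bool" where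
  "bullet_spec \<sigma> \<longleftrightarrow> \<sigma> permutes idx C \<and>
     (\<forall>L\<in>level_sets C. \<sigma> ` L = L \<and> strict_mono_on (\<tau> -` L) (\<sigma> \<circ> \<tau>))"

lemma bullet_spec_exists: "\<exists>\<sigma>. bullet_spec \<sigma>"
proof -
  have "\<exists>g. bij_betw g (\<tau> -` level_set C j) (level_set C j) \<and> strict_mono_on (\<tau> -` level_set C j) g" for j
  proof (rule strict_mono_bij_exists)
    show "finite (\<tau> -` level_set C j)" unfolding vimage_level by simp
    show "finite (level_set C j)" by (simp add: level_set_eq)
  qed (rule card_vimage_level)
  then have "\<forall>L. \<exists>g. L \<in> level_sets C \<longrightarrow> bij_betw g (\<tau> -` L) L \<and> strict_mono_on (\<tau> -` L) g"
    unfolding level_sets_def by blast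
  then obtain G where G: "\<And>L. L \<in> level_sets C \<Longrightarrow> bij_betw (G L) (\<tau> -` L) L"
      "\<And>L. L \<in> level_sets C \<Longrightarrow> strict_mono_on (\<tau> -` L) (G L)"
    using choice[of "\<lambda>L g. L \<in> level_sets C \<longrightarrow> bij_betw g (\<tau> -` L) L \<and> strict_mono_on (\<tau> -` L) g"] by blast
  define \<kappa> where "\<kappa> m = (if m \<in> idx C then G (level_set C (\<tau> m)) m else m)" for m
  have \<kappa>G: "\<kappa> m = G L m" if L: "L \<in> level_sets C" and m: "m \<in> \<tau> -` L" for L m
  proof -
    obtain j where j: "L = level_set C j" using L by (auto simp: level_sets_def)
    have mj: "m \<in> idx C" "j \<approx> \<tau> m" using m unfolding j vimage_level by auto
    have "level_set C (\<tau> m) = L" unfolding j level_set_eq using mj(2) lkeq_trans lkeq_sym by blast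
    then show ?thesis using mj by (simp add: \<kappa>_def)
  qed
  have \<kappa>L: "\<kappa> ` (\<tau> -` L) = L" if L: "L \<in> level_sets C" for L
    using G(1)[OF L] \<kappa>G[OF L] by (auto simp: bij_betw_def image_def)
  have own: "m \<in> \<tau> -` level_set C (\<tau> m)" if "m \<in> idx C" for m
    using that by (simp add: vimage_level)
  have \<kappa>own: "\<kappa> m \<in> idx C" "\<tau> m \<approx> \<kappa> m" if m: "m \<in> idx C" for m
  proof -
    have "\<kappa> m \<in> level_set C (\<tau> m)" using \<kappa>L[OF level_in[OF m]] own[OF m] by blast
    then show "\<kappa> m \<in> idx C" "\<tau> m \<approx> \<kappa> m" by (simp_all add: level_set_eq)
  qed
  have inj: "inj_on \<kappa> (idx C)"
  proof (rule inj_onI)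
    fix m m' assume m: "m \<in> idx C" "m' \<in> idx C" "\<kappa> m = \<kappa> m'"
    let ?L = "level_set C (\<tau> m)"
    have "\<tau> m \<approx> \<tau> m'" using \<kappa>own[OF m(1)] \<kappa>own[OF m(2)] unfolding m(3) using lkeq_trans lkeq_sym by blast
    then have m': "m' \<in> \<tau> -` ?L" using m by (simp add: vimage_level)
    have "G ?L m = G ?L m'" using \<kappa>G[OF level_in[OF m(1)]] own[OF m(1)] m' m(3) by simp
    then show "m = m'" using G(1)[OF level_in[OF m(1)]] own[OF m(1)] m' by (auto simp: bij_betw_def dest: inj_onD)
  qed
  have "\<kappa> ` idx C = idx C" by (rule endo_inj_surj) (use inj \<kappa>own in auto)
  then have "\<kappa> permutes idx C"
    using inj by (intro bij_imp_permutes) (auto simp: bij_betw_def \<kappa>_def)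
  then have p: "(\<kappa> \<circ> inv \<tau>) permutes idx C" by (intro permutes_compose permutes_inv tau_perm)
  have k: "(\<kappa> \<circ> inv \<tau>) \<circ> \<tau> = \<kappa>" by (simp add: fun_eq_iff permutes_inverses[OF tau_perm])
  have "(\<kappa> \<circ> inv \<tau>) ` L = L" if L: "L \<in> level_sets C" for L
  proof -
    have "inv \<tau> ` L = \<tau> -` L" using bij_vimage_eq_inv_image[OF permutes_bij[OF tau_perm]] by simp
    then show ?thesis using \<kappa>L[OF L] unfolding image_comp[symmetric] by simp
  qed
  moreover have "strict_mono_on (\<tau> -` L) \<kappa>" if L: "L \<in> level_sets C" for L
    using G(2)[OF L] \<kappa>G[OF L] by (simp add: strict_mono_on_def)
  ultimately have "bullet_spec (\<kappa> \<circ> inv \<tau>)" unfolding bullet_spec_def k using p by blast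
  then show ?thesis by blast
qed

lemma bullet_spec_unique:
  assumes s: "bullet_spec \<sigma>" and s': "bullet_spec \<sigma>'"
  shows "\<sigma> = \<sigma>'"
proof
  fix k
  show "\<sigma> k = \<sigma>' k"
  proof (cases "k \<in> idx C")
    case False
    then show ?thesis using s s' unfolding bullet_spec_def by (metis permutes_not_in)
  next
    case True
    define m where "m = inv \<tau> k"
    have km: "k = \<tau> m" by (simp add: m_def permutes_inverses[OF tau_perm])
    have m: "m \<in> idx C" using True permutes_in_image[OF tau_perm] by (simp add: km)
    let ?L = "level_set C (\<tau> m)"
    have L: "?L \<in> level_sets C" by (rule level_in[OF m])
    have on: "(\<rho> \<circ> \<tau>) ` (\<tau> -` ?L) = ?L" if "bullet_spec \<rho>" for \<rho>
    proof -
      have "\<tau> ` (\<tau> -` ?L) = ?L" using permutes_surj[OF tau_perm] by (rule surj_image_vimage_eq)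
      then have "(\<rho> \<circ> \<tau>) ` (\<tau> -` ?L) = \<rho> ` ?L" unfolding image_comp[symmetric] by simp
      also have "\<dots> = ?L" using that L unfolding bullet_spec_def by blast
      finally show ?thesis .
    qed
    have "(\<sigma> \<circ> \<tau>) m = (\<sigma>' \<circ> \<tau>) m"
    proof (rule strict_mono_onto_unique[where S = "\<tau> -` ?L" and T = ?L and f = "\<sigma> \<circ> \<tau>" and g = "\<sigma>' \<circ> \<tau>"])
      show "strict_mono_on (\<tau> -` ?L) (\<sigma> \<circ> \<tau>)" "strict_mono_on (\<tau> -` ?L) (\<sigma>' \<circ> \<tau>)"
        using s s' L unfolding bullet_spec_def by blast+
      show "m \<in> \<tau> -` ?L" using m by (simp add: vimage_level)
    qed (rule on[OF s], rule on[OF s'])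
    then show ?thesis by (simp add: km)
  qed
qed

definition tb :: "nat \<Rightarrow> nat" where "tb = tau_bullet C \<tau>"
definition \<kappa> :: "nat \<Rightarrow> nat" where "\<kappa> = tb \<circ> \<tau>"

lemma bullet_tb: "bullet_spec tb"
proof -
  have "tb = (THE \<sigma>. bullet_spec \<sigma>)" by (simp add: tb_def tau_bullet_def bullet_spec_def)
  moreover have "bullet_spec (THE \<sigma>. bullet_spec \<sigma>)"
    using bullet_spec_exists bullet_spec_unique by (metis theI)
  ultimately show ?thesis by simp
qed

lemma tb_eqI: "bullet_spec \<sigma> \<Longrightarrow> tb = \<sigma>"
  using bullet_spec_unique[OF bullet_tb] .

lemma tb_perm: "tb permutes idx C"
  using bullet_tb by (simp add: bullet_spec_def)

lemma kappa_perm: "\<kappa> permutes idx C"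
  unfolding \<kappa>_def by (rule permutes_compose[OF tau_perm tb_perm])

lemma tb_lkeq: "k \<in> idx C \<Longrightarrow> tb k \<approx> k"
proof -
  assume k: "k \<in> idx C"
  then have "level_set C k \<in> level_sets C" "k \<in> level_set C k" by (auto simp: level_sets_def level_set_eq)
  then have "tb k \<in> level_set C k" using bullet_tb unfolding bullet_spec_def by blast
  then show ?thesis using lkeq_sym by (simp add: level_set_eq)
qed

lemma kappa_idx: "m \<in> idx C \<longleftrightarrow> \<kappa> m \<in> idx C"
  using permutes_in_image[OF kappa_perm] by blast

lemma kappa_lkeq: "m \<in> idx C \<Longrightarrow> \<kappa> m \<approx> \<tau> m"
  unfolding \<kappa>_def using tb_lkeq Xi_idx[OF tau] by simp

lemma kappa_less:
  assumes m: "m \<in> idx C" "m' \<in> idx C" and e: "\<tau> m \<approx> \<tau> m'"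
  shows "\<kappa> m < \<kappa> m' \<longleftrightarrow> m < m'"
proof -
  let ?L = "level_set C (\<tau> m)"
  have s: "strict_mono_on (\<tau> -` ?L) \<kappa>"
    using bullet_tb level_in[OF m(1)] by (simp add: bullet_spec_def \<kappa>_def)
  have "m \<in> \<tau> -` ?L" "m' \<in> \<tau> -` ?L" using m e by (auto simp: vimage_level)
  then show ?thesis using strict_mono_on_less[OF s] by blast
qed

text \<open>\<open>\<kappa>\<close> sends positions increasingly onto each level set, so the last
  earlier position in a class becomes the preceding element of the level set.\<close>

lemma pt_kappa:
  assumes m: "m \<in> idx C" and j: "j \<in> idx C"
  shows "pt m = Some j \<longleftrightarrow> lnk (\<kappa> j) (\<kappa> m)"
proof -
  have k: "\<kappa> j \<in> idx C" "\<kappa> m \<in> idx C" using m j kappa_idx by auto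
  have eqv: "\<kappa> a \<approx> \<kappa> b \<longleftrightarrow> \<tau> a \<approx> \<tau> b" if "a \<in> idx C" "b \<in> idx C" for a b
    using kappa_lkeq[OF that(1)] kappa_lkeq[OF that(2)] lkeq_trans lkeq_sym by blast
  have q: "(\<exists>c. \<kappa> j < c \<and> c < \<kappa> m \<and> \<kappa> j \<approx> c) \<longleftrightarrow> (\<exists>i. j < i \<and> i < m \<and> \<tau> i \<approx> \<tau> m)"
    if e: "\<tau> j \<approx> \<tau> m"
  proof
    assume "\<exists>c. \<kappa> j < c \<and> c < \<kappa> m \<and> \<kappa> j \<approx> c"
    then obtain c where c: "\<kappa> j < c" "c < \<kappa> m" "\<kappa> j \<approx> c" by blast
    have "c \<in> idx C" using c k by auto
    then obtain i where i: "i \<in> idx C" "c = \<kappa> i" using permutes_image[OF kappa_perm] by blast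
    have ji: "\<tau> j \<approx> \<tau> i" using c(3) eqv[OF j i(1)] i(2) by simp
    then have im: "\<tau> i \<approx> \<tau> m" using e lkeq_trans lkeq_sym by blast
    have "j < i" "i < m" using kappa_less[OF j i(1) ji] kappa_less[OF i(1) m im] c i by auto
    then show "\<exists>i. j < i \<and> i < m \<and> \<tau> i \<approx> \<tau> m" using im by blast
  next
    assume "\<exists>i. j < i \<and> i < m \<and> \<tau> i \<approx> \<tau> m"
    then obtain i where i: "j < i" "i < m" "\<tau> i \<approx> \<tau> m" by blast
    have ii: "i \<in> idx C" using i m j by auto
    have ji: "\<tau> j \<approx> \<tau> i" using e i(3) lkeq_trans lkeq_sym by blast
    have "\<kappa> j < \<kappa> i" "\<kappa> i < \<kappa> m" "\<kappa> j \<approx> \<kappa> i"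
      using kappa_less[OF j ii ji] kappa_less[OF ii m i(3)] i eqv[OF j ii] ji by auto
    then show "\<exists>c. \<kappa> j < c \<and> c < \<kappa> m \<and> \<kappa> j \<approx> c" by blast
  qed
  have jm: "j \<in> {1..<m} \<longleftrightarrow> j < m" using j by simp
  show ?thesis
  proof (cases "\<tau> j \<approx> \<tau> m")
    case True
    have "pt m = Some j \<longleftrightarrow> j < m \<and> (\<forall>i. j < i \<and> i < m \<longrightarrow> \<not> \<tau> i \<approx> \<tau> m)"
      by (simp only: pt_iff[OF m] jm True simp_thms)
    moreover have "lnk (\<kappa> j) (\<kappa> m) \<longleftrightarrow> j < m \<and> \<not> (\<exists>i. j < i \<and> i < m \<and> \<tau> i \<approx> \<tau> m)"
      by (simp only: lnk_iff[of "\<kappa> j"] kappa_less[OF j m True] eqv[OF j m] q[OF True] k True simp_thms)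
    ultimately show ?thesis by blast
  next
    case False
    then show ?thesis by (simp only: pt_iff[OF m] lnk_iff[of "\<kappa> j"] eqv[OF j m] simp_thms)
  qed
qed

lemma succ_kappa:
  assumes m: "m \<in> idx C" and j: "j \<in> idx C"
  shows "succ CT j = Some m \<longleftrightarrow> succ C (\<kappa> j) = Some (\<kappa> m)"
  using succ_T_iff[OF j, of m] pt_kappa[OF m j] m succ_eq_Some_iff by simp

lemma succ_T_idx: "j \<in> idx C \<Longrightarrow> succ CT j = Some m \<Longrightarrow> m \<in> idx C"
  using succ_T_iff by blast

lemma ex_kappa: "j \<in> ex CT \<longleftrightarrow> \<kappa> j \<in> ex C"
proof (cases "j \<in> idx C")
  case True
  have "succ CT j \<noteq> None \<longleftrightarrow> (\<exists>m\<in>idx C. succ CT j = Some m)" using succ_T_idx[OF True] by auto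
  also have "\<dots> \<longleftrightarrow> (\<exists>m\<in>idx C. succ C (\<kappa> j) = Some (\<kappa> m))" using succ_kappa True by blast
  also have "\<dots> \<longleftrightarrow> (\<exists>k\<in>idx C. succ C (\<kappa> j) = Some k)"
    by (subst (2) permutes_image[OF kappa_perm, symmetric]) blast
  also have "\<dots> \<longleftrightarrow> succ C (\<kappa> j) \<noteq> None" using lnk_idx by (auto simp: succ_eq_Some_iff)
  finally show ?thesis using True kappa_idx[of j] unfolding ex_def by auto
next
  case False
  then show ?thesis using kappa_idx[of j] unfolding ex_def by auto
qed

end

section \<open>Matrix algebra: associativity, triangular systems and inverses\<close>

section \<open>Triangular matrices\<close>

lemma mat_mul_assoc: "(A \<cdot>\<^bsub>K\<^esub> B) \<cdot>\<^bsub>L\<^esub> D = A \<cdot>\<^bsub>K\<^esub> (B \<cdot>\<^bsub>L\<^esub> D)"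
  unfolding mat_mul_def sum_distrib_right sum_distrib_left
  by (intro ext, subst sum.swap, simp only: mult.assoc)

lemma sum_select:
  fixes F :: "nat \<Rightarrow> 'a::comm_ring_1"
  assumes "finite S" "a \<in> S"
  shows "(\<Sum>k\<in>S. (if k = a then 1 else 0) * F k) = F a" "(\<Sum>k\<in>S. (if a = k then 1 else 0) * F k) = F a"
    "(\<Sum>k\<in>S. F k * (if k = a then 1 else 0)) = F a" "(\<Sum>k\<in>S. F k * (if a = k then 1 else 0)) = F a"
proof -
  have "(\<Sum>k\<in>S. if k = a then F k else 0) = F a" using assms by simp
  moreover have "(if k = a then 1 else 0) * F k = (if k = a then F k else 0)"
    "(if a = k then 1 else 0) * F k = (if k = a then F k else 0)"
    "F k * (if k = a then 1 else 0) = (if k = a then F k else 0)"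
    "F k * (if a = k then 1 else 0) = (if k = a then F k else 0)" for k by auto
  ultimately show "(\<Sum>k\<in>S. (if k = a then 1 else 0) * F k) = F a" "(\<Sum>k\<in>S. (if a = k then 1 else 0) * F k) = F a"
    "(\<Sum>k\<in>S. F k * (if k = a then 1 else 0)) = F a" "(\<Sum>k\<in>S. F k * (if a = k then 1 else 0)) = F a"
    by (simp_all only:)
qed

lemma lower_solve:
  fixes A :: "nat \<Rightarrow> nat \<Rightarrow> 'a::field"
  assumes "\<And>i. i \<in> {1..n} \<Longrightarrow> A i i \<noteq> 0" "\<And>i k. i \<in> {1..n} \<Longrightarrow> k \<in> {1..n} \<Longrightarrow> i < k \<Longrightarrow> A i k = 0"
  shows "\<exists>f. \<forall>i\<in>{1..n}. (\<Sum>k\<in>{1..n}. A i k * f k) = g i"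
  using assms
proof (induct n)
  case (Suc n)
  have "\<exists>f. \<forall>i\<in>{1..n}. (\<Sum>k\<in>{1..n}. A i k * f k) = g i" 
  proof (rule Suc.hyps)
    show "A i i \<noteq> 0" if "i \<in> {1..n}" for i by (rule Suc.prems(1)) (use that in simp)
    show "A i k = 0" if "i \<in> {1..n}" "k \<in> {1..n}" "i < k" for i k by (rule Suc.prems(2)) (use that in simp_all)
  qed
  then obtain f where f: "\<And>i. i \<in> {1..n} \<Longrightarrow> (\<Sum>k\<in>{1..n}. A i k * f k) = g i" by blast
  define c where "c = (g (Suc n) - (\<Sum>k\<in>{1..n}. A (Suc n) k * f k)) / A (Suc n) (Suc n)"
  define f' where "f' = f(Suc n := c)"
  have I: "{1..Suc n} = insert (Suc n) {1..n}" by auto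
  have s: "(\<Sum>k\<in>{1..Suc n}. A i k * f' k) = A i (Suc n) * c + (\<Sum>k\<in>{1..n}. A i k * f k)" for i
  proof -
    have "(\<Sum>k\<in>{1..n}. A i k * f' k) = (\<Sum>k\<in>{1..n}. A i k * f k)"
      by (rule sum.cong) (auto simp: f'_def)
    then show ?thesis unfolding I by (simp add: f'_def)
  qed
  have "(\<Sum>k\<in>{1..Suc n}. A i k * f' k) = g i" if i: "i \<in> {1..Suc n}" for i
  proof (cases "i = Suc n")
    case True
    have "A (Suc n) (Suc n) \<noteq> 0" by (rule Suc.prems(1)) simp
    then show ?thesis unfolding s unfolding True c_def by simp
  next
    case False
    then have i': "i \<in> {1..n}" using i by auto
    have "A i (Suc n) = 0" by (rule Suc.prems(2)) (use i' in auto)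
    then show ?thesis unfolding s using f[OF i'] by simp
  qed
  then show ?case by blast
qed simp

lemma upper_solve:
  fixes A :: "nat \<Rightarrow> nat \<Rightarrow> 'a::field"
  assumes "\<And>i. i \<in> {1..n} \<Longrightarrow> A i i \<noteq> 0" "\<And>i k. i \<in> {1..n} \<Longrightarrow> k \<in> {1..n} \<Longrightarrow> k < i \<Longrightarrow> A i k = 0"
  shows "\<exists>f. \<forall>i\<in>{1..n}. (\<Sum>k\<in>{1..n}. A i k * f k) = g i"
proof -
  have "\<exists>f. \<forall>i\<in>{1..n}. (\<Sum>k\<in>{1..n}. A (n + 1 - i) (n + 1 - k) * f k) = g (n + 1 - i)"
  proof (rule lower_solve)
    show "A (n + 1 - i) (n + 1 - i) \<noteq> 0" if "i \<in> {1..n}" for i by (rule assms(1)) (use that in auto)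
    show "A (n + 1 - i) (n + 1 - k) = 0" if "i \<in> {1..n}" "k \<in> {1..n}" "i < k" for i k
      by (rule assms(2)) (use that in auto)
  qed
  then obtain f where f: "\<And>i. i \<in> {1..n} \<Longrightarrow> (\<Sum>k\<in>{1..n}. A (n + 1 - i) (n + 1 - k) * f k) = g (n + 1 - i)"
    by blast
  have "(\<Sum>k\<in>{1..n}. A i k * f (n + 1 - k)) = g i" if i: "i \<in> {1..n}" for i
  proof -
    have i': "n + 1 - i \<in> {1..n}" and ii: "n + 1 - (n + 1 - i) = i" using i by auto
    have "(\<Sum>k\<in>{1..n}. A i (n + 1 - k) * f k) = g i" using f[OF i'] unfolding ii .
    moreover have "(\<Sum>k\<in>{1..n}. A i k * f (n + 1 - k)) = (\<Sum>k\<in>{1..n}. A i (n + 1 - k) * f k)"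
      by (rule sum.reindex_bij_witness[of _ "\<lambda>k. n + 1 - k" "\<lambda>k. n + 1 - k"]) auto
    ultimately show ?thesis by simp
  qed
  then show ?thesis by (intro exI[of _ "\<lambda>k. f (n + 1 - k)"] ballI)
qed

lemma mat_inverse_unique:
  assumes N: "finite N" and DA: "mat_eq N N (D \<cdot>\<^bsub>N\<^esub> A) id_mat" and AB: "mat_eq N N (A \<cdot>\<^bsub>N\<^esub> B) id_mat"
    and ij: "i \<in> N" "j \<in> N"
  shows "D i j = B i j"
proof -
  have "D i j = (\<Sum>l\<in>N. D i l * (if l = j then 1 else 0))" by (rule sum_select(3)[OF N ij(2), symmetric])
  also have "\<dots> = (D \<cdot>\<^bsub>N\<^esub> (A \<cdot>\<^bsub>N\<^esub> B)) i j"
    unfolding mat_mul_def[of D]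
    by (rule sum.cong[OF refl]) (use AB ij in \<open>simp add: mat_eq_def id_mat_def\<close>)
  also have "\<dots> = ((D \<cdot>\<^bsub>N\<^esub> A) \<cdot>\<^bsub>N\<^esub> B) i j" by (simp only: mat_mul_assoc)
  also have "\<dots> = (\<Sum>k\<in>N. (if i = k then 1 else 0) * B k j)"
    unfolding mat_mul_def[of "D \<cdot>\<^bsub>N\<^esub> A"]
    by (rule sum.cong[OF refl]) (use DA ij in \<open>simp add: mat_eq_def id_mat_def\<close>)
  also have "\<dots> = B i j" by (rule sum_select(2)[OF N ij(1)])
  finally show ?thesis .
qed

text \<open>Solving triangular systems by columns and by rows gives a right and a left inverse,
  which agree; filling with zeros outside the index set makes the definite description in
  \<open>mat_inv\<close> meaningful.\<close>

lemma mat_inv_triangular: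
  fixes A :: "nat \<Rightarrow> nat \<Rightarrow> 'a::field"
  assumes diag: "\<And>i. i \<in> {1..n} \<Longrightarrow> A i i \<noteq> 0"
    and tri: "(\<forall>i\<in>{1..n}. \<forall>k\<in>{1..n}. i < k \<longrightarrow> A i k = 0) \<or> (\<forall>i\<in>{1..n}. \<forall>k\<in>{1..n}. k < i \<longrightarrow> A i k = 0)"
  shows "mat_eq {1..n} {1..n} (A \<cdot>\<^bsub>{1..n}\<^esub> mat_inv {1..n} A) id_mat \<and>
    mat_eq {1..n} {1..n} (mat_inv {1..n} A \<cdot>\<^bsub>{1..n}\<^esub> A) id_mat"
proof -
  let ?N = "{1..n}"
  have 1: "\<forall>j. \<exists>f. \<forall>i\<in>?N. (\<Sum>k\<in>?N. A i k * f k) = id_mat i j"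
  proof
    fix j
    from tri show "\<exists>f. \<forall>i\<in>?N. (\<Sum>k\<in>?N. A i k * f k) = id_mat i j"
    proof
      assume t: "\<forall>i\<in>?N. \<forall>k\<in>?N. i < k \<longrightarrow> A i k = 0"
      show ?thesis by (rule lower_solve) (use diag t in blast)+
    next
      assume t: "\<forall>i\<in>?N. \<forall>k\<in>?N. k < i \<longrightarrow> A i k = 0"
      show ?thesis by (rule upper_solve) (use diag t in blast)+
    qed
  qed
  have 2: "\<forall>i. \<exists>f. \<forall>j\<in>?N. (\<Sum>k\<in>?N. A k j * f k) = id_mat i j"
  proof
    fix i
    from tri show "\<exists>f. \<forall>j\<in>?N. (\<Sum>k\<in>?N. A k j * f k) = id_mat i j"
    proof
      assume t: "\<forall>i\<in>?N. \<forall>k\<in>?N. i < k \<longrightarrow> A i k = 0"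
      show ?thesis by (rule upper_solve) (use diag t in blast)+
    next
      assume t: "\<forall>i\<in>?N. \<forall>k\<in>?N. k < i \<longrightarrow> A i k = 0"
      show ?thesis by (rule lower_solve) (use diag t in blast)+
    qed
  qed
  obtain B where B: "\<And>i j. i \<in> ?N \<Longrightarrow> (\<Sum>k\<in>?N. A i k * B j k) = id_mat i j"
    using choice[OF 1] by blast
  obtain D where D: "\<And>i j. j \<in> ?N \<Longrightarrow> (\<Sum>k\<in>?N. A k j * D i k) = id_mat i j"
    using choice[OF 2] by blast
  define B' where "B' i j = (if i \<in> ?N \<and> j \<in> ?N then B j i else 0)" for i j
  have AB: "mat_eq ?N ?N (A \<cdot>\<^bsub>?N\<^esub> B') id_mat"
    unfolding mat_eq_def
  proof (intro ballI)
    fix i j assume ij: "i \<in> ?N" "j \<in> ?N"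
    have "(A \<cdot>\<^bsub>?N\<^esub> B') i j = (\<Sum>k\<in>?N. A i k * B j k)"
      unfolding mat_mul_def by (rule sum.cong[OF refl]) (use ij in \<open>simp add: B'_def\<close>)
    then show "(A \<cdot>\<^bsub>?N\<^esub> B') i j = id_mat i j" using B[OF ij(1)] by simp
  qed
  have DA: "mat_eq ?N ?N (D \<cdot>\<^bsub>?N\<^esub> A) id_mat"
    using D by (simp add: mat_eq_def mat_mul_def mult.commute)
  have DB: "D i j = B' i j" if "i \<in> ?N" "j \<in> ?N" for i j
    by (rule mat_inverse_unique[OF _ DA AB that]) simp
  have BA: "mat_eq ?N ?N (B' \<cdot>\<^bsub>?N\<^esub> A) id_mat"
    unfolding mat_eq_def
  proof (intro ballI)
    fix i j assume ij: "i \<in> ?N" "j \<in> ?N"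
    have "(B' \<cdot>\<^bsub>?N\<^esub> A) i j = (D \<cdot>\<^bsub>?N\<^esub> A) i j"
      unfolding mat_mul_def by (rule sum.cong[OF refl]) (simp add: DB[OF ij(1)])
    then show "(B' \<cdot>\<^bsub>?N\<^esub> A) i j = id_mat i j" using DA ij by (simp add: mat_eq_def)
  qed
  let ?P = "\<lambda>B. (\<forall>i j. i \<notin> ?N \<or> j \<notin> ?N \<longrightarrow> B i j = 0) \<and> mat_eq ?N ?N (A \<cdot>\<^bsub>?N\<^esub> B) id_mat \<and> mat_eq ?N ?N (B \<cdot>\<^bsub>?N\<^esub> A) id_mat"
  have P: "?P B'" using AB BA by (auto simp: B'_def)
  have "?P (THE B. ?P B)"
  proof (rule theI[of ?P, OF P])
    fix X assume X: "?P X"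
    show "X = B'"
    proof (intro ext)
      fix i j
      show "X i j = B' i j"
      proof (cases "i \<in> ?N \<and> j \<in> ?N")
        case True
        then show ?thesis using X AB mat_inverse_unique[of ?N X A B' i j] by blast
      next
        case False
        then have "X i j = 0" "B' i j = 0" using X P by blast+
        then show ?thesis by simp
      qed
    qed
  qed
  then show ?thesis unfolding mat_inv_def by blast
qed

section \<open>One column at a time: passing between the Y and the x coordinates\<close>

section \<open>The equations for one column\<close>

text \<open>Evaluation at an index that may be infinite, with value 0 there, in line with the
  convention for basis vectors with infinite index.\<close>

definition opt0 :: "('b \<Rightarrow> 'a::zero) \<Rightarrow> 'b option \<Rightarrow> 'a" where
  "opt0 f u = (case u of None \<Rightarrow> 0 | Some q \<Rightarrow> f q)"

lemma opt0_simps [simp]: "opt0 f None = 0" "opt0 f (Some q) = f q"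
  by (simp_all add: opt0_def)

context sym
begin

lemma nu_inv:
  "mat_eq (idx C) (idx C) (mat_inv (idx C) (nu_mat C) \<cdot>\<^bsub>idx C\<^esub> nu_mat C) id_mat"
proof -
  have "nu_mat C i i \<noteq> 0" if "i \<in> idx C" for i using lam_neq_0[OF that] by (simp add: nu_mat_def)
  then show ?thesis
    using mat_inv_triangular[of "len C" "nu_mat C"] by (simp add: nu_mat_def)
qed

lemma E_inv:
  "mat_eq (idx C) (idx C) (E_mat C \<cdot>\<^bsub>idx C\<^esub> mat_inv (idx C) (E_mat C)) (id_mat :: 'k matr)"
  "mat_eq (idx C) (idx C) (mat_inv (idx C) (E_mat C) \<cdot>\<^bsub>idx C\<^esub> E_mat C) (id_mat :: 'k matr)"
proof -
  have 1: "(E_mat C i i :: 'k) \<noteq> 0" if "i \<in> idx C" for i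
    using lnk_less[of i i] by (auto simp: E_mat_def succ_eq_Some_iff)
  have 2: "(E_mat C i k :: 'k) = 0" if "i < k" for i k
    using lnk_less[of k i] that by (auto simp: E_mat_def succ_eq_Some_iff)
  show "mat_eq (idx C) (idx C) (E_mat C \<cdot>\<^bsub>idx C\<^esub> mat_inv (idx C) (E_mat C)) (id_mat :: 'k matr)"
    "mat_eq (idx C) (idx C) (mat_inv (idx C) (E_mat C) \<cdot>\<^bsub>idx C\<^esub> E_mat C) (id_mat :: 'k matr)"
    using mat_inv_triangular[of "len C" "E_mat C :: 'k matr", OF 1] 2 by blast+
qed

text \<open>By \<open>qz_nu\<close> the equations in \<open>isol\<close> say that
  \<open>nu_mat\<close> sends X to c (e_a - e_b). So X is determined, and equals the inverse of
  \<open>nu_mat\<close> applied to that vector.\<close>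

lemma nu_solve:
  assumes X: "isol X c a b" and i: "i \<in> idx C"
  shows "(\<Sum>k\<in>idx C. mat_inv (idx C) (nu_mat C) i k * (c * ((if k = a then 1 else 0) - (if k = b then 1 else 0)))) = X i"
proof -
  let ?N = "idx C" let ?B = "mat_inv (idx C) (nu_mat C)"
  have nX: "c * ((if k = a then 1 else 0) - (if k = b then 1 else 0)) = (\<Sum>l\<in>?N. nu_mat C k l * X l)" if k: "k \<in> ?N" for k
  proof -
    have "(\<Sum>l\<in>?N. nu_mat C k l * X l) + (\<Sum>l\<in>?N. qz k l * X l) = (\<Sum>l\<in>?N. char_diff (wt C l) (lie C k) * X l)"
      unfolding sum.distrib[symmetric] distrib_right[symmetric] add.commute[of "nu_mat C k _"] qz_nu ..
    also have "\<dots> = 0" using X unfolding isol_def by blast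
    finally have "(\<Sum>l\<in>?N. nu_mat C k l * X l) = - (\<Sum>l\<in>?N. qz k l * X l)" by (simp only: eq_neg_iff_add_eq_0)
    also have "(\<Sum>l\<in>?N. qz k l * X l) = - c * ((if k = a then 1 else 0) - (if k = b then 1 else 0))"
      using X k unfolding isol_def by blast
    finally show ?thesis by simp
  qed
  have "(\<Sum>k\<in>?N. ?B i k * (c * ((if k = a then 1 else 0) - (if k = b then 1 else 0))))
      = (\<Sum>k\<in>?N. ?B i k * (\<Sum>l\<in>?N. nu_mat C k l * X l))"
    by (rule sum.cong[OF refl]) (simp only: nX)
  also have "\<dots> = (?B \<cdot>\<^bsub>?N\<^esub> (nu_mat C \<cdot>\<^bsub>?N\<^esub> (\<lambda>l _. X l))) i i" unfolding mat_mul_def ..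
  also have "\<dots> = ((?B \<cdot>\<^bsub>?N\<^esub> nu_mat C) \<cdot>\<^bsub>?N\<^esub> (\<lambda>l _. X l)) i i" by (simp only: mat_mul_assoc)
  also have "\<dots> = (\<Sum>l\<in>?N. (if i = l then 1 else 0) * X l)"
    unfolding mat_mul_def[of "?B \<cdot>\<^bsub>?N\<^esub> nu_mat C"]
    by (rule sum.cong[OF refl]) (use nu_inv i in \<open>simp add: mat_eq_def id_mat_def\<close>)
  also have "\<dots> = X i" by (rule sum_select(2)) (use i in auto)
  finally show ?thesis .
qed

lemma Et_row:
  assumes i: "i \<in> idx C"
  shows "(\<Sum>k\<in>idx C. E_mat C k i * v k) = (v i - opt0 v (succ C i) :: 'k)"
proof -
  have "(\<Sum>k\<in>idx C. E_mat C k i * v k) = (\<Sum>k\<in>idx C. (if k = i then 1 else 0) * v k) - (\<Sum>k\<in>idx C. if succ C i = Some k then v k else 0)"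
    unfolding sum_subtractf[symmetric] by (rule sum.cong) (auto simp: E_mat_def)
  also have "(\<Sum>k\<in>idx C. (if k = i then 1 else 0) * v k) = v i" by (rule sum_select(1)) (use i in auto)
  also have "(\<Sum>k\<in>idx C. if succ C i = Some k then v k else 0) = opt0 v (succ C i)"
  proof (cases "succ C i")
    case (Some m)
    then have "m \<in> idx C" using lnk_idx succ_eq_Some_iff by blast
    then show ?thesis using Some by simp
  qed simp
  finally show ?thesis .
qed

end

context sym_tau
begin

lemma idx_J: "m \<in> idx C \<Longrightarrow> m \<in> {1..<Suc (len CT)}"
  by simp

lemma pt_in: "m \<in> idx C \<Longrightarrow> pt m = Some q \<Longrightarrow> q \<in> idx C \<and> q < m"
  using pt_Some(1)[of m q] by auto

text \<open>The difference along predecessors of the re-ordered sequence. It models passing from Y_p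
  to the quotient by its predecessor, which behaves like the generator at position p.\<close>

definition dif :: "(nat \<Rightarrow> 'k) \<Rightarrow> nat \<Rightarrow> 'k" where
  "dif f p = f p - opt0 f (pt p)"

lemma dif_inj:
  assumes d: "\<And>p. p \<in> idx C \<Longrightarrow> dif f p = dif g p" and p: "p \<in> idx C"
  shows "f p = g p"
  using p
proof (induct p rule: less_induct)
  case (less p)
  show ?case
  proof (cases "pt p")
    case None
    then show ?thesis using d[OF less.prems] by (simp add: dif_def)
  next
    case (Some q)
    then have "f q = g q" using less.hyps pt_in[OF less.prems] by blast
    then show ?thesis using Some d[OF less.prems] by (simp add: dif_def)
  qed
qed

lemma dif_sum: "dif (\<lambda>r. \<Sum>p\<in>S. F r p * Z p) r = (\<Sum>p\<in>S. dif (\<lambda>r. F r p) r * Z p)"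
  by (cases "pt r") (simp_all add: dif_def sum_subtractf left_diff_distrib)

lemma dif_swap: "dif (\<lambda>r. dif (F r) p) r = dif (\<lambda>i. dif (\<lambda>r. F r i) r) p"
  by (cases "pt r"; cases "pt p") (simp_all add: dif_def)

text \<open>Predecessor and successor are mutually inverse partial maps, so the differences along
  them are transposed operators.\<close>

lemma summation_by_parts:
  "(\<Sum>p\<in>idx C. (Z p - opt0 Z (succ CT p)) * g p) = (\<Sum>p\<in>idx C. Z p * dif g p)"
proof -
  let ?N = "idx C"
  have 1: "opt0 Z (succ CT p) * g p = (\<Sum>q\<in>?N. if pt q = Some p then Z q * g p else 0)" if p: "p \<in> ?N" for p
  proof (cases "succ CT p")
    case None
    then have "\<not> (q \<in> ?N \<and> pt q = Some p)" for q using succ_T_iff[OF p, of q] by simp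
    then have "(\<Sum>q\<in>?N. if pt q = Some p then Z q * g p else 0) = 0" by (intro sum.neutral) auto
    then show ?thesis using None by simp
  next
    case (Some m)
    have m: "m \<in> ?N" by (rule succ_T_idx[OF p Some])
    have "pt q = Some p \<longleftrightarrow> q = m" if "q \<in> ?N" for q
    proof
      assume "pt q = Some p"
      then have "succ CT p = Some q" using succ_T_iff[OF p] that by blast
      then show "q = m" using Some by simp
    next
      assume "q = m"
      then show "pt q = Some p" using succ_T_iff[OF p, of m] Some by blast
    qed
    then have "(\<Sum>q\<in>?N. if pt q = Some p then Z q * g p else 0) = (\<Sum>q\<in>?N. if q = m then Z q * g p else 0)"
      by (intro sum.cong) auto
    also have "\<dots> = Z m * g p" using m by simp
    finally show ?thesis using Some by simp
  qed
  have 2: "Z q * opt0 g (pt q) = (\<Sum>p\<in>?N. if pt q = Some p then Z q * g p else 0)" if q: "q \<in> ?N" for q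
  proof (cases "pt q")
    case (Some m)
    then have "m \<in> ?N" using pt_in[OF q] by blast
    then show ?thesis using Some by simp
  qed simp
  have "(\<Sum>p\<in>?N. opt0 Z (succ CT p) * g p) = (\<Sum>q\<in>?N. Z q * opt0 g (pt q))"
  proof -
    have "(\<Sum>p\<in>?N. opt0 Z (succ CT p) * g p) = (\<Sum>p\<in>?N. \<Sum>q\<in>?N. if pt q = Some p then Z q * g p else 0)"
      by (rule sum.cong[OF refl]) (rule 1)
    also have "\<dots> = (\<Sum>q\<in>?N. \<Sum>p\<in>?N. if pt q = Some p then Z q * g p else 0)" by (rule sum.swap)
    also have "\<dots> = (\<Sum>q\<in>?N. Z q * opt0 g (pt q))" by (rule sum.cong[OF refl]) (rule 2[symmetric])
    finally show ?thesis .
  qed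
  then show ?thesis by (simp add: dif_def left_diff_distrib right_diff_distrib sum_subtractf)
qed

lemma lie_T: "lie CT r = (if r \<in> tau_minus n \<tau> then hs (\<tau> r) else lie C (\<tau> r))"
  by (simp add: reorder_def)

lemma side_T:
  assumes r: "r \<in> idx C" and p: "p \<in> {1..<r}"
  shows "\<tau> p < \<tau> r \<and> r \<in> tau_plus n \<tau> \<and> r \<notin> tau_minus n \<tau> \<or>
    \<tau> r < \<tau> p \<and> r \<in> tau_minus n \<tau> \<and> r \<notin> tau_plus n \<tau>"
proof -
  have 1: "1 \<in> {1..<r}" "r \<in> {2..n}" using p r by auto
  have s: "\<tau> 1 < \<tau> r \<longleftrightarrow> \<tau> p < \<tau> r" using Xi_side[OF tau _ 1(1) p] r by simp
  have "\<tau> p \<noteq> \<tau> r" "\<tau> 1 \<noteq> \<tau> r" using inj_eq[OF Xi_inj[OF tau]] p 1 by auto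
  then show ?thesis using s 1(2) unfolding tau_plus_def tau_minus_def by auto
qed

lemma char_lie_T:
  assumes r: "r \<in> idx C" and p: "p \<in> {1..<r}"
  shows "char_diff (wt C (\<tau> p)) (lie CT r) = qz (\<tau> r) (\<tau> p)"
proof -
  have pi: "\<tau> p \<in> idx C" "\<tau> r \<in> idx C" using p r Xi_idx[OF tau] by auto
  consider "\<tau> p < \<tau> r" "r \<notin> tau_minus n \<tau>" | "\<tau> r < \<tau> p" "r \<in> tau_minus n \<tau>"
    using side_T[OF r p] by blast
  then show ?thesis
  proof cases
    case 1
    then show ?thesis by (simp add: lie_T qz_def)
  next
    case 2
    have "char_diff (wt C (\<tau> r)) (lie C (\<tau> p)) = - char_diff (wt C (\<tau> p)) (hs (\<tau> r))"
      by (rule sym_wt[OF pi(1)]) (use 2 pi in simp)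
    then show ?thesis using 2 by (simp add: lie_T qz_def)
  qed
qed

lemma dif_W:
  fixes h :: "'k ^ 'r"
  assumes p: "p \<in> idx C"
  shows "dif (\<lambda>i. char_diff (T.F.W i) h) p = char_diff (wt C (\<tau> p)) h"
proof (cases "pt p")
  case None
  then show ?thesis
    using T.F.W_eq[OF idx_J[OF p]] by (simp add: dif_def T.F.Wp_def char_diff_add char_diff_def[of 0])
next
  case (Some q)
  then show ?thesis
    using T.F.W_eq[OF idx_J[OF p]] by (simp add: dif_def T.F.Wp_def char_diff_add)
qed

text \<open>For p < r, \<open>eq_rec\<close> turns the difference in r into a weight of Y evaluated
  at h_r, and \<open>dif_W\<close> turns the difference in p into the weight of a generator, which
  is the stated coefficient. The remaining cases follow by antisymmetry.\<close>

lemma second_difference: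
  assumes r: "r \<in> idx C" and p: "p \<in> idx C"
  shows "dif (\<lambda>r. dif (T.F.eq r) p) r = qz (\<tau> r) (\<tau> p)"
proof -
  have *: "dif (\<lambda>r. dif (T.F.eq r) p) r = qz (\<tau> r) (\<tau> p)"
    if r: "r \<in> idx C" and p: "p \<in> idx C" and lt: "p < r" for r p
  proof -
    have A: "dif (\<lambda>r. T.F.eq r i) r = char_diff (T.F.W i) (lie CT r)" if i: "i \<in> idx C" "i < r" for i
      using T.F.eq_rec[OF idx_J[OF i(1)] idx_J[OF r] i(2)] by (simp add: dif_def T.F.eqp_def opt0_def)
    have "dif (\<lambda>r. dif (T.F.eq r) p) r = dif (\<lambda>i. dif (\<lambda>r. T.F.eq r i) r) p" by (rule dif_swap)
    also have "\<dots> = dif (\<lambda>i. char_diff (T.F.W i) (lie CT r)) p"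
    proof (cases "pt p")
      case None
      then show ?thesis using A[OF p lt] by (simp add: dif_def[of _ p])
    next
      case (Some q)
      then have "q \<in> idx C" "q < r" using pt_in[OF p] lt by fastforce+
      then show ?thesis using A[OF p lt] A[of q] Some by (simp add: dif_def[of _ p])
    qed
    also have "\<dots> = qz (\<tau> r) (\<tau> p)" unfolding dif_W[OF p] by (rule char_lie_T[OF r]) (use p lt in auto)
    finally show ?thesis .
  qed
  have anti: "T.F.eq a b = - T.F.eq b a" if "a \<in> idx C" "b \<in> idx C" for a b
    using T.F.eq_anti idx_J that by blast
  have "dif (\<lambda>r. dif (T.F.eq r) p) r = - dif (\<lambda>p. dif (T.F.eq p) r) p"
  proof (cases "pt r")
    case None
    show ?thesis
    proof (cases "pt p")
      case None
      then show ?thesis using \<open>pt r = None\<close> anti[OF r p] by (simp add: dif_def)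
    next
      case (Some q)
      then have "q \<in> idx C" using pt_in[OF p] by blast
      then show ?thesis using Some \<open>pt r = None\<close> anti[OF r p] anti[OF r, of q] by (simp add: dif_def)
    qed
  next
    case (Some s)
    then have s: "s \<in> idx C" using pt_in[OF r] by blast
    show ?thesis
    proof (cases "pt p")
      case None
      then show ?thesis using Some anti[OF r p] anti[OF s p] by (simp add: dif_def)
    next
      case (Some q)
      then have q: "q \<in> idx C" using pt_in[OF p] by blast
      show ?thesis using Some \<open>pt r = Some s\<close> anti[OF r p] anti[OF s p] anti[OF r q] anti[OF s q] by (simp add: dif_def)
    qed
  qed
  then show ?thesis
  proof (cases p r rule: linorder_cases)
    case greater
    then show ?thesis using * [OF p r greater] \<open>dif (\<lambda>r. dif (T.F.eq r) p) r = _\<close> qz_anti[of "\<tau> r" "\<tau> p"] by simp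
  next
    case equal
    have z: "T.F.eq a a = 0" if "a \<in> idx C" for a using T.F.eq_self[OF idx_J[OF that]] .
    show ?thesis
    proof (cases "pt p")
      case None
      then show ?thesis using equal z[OF p] by (simp add: dif_def qz_def)
    next
      case (Some q)
      then have q: "q \<in> idx C" using pt_in[OF p] by blast
      then show ?thesis using Some equal z[OF p] z[OF q] anti[OF q p] by (simp add: dif_def qz_def)
    qed
  qed (use * [OF r p] in blast)
qed

text \<open>One column of the GSV system of the re-ordered extension, with the constant on the right
  left free: it is an eigenvalue of R_\<tau> for the GSV matrix and the level-set constant after the
  sign correction.\<close>

definition gcol :: "(nat \<Rightarrow> 'k) \<Rightarrow> nat \<Rightarrow> 'k \<Rightarrow> bool" where
  "gcol f j c \<longleftrightarrow> (\<forall>r\<in>idx C. (\<Sum>p\<in>idx C. T.F.eq r p * f p) = - (if r = j then c else 0)) \<and>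
     (\<forall>h. (\<Sum>p\<in>idx C. char_diff (T.F.W p) h * f p) = 0)"

lemma gcol_scale: "gcol f j c \<Longrightarrow> gcol (\<lambda>p. f p * s) j (c * s)"
  unfolding gcol_def mult.assoc[symmetric] sum_distrib_right[symmetric] by simp

lemma dif_eq_sum:
  assumes r: "r \<in> idx C"
  shows "dif (\<lambda>r. \<Sum>p\<in>idx C. dif (T.F.eq r) p * X (\<tau> p)) r = (\<Sum>l\<in>idx C. qz (\<tau> r) l * X l)"
proof -
  have "dif (\<lambda>r. \<Sum>p\<in>idx C. dif (T.F.eq r) p * X (\<tau> p)) r = (\<Sum>p\<in>idx C. qz (\<tau> r) (\<tau> p) * X (\<tau> p))"
    unfolding dif_sum by (rule sum.cong[OF refl]) (simp only: second_difference[OF r])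
  also have "\<dots> = (\<Sum>l\<in>idx C. qz (\<tau> r) l * X l)"
    by (subst (2) sum.permute[OF tau_perm]) (simp add: o_def)
  finally show ?thesis .
qed

lemma parts_eq:
  assumes "\<And>p. p \<in> idx C \<Longrightarrow> f p = X (\<tau> p) - opt0 (\<lambda>p. X (\<tau> p)) (succ CT p)"
  shows "(\<Sum>p\<in>idx C. g p * f p) = (\<Sum>p\<in>idx C. dif g p * X (\<tau> p))"
proof -
  have "(\<Sum>p\<in>idx C. g p * f p) = (\<Sum>p\<in>idx C. (X (\<tau> p) - opt0 (\<lambda>p. X (\<tau> p)) (succ CT p)) * g p)"
    by (rule sum.cong[OF refl]) (simp add: assms mult.commute)
  also have "\<dots> = (\<Sum>p\<in>idx C. X (\<tau> p) * dif g p)" by (rule summation_by_parts)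
  finally show ?thesis by (simp only: mult.commute)
qed

lemma parts_chi:
  fixes h :: "'k ^ 'r"
  assumes f: "\<And>p. p \<in> idx C \<Longrightarrow> f p = X (\<tau> p) - opt0 (\<lambda>p. X (\<tau> p)) (succ CT p)"
  shows "(\<Sum>p\<in>idx C. char_diff (T.F.W p) h * f p) = (\<Sum>l\<in>idx C. char_diff (wt C l) h * X l)"
proof -
  have "(\<Sum>p\<in>idx C. char_diff (T.F.W p) h * f p) = (\<Sum>p\<in>idx C. dif (\<lambda>i. char_diff (T.F.W i) h) p * X (\<tau> p))"
    using f by (rule parts_eq)
  also have "\<dots> = (\<Sum>p\<in>idx C. char_diff (wt C (\<tau> p)) h * X (\<tau> p))"
    by (rule sum.cong[OF refl]) (simp only: dif_W)
  also have "\<dots> = (\<Sum>l\<in>idx C. char_diff (wt C l) h * X l)"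
    by (subst (2) sum.permute[OF tau_perm]) (simp add: o_def)
  finally show ?thesis .
qed

text \<open>The row equations are compared after applying \<open>dif\<close>, which loses nothing by
  \<open>dif_inj\<close>. On the left this gives a row of \<open>qz\<close> applied to
  \<open>X\<close>; on the right the unit vector at \<open>j\<close> becomes a difference of unit
  vectors at \<open>j\<close> and its successor \<open>m\<close>.\<close>

lemma gcol_of_isol:
  assumes X: "isol X c (\<tau> j) (\<tau> m)" and j: "j \<in> idx C" and s: "succ CT j = Some m"
  shows "gcol (\<lambda>p. X (\<tau> p) - opt0 (\<lambda>p. X (\<tau> p)) (succ CT p)) j c"
proof -
  have m: "m \<in> idx C" by (rule succ_T_idx[OF j s])
  have inj: "\<tau> a = \<tau> b \<longleftrightarrow> a = b" for a b using inj_eq[OF Xi_inj[OF tau]] .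
  let ?S = "\<lambda>r. \<Sum>p\<in>idx C. dif (T.F.eq r) p * X (\<tau> p)" let ?G = "\<lambda>r. - (if r = j then c else 0)"
  have "?S r = ?G r" if r: "r \<in> idx C" for r
  proof (rule dif_inj[OF _ r])
    fix r assume r: "r \<in> idx C"
    have pj: "pt r = Some j \<longleftrightarrow> r = m"
    proof
      assume "pt r = Some j"
      then have "succ CT j = Some r" using succ_T_iff[OF j] r by blast
      then show "r = m" using s by simp
    next
      assume "r = m"
      then show "pt r = Some j" using succ_T_iff[OF j, of m] s by blast
    qed
    have "dif ?S r = - c * ((if \<tau> r = \<tau> j then 1 else 0) - (if \<tau> r = \<tau> m then 1 else 0))"
      unfolding dif_eq_sum[OF r] using X Xi_idx[OF tau r] unfolding isol_def by blast
    moreover have "opt0 ?G (pt r) = (if r = m then - c else 0)"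
      using pj by (cases "pt r") auto
    ultimately show "dif ?S r = dif ?G r" unfolding dif_def[of ?G] by (simp add: inj)
  qed
  then have "\<forall>r\<in>idx C. (\<Sum>p\<in>idx C. T.F.eq r p * (X (\<tau> p) - opt0 (\<lambda>p. X (\<tau> p)) (succ CT p))) = ?G r"
    by (simp only: parts_eq[OF refl]) blast
  moreover have "\<forall>h. (\<Sum>p\<in>idx C. char_diff (T.F.W p) h * (X (\<tau> p) - opt0 (\<lambda>p. X (\<tau> p)) (succ CT p))) = 0"
    using X unfolding isol_def by (simp only: parts_chi[OF refl]) simp
  ultimately show ?thesis unfolding gcol_def by blast
qed

text \<open>The difference of two solutions is a successor difference of some Z, as the matrix
  \<open>A\<close> is triangular with nonzero diagonal. Transported to the x coordinates, Z solves
  the homogeneous equations, and \<open>nu_solve\<close> makes it vanish.\<close>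

lemma gcol_unique:
  assumes f: "gcol f j c" and g: "gcol g j c" and p: "p \<in> idx C"
  shows "f p = g p"
proof -
  let ?N = "idx C"
  define d where "d p = f p - g p" for p
  have d1: "(\<Sum>p\<in>?N. T.F.eq r p * d p) = 0" if "r \<in> ?N" for r
    using f g that unfolding gcol_def d_def by (simp add: right_diff_distrib sum_subtractf)
  have d2: "(\<Sum>p\<in>?N. char_diff (T.F.W p) h * d p) = 0" for h
    using f g unfolding gcol_def d_def by (simp add: right_diff_distrib sum_subtractf)
  have lt: "p < k" if "p \<in> ?N" "succ CT p = Some k" for p k
    using succ_T_iff[OF that(1), of k] that(2) pt_in[of k p] by blast
  define A :: "nat \<Rightarrow> nat \<Rightarrow> 'k" where "A p k = (if p = k then 1 else 0) - (if succ CT p = Some k then 1 else 0)" for p k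
  have A1: "A p p \<noteq> 0" if "p \<in> ?N" for p using lt[OF that, of p] by (auto simp: A_def)
  have A2: "A p k = 0" if "p \<in> ?N" "k \<in> ?N" "k < p" for p k using lt[OF that(1), of k] that by (auto simp: A_def)
  obtain Z where Z: "\<And>p. p \<in> ?N \<Longrightarrow> (\<Sum>k\<in>?N. A p k * Z k) = d p"
    using upper_solve[of "len C" A d, OF A1 A2] by blast
  have row: "(\<Sum>k\<in>?N. A p k * Z k) = Z p - opt0 Z (succ CT p)" if p: "p \<in> ?N" for p
  proof -
    have "(\<Sum>k\<in>?N. A p k * Z k) = (\<Sum>k\<in>?N. (if p = k then 1 else 0) * Z k) - (\<Sum>k\<in>?N. if succ CT p = Some k then Z k else 0)"
      unfolding sum_subtractf[symmetric] by (rule sum.cong) (auto simp: A_def)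
    also have "(\<Sum>k\<in>?N. (if p = k then 1 else 0) * Z k) = Z p" by (rule sum_select(2)) (use p in auto)
    also have "(\<Sum>k\<in>?N. if succ CT p = Some k then Z k else 0) = opt0 Z (succ CT p)"
    proof (cases "succ CT p")
      case (Some m)
      then have "m \<in> ?N" by (rule succ_T_idx[OF p])
      then show ?thesis using Some by simp
    qed simp
    finally show ?thesis .
  qed
  define X where "X l = Z (inv \<tau> l)" for l
  have XZ: "X (\<tau> p) = Z p" for p by (simp add: X_def permutes_inverses[OF tau_perm])
  have dX: "d p = X (\<tau> p) - opt0 (\<lambda>p. X (\<tau> p)) (succ CT p)" if "p \<in> ?N" for p
    using Z[OF that] row[OF that] by (simp add: XZ)
  have S0: "(\<Sum>p\<in>?N. dif (T.F.eq r) p * X (\<tau> p)) = 0" if r: "r \<in> ?N" for r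
    using d1[OF r] parts_eq[OF dX, of "T.F.eq r"] by simp
  have q0: "(\<Sum>l\<in>?N. qz i l * X l) = 0" if i: "i \<in> ?N" for i
  proof -
    obtain r where r: "r \<in> ?N" "i = \<tau> r" using i permutes_image[OF tau_perm] by blast
    have "dif (\<lambda>r. \<Sum>p\<in>?N. dif (T.F.eq r) p * X (\<tau> p)) r = 0"
    proof (cases "pt r")
      case None
      then show ?thesis using S0[OF r(1)] by (simp add: dif_def[of _ r])
    next
      case (Some q)
      then show ?thesis using S0[OF r(1)] S0[of q] pt_in[OF r(1) Some] by (simp add: dif_def[of _ r])
    qed
    then show ?thesis unfolding dif_eq_sum[OF r(1)] r(2) .
  qed
  \<comment> \<open>With constant 0 the two marked indices are placeholders.\<close>
  have "isol X 0 1 1"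
    unfolding isol_def using q0 d2 parts_chi[of d X, OF dX] by simp
  from nu_solve[OF this] have X0: "X i = 0" if "i \<in> ?N" for i using that by simp
  have "opt0 (\<lambda>p. X (\<tau> p)) (succ CT p) = 0"
    using succ_T_idx[OF p] X0 Xi_idx[OF tau] by (cases "succ CT p") auto
  then have "d p = 0" using dX[OF p] X0[OF Xi_idx[OF tau p]] by simp
  then show ?thesis by (simp add: d_def)
qed

text \<open>If the successor is added from above, its eigenvalue is the level-set constant
  (\<open>lamK_upper\<close>); if from below, it is the negative of that constant
  (\<open>lamK_lower\<close>), which the sign in \<open>eps_mat\<close> undoes.\<close>

lemma lam_T:
  assumes j: "j \<in> idx C" and s: "succ CT j = Some m"
  shows "lam CT m * eps_mat C hs \<tau> j j = lamK (\<tau> j)" "eps_mat C hs \<tau> j j * eps_mat C hs \<tau> j j = (1::'k)"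
proof -
  have m: "m \<in> idx C" "pt m = Some j" using s unfolding succ_T_iff[OF j] by (rule conjunct1, rule conjunct2)
  have jm: "j \<in> {1..<m}" by (rule pt_Some(1)[OF m])
  have lk: "\<tau> j \<approx> \<tau> m" by (rule pt_lkeq[OF m])
  have i: "\<tau> j \<in> idx C" "\<tau> m \<in> idx C" using Xi_idx[OF tau] j m by auto
  have "lam CT m * eps_mat C hs \<tau> j j = lamK (\<tau> j) \<and> eps_mat C hs \<tau> j j * eps_mat C hs \<tau> j j = (1::'k)"
    using side_T[OF m(1) jm]
  proof (elim disjE conjE)
    assume a: "\<tau> j < \<tau> m" "m \<in> tau_plus n \<tau>" "m \<notin> tau_minus n \<tau>"
    have "lam CT m = lam C (\<tau> m)" using a(3) by (simp add: lam_def lie_T)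
    then show ?thesis using lamK_upper[OF a(1) lk i] a s by (simp add: eps_mat_def)
  next
    assume a: "\<tau> m < \<tau> j" "m \<in> tau_minus n \<tau>" "m \<notin> tau_plus n \<tau>"
    have "lam CT m = char_diff (wt C (\<tau> m)) (hs (\<tau> m))" using a(2) by (simp add: lam_def lie_T)
    also have "\<dots> = - lamK (\<tau> m)" by (rule lamK_lower[OF a(1) lkeq_sym[OF lk] i(2,1)])
    finally show ?thesis using a s lamK_cong[OF lk] by (simp add: eps_mat_def)
  qed
  then show "lam CT m * eps_mat C hs \<tau> j j = lamK (\<tau> j)" "eps_mat C hs \<tau> j j * eps_mat C hs \<tau> j j = (1::'k)" by auto
qed

lemma gsv_T_iff:
  "gsv_equations CT YT (ex CT) (Lam_mat CT) M \<longleftrightarrow> (\<forall>j\<in>ex CT. gcol (\<lambda>p. M p j) j (lam CT (the (succ CT j))))"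
  by (simp only: gsv_equations_def mat_eq_def mat_mul_def gcol_def Lam_mat_def T.F.eq_def T.F.W_def reorder_simps ball_conj_distrib)
    blast

lemma ex_T: "j \<in> ex CT \<Longrightarrow> j \<in> idx C \<and> (\<exists>m. succ CT j = Some m)"
  by (auto simp: ex_def)

lemma column_exists:
  assumes j: "j \<in> idx C" and s: "succ CT j = Some m"
  shows "\<exists>X. (\<forall>l. X l \<in> \<int>) \<and> isol X (lamK (\<tau> j)) (\<tau> j) (\<tau> m) \<and>
    gcol (\<lambda>p. X (\<tau> p) - opt0 (\<lambda>p. X (\<tau> p)) (succ CT p)) j (lamK (\<tau> j))"
proof -
  have m: "m \<in> idx C" "pt m = Some j" using s unfolding succ_T_iff[OF j] by (rule conjunct1, rule conjunct2)
  obtain X where X: "\<forall>l. X l \<in> \<int>" "isol X (lamK (\<tau> j)) (\<tau> j) (\<tau> m)"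
    using isol_lkeq[OF pt_lkeq[OF m]] by blast
  then show ?thesis using gcol_of_isol[OF X(2) j s] by (intro exI[of _ X] conjI)
qed

text \<open>Since \<open>gsv_mat\<close> is a definite description, existence and uniqueness of all
  columns are needed. Existence comes from \<open>column_exists\<close>, rescaled by the sign to the
  required constant.\<close>

lemma gsv_T:
  assumes j: "j \<in> ex CT"
  shows "gcol (\<lambda>p. gsv_mat CT p j) j (lam CT (the (succ CT j)))"
proof -
  have "\<exists>f. gcol f j (lam CT (the (succ CT j)))" if j: "j \<in> ex CT" for j
  proof -
    obtain m where s: "succ CT j = Some m" and ji: "j \<in> idx C" using ex_T[OF j] by blast
    let ?e = "eps_mat C hs \<tau> j j :: 'k"
    obtain f where f: "gcol f j (lamK (\<tau> j))" using column_exists[OF ji s] by blast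
    have "lamK (\<tau> j) * ?e = lam CT m * (?e * ?e)" unfolding lam_T(1)[OF ji s, symmetric] by (simp only: mult.assoc)
    then have "lamK (\<tau> j) * ?e = lam CT m" unfolding lam_T(2)[OF ji s] by simp
    then show ?thesis using gcol_scale[OF f, of ?e] s by auto
  qed
  then have "\<forall>j. \<exists>f. j \<in> ex CT \<longrightarrow> gcol f j (lam CT (the (succ CT j)))" by blast
  from choice[OF this] obtain G where G: "\<And>j. j \<in> ex CT \<Longrightarrow> gcol (G j) j (lam CT (the (succ CT j)))" by blast
  define M where "M p j = (if p \<in> idx C \<and> j \<in> ex CT then G j p else 0)" for p j
  let ?P = "\<lambda>M. (\<forall>i j. i \<notin> idx CT \<or> j \<notin> ex CT \<longrightarrow> M i j = 0) \<and> gsv_equations CT YT (ex CT) (Lam_mat CT) M"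
  have cong: "gcol f j c" if "gcol g j c" "\<And>p. p \<in> idx C \<Longrightarrow> f p = g p" for f g j c
    using that unfolding gcol_def by simp
  have "gcol (\<lambda>p. M p j) j (lam CT (the (succ CT j)))" if j: "j \<in> ex CT" for j
    by (rule cong[OF G[OF j]]) (use j in \<open>simp add: M_def\<close>)
  then have PM: "?P M" unfolding gsv_T_iff by (auto simp: M_def)
  have "?P (THE M. ?P M)"
  proof (rule theI[of ?P, OF PM])
    fix M' assume P': "?P M'"
    show "M' = M"
    proof (intro ext)
      fix i j
      show "M' i j = M i j"
      proof (cases "i \<in> idx C \<and> j \<in> ex CT")
        case True
        then show ?thesis
          using gcol_unique[of "\<lambda>p. M' p j" j _ "\<lambda>p. M p j" i] P' PM unfolding gsv_T_iff by blast
      next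
        case False
        then have "i \<notin> idx CT \<or> j \<notin> ex CT" by simp
        then have "M' i j = 0" "M i j = 0" using P' PM by blast+
        then show ?thesis by simp
      qed
    qed
  qed
  then have "?P (gsv_mat CT)" unfolding gsv_mat_def .
  then show ?thesis using j unfolding gsv_T_iff by blast
qed

end

section \<open>Assembly: the columns of M_\<tau>, its equations and the three formulas\<close>

section \<open>The matrix \<open>M\<^sub>\<tau>\<close>\<close>

context sym
begin

lemma lam_succ: "c \<in> ex C \<Longrightarrow> lam C (the (succ C c)) = lamK c"
proof -
  assume "c \<in> ex C"
  then obtain v where v: "lnk c v" unfolding ex_iff by blast
  then have "succ C c = Some v" by (simp only: succ_eq_Some_iff)
  then show ?thesis using lamK_upper[OF lnk_less[OF v] lnk_lkeq[OF v]] lnk_idx[OF v] by simp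
qed

text \<open>Along a path inside a level set e_a - e_b telescopes into columns of
  \<open>E_mat\<close> with index in \<open>ex C\<close>.\<close>

lemma E_solve:
  assumes "a \<approx> b"
  shows "\<exists>G :: nat \<Rightarrow> 'k. (\<forall>k. k \<notin> ex C \<or> \<not> a \<approx> k \<longrightarrow> G k = 0) \<and>
    (\<forall>i\<in>idx C. (\<Sum>k\<in>idx C. E_mat C i k * G k) = (if i = a then 1 else 0) - (if i = b then 1 else 0))"
  using assms
proof (induct rule: equivclp_induct)
  case base
  show ?case by (intro exI[of _ "\<lambda>k. 0"]) simp
next
  case (step y z)
  obtain G :: "nat \<Rightarrow> 'k" where G0: "\<And>k. k \<notin> ex C \<or> \<not> a \<approx> k \<Longrightarrow> G k = 0"
    and G: "\<And>i. i \<in> idx C \<Longrightarrow> (\<Sum>k\<in>idx C. E_mat C i k * G k) = (if i = a then 1 else 0) - (if i = y then 1 else 0)"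
    using step by blast
  have unit: "(\<Sum>k\<in>idx C. E_mat C i k * (if k = u then 1 else 0)) = ((if i = u then 1 else 0) - (if i = v then 1 else 0) :: 'k)"
    if l: "lnk u v" for i u v
  proof -
    have "u \<in> idx C" using lnk_idx[OF l] by blast
    then have "(\<Sum>k\<in>idx C. E_mat C i k * (if k = u then 1 else 0)) = (E_mat C i u :: 'k)"
      by (intro sum_select(3)) auto
    moreover have "succ C u = Some v" using l by (simp only: succ_eq_Some_iff)
    ultimately show ?thesis by (simp add: E_mat_def eq_commute[of v])
  qed
  from step(2) show ?case
  proof
    assume l: "lnk y z"
    have "y \<in> ex C" "a \<approx> y" using l ex_iff step(1) by blast+
    then have "\<forall>k. k \<notin> ex C \<or> \<not> a \<approx> k \<longrightarrow> G k + (if k = y then 1 else 0) = 0" using G0 by auto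
    moreover have "\<forall>i\<in>idx C. (\<Sum>k\<in>idx C. E_mat C i k * (G k + (if k = y then 1 else 0))) = (if i = a then 1 else 0) - (if i = z then 1 else 0)"
      unfolding distrib_left sum.distrib unit[OF l] using G by simp
    ultimately show ?thesis by (intro exI[of _ "\<lambda>k. G k + (if k = y then 1 else 0)"] conjI)
  next
    assume l: "lnk z y"
    have "a \<approx> z" using step(1) lnk_lkeq[OF l] lkeq_sym lkeq_trans by blast
    then have "\<forall>k. k \<notin> ex C \<or> \<not> a \<approx> k \<longrightarrow> G k - (if k = z then 1 else 0) = 0" using G0 l ex_iff by auto
    moreover have "\<forall>i\<in>idx C. (\<Sum>k\<in>idx C. E_mat C i k * (G k - (if k = z then 1 else 0))) = (if i = a then 1 else 0) - (if i = z then 1 else 0)"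
      unfolding right_diff_distrib sum_subtractf unit[OF l] using G by simp
    ultimately show ?thesis by (intro exI[of _ "\<lambda>k. G k - (if k = z then 1 else 0)"] conjI)
  qed
qed

lemma E_Lam:
  assumes "c \<in> ex C"
  shows "(E_mat C \<cdot>\<^bsub>idx C\<^esub> Lam_mat C) k c = lamK c * E_mat C k c"
proof -
  have "(E_mat C \<cdot>\<^bsub>idx C\<^esub> Lam_mat C) k c = (\<Sum>l\<in>idx C. (lamK c * E_mat C k l) * (if l = c then 1 else 0))"
    unfolding mat_mul_def by (rule sum.cong[OF refl]) (simp add: Lam_mat_def lam_succ[OF assms])
  also have "\<dots> = lamK c * E_mat C k c" by (rule sum_select(3)) (use assms in \<open>auto simp: ex_def\<close>)
  finally show ?thesis .
qed

end

context sym_tau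
begin

lemma inv_kappa: "inv \<kappa> (\<kappa> j) = j" "\<kappa> (inv \<kappa> c) = c"
  using permutes_inverses[OF kappa_perm] by auto

lemma inv_tb: "inv tb (tb j) = j" "tb (inv tb c) = c"
  using permutes_inverses[OF tb_perm] by auto

lemma tb_eq_iff: "tb k = v \<longleftrightarrow> k = inv tb v"
  using inv_tb by auto

lemma tb_in: "k \<in> idx C \<Longrightarrow> tb k \<in> idx C" "k \<in> idx C \<Longrightarrow> inv tb k \<in> idx C"
  using permutes_in_image[OF tb_perm] permutes_in_image[OF permutes_inv[OF tb_perm]] by blast+

lemma inv_tb_kappa: "inv tb (\<kappa> p) = \<tau> p"
  by (simp add: \<kappa>_def inv_tb)

lemma M_tau_entry:
  assumes p: "p \<in> idx C" and j: "j \<in> ex CT"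
  shows "M_tau C hs \<tau> (\<kappa> p) (\<kappa> j) = gsv_mat CT p j * eps_mat C hs \<tau> j j"
proof -
  let ?G = "gsv_mat CT" let ?e = "eps_mat C hs \<tau> :: 'k matr" let ?x = "ex CT"
  let ?Ge = "?G \<cdot>\<^bsub>?x\<^esub> ?e"
  have fx: "finite ?x" by (simp add: ex_def)
  have kap: "tau_bullet C \<tau> \<circ> \<tau> = \<kappa>" by (simp add: \<kappa>_def tb_def)
  have 1: "(perm_mat \<kappa> \<cdot>\<^bsub>idx C\<^esub> ?Ge) (\<kappa> p) l = ?Ge p l" for l
  proof -
    have "(perm_mat \<kappa> \<cdot>\<^bsub>idx C\<^esub> ?Ge) (\<kappa> p) l = (\<Sum>k\<in>idx C. (if p = k then 1 else 0) * ?Ge k l)"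
      unfolding mat_mul_def[of "perm_mat \<kappa>"]
      by (rule sum.cong[OF refl]) (simp add: perm_mat_def inj_eq[OF permutes_inj[OF kappa_perm]])
    also have "\<dots> = ?Ge p l" by (rule sum_select(2)) (use p in auto)
    finally show ?thesis .
  qed
  have "?Ge p j = (\<Sum>r\<in>?x. (?G p r * ?e j j) * (if r = j then 1 else 0))"
    unfolding mat_mul_def by (rule sum.cong[OF refl]) (simp add: eps_mat_def)
  also have "\<dots> = ?G p j * ?e j j" by (rule sum_select(3)[OF fx j])
  finally have 2: "?Ge p j = ?G p j * ?e j j" .
  have "M_tau C hs \<tau> (\<kappa> p) (\<kappa> j) = (\<Sum>l\<in>?x. (perm_mat \<kappa> \<cdot>\<^bsub>idx C\<^esub> ?Ge) (\<kappa> p) l * perm_mat (inv \<kappa>) l (\<kappa> j))"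
    unfolding M_tau_def kap mat_mul_def[of _ ?x "perm_mat (inv \<kappa>)"] ..
  also have "\<dots> = (\<Sum>l\<in>?x. ?Ge p l * (if l = j then 1 else 0))"
    unfolding 1 by (simp only: perm_mat_def inv_kappa)
  also have "\<dots> = ?Ge p j" by (rule sum_select(3)[OF fx j])
  finally show ?thesis unfolding 2 .
qed

text \<open>After sign correction the column solves the system with the level-set constant, so
  \<open>gcol_unique\<close> identifies it with the successor difference of an integral
  \<open>X\<close>. Integrality, the equations and the formulas are all read off from this
  description.\<close>

lemma M_col:
  assumes c: "c \<in> ex C"
  obtains X where "\<And>l. X l \<in> \<int>" "isol X (lamK c) (inv tb c) (inv tb (the (succ C c)))"
    "\<And>i. i \<in> idx C \<Longrightarrow> M_tau C hs \<tau> i c = X (inv tb i) - opt0 (\<lambda>k. X (inv tb k)) (succ C i)"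
    "gcol (\<lambda>p. M_tau C hs \<tau> (\<kappa> p) c) (inv \<kappa> c) (lamK c)"
proof -
  define j where "j = inv \<kappa> c"
  have cj: "c = \<kappa> j" by (simp add: j_def inv_kappa)
  have jx: "j \<in> ex CT" using c ex_kappa[of j] unfolding cj by blast
  obtain m where ji: "j \<in> idx C" and s: "succ CT j = Some m" using ex_T[OF jx] by blast
  have m: "m \<in> idx C" by (rule succ_T_idx[OF ji s])
  have lc: "lamK (\<tau> j) = lamK c" unfolding cj using lamK_cong[OF kappa_lkeq[OF ji]] by (rule sym)
  obtain X where X: "\<And>l. X l \<in> \<int>" "isol X (lamK c) (\<tau> j) (\<tau> m)"
    "gcol (\<lambda>p. X (\<tau> p) - opt0 (\<lambda>p. X (\<tau> p)) (succ CT p)) j (lamK c)"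
    using column_exists[OF ji s] unfolding lc by blast
  have g: "gcol (\<lambda>p. gsv_mat CT p j * eps_mat C hs \<tau> j j) j (lamK c)"
    using gcol_scale[OF gsv_T[OF jx], of "eps_mat C hs \<tau> j j"] lam_T(1)[OF ji s] unfolding s option.sel lc by simp
  have Mp: "M_tau C hs \<tau> (\<kappa> p) c = X (\<tau> p) - opt0 (\<lambda>p. X (\<tau> p)) (succ CT p)" if p: "p \<in> idx C" for p
    unfolding cj M_tau_entry[OF p jx] by (rule gcol_unique[OF g X(3) p])
  have sc: "succ C c = Some (\<kappa> m)" unfolding cj using succ_kappa[OF m ji] s by blast
  show thesis
  proof (rule that)
    show "X l \<in> \<int>" for l by (rule X(1))
    have "inv tb c = \<tau> j" "inv tb (the (succ C c)) = \<tau> m" unfolding sc option.sel by (simp_all only: cj inv_tb_kappa)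
    then show "isol X (lamK c) (inv tb c) (inv tb (the (succ C c)))" using X(2) by simp
    show "M_tau C hs \<tau> i c = X (inv tb i) - opt0 (\<lambda>k. X (inv tb k)) (succ C i)" if i: "i \<in> idx C" for i
    proof -
      define p where "p = inv \<kappa> i"
      have ip: "i = \<kappa> p" by (simp add: p_def inv_kappa)
      have p: "p \<in> idx C" using i kappa_idx[of p] unfolding ip by blast
      have "opt0 (\<lambda>p. X (\<tau> p)) (succ CT p) = opt0 (\<lambda>k. X (inv tb k)) (succ C i)"
      proof (cases "succ CT p")
        case None
        then have "p \<notin> ex CT" unfolding ex_def by simp
        then have "i \<notin> ex C" using ex_kappa[of p] unfolding ip by blast
        then have "succ C i = None" using i unfolding ex_def by blast
        then show ?thesis using None by simp
      next
        case (Some q)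
        then have "succ C i = Some (\<kappa> q)" unfolding ip using succ_kappa[OF succ_T_idx[OF p Some] p] by blast
        then show ?thesis using Some by (simp add: inv_tb_kappa)
      qed
      then show ?thesis using Mp[OF p] unfolding ip inv_tb_kappa by simp
    qed
    show "gcol (\<lambda>p. M_tau C hs \<tau> (\<kappa> p) c) (inv \<kappa> c) (lamK c)"
      using X(3) Mp unfolding gcol_def j_def[symmetric] by simp
  qed
qed

lemma gsv_tau_iff:
  "gsv_equations C (prime_seq_tau C hs \<tau>) (ex C) (Lam_mat C) M \<longleftrightarrow>
    (\<forall>c\<in>ex C. gcol (\<lambda>p. M (\<kappa> p) c) (inv \<kappa> c) (lamK c))"
proof -
  let ?y = "prime_seq_tau C hs \<tau>"
  have y: "?y k = YT (inv \<kappa> k)" for k by (simp add: prime_seq_tau_def \<kappa>_def tb_def)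
  have q: "q_mat C ?y (\<kappa> r) (\<kappa> p) = T.F.eq r p" for r p
    by (simp add: q_mat_def y inv_kappa T.F.eq_def)
  have w: "weight_of C (?y (\<kappa> p)) = T.F.W p" for p
    by (simp add: y inv_kappa T.F.W_def)
  have A: "(q_mat C ?y \<cdot>\<^bsub>idx C\<^esub> M) (\<kappa> r) c = (\<Sum>p\<in>idx C. T.F.eq r p * M (\<kappa> p) c)" for r c
    unfolding mat_mul_def by (subst sum.permute[OF kappa_perm]) (simp add: o_def q)
  have D: "(\<Sum>k\<in>idx C. char_diff (weight_of C (?y k)) h * M k c) = (\<Sum>p\<in>idx C. char_diff (T.F.W p) h * M (\<kappa> p) c)" for h c
    by (subst sum.permute[OF kappa_perm]) (simp add: o_def w)
  have B: "Lam_mat C (\<kappa> r) c = (if r = inv \<kappa> c then lamK c else 0)" if c: "c \<in> ex C" for r c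
  proof -
    have "\<kappa> r = c \<longleftrightarrow> r = inv \<kappa> c" using inv_kappa by auto
    then show ?thesis by (simp add: Lam_mat_def lam_succ[OF c])
  qed
  have all: "(\<forall>i\<in>idx C. P i) \<longleftrightarrow> (\<forall>r\<in>idx C. P (\<kappa> r))" for P
    by (subst permutes_image[OF kappa_perm, symmetric]) blast
  have "gsv_equations C ?y (ex C) (Lam_mat C) M \<longleftrightarrow>
    (\<forall>c\<in>ex C. (\<forall>i\<in>idx C. (q_mat C ?y \<cdot>\<^bsub>idx C\<^esub> M) i c = - Lam_mat C i c) \<and>
      (\<forall>h. (\<Sum>k\<in>idx C. char_diff (weight_of C (?y k)) h * M k c) = 0))"
    unfolding gsv_equations_def mat_eq_def by blast
  also have "\<dots> \<longleftrightarrow> (\<forall>c\<in>ex C. gcol (\<lambda>p. M (\<kappa> p) c) (inv \<kappa> c) (lamK c))"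
  proof (rule ball_cong[OF refl])
    fix c assume c: "c \<in> ex C"
    have "(\<forall>i\<in>idx C. (q_mat C ?y \<cdot>\<^bsub>idx C\<^esub> M) i c = - Lam_mat C i c) \<longleftrightarrow>
      (\<forall>r\<in>idx C. (\<Sum>p\<in>idx C. T.F.eq r p * M (\<kappa> p) c) = - (if r = inv \<kappa> c then lamK c else 0))"
      by (subst all) (simp only: A B[OF c])
    then show "((\<forall>i\<in>idx C. (q_mat C ?y \<cdot>\<^bsub>idx C\<^esub> M) i c = - Lam_mat C i c) \<and>
      (\<forall>h. (\<Sum>k\<in>idx C. char_diff (weight_of C (?y k)) h * M k c) = 0)) \<longleftrightarrow> gcol (\<lambda>p. M (\<kappa> p) c) (inv \<kappa> c) (lamK c)"
      unfolding gcol_def D by (simp only:)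
  qed
  finally show ?thesis .
qed

lemma E_tb:
  assumes "c \<in> ex C"
  shows "E_mat C (tb k) c = ((if k = inv tb c then 1 else 0) - (if k = inv tb (the (succ C c)) then 1 else 0) :: 'k)"
proof -
  obtain v where v: "succ C c = Some v" using assms by (auto simp: ex_def)
  have "v = tb k \<longleftrightarrow> k = inv tb v" using tb_eq_iff[of k v] by auto
  then show ?thesis using tb_eq_iff[of k c] by (simp add: E_mat_def v)
qed

lemma perm_mul: "k \<in> idx C \<Longrightarrow> (perm_mat tb \<cdot>\<^bsub>idx C\<^esub> mm) k c = mm (inv tb k) c"
proof -
  assume k: "k \<in> idx C"
  have "(perm_mat tb \<cdot>\<^bsub>idx C\<^esub> mm) k c = (\<Sum>l\<in>idx C. (if l = inv tb k then 1 else 0) * mm l c)"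
    unfolding mat_mul_def by (rule sum.cong[OF refl]) (auto simp: perm_mat_def inv_tb)
  also have "\<dots> = mm (inv tb k) c" by (rule sum_select(1)) (use tb_in(2)[OF k] in auto)
  finally show ?thesis .
qed

lemma perm_transpose_mul: "k \<in> idx C \<Longrightarrow> (mat_transpose (perm_mat tb) \<cdot>\<^bsub>idx C\<^esub> mm) k c = mm (tb k) c"
proof -
  assume k: "k \<in> idx C"
  have "(mat_transpose (perm_mat tb) \<cdot>\<^bsub>idx C\<^esub> mm) k c = (\<Sum>l\<in>idx C. (if l = tb k then 1 else 0) * mm l c)"
    unfolding mat_mul_def mat_transpose_def perm_mat_def ..
  also have "\<dots> = mm (tb k) c" by (rule sum_select(1)) (use tb_in(1)[OF k] in auto)
  finally show ?thesis .
qed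

lemma perm_inv_mul: "k \<in> idx C \<Longrightarrow> (perm_mat (inv tb) \<cdot>\<^bsub>idx C\<^esub> mm) k c = mm (tb k) c"
proof -
  assume k: "k \<in> idx C"
  have "(perm_mat (inv tb) \<cdot>\<^bsub>idx C\<^esub> mm) k c = (\<Sum>l\<in>idx C. (if l = tb k then 1 else 0) * mm l c)"
    unfolding mat_mul_def by (rule sum.cong[OF refl]) (auto simp: perm_mat_def inv_tb)
  also have "\<dots> = mm (tb k) c" by (rule sum_select(1)) (use tb_in(1)[OF k] in auto)
  finally show ?thesis .
qed

text \<open>Common core of the two formulas with the inverse of \<open>nu_mat\<close>:
  \<open>mm\<close> stands for the factors to its right. It equals the level-set constant times a
  difference of two unit vectors, so \<open>nu_solve\<close> returns the vector X of
  \<open>M_col\<close>.\<close>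

lemma M_tau_chain:
  assumes c: "c \<in> ex C" and i: "i \<in> idx C"
    and mm: "\<And>k. k \<in> idx C \<Longrightarrow> mm k c = lamK c * E_mat C (tb k) c"
  shows "(mat_transpose (E_mat C) \<cdot>\<^bsub>idx C\<^esub> (perm_mat tb \<cdot>\<^bsub>idx C\<^esub> (mat_inv (idx C) (nu_mat C) \<cdot>\<^bsub>idx C\<^esub> mm))) i c
    = M_tau C hs \<tau> i c"
proof -
  obtain X where X: "isol X (lamK c) (inv tb c) (inv tb (the (succ C c)))"
    "\<And>i. i \<in> idx C \<Longrightarrow> M_tau C hs \<tau> i c = X (inv tb i) - opt0 (\<lambda>k. X (inv tb k)) (succ C i)"
    using M_col[OF c] by blast
  let ?Z = "mat_inv (idx C) (nu_mat C) \<cdot>\<^bsub>idx C\<^esub> mm"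
  have Z: "?Z k c = X k" if k: "k \<in> idx C" for k
    unfolding mat_mul_def nu_solve[OF X(1) k, symmetric]
    by (rule sum.cong[OF refl]) (simp only: mm E_tb[OF c])
  have "(mat_transpose (E_mat C) \<cdot>\<^bsub>idx C\<^esub> (perm_mat tb \<cdot>\<^bsub>idx C\<^esub> ?Z)) i c = (\<Sum>k\<in>idx C. E_mat C k i * X (inv tb k))"
    unfolding mat_mul_def[of "mat_transpose (E_mat C)"] unfolding mat_transpose_def
    by (rule sum.cong[OF refl]) (simp only: perm_mul Z tb_in(2))
  also have "\<dots> = M_tau C hs \<tau> i c" unfolding X(2)[OF i] by (rule Et_row[OF i])
  finally show ?thesis .
qed

lemma formula_nu:
  assumes c: "c \<in> ex C" and i: "i \<in> idx C"
  shows "M_tau C hs \<tau> i c = (mat_transpose (E_mat C) \<cdot>\<^bsub>idx C\<^esub> perm_mat tb \<cdot>\<^bsub>idx C\<^esub> mat_inv (idx C) (nu_mat C)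
    \<cdot>\<^bsub>idx C\<^esub> mat_transpose (perm_mat tb) \<cdot>\<^bsub>idx C\<^esub> E_mat C \<cdot>\<^bsub>idx C\<^esub> Lam_mat C) i c"
  unfolding mat_mul_assoc by (rule M_tau_chain[OF c i, symmetric]) (simp only: perm_transpose_mul E_Lam[OF c])

lemma formula_Q:
  assumes c: "c \<in> ex C" and i: "i \<in> idx C"
  shows "M_tau C hs \<tau> i c = (mat_transpose (E_mat C) \<cdot>\<^bsub>idx C\<^esub> perm_mat tb \<cdot>\<^bsub>idx C\<^esub> Q_mat C
    \<cdot>\<^bsub>idx C\<^esub> mat_transpose (perm_mat tb) \<cdot>\<^bsub>idx C\<^esub> E_mat C) i c"
  unfolding Q_mat_def mat_mul_assoc
proof (rule M_tau_chain[OF c i, symmetric])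
  fix k assume k: "k \<in> idx C"
  let ?D = "mat_transpose (perm_mat tb) \<cdot>\<^bsub>idx C\<^esub> E_mat C :: 'k matr"
  obtain v where v: "lnk c v" using c unfolding ex_iff by blast
  have sv: "the (succ C c) = v" using v succ_eq_Some_iff[of c v] by simp
  have inv: "lamK (inv tb u) = lamK u" if "u \<in> idx C" for u
    using lamK_cong[OF tb_lkeq[OF tb_in(2)[OF that]]] unfolding inv_tb by (rule sym)
  \<comment> \<open>The column of \<open>?D\<close> is supported at two indices of one level set, on
    which \<open>Lam_bar_mat\<close> is the scalar \<open>lamK c\<close>.\<close>
  have l: "lamK (inv tb c) = lamK c" "lamK (inv tb v) = lamK c"
    using inv lnk_idx[OF v] lamK_cong[OF lnk_lkeq[OF v]] by auto
  have "(Lam_bar_mat C \<cdot>\<^bsub>idx C\<^esub> ?D) k c = (\<Sum>l\<in>idx C. (if k = l then 1 else 0) * (lamK l * ?D l c))"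
    unfolding mat_mul_def[of "Lam_bar_mat C"]
    by (rule sum.cong[OF refl]) (simp add: Lam_bar_mat_def lamK_def)
  also have "\<dots> = lamK k * ?D k c" by (rule sum_select(2)) (use k in auto)
  also have "\<dots> = lamK k * E_mat C (tb k) c" by (simp only: perm_transpose_mul[OF k])
  also have "\<dots> = lamK c * E_mat C (tb k) c"
    unfolding E_tb[OF c] sv using l by (cases "k = inv tb c"; cases "k = inv tb v") auto
  finally show "(Lam_bar_mat C \<cdot>\<^bsub>idx C\<^esub> ?D) k c = lamK c * E_mat C (tb k) c" .
qed

end

context sym
begin

text \<open>For the identity order the identity meets the conditions that characterize tau_bullet,
  so both permutation factors drop out.\<close>

lemma M_id:
  assumes c: "c \<in> ex C" and i: "i \<in> idx C"
  shows "M_tau C hs id i c = (mat_transpose (E_mat C) \<cdot>\<^bsub>idx C\<^esub> (mat_inv (idx C) (nu_mat C) \<cdot>\<^bsub>idx C\<^esub> (E_mat C \<cdot>\<^bsub>idx C\<^esub> Lam_mat C))) i c"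
proof -
  interpret I: sym_tau C hs id by (rule sym_tau_id)
  have "I.bullet_spec id"
    unfolding I.bullet_spec_def by (auto simp: permutes_id strict_mono_on_def)
  then have tb: "I.tb = id" by (rule I.tb_eqI)
  let ?Z = "mat_inv (idx C) (nu_mat C) \<cdot>\<^bsub>idx C\<^esub> (E_mat C \<cdot>\<^bsub>idx C\<^esub> Lam_mat C)"
  have "M_tau C hs id i c = (mat_transpose (E_mat C) \<cdot>\<^bsub>idx C\<^esub> (perm_mat I.tb \<cdot>\<^bsub>idx C\<^esub> ?Z)) i c"
    by (rule I.M_tau_chain[OF c i, symmetric]) (simp only: tb id_apply E_Lam[OF c])
  also have "\<dots> = (mat_transpose (E_mat C) \<cdot>\<^bsub>idx C\<^esub> ?Z) i c"
    unfolding mat_mul_def[of "mat_transpose (E_mat C)"]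
    by (rule sum.cong[OF refl]) (simp only: I.perm_mul, simp only: tb inv_id id_apply)
  finally show ?thesis .
qed

end

text \<open>On the left, E F is the inverse of tau_bullet times E, so F^t E^t = E^t tau_bullet. On
  the right, column c of F expands the image of e_c - e_{s(c)} under the inverse of tau_bullet in
  columns of E (\<open>FG\<close>, \<open>E_solve\<close>); Lambda acts on it as a scalar, and the
  formula for M reduces to the one for M_\<tau>.\<close>

lemma (in sym_tau) formula_F:
  defines "F \<equiv> mat_inv (idx C) (E_mat C) \<cdot>\<^bsub>idx C\<^esub> perm_mat (inv tb) \<cdot>\<^bsub>idx C\<^esub> (E_mat C :: 'k matr)"
  assumes c: "c \<in> ex C" and i: "i \<in> idx C"
  shows "M_tau C hs \<tau> i c = (mat_transpose F \<cdot>\<^bsub>idx C\<^esub> M_tau C hs id \<cdot>\<^bsub>ex C\<^esub> F) i c"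
proof -
  let ?N = "idx C" let ?E = "E_mat C :: 'k matr" let ?Ei = "mat_inv ?N ?E" let ?ni = "mat_inv ?N (nu_mat C)"
  obtain X where X: "isol X (lamK c) (inv tb c) (inv tb (the (succ C c)))"
    "\<And>i. i \<in> ?N \<Longrightarrow> M_tau C hs \<tau> i c = X (inv tb i) - opt0 (\<lambda>k. X (inv tb k)) (succ C i)"
    using M_col[OF c] by blast
  obtain v where v: "lnk c v" using c unfolding ex_iff by blast
  have ci: "c \<in> ?N" "v \<in> ?N" using lnk_idx[OF v] by auto
  have sv: "the (succ C c) = v" using v succ_eq_Some_iff[of c v] by simp
  define a where "a = inv tb c" define b where "b = inv tb v"
  have lk: "c \<approx> a" "v \<approx> b"
    using tb_lkeq[OF tb_in(2)[OF ci(1)]] tb_lkeq[OF tb_in(2)[OF ci(2)]] unfolding inv_tb a_def b_def by auto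
  have "a \<approx> b" using lk lnk_lkeq[OF v] lkeq_sym lkeq_trans by blast
  then obtain G :: "nat \<Rightarrow> 'k" where G0: "\<And>k. k \<notin> ex C \<or> \<not> a \<approx> k \<Longrightarrow> G k = 0"
    and G: "\<And>i. i \<in> ?N \<Longrightarrow> (\<Sum>k\<in>?N. ?E i k * G k) = (if i = a then 1 else 0) - (if i = b then 1 else 0)"
    using E_solve[of a b] by blast
  define Gm :: "'k matr" where "Gm = (\<lambda>k _. G k)"
  define R where "R = perm_mat (inv tb) \<cdot>\<^bsub>?N\<^esub> ?E"
  have R: "R k l = ?E (tb k) l" if "k \<in> ?N" for k l unfolding R_def by (rule perm_inv_mul[OF that])
  have F: "F = ?Ei \<cdot>\<^bsub>?N\<^esub> R" unfolding F_def R_def by (rule mat_mul_assoc)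
  have idm: "((A \<cdot>\<^bsub>?N\<^esub> B) \<cdot>\<^bsub>?N\<^esub> D) k l = D k l" if e: "mat_eq ?N ?N (A \<cdot>\<^bsub>?N\<^esub> B) id_mat" and k: "k \<in> ?N"
    for A B D :: "'k matr" and k l
  proof -
    have "((A \<cdot>\<^bsub>?N\<^esub> B) \<cdot>\<^bsub>?N\<^esub> D) k l = (\<Sum>r\<in>?N. (if k = r then 1 else 0) * D r l)"
      unfolding mat_mul_def[of "A \<cdot>\<^bsub>?N\<^esub> B"]
      by (rule sum.cong[OF refl]) (use e k in \<open>simp add: mat_eq_def id_mat_def\<close>)
    also have "\<dots> = D k l" by (rule sum_select(2)) (use k in auto)
    finally show ?thesis .
  qed
  have EF: "(?E \<cdot>\<^bsub>?N\<^esub> F) k l = ?E (tb k) l" if k: "k \<in> ?N" for k l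
    unfolding F mat_mul_assoc[symmetric] idm[OF E_inv(1) k] by (rule R[OF k])
  have EG: "(?E \<cdot>\<^bsub>?N\<^esub> Gm) l c = ?E (tb l) c" if l: "l \<in> ?N" for l
    unfolding mat_mul_def Gm_def G[OF l] E_tb[OF c] sv a_def b_def ..
  have FG: "F k c = G k" if k: "k \<in> ?N" for k
  proof -
    have "F k c = (?Ei \<cdot>\<^bsub>?N\<^esub> (?E \<cdot>\<^bsub>?N\<^esub> Gm)) k c"
      unfolding F mat_mul_def[of ?Ei] by (rule sum.cong[OF refl]) (simp only: R EG)
    also have "\<dots> = Gm k c" unfolding mat_mul_assoc[symmetric] by (rule idm[OF E_inv(2) k])
    finally show ?thesis by (simp only: Gm_def)
  qed
  have fx: "finite (ex C)" by (simp add: ex_def)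
  \<comment> \<open>\<open>G\<close> vanishes outside \<open>ex C\<close> and outside one level set,
    where the diagonal entries of \<open>Lam_mat\<close> all equal \<open>lamK c\<close>.\<close>
  have LG: "(Lam_mat C \<cdot>\<^bsub>ex C\<^esub> Gm) k c = lamK c * G k" for k
  proof (cases "k \<in> ex C")
    case True
    have "(Lam_mat C \<cdot>\<^bsub>ex C\<^esub> Gm) k c = (\<Sum>r\<in>ex C. (if k = r then 1 else 0) * (lamK r * G r))"
      unfolding mat_mul_def by (rule sum.cong[OF refl]) (simp add: Lam_mat_def Gm_def lam_succ)
    also have "\<dots> = lamK k * G k" by (rule sum_select(2)[OF fx True])
    also have "\<dots> = lamK c * G k"
    proof (cases "a \<approx> k")
      case True
      then show ?thesis using lamK_cong[OF lk(1)] lamK_cong[OF True] by simp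
    qed (simp add: G0)
    finally show ?thesis .
  next
    case False
    then have "(Lam_mat C \<cdot>\<^bsub>ex C\<^esub> Gm) k c = 0"
      unfolding mat_mul_def by (intro sum.neutral ballI) (auto simp: Lam_mat_def)
    then show ?thesis using False by (simp add: G0)
  qed
  have ELG: "(?E \<cdot>\<^bsub>?N\<^esub> (Lam_mat C \<cdot>\<^bsub>ex C\<^esub> Gm)) l c = lamK c * ((if l = a then 1 else 0) - (if l = b then 1 else 0))"
    if l: "l \<in> ?N" for l
    unfolding mat_mul_def[of ?E] LG G[OF l, symmetric] sum_distrib_left by (rule sum.cong[OF refl]) (simp only: mult.left_commute)
  have nX: "(?ni \<cdot>\<^bsub>?N\<^esub> (?E \<cdot>\<^bsub>?N\<^esub> (Lam_mat C \<cdot>\<^bsub>ex C\<^esub> Gm))) k c = X k" if k: "k \<in> ?N" for k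
    unfolding mat_mul_def[of ?ni] nu_solve[OF X(1)[unfolded sv, folded a_def b_def] k, symmetric]
    by (rule sum.cong[OF refl]) (simp only: ELG)
  have MF: "(M_tau C hs id \<cdot>\<^bsub>ex C\<^esub> F) k c = (\<Sum>l\<in>?N. ?E l k * X l)" if k: "k \<in> ?N" for k
  proof -
    let ?W = "mat_transpose ?E \<cdot>\<^bsub>?N\<^esub> (?ni \<cdot>\<^bsub>?N\<^esub> (?E \<cdot>\<^bsub>?N\<^esub> Lam_mat C))"
    have "(M_tau C hs id \<cdot>\<^bsub>ex C\<^esub> F) k c = (?W \<cdot>\<^bsub>ex C\<^esub> Gm) k c"
      unfolding mat_mul_def[of _ "ex C"]
    proof (rule sum.cong[OF refl])
      fix r assume r: "r \<in> ex C"
      then have "r \<in> ?N" by (simp add: ex_def)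
      then show "M_tau C hs id k r * F r c = ?W k r * Gm r c" by (simp only: M_id[OF r k] FG Gm_def)
    qed
    also have "\<dots> = (mat_transpose ?E \<cdot>\<^bsub>?N\<^esub> (?ni \<cdot>\<^bsub>?N\<^esub> (?E \<cdot>\<^bsub>?N\<^esub> (Lam_mat C \<cdot>\<^bsub>ex C\<^esub> Gm)))) k c"
      by (simp only: mat_mul_assoc)
    also have "\<dots> = (\<Sum>l\<in>?N. ?E l k * X l)"
      unfolding mat_mul_def[of "mat_transpose ?E"] unfolding mat_transpose_def
      by (rule sum.cong[OF refl]) (simp only: nX)
    finally show ?thesis .
  qed
  have "(mat_transpose F \<cdot>\<^bsub>?N\<^esub> M_tau C hs id \<cdot>\<^bsub>ex C\<^esub> F) i c = (\<Sum>k\<in>?N. F k i * (\<Sum>l\<in>?N. ?E l k * X l))"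
    unfolding mat_mul_assoc unfolding mat_mul_def[of "mat_transpose F"] unfolding mat_transpose_def
    by (rule sum.cong[OF refl]) (simp only: MF)
  also have "\<dots> = (\<Sum>k\<in>?N. \<Sum>l\<in>?N. (?E l k * F k i) * X l)"
    unfolding sum_distrib_left by (intro sum.cong refl) (simp only: ac_simps)
  also have "\<dots> = (\<Sum>l\<in>?N. \<Sum>k\<in>?N. (?E l k * F k i) * X l)" by (rule sum.swap)
  also have "\<dots> = (\<Sum>l\<in>?N. (?E \<cdot>\<^bsub>?N\<^esub> F) l i * X l)"
    unfolding mat_mul_def sum_distrib_right ..
  also have "\<dots> = (\<Sum>l\<in>?N. ?E (tb l) i * X l)"
    by (rule sum.cong[OF refl]) (simp only: EF)
  also have "\<dots> = (\<Sum>k\<in>?N. ?E k i * X (inv tb k))"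
    by (subst (2) sum.permute[OF tb_perm]) (simp add: o_def inv_tb)
  also have "\<dots> = M_tau C hs \<tau> i c" unfolding X(2)[OF i] by (rule Et_row[OF i])
  finally show ?thesis ..
qed

theorem theorem4p7p5:
  fixes C :: "('k::field_char_0, 'r::finite) cgl"
    and hs :: "nat \<Rightarrow> 'k ^ 'r"
    and \<tau> :: "nat \<Rightarrow> nat"
  assumes "symmetric_cgl_extension C hs"
    and "\<tau> \<in> Xi (len C)"
  shows
    "let N = idx C;
         M\<tau> = M_tau C hs \<tau>;
         y\<tau> = prime_seq_tau C hs \<tau>;
         E = E_mat C;
         Et = mat_transpose E;
         P = perm_mat (tau_bullet C \<tau>);
         Pt = mat_transpose P;
         M = M_tau C hs id;
         F = mat_inv N E \<cdot>\<^bsub>N\<^esub> perm_mat (inv (tau_bullet C \<tau>)) \<cdot>\<^bsub>N\<^esub> E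
     in
       (\<forall>i\<in>N. \<forall>j\<in>ex C. M\<tau> i j \<in> \<int>) \<and>
       gsv_equations C y\<tau> (ex C) (Lam_mat C) M\<tau> \<and>
       (\<forall>M'. gsv_equations C y\<tau> (ex C) (Lam_mat C) M' \<longrightarrow> mat_eq N (ex C) M' M\<tau>) \<and>
       mat_eq N (ex C) M\<tau>
         (Et \<cdot>\<^bsub>N\<^esub> P \<cdot>\<^bsub>N\<^esub> mat_inv N (nu_mat C) \<cdot>\<^bsub>N\<^esub> Pt \<cdot>\<^bsub>N\<^esub> E \<cdot>\<^bsub>N\<^esub> Lam_mat C) \<and>
       mat_eq N (ex C) M\<tau>
         (Et \<cdot>\<^bsub>N\<^esub> P \<cdot>\<^bsub>N\<^esub> Q_mat C \<cdot>\<^bsub>N\<^esub> Pt \<cdot>\<^bsub>N\<^esub> E) \<and>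
       mat_eq N (ex C) M\<tau>
         (mat_transpose F \<cdot>\<^bsub>N\<^esub> M \<cdot>\<^bsub>ex C\<^esub> F)"
proof -
  interpret sym_tau C hs \<tau> by unfold_locales (rule assms)+
  have tb: "tau_bullet C \<tau> = tb" by (simp only: tb_def)
  have gM: "gcol (\<lambda>p. M_tau C hs \<tau> (\<kappa> p) c) (inv \<kappa> c) (lamK c)" if "c \<in> ex C" for c
    using M_col[OF that] by blast
  show ?thesis
    unfolding Let_def tb mat_eq_def
  proof (intro conjI)
    show "\<forall>i\<in>idx C. \<forall>j\<in>ex C. M_tau C hs \<tau> i j \<in> \<int>"
    proof (intro ballI)
      fix i c assume i: "i \<in> idx C" and c: "c \<in> ex C"
      obtain X where X: "\<And>l. X l \<in> \<int>"
        "\<And>i. i \<in> idx C \<Longrightarrow> M_tau C hs \<tau> i c = X (inv tb i) - opt0 (\<lambda>k. X (inv tb k)) (succ C i)"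
        using M_col[OF c] by blast
      show "M_tau C hs \<tau> i c \<in> \<int>"
        unfolding X(2)[OF i] using X(1) by (cases "succ C i") simp_all
    qed
    show "gsv_equations C (prime_seq_tau C hs \<tau>) (ex C) (Lam_mat C) (M_tau C hs \<tau>)"
      unfolding gsv_tau_iff using gM by blast
    show "\<forall>M'. gsv_equations C (prime_seq_tau C hs \<tau>) (ex C) (Lam_mat C) M' \<longrightarrow>
        (\<forall>i\<in>idx C. \<forall>j\<in>ex C. M' i j = M_tau C hs \<tau> i j)"
    proof (intro allI impI ballI)
      fix M' :: "'k matr" and i c
      assume M': "gsv_equations C (prime_seq_tau C hs \<tau>) (ex C) (Lam_mat C) M'" and i: "i \<in> idx C" and c: "c \<in> ex C"
      have g: "gcol (\<lambda>p. M' (\<kappa> p) c) (inv \<kappa> c) (lamK c)" using M' c unfolding gsv_tau_iff by blast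
      have "inv \<kappa> i \<in> idx C" using i kappa_idx[of "inv \<kappa> i"] unfolding inv_kappa by blast
      from gcol_unique[OF g gM[OF c] this] show "M' i c = M_tau C hs \<tau> i c" unfolding inv_kappa .
    qed
  qed (intro ballI, rule formula_nu formula_Q formula_F, assumption, assumption)+
qed

end
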